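(* Let $1\le r\le n$ be integers, let $X_1,\ldots,X_{r+1}$ be independent random points in $\mathbb{R}^n$ chosen according to one of the four models below, and let $\mathcal V_{n,r}$ be the $r$-dimensional volume of the simplex with vertices $X_1,\ldots,X_{r+1}$. (a) In the Gaussian model, $(r!\,\mathcal V_{n,r})^2 \overset{d}{=} (r+1)\prod_{j=1}^r \chi^2_{n-r+j}$. (b) In the Beta model with parameter $\nu>0$, $$\xi(1-\xi)^r (r!\,\mathcal V_{n,r})^2 \overset{d}{=} (1-\eta)^r\prod_{j=1}^r \beta_{\frac{n-r+j}{2},\frac{\nu+r-j}{2}},$$ where $\xi,\eta\sim \mathrm{Beta}\big(\frac{n+\nu}{2},\frac{r(n+\nu-2)}{2}\big)$ are random variables such that $\xi$ is independent of $\mathcal V_{n,r}$, while $\eta$ is independent of $\beta_{\frac{n-r+j}{2},\frac{\nu+r-j}{2}}$, $j=1,\ldots,r$. (c) In the Beta prime model with parameter $\nu>0$, $$(1+\eta)^r (r!\,\mathcal V_{n,r})^2 \overset{d}{=} \xi^{-1}(1+\xi)^{r+1}\prod_{j=1}^r \beta'_{\frac{n-r+j}{2},\frac{\nu}{2}},$$ where $\xi,\eta\sim\mathrm{Beta}'\big(\frac{\nu}{2},\frac{r\nu}{2}\big)$ are random variables such that $\eta$ is independent of $\mathcal V_{n,r}$, while $\xi$ is independent of $\beta'_{\frac{n-r+j}{2},\frac{\nu}{2}}$, $j=1,\ldots,r$. (d) In the spherical model, $$\xi(1-\xi)^r (r!\,\mathcal V_{n,r})^2 \overset{d}{=} (1-\eta)^r\prod_{j=1}^r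 \beta_{\frac{n-r+j}{2},\frac{r-j}{2}},$$ where $\xi,\eta\sim \mathrm{Beta}\big(\frac{n}{2},\frac{r(n-2)}{2}\big)$ are random variables such that $\xi$ is independent of $\mathcal V_{n,r}$, while $\eta$ is independent of $\beta_{\frac{n-r+j}{2},\frac{r-j}{2}}$, $j=1,\ldots,r$. The random variables appearing in each product are independent.
   Context: Models for i.i.d. points in $\mathbb{R}^n$. Gaussian model: density $(2\pi)^{-n/2}e^{-|x|^2/2}$. Beta model with parameter $\nu>0$: density $\pi^{-n/2}\frac{\Gamma((n+\nu)/2)}{\Gamma(\nu/2)}(1-|x|^2)^{(\nu-2)/2}$ on $|x|<1$. Beta prime model with parameter $\nu>0$: density $\pi^{-n/2}\frac{\Gamma((n+\nu)/2)}{\Gamma(\nu/2)}(1+|x|^2)^{-(n+\nu)/2}$ on $\mathbb{R}^n$. Spherical model: uniform distribution on the unit sphere of $\mathbb{R}^n$ centred at the origin; part (d) is the limit case of part (b) as $\nu\downarrow0$. Distributions: $\chi^2_d$ denotes a chi-squared variable with $d$ degrees of freedom. $\beta_{a,b}\sim\mathrm{Beta}(a,b)$ has density $\frac{\Gamma(a+b)}{\Gamma(a)\Gamma(b)}t^{a-1}(1-t)^{b-1}$ on $(0,1)$; $\beta'_{a,b}\sim\mathrm{Beta}'(a,b)$ has density $\frac{\Gamma(a+b)}{\Gamma(a)\Gamma(b)}t^{a-1}(1+t)^{-a-b}$ on $(0,\infty)$. The symbol $\overset{d}{=}$ denotes equality in distribution. *)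

theory Defs
  imports "HOL-Probability.Probability"
begin

section \<open>Volume of simplices of arbitrary dimension\<close>

definition orthonormal_frame :: "nat \<Rightarrow> (nat \<Rightarrow> 'a::euclidean_space) \<Rightarrow> bool" where
  "orthonormal_frame r e \<longleftrightarrow> (\<forall>i<r. \<forall>j<r. e i \<bullet> e j = (if i = j then 1 else 0))"

definition flat_chart :: "nat \<Rightarrow> 'a::euclidean_space \<Rightarrow> (nat \<Rightarrow> 'a) \<Rightarrow> (nat \<Rightarrow> real) \<Rightarrow> 'a" where
  "flat_chart r p e c = p + (\<Sum>i<r. c i *\<^sub>R e i)"

text \<open>
  The \<open>r\<close>-dimensional volume of a set contained in an \<open>r\<close>-dimensional affine subspace:
  the Lebesgue measure of the set in Cartesian coordinates on such a subspace.  The value does not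
  depend on the subspace (if the set spans a smaller one, it is 0) or on the coordinates.
  The space \<open>\<real>\<^sup>r\<close> is rendered as the product measure space over the index set \<open>{..<r}\<close>.
\<close>

definition flat_volume :: "nat \<Rightarrow> 'a::euclidean_space set \<Rightarrow> real" where
  "flat_volume r S = (THE v. \<exists>p e. orthonormal_frame r e \<and> S \<subseteq> range (flat_chart r p e) \<and>
     v = measure (\<Pi>\<^sub>M i\<in>{..<r}. lborel)
           {c \<in> space (\<Pi>\<^sub>M i\<in>{..<r}. lborel). flat_chart r p e c \<in> S})"

definition simplex_volume :: "nat \<Rightarrow> (nat \<Rightarrow> 'a::euclidean_space) \<Rightarrow> real" where
  "simplex_volume r x = flat_volume r (convex hull (x ` {1..r+1}))"

section \<open>Distributions on the line\<close>

definition chi_squared_law :: "nat \<Rightarrow> real measure" where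
  "chi_squared_law d =
     distr (\<Pi>\<^sub>M i\<in>{..<d}. density lborel std_normal_density) borel (\<lambda>z. \<Sum>i<d. (z i)\<^sup>2)"

text \<open>
  The Beta distribution for \<open>a > 0\<close> and \<open>b \<ge> 0\<close>.  The case \<open>b = 0\<close>, needed for the spherical
  model, is the weak limit for \<open>b\<close> decreasing to 0, i.e. the point mass at 1.
\<close>

definition beta_law :: "real \<Rightarrow> real \<Rightarrow> real measure" where
  "beta_law a b =
     (if b = 0 then return borel 1
      else density lborel (\<lambda>t. ennreal (indicator {0<..<1} t *
             (Gamma (a + b) / (Gamma a * Gamma b) * t powr (a - 1) * (1 - t) powr (b - 1)))))"

definition beta_prime_law :: "real \<Rightarrow> real \<Rightarrow> real measure" where
  "beta_prime_law a b =
     density lborel (\<lambda>t. ennreal (indicator {0<..} t *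
       (Gamma (a + b) / (Gamma a * Gamma b) * t powr (a - 1) * (1 + t) powr (- a - b))))"

section \<open>The four models for a random point\<close>

definition gaussian_model :: "(real ^ 'n) measure" where
  "gaussian_model =
     density lborel (\<lambda>x. ennreal ((2 * pi) powr (- real CARD('n) / 2) * exp (- (norm x)\<^sup>2 / 2)))"

definition beta_model :: "real \<Rightarrow> (real ^ 'n) measure" where
  "beta_model \<nu> =
     density lborel (\<lambda>x. ennreal (indicator {x. norm x < 1} x *
       (pi powr (- real CARD('n) / 2) * (Gamma ((real CARD('n) + \<nu>) / 2) / Gamma (\<nu> / 2)) *
        (1 - (norm x)\<^sup>2) powr ((\<nu> - 2) / 2))))"

definition beta_prime_model :: "real \<Rightarrow> (real ^ 'n) measure" where
  "beta_prime_model \<nu> =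
     density lborel (\<lambda>x. ennreal
       (pi powr (- real CARD('n) / 2) * (Gamma ((real CARD('n) + \<nu>) / 2) / Gamma (\<nu> / 2)) *
        (1 + (norm x)\<^sup>2) powr (- (real CARD('n) + \<nu>) / 2)))"

text \<open>
  Normalised surface measure on the unit sphere, via polar coordinates: the mass of a subset \<open>A\<close>
  of the sphere is the share of the unit ball taken up by the cone over \<open>A\<close>.
\<close>

definition spherical_model :: "(real ^ 'n) measure" where
  "spherical_model = distr (uniform_measure lborel (ball 0 1)) borel (\<lambda>x. x /\<^sub>R norm x)"

section \<open>Equality in distribution\<close>

definition eq_in_law :: "'m measure \<Rightarrow> ('m \<Rightarrow> real) \<Rightarrow> 'k measure \<Rightarrow> ('k \<Rightarrow> real) \<Rightarrow> bool" where
  "eq_in_law M Y N Z \<longleftrightarrow>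
     Y \<in> borel_measurable M \<and> Z \<in> borel_measurable N \<and> distr M borel Y = distr N borel Z"

text \<open>
  \<open>\<eta>\<close> is independent of the family \<open>\<beta> 1, \<dots>, \<beta> r\<close>, which is itself independent; that is,
  \<open>\<eta>, \<beta> 1, \<dots>, \<beta> r\<close> are mutually independent.  The unused index 0 holds \<open>\<eta>\<close>.
\<close>

definition indep_of_indep_family ::
  "'k measure \<Rightarrow> nat \<Rightarrow> ('k \<Rightarrow> real) \<Rightarrow> (nat \<Rightarrow> 'k \<Rightarrow> real) \<Rightarrow> bool" where
  "indep_of_indep_family N r \<eta> \<beta> \<longleftrightarrow>
     prob_space.indep_vars N (\<lambda>_. borel) (\<beta>(0 := \<eta>)) {0..r}"

end

theory Submission
  imports Defs "HOL-Analysis.Simplex_Content" "HOL-Computational_Algebra.Computational_Algebra"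
begin

text \<open>
  The squared volume of a simplex is, up to \<open>(r!)\<^sup>2\<close>, the Gram determinant of its edges, that is, the
  product of the squared Gram--Schmidt residuals.  If the vertices are independent centred Gaussian
  vectors with standard deviations \<open>t i\<close>, the edges may be replaced by the differences from
  precision-weighted means without changing the determinant.  These differences are independent, so the
  determinant is the product of independent chi-squared variables and the constant
  \<open>(\<Prod> (t i)\<^sup>2) * (\<Sum> 1 / (t i)\<^sup>2)\<close>.  This gives the Gaussian case.

  A beta prime point is a Gaussian vector divided by the root of an independent Gamma variable, which
  reduces that case to an identity between laws of functions of independent Gamma variables.

  Conversely, a beta or spherical point times an independent radius is a Gaussian vector.  The determinant
  is a quadratic polynomial in the scale of each vertex, so its moments follow from the Gaussian ones by
  dividing coefficients by moments of the radius, one vertex at a time.  The variables in these two cases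
  are bounded, hence their laws are determined by their moments.
\<close>

section \<open>Gram determinants and volumes of simplices\<close>

text \<open>In the beta and spherical models the radius cannot simply be divided out of an identity
  between laws. It can be divided out of moments, but only after the k-th power of the determinant
  is expanded in the scale of one vertex, since different powers of the radius have different
  moments. Hence the Gaussian result is needed for arbitrary standard deviations \<open>t i\<close>.

  With p the total precision, p^k is k! times the coefficient of X^k in exp(p X). Division by the
  radial moments turns the contribution (t i)^(2 k) exp(X / (t i)^2) of a vertex to this coefficient
  into (1 + X)^(a + k - 1) / (a)_k, where (a)_k is the Pochhammer symbol. When all vertices are
  replaced, one generalised binomial coefficient remains, and it amounts to (a + b + r k)_k with b =
  r (a - 1). The factor \<xi> (1 - \<xi>)^r is there to cancel it against the end of (a + b)_(k + r
  k); what is left over is the moment of (1 - \<eta>)^r.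

  In the beta prime model the auxiliary variable acts directly: if s is a Gamma variable of shape (r
  + 1) \<alpha> and \<eta> is an independent beta prime variable with parameters \<alpha> and r
  \<alpha>, then s / (1 + \<eta>) is a Gamma variable of shape r \<alpha>.\<close>

fun gso :: "(nat \<Rightarrow> 'a::euclidean_space) \<Rightarrow> nat \<Rightarrow> 'a" where
  "gso y k = y k - (\<Sum>j<k. ((y k \<bullet> gso y j) / (gso y j \<bullet> gso y j)) *\<^sub>R gso y j)"

declare gso.simps [simp del]

lemma gso_cong:
  assumes "\<And>i. i \<le> k \<Longrightarrow> y i = z i"
  shows "gso y k = gso z k"
  using assms
proof (induction k rule: less_induct)
  case (less k)
  have "gso y j = gso z j" if "j < k" for j
    using less that by auto
  then show ?case
    using less.prems by (subst (1 2) gso.simps) (auto intro!: sum.cong)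
qed

text \<open>Strong induction makes the earlier residuals orthogonal, so pairing the projection sum
  with \<open>gso y j\<close> leaves a single term. If \<open>gso y j = 0\<close>, that term and the
  value it should have are both 0, so dependent families need no separate treatment.\<close>

lemma gso_orthogonal: "j < k \<Longrightarrow> gso y k \<bullet> gso y j = 0"
proof (induction k arbitrary: j rule: less_induct)
  case (less k)
  have orth: "gso y i \<bullet> gso y j = 0" if "i < k" "i \<noteq> j" for i
    using that less.IH[of i j] less.IH[of j i] less.prems by (metis inner_commute linorder_neqE_nat)
  have "gso y k \<bullet> gso y j = y k \<bullet> gso y j -
      (\<Sum>i<k. ((y k \<bullet> gso y i) / (gso y i \<bullet> gso y i)) * (gso y i \<bullet> gso y j))"
    by (subst gso.simps) (simp add: inner_diff_left inner_sum_left)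
  also have "(\<Sum>i<k. ((y k \<bullet> gso y i) / (gso y i \<bullet> gso y i)) * (gso y i \<bullet> gso y j)) =
      (\<Sum>i<k. if i = j then y k \<bullet> gso y j else 0)"
    by (intro sum.cong refl) (auto simp: orth)
  also have "\<dots> = y k \<bullet> gso y j"
    using less.prems by simp
  finally show ?case by simp
qed

lemma gso_orthogonal': "i \<noteq> j \<Longrightarrow> gso y i \<bullet> gso y j = 0"
  by (metis gso_orthogonal inner_commute linorder_neqE_nat)

lemma gso_diff_in_span_gso: "y k - gso y k \<in> span (gso y ` {..<k})"
  by (subst gso.simps) (auto intro!: span_sum span_scale intro: span_base)

lemma span_insert_cong:
  fixes x :: "'a::real_vector"
  assumes "span A = span B" "x - y \<in> span B"
  shows "span (insert x A) = span (insert y B)"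
proof -
  have "span (insert x A) = {v. \<exists>c. v - c *\<^sub>R x \<in> span B}"
    unfolding span_insert assms(1) by simp
  also have "\<dots> = {v. \<exists>c. v - c *\<^sub>R y \<in> span B}"
  proof -
    have eq: "v - c *\<^sub>R y = (v - c *\<^sub>R x) + c *\<^sub>R (x - y)" for v c
      by (simp add: algebra_simps)
    have "v - c *\<^sub>R x \<in> span B \<longleftrightarrow> v - c *\<^sub>R y \<in> span B" for v c
      unfolding eq using span_add_eq2[OF span_scale[OF assms(2), of c]] by simp
    then show ?thesis by simp
  qed
  also have "\<dots> = span (insert y B)" unfolding span_insert by simp
  finally show ?thesis .
qed

lemma span_unitriangular_eq:
  fixes y z :: "nat \<Rightarrow> 'a::real_vector"
  assumes "\<And>k. k < r \<Longrightarrow> z k - y k \<in> span (y ` {..<k})"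
  shows "span (z ` {..<r}) = span (y ` {..<r})"
  using assms
proof (induction r)
  case (Suc k)
  have img: "f ` {..<Suc k} = insert (f k) (f ` {..<k})" for f :: "nat \<Rightarrow> 'a"
    by (auto simp: lessThan_Suc)
  show ?case
    unfolding img by (rule span_insert_cong) (use Suc in auto)
qed simp

lemma span_gso: "span (gso y ` {..<k}) = span (y ` {..<k})"
proof (induction k)
  case (Suc k)
  have img: "f ` {..<Suc k} = insert (f k) (f ` {..<k})" for f :: "nat \<Rightarrow> 'a"
    by (auto simp: lessThan_Suc)
  show ?case
    unfolding img by (rule span_insert_cong[OF Suc])
      (use span_neg[OF gso_diff_in_span_gso[of y k]] Suc in simp)
qed simp

lemma gso_diff_in_span: "y k - gso y k \<in> span (y ` {..<k})"
  using gso_diff_in_span_gso[of y k] by (simp add: span_gso)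

lemma gso_perp: "v \<in> span (y ` {..<k}) \<Longrightarrow> gso y k \<bullet> v = 0"
proof -
  assume "v \<in> span (y ` {..<k})"
  then have "v \<in> span (gso y ` {..<k})" by (simp add: span_gso)
  then have "orthogonal (gso y k) v"
    by (intro orthogonal_to_span[of v "gso y ` {..<k}"]) (auto simp: orthogonal_def gso_orthogonal)
  then show ?thesis by (simp add: orthogonal_def)
qed

text \<open>The difference of two candidates lies in the span of the earlier vectors and is
  orthogonal to that span, hence to itself. The transformation rules for residuals below rest on
  this characterisation.\<close>

lemma gso_unique:
  assumes "y k - w \<in> span (y ` {..<k})" "\<And>v. v \<in> span (y ` {..<k}) \<Longrightarrow> w \<bullet> v = 0"
  shows "gso y k = w"
proof -
  have "gso y k - w \<in> span (y ` {..<k})"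
    using span_diff[OF assms(1) gso_diff_in_span[of y k]] by simp
  then have "(gso y k - w) \<bullet> (gso y k - w) = 0"
    using assms(2)[of "gso y k - w"] gso_perp[of "gso y k - w" y k]
    by (simp add: inner_diff_left)
  then show ?thesis by simp
qed

text \<open>Both families have the same span at every stage, and a residual depends only on the
  vector modulo the span of its predecessors. This takes the place of the invariance of a
  determinant under unitriangular operations.\<close>

lemma gso_unitriangular:
  assumes "\<And>k. k < r \<Longrightarrow> z k - y k \<in> span (y ` {..<k})" "k < r"
  shows "gso z k = gso y k"
proof (rule gso_unique)
  have s: "span (z ` {..<k}) = span (y ` {..<k})"
    using assms by (intro span_unitriangular_eq) auto
  show "z k - gso y k \<in> span (z ` {..<k})"
    using span_add[OF assms(1)[OF assms(2)] gso_diff_in_span[of y k]] s by simp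
  show "gso y k \<bullet> v = 0" if "v \<in> span (z ` {..<k})" for v
    using that s gso_perp by auto
qed

lemma gso_scale:
  assumes "\<And>k. k < r \<Longrightarrow> a k \<noteq> 0" "k < r"
  shows "gso (\<lambda>k. a k *\<^sub>R y k) k = a k *\<^sub>R gso y k"
proof (rule gso_unique)
  have s: "span ((\<lambda>k. a k *\<^sub>R y k) ` {..<k}) = span (y ` {..<k})"
  proof (rule span_eq[THEN iffD2], intro conjI subsetI)
    fix x assume "x \<in> y ` {..<k}"
    then obtain j where j: "j < k" "x = y j" by auto
    have "(1 / a j) *\<^sub>R (a j *\<^sub>R y j) \<in> span ((\<lambda>k. a k *\<^sub>R y k) ` {..<k})"
      using j by (intro span_scale span_base) auto
    then show "x \<in> span ((\<lambda>k. a k *\<^sub>R y k) ` {..<k})" using j assms by auto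
  next
    fix x assume "x \<in> (\<lambda>k. a k *\<^sub>R y k) ` {..<k}"
    then show "x \<in> span (y ` {..<k})" by (auto intro!: span_scale intro: span_base)
  qed
  show "a k *\<^sub>R y k - a k *\<^sub>R gso y k \<in> span ((\<lambda>k. a k *\<^sub>R y k) ` {..<k})"
    using span_scale[OF gso_diff_in_span[of y k], of "a k"] s by (simp add: scaleR_diff_right)
  show "a k *\<^sub>R gso y k \<bullet> v = 0" if "v \<in> span ((\<lambda>k. a k *\<^sub>R y k) ` {..<k})" for v
    using that s gso_perp by auto
qed

lemma norm_gso_le: "norm (gso y k) \<le> norm (y k)"
proof -
  have "(norm (y k))\<^sup>2 = (norm (gso y k))\<^sup>2 + (norm (y k - gso y k))\<^sup>2"
    using norm_add_Pythagorean[of "gso y k" "y k - gso y k"] gso_perp[OF gso_diff_in_span, of y k]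
    by (simp add: orthogonal_def del: inner_diff_right)
  then show ?thesis by (simp add: power2_le_imp_le)
qed

text \<open>Written through residuals instead of as a matrix determinant, so that only the last
  factor involves the last vector. Both the induction over Gaussian vectors and the quadratic
  expansion in one vertex exploit this.\<close>

definition gramdet :: "nat \<Rightarrow> (nat \<Rightarrow> 'a::euclidean_space) \<Rightarrow> real" where
  "gramdet r y = (\<Prod>k<r. (norm (gso y k))\<^sup>2)"

lemma gramdet_nonneg: "0 \<le> gramdet r y"
  by (simp add: gramdet_def prod_nonneg)

lemma gramdet_unitriangular:
  assumes "\<And>k. k < r \<Longrightarrow> z k - y k \<in> span (y ` {..<k})"
  shows "gramdet r z = gramdet r y"
  unfolding gramdet_def by (intro prod.cong refl) (simp add: gso_unitriangular[OF assms])

lemma gramdet_scale: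
  assumes "\<And>k. k < r \<Longrightarrow> a k \<noteq> 0"
  shows "gramdet r (\<lambda>k. a k *\<^sub>R y k) = (\<Prod>k<r. (a k)\<^sup>2) * gramdet r y"
  unfolding gramdet_def prod.distrib[symmetric]
  by (intro prod.cong refl) (simp add: gso_scale[OF assms] power_mult_distrib)

lemma gramdet_cong: "(\<And>k. k < r \<Longrightarrow> y k = z k) \<Longrightarrow> gramdet r y = gramdet r z"
  unfolding gramdet_def by (intro prod.cong refl arg_cong[of _ _ "\<lambda>v. (norm v)\<^sup>2"] gso_cong) auto

lemma dim_span_gso:
  assumes "gramdet r y \<noteq> 0"
  shows "dim (span (y ` {..<r})) = r"
proof -
  have nz: "gso y k \<noteq> 0" if "k < r" for k
    using assms that unfolding gramdet_def by (metis finite_lessThan lessThan_iff norm_zero power_zero_numeral prod_zero)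
  have inj: "inj_on (gso y) {..<r}"
  proof (rule inj_onI, rule ccontr)
    fix i j assume *: "i \<in> {..<r}" "j \<in> {..<r}" "gso y i = gso y j" "i \<noteq> j"
    then have "gso y j \<bullet> gso y j = 0" using gso_orthogonal'[of i j y] by simp
    moreover have "gso y j \<noteq> 0" by (rule nz) (use *(2) in simp)
    ultimately show False using inner_eq_zero_iff by blast
  qed
  have "independent (gso y ` {..<r})"
  proof (rule pairwise_orthogonal_independent)
    show "pairwise orthogonal (gso y ` {..<r})"
      unfolding pairwise_image by (simp add: pairwise_def orthogonal_def gso_orthogonal')
    show "0 \<notin> gso y ` {..<r}"
    proof
      assume "0 \<in> gso y ` {..<r}"
      then obtain k where "k < r" "gso y k = 0" by (metis imageE lessThan_iff)
      with nz show False by blast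
    qed
  qed
  then have "dim (span (gso y ` {..<r})) = r"
    by (simp add: dim_eq_card_independent card_image inj)
  then show ?thesis by (simp only: span_gso)
qed

lemma measurable_gso:
  assumes "\<And>i. i \<le> k \<Longrightarrow> (\<lambda>x. y x i) \<in> borel_measurable M"
  shows "(\<lambda>x. gso (y x) k) \<in> borel_measurable M"
  using assms
proof (induction k rule: less_induct)
  case (less k)
  have IH: "(\<lambda>x. gso (y x) j) \<in> borel_measurable M" if "j \<in> {..<k}" for j
    using less that by simp
  have y: "(\<lambda>x. y x k) \<in> borel_measurable M"
    using less.prems by simp
  show ?case
    by (subst gso.simps) (intro borel_measurable_diff borel_measurable_sum
      borel_measurable_scaleR borel_measurable_divide borel_measurable_inner IH y; assumption)
qed

lemma measurable_gramdet:
  assumes "\<And>i. i < r \<Longrightarrow> (\<lambda>x. y x i) \<in> borel_measurable M"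
  shows "(\<lambda>x. gramdet r (y x)) \<in> borel_measurable M"
  unfolding gramdet_def
  by (intro borel_measurable_prod borel_measurable_power measurable_compose[OF _ borel_measurable_norm] measurable_gso)
     (auto intro: assms)

section \<open>Orthonormal frames and adapted bases\<close>

lemma frame_inner_sum:
  assumes "orthonormal_frame r e" "j < r"
  shows "(\<Sum>i<r. c i *\<^sub>R e i) \<bullet> e j = c j"
proof -
  have "(\<Sum>i<r. c i *\<^sub>R e i) \<bullet> e j = (\<Sum>i<r. if i = j then c j else 0)"
    unfolding inner_sum_left using assms by (intro sum.cong refl) (auto simp: orthonormal_frame_def)
  then show ?thesis using assms by simp
qed

lemma frame_in_span: "(\<Sum>i<r. c i *\<^sub>R e i) \<in> span (e ` {..<r})"
  by (auto intro!: span_sum span_scale intro: span_base)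

lemma frame_norm: "orthonormal_frame r e \<Longrightarrow> i < r \<Longrightarrow> norm (e i) = 1"
  by (simp add: orthonormal_frame_def norm_eq_1)

lemma frame_mono: "orthonormal_frame r e \<Longrightarrow> s \<le> r \<Longrightarrow> orthonormal_frame s e"
  by (auto simp: orthonormal_frame_def)

lemma frame_inj_on:
  assumes "orthonormal_frame r e" shows "inj_on e {..<r}"
proof (rule inj_onI, rule ccontr)
  fix i j assume "i \<in> {..<r}" "j \<in> {..<r}" "e i = e j" "i \<noteq> j"
  then show False using assms unfolding orthonormal_frame_def by (metis lessThan_iff zero_neq_one)
qed

lemma frame_independent:
  assumes "orthonormal_frame r e" shows "independent (e ` {..<r})"
proof (rule pairwise_orthogonal_independent)
  show "pairwise orthogonal (e ` {..<r})"
    using assms by (auto simp: pairwise_def orthogonal_def orthonormal_frame_def)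
  show "0 \<notin> e ` {..<r}"
    using frame_norm[OF assms] by force
qed

lemma frame_dim: "orthonormal_frame r e \<Longrightarrow> dim (span (e ` {..<r})) = r"
  by (simp add: dim_eq_card_independent frame_independent card_image frame_inj_on)

lemma frame_expand:
  assumes "orthonormal_frame r e" "v \<in> span (e ` {..<r})"
  shows "(\<Sum>i<r. (v \<bullet> e i) *\<^sub>R e i) = v"
proof -
  let ?w = "v - (\<Sum>i<r. (v \<bullet> e i) *\<^sub>R e i)"
  have "?w \<in> span (e ` {..<r})"
    using assms(2) frame_in_span by (rule span_diff)
  moreover have "orthogonal ?w x" if "x \<in> e ` {..<r}" for x
    using that frame_inner_sum[OF assms(1)] by (auto simp: orthogonal_def inner_diff_left)
  ultimately have "orthogonal ?w ?w"
    using orthogonal_to_span by blast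
  then show ?thesis by (simp add: orthogonal_self)
qed

text \<open>An orthonormal basis of \<open>W\<close>, enumerated by \<open>h\<close>, is appended
  after the frame \<open>e\<close>. Completing a frame to a basis of the whole space and choosing a
  basis adapted to a pair of subspaces are both instances.\<close>

lemma orthonormal_frame_join:
  assumes e: "orthonormal_frame r e" and W: "subspace W"
    and orth: "\<And>x w. x \<in> e ` {..<r} \<Longrightarrow> w \<in> W \<Longrightarrow> x \<bullet> w = 0"
  obtains b where "orthonormal_frame (r + dim W) b" "\<And>i. i < r \<Longrightarrow> b i = e i"
    "span (b ` {..<r + dim W}) = span (e ` {..<r} \<union> W)"
proof -
  obtain B where B: "B \<subseteq> W" "pairwise orthogonal B" "\<And>x. x \<in> B \<Longrightarrow> norm x = 1"
    "independent B" "card B = dim W" "span B = W"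
    using orthonormal_basis_subspace[OF W] by blast
  obtain h where h: "bij_betw h {..<dim W} B"
    using ex_bij_betw_nat_finite[of B] B(4,5) independent_imp_finite
    by (metis atLeast0LessThan)
  define b where "b i = (if i < r then e i else h (i - r))" for i
  have hB: "h i \<in> B" if "i < dim W" for i
    using h that by (auto simp: bij_betw_def)
  have hh: "h i \<bullet> h j = (if i = j then 1 else 0)" if "i < dim W" "j < dim W" for i j
  proof (cases "i = j")
    case True
    then show ?thesis using B(3)[OF hB[OF that(1)]] by (simp add: norm_eq_1)
  next
    case False
    then have "h i \<noteq> h j" using h that by (auto simp: bij_betw_def inj_on_def)
    then show ?thesis using B(2) hB that False by (auto simp: pairwise_def orthogonal_def)
  qed
  have eh: "e i \<bullet> h j = 0" if "i < r" "j < dim W" for i j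
    using orth[of "e i" "h j"] hB[of j] B(1) that by auto
  have "orthonormal_frame (r + dim W) b"
    unfolding orthonormal_frame_def
  proof (intro allI impI)
    fix i j assume "i < r + dim W" "j < r + dim W"
    then show "b i \<bullet> b j = (if i = j then 1 else 0)"
      using e eh[of i "j - r"] eh[of j "i - r"] hh[of "i - r" "j - r"]
      by (auto simp: b_def orthonormal_frame_def inner_commute)
  qed
  moreover have "b ` {..<r + dim W} = e ` {..<r} \<union> B"
  proof -
    have "b ` {..<r + dim W} = b ` {..<r} \<union> b ` {r..<r + dim W}"
      by (subst image_Un[symmetric]) (auto intro!: arg_cong[of _ _ "image b"])
    also have "b ` {r..<r + dim W} = h ` {..<dim W}"
    proof -
      have "{r..<r + dim W} = (\<lambda>i. i + r) ` {..<dim W}"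
        by (simp add: image_add_atLeastLessThan' lessThan_atLeast0 add.commute)
      then have "b ` {r..<r + dim W} = (\<lambda>i. b (i + r)) ` {..<dim W}"
        by (simp only: image_image)
      then show ?thesis by (simp add: b_def)
    qed
    finally show ?thesis using h by (auto simp: b_def bij_betw_def)
  qed
  then have "span (b ` {..<r + dim W}) = span (e ` {..<r} \<union> W)"
    using B(6) span_superset[of B] by (simp add: span_Un span_span) (metis B(6) span_span)
  ultimately show ?thesis using that[of b] by (simp add: b_def)
qed

text \<open>A frame of \<open>U\<close>, obtained by joining \<open>U\<close> to the empty frame, is
  joined to the orthogonal complement of \<open>U\<close> inside \<open>L\<close>; the dimensions of
  the two add up to that of \<open>L\<close>.\<close>

lemma adapted_frame:
  assumes U: "subspace U" and L: "subspace L" and UL: "U \<subseteq> L"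
  obtains b where "orthonormal_frame (dim L) b" "span (b ` {..<dim L}) = L"
    "span (b ` {..<dim U}) = U"
proof -
  obtain e where e: "orthonormal_frame (dim U) e" "span (e ` {..<dim U}) = U"
    by (rule orthonormal_frame_join[of 0 "\<lambda>_. 0" U, OF _ U])
      (use U in \<open>simp_all add: orthonormal_frame_def span_eq_iff[THEN iffD2]\<close>)
  define W where "W = {y \<in> L. \<forall>x\<in>U. orthogonal x y}"
  have W: "subspace W"
    unfolding W_def using L
    by (auto simp: subspace_def orthogonal_def inner_add_right)
  have dW: "dim U + dim W = dim L"
    unfolding W_def using dim_subspace_orthogonal_to_vectors[OF U L UL] by simp
  obtain b where b: "orthonormal_frame (dim U + dim W) b" "\<And>i. i < dim U \<Longrightarrow> b i = e i"
    "span (b ` {..<dim U + dim W}) = span (e ` {..<dim U} \<union> W)"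
    using orthonormal_frame_join[OF e(1) W] e(2) span_superset[of "e ` {..<dim U}"]
    by (smt (verit, ccfv_SIG) W_def mem_Collect_eq orthogonal_def subsetD)
  have 1: "span (b ` {..<dim U}) = U"
    using b(2) e(2) by (metis (no_types, lifting) image_cong lessThan_iff)
  have "span (b ` {..<dim L}) = L"
  proof (rule subspace_dim_equal)
    have "e ` {..<dim U} \<union> W \<subseteq> L"
      using e(2) span_superset[of "e ` {..<dim U}"] UL by (auto simp: W_def)
    then show "span (b ` {..<dim L}) \<subseteq> L"
      unfolding dW[symmetric] b(3) using span_minimal L by blast
    show "dim L \<le> dim (span (b ` {..<dim L}))"
      using frame_dim[of "dim L" b] b(1) dW by simp
  qed (use L in auto)
  then show ?thesis using that b(1) dW 1 by simp
qed

lemma orthonormal_frame_extend: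
  fixes e :: "nat \<Rightarrow> 'a::euclidean_space"
  assumes e: "orthonormal_frame r e"
  obtains b where "orthonormal_frame DIM('a) b" "\<And>i. i < r \<Longrightarrow> b i = e i" "r \<le> DIM('a)"
proof -
  define U where "U = span (e ` {..<r})"
  define W where "W = {y \<in> UNIV. \<forall>x\<in>U. orthogonal x y}"
  have W: "subspace W"
    unfolding W_def by (auto simp: subspace_def orthogonal_def inner_add_right)
  have dW: "r + dim W = DIM('a)"
    unfolding W_def using dim_subspace_orthogonal_to_vectors[of U UNIV] frame_dim[OF e]
    by (simp add: U_def)
  have "x \<bullet> w = 0" if "x \<in> e ` {..<r}" "w \<in> W" for x w
    using that span_base[of x "e ` {..<r}"] by (auto simp: W_def U_def orthogonal_def)
  then show ?thesis
    using orthonormal_frame_join[OF e W] dW that by (metis le_add1)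
qed

lemma frame_span_UNIV:
  fixes b :: "nat \<Rightarrow> 'a::euclidean_space"
  assumes "orthonormal_frame DIM('a) b"
  shows "span (b ` {..<DIM('a)}) = UNIV"
  using frame_dim[OF assms] by (metis dim_eq_full dim_span span_span)

lemma onb_expand:
  fixes b :: "nat \<Rightarrow> 'a::euclidean_space"
  assumes "orthonormal_frame DIM('a) b"
  shows "(\<Sum>i<DIM('a). (v \<bullet> b i) *\<^sub>R b i) = v"
  by (rule frame_expand[OF assms]) (simp add: frame_span_UNIV[OF assms])

lemma onb_norm:
  fixes b :: "nat \<Rightarrow> 'a::euclidean_space"
  assumes "orthonormal_frame DIM('a) b"
  shows "(norm v)\<^sup>2 = (\<Sum>i<DIM('a). (v \<bullet> b i)\<^sup>2)"
proof -
  have "(norm v)\<^sup>2 = v \<bullet> (\<Sum>i<DIM('a). (v \<bullet> b i) *\<^sub>R b i)"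
    by (simp add: onb_expand[OF assms] power2_norm_eq_inner)
  also have "\<dots> = (\<Sum>i<DIM('a). (v \<bullet> b i)\<^sup>2)"
    by (simp add: inner_sum_left inner_sum_right power2_eq_square inner_commute)
  finally show ?thesis .
qed

section \<open>Lebesgue measure in orthonormal coordinates\<close>

lemma nn_integral_lborel_translate:
  fixes f :: "'a::euclidean_space \<Rightarrow> ennreal"
  assumes [measurable]: "f \<in> borel_measurable borel"
  shows "(\<integral>\<^sup>+x. f (x + c) \<partial>lborel) = (\<integral>\<^sup>+x. f x \<partial>lborel)"
proof -
  have "(\<integral>\<^sup>+x. f x \<partial>lborel) = (\<integral>\<^sup>+x. f x \<partial>distr lborel borel (\<lambda>x. c + x))"
    by (simp add: lborel_distr_plus)
  also have "\<dots> = (\<integral>\<^sup>+x. f (x + c) \<partial>lborel)"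
    by (subst nn_integral_distr) (auto simp: add.commute)
  finally show ?thesis by simp
qed

text \<open>Both sides, weighted by the mass of the unit ball \<open>A\<close>, equal
  \<open>\<integral>\<integral> 1\<^sub>A(y - T x) f y \<partial>x \<partial>y\<close>.\<close>

lemma nn_integral_lborel_isometry:
  fixes f :: "'a::euclidean_space \<Rightarrow> ennreal" and T :: "'a \<Rightarrow> 'a"
  assumes lin: "linear T" and nT: "\<And>x. norm (T x) = norm x"
    and [measurable]: "f \<in> borel_measurable borel"
  shows "(\<integral>\<^sup>+x. f (T x) \<partial>lborel) = (\<integral>\<^sup>+x. f x \<partial>lborel)"
proof -
  interpret linear T by fact
  have [measurable]: "T \<in> borel_measurable borel"
    using linear_continuous_on[OF linear_conv_bounded_linear[THEN iffD1, OF lin]]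
    by (rule borel_measurable_continuous_onI)
  have "inj T"
    unfolding linear_injective_0[OF lin] by (metis nT norm_eq_zero)
  then have surj: "surj T" using linear_injective_imp_surjective[OF lin] by simp
  define A where "A = ball (0::'a) 1"
  have [measurable]: "A \<in> sets borel" by (simp add: A_def)
  let ?c = "emeasure lborel A"
  have c: "?c \<noteq> 0" "?c \<noteq> top"
    using emeasure_lborel_ball_finite[of "0::'a" 1] content_ball_pos[of 1 "0::'a"]
    by (auto simp: A_def measure_def simp flip: less_top)
  have tr: "(\<integral>\<^sup>+x. f (T x) \<partial>lborel) = (\<integral>\<^sup>+x. f (T x + y) \<partial>lborel)" for y
  proof -
    obtain z where z: "y = T z" using surj by blast
    show ?thesis
      using nn_integral_lborel_translate[of "\<lambda>x. f (T x)" z] by (simp add: z add)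
  qed
  have ball: "(\<integral>\<^sup>+x. indicator A (y - T x) \<partial>lborel) = ?c" for y
  proof -
    obtain z where z: "y = T z" using surj by blast
    have "indicator A (y - T x) = (indicator A (x + (- z)) :: ennreal)" for x
      using nT[of "z - x"] by (auto simp: A_def z diff indicator_def norm_minus_commute)
    then have "(\<integral>\<^sup>+x. indicator A (y - T x) \<partial>lborel) = (\<integral>\<^sup>+x. indicator A (x + (-z)) \<partial>lborel)"
      by simp
    also have "\<dots> = (\<integral>\<^sup>+x. indicator A x \<partial>lborel)"
      by (rule nn_integral_lborel_translate) (rule borel_measurable_indicator, simp)
    finally show ?thesis by simp
  qed
  have "?c * (\<integral>\<^sup>+x. f (T x) \<partial>lborel) = (\<integral>\<^sup>+y. indicator A y * (\<integral>\<^sup>+x. f (T x) \<partial>lborel) \<partial>lborel)"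
    by (subst nn_integral_multc) (auto intro!: borel_measurable_indicator)
  also have "\<dots> = (\<integral>\<^sup>+y. \<integral>\<^sup>+x. indicator A y * f (T x + y) \<partial>lborel \<partial>lborel)"
  proof (intro nn_integral_cong)
    fix y :: 'a
    show "indicator A y * (\<integral>\<^sup>+x. f (T x) \<partial>lborel) = (\<integral>\<^sup>+x. indicator A y * f (T x + y) \<partial>lborel)"
      using tr[of y] by (simp add: nn_integral_cmult)
  qed
  also have "\<dots> = (\<integral>\<^sup>+x. \<integral>\<^sup>+y. indicator A y * f (T x + y) \<partial>lborel \<partial>lborel)"
    by (rule lborel_pair.Fubini') simp
  also have "\<dots> = (\<integral>\<^sup>+x. \<integral>\<^sup>+y. indicator A (y - T x) * f y \<partial>lborel \<partial>lborel)"
  proof (rule nn_integral_cong)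
    fix x :: 'a
    show "(\<integral>\<^sup>+y. indicator A y * f (T x + y) \<partial>lborel) = (\<integral>\<^sup>+y. indicator A (y - T x) * f y \<partial>lborel)"
      using nn_integral_lborel_translate[of "\<lambda>y. indicator A (y - T x) * f y" "T x"]
      by (simp add: add.commute)
  qed
  also have "\<dots> = (\<integral>\<^sup>+y. \<integral>\<^sup>+x. indicator A (y - T x) * f y \<partial>lborel \<partial>lborel)"
    by (rule lborel_pair.Fubini') measurable
  also have "\<dots> = (\<integral>\<^sup>+y. ?c * f y \<partial>lborel)"
    by (subst nn_integral_multc) (auto simp: ball)
  also have "\<dots> = ?c * (\<integral>\<^sup>+y. f y \<partial>lborel)"
    by (simp add: nn_integral_cmult)
  finally show ?thesis
    using c by (simp add: ennreal_mult_cancel_left)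
qed

interpretation lborel_PiM: product_sigma_finite "\<lambda>_::nat. lborel :: real measure" ..

lemma measurable_PiM_component:
  "i \<in> I \<Longrightarrow> f \<in> M i \<rightarrow>\<^sub>M N \<Longrightarrow> (\<lambda>x. f (x i)) \<in> Pi\<^sub>M I M \<rightarrow>\<^sub>M N"
  by (rule measurable_compose[OF measurable_component_singleton])

text \<open>For the standard basis, enumerated by \<open>h\<close>, the coordinate map carries the
  product measure to \<open>lborel\<close>, because both give boxes the same measure. Any other
  orthonormal basis is the image of this one under the linear isometry \<open>T\<close>.\<close>

lemma nn_integral_onb:
  fixes b :: "nat \<Rightarrow> 'a::euclidean_space" and f :: "'a \<Rightarrow> ennreal"
  assumes b: "orthonormal_frame DIM('a) b" and [measurable]: "f \<in> borel_measurable borel"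
  shows "(\<integral>\<^sup>+c. f (\<Sum>i<DIM('a). c i *\<^sub>R b i) \<partial>(\<Pi>\<^sub>M i\<in>{..<DIM('a)}. lborel)) = (\<integral>\<^sup>+x. f x \<partial>lborel)"
proof -
  let ?n = "DIM('a)"
  obtain h where h: "bij_betw h {..<?n} (Basis :: 'a set)"
    using ex_bij_betw_nat_finite[of "Basis :: 'a set"] by (metis atLeast0LessThan finite_Basis)
  have hB: "h i \<in> Basis" if "i < ?n" for i
    using h that by (auto simp: bij_betw_def)
  have h_frame: "orthonormal_frame ?n h"
    unfolding orthonormal_frame_def
  proof (intro allI impI)
    fix i j assume "i < ?n" "j < ?n"
    moreover from this have "h i = h j \<longleftrightarrow> i = j"
      using h inj_on_eq_iff[of h "{..<?n}" i j] by (simp add: bij_betw_def)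
    ultimately show "h i \<bullet> h j = (if i = j then 1 else 0)"
      by (simp add: inner_Basis[OF hB hB])
  qed
  have std: "distr (\<Pi>\<^sub>M i\<in>{..<?n}. lborel) borel (\<lambda>c. \<Sum>i<?n. c i *\<^sub>R h i) = lborel"
  proof (rule lborel_eqI[symmetric])
    fix l u :: 'a assume le: "\<And>b. b \<in> Basis \<Longrightarrow> l \<bullet> b \<le> u \<bullet> b"
    have "(\<lambda>c. \<Sum>i<?n. c i *\<^sub>R h i) -` box l u \<inter> space (\<Pi>\<^sub>M i\<in>{..<?n}. lborel) =
        (\<Pi>\<^sub>E i\<in>{..<?n}. {l \<bullet> h i<..<u \<bullet> h i})"
    proof -
      have "x \<in> box l u \<longleftrightarrow> (\<forall>i<?n. l \<bullet> h i < x \<bullet> h i \<and> x \<bullet> h i < u \<bullet> h i)" for x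
        unfolding mem_box bij_betw_ball[OF h] by (simp only: Ball_def lessThan_iff)
      then show ?thesis
        by (auto simp add: space_PiM PiE_iff frame_inner_sum[OF h_frame])
    qed
    then have "emeasure (distr (\<Pi>\<^sub>M i\<in>{..<?n}. lborel) borel (\<lambda>c. \<Sum>i<?n. c i *\<^sub>R h i)) (box l u) =
        emeasure (\<Pi>\<^sub>M i\<in>{..<?n}. lborel) (\<Pi>\<^sub>E i\<in>{..<?n}. {l \<bullet> h i<..<u \<bullet> h i})"
      by (subst emeasure_distr) auto
    also have "\<dots> = (\<Prod>i<?n. emeasure lborel {l \<bullet> h i<..<u \<bullet> h i})"
      by (subst lborel_PiM.emeasure_PiM) auto
    also have "\<dots> = (\<Prod>i<?n. ennreal ((u - l) \<bullet> h i))"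
      using le hB by (intro prod.cong refl) (auto simp: inner_diff_left)
    also have "\<dots> = ennreal (\<Prod>i<?n. (u - l) \<bullet> h i)"
      using le hB by (intro prod_ennreal) (auto simp: inner_diff_left)
    also have "(\<Prod>i<?n. (u - l) \<bullet> h i) = (\<Prod>b\<in>Basis. (u - l) \<bullet> b)"
      by (rule prod.reindex_bij_betw[OF h])
    finally show "emeasure (distr (\<Pi>\<^sub>M i\<in>{..<?n}. lborel) borel (\<lambda>c. \<Sum>i<?n. c i *\<^sub>R h i)) (box l u) =
        ennreal (\<Prod>b\<in>Basis. (u - l) \<bullet> b)" .
  qed simp
  define T where "T x = (\<Sum>i<?n. (x \<bullet> h i) *\<^sub>R b i)" for x
  have lin: "linear T"
    unfolding T_def
    by (intro linearI) (simp_all add: inner_add_left scaleR_add_left sum.distrib scaleR_sum_right)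
  have "(norm (T x))\<^sup>2 = (norm x)\<^sup>2" for x
    unfolding onb_norm[OF b, of "T x"] onb_norm[OF h_frame, of x]
    by (intro sum.cong refl) (simp add: T_def frame_inner_sum[OF b])
  then have nT: "norm (T x) = norm x" for x
    by (simp add: power2_eq_iff_nonneg)
  have [measurable]: "T \<in> borel_measurable borel"
    unfolding T_def by measurable
  have "(\<integral>\<^sup>+x. f x \<partial>lborel) = (\<integral>\<^sup>+x. f (T x) \<partial>lborel)"
    by (rule nn_integral_lborel_isometry[OF lin nT, symmetric]) simp
  also have "\<dots> = (\<integral>\<^sup>+c. f (T (\<Sum>i<?n. c i *\<^sub>R h i)) \<partial>(\<Pi>\<^sub>M i\<in>{..<?n}. lborel))"
    by (subst std[symmetric]) (simp add: nn_integral_distr)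
  also have "\<dots> = (\<integral>\<^sup>+c. f (\<Sum>i<?n. c i *\<^sub>R b i) \<partial>(\<Pi>\<^sub>M i\<in>{..<?n}. lborel))"
    by (simp add: T_def frame_inner_sum[OF h_frame])
  finally show ?thesis by simp
qed

text \<open>Thickening: the unit cube in the remaining coordinates has measure 1, so an integral
  over r coordinates becomes one over the whole space, where invariance under translations and
  isometries is available.\<close>

lemma nn_integral_frame:
  fixes b :: "nat \<Rightarrow> 'a::euclidean_space" and f :: "'a \<Rightarrow> ennreal"
  assumes b: "orthonormal_frame DIM('a) b" and r: "r \<le> DIM('a)"
    and f[measurable]: "f \<in> borel_measurable borel"
  shows "(\<integral>\<^sup>+c. f (\<Sum>i<r. c i *\<^sub>R b i) \<partial>(\<Pi>\<^sub>M i\<in>{..<r}. lborel)) =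
    (\<integral>\<^sup>+x. f (\<Sum>i<r. (x \<bullet> b i) *\<^sub>R b i) *
       (\<Prod>i\<in>{r..<DIM('a)}. indicator {0..1} (x \<bullet> b i)) \<partial>lborel)"
proof -
  let ?n = "DIM('a)"
  have U: "{..<r} \<union> {r..<?n} = {..<?n}" using r by auto
  let ?g = "\<lambda>c. f (\<Sum>i<r. c i *\<^sub>R b i) * (\<Prod>i\<in>{r..<?n}. indicator {0..1} (c i)) :: ennreal"
  have [measurable]: "(\<lambda>c. \<Sum>i<r. c i *\<^sub>R b i) \<in> borel_measurable (\<Pi>\<^sub>M i\<in>{..<?n}. lborel)"
    using r by (intro borel_measurable_sum borel_measurable_scaleR) auto
  have mg: "?g \<in> borel_measurable (\<Pi>\<^sub>M i\<in>{..<?n}. lborel)"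
    by (intro borel_measurable_times_ennreal borel_measurable_prod_ennreal) 
       (auto intro!: measurable_compose[OF measurable_component_singleton])
  have "(\<integral>\<^sup>+x. f (\<Sum>i<r. (x \<bullet> b i) *\<^sub>R b i) *
       (\<Prod>i\<in>{r..<?n}. indicator {0..1} (x \<bullet> b i)) \<partial>lborel) =
     (\<integral>\<^sup>+c. ?g c \<partial>(\<Pi>\<^sub>M i\<in>{..<?n}. lborel))"
    using r by (subst nn_integral_onb[OF b, symmetric])
      (auto intro!: nn_integral_cong arg_cong2[where f="(*)"] arg_cong[of _ _ f] sum.cong prod.cong
        simp: frame_inner_sum[OF b])
  also have "\<dots> = (\<integral>\<^sup>+x. \<integral>\<^sup>+y. ?g (merge {..<r} {r..<?n} (x, y))
      \<partial>(\<Pi>\<^sub>M i\<in>{r..<?n}. (lborel :: real measure)) \<partial>(\<Pi>\<^sub>M i\<in>{..<r}. lborel))"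
    using mg unfolding U[symmetric] by (intro lborel_PiM.product_nn_integral_fold) auto
  also have "\<dots> = (\<integral>\<^sup>+x. f (\<Sum>i<r. x i *\<^sub>R b i) *
      (\<integral>\<^sup>+y. (\<Prod>i\<in>{r..<?n}. indicator {0..1} (y i)) \<partial>(\<Pi>\<^sub>M i\<in>{r..<?n}. (lborel :: real measure))) \<partial>(\<Pi>\<^sub>M i\<in>{..<r}. lborel))"
  proof (intro nn_integral_cong)
    fix x :: "nat \<Rightarrow> real"
    have ind: "(indicator {0..1} :: real \<Rightarrow> ennreal) \<in> borel_measurable lborel" by measurable
    have [measurable]: "(\<lambda>y. \<Prod>i\<in>{r..<?n}. indicator {0..1} (y i) :: ennreal)
        \<in> borel_measurable (\<Pi>\<^sub>M i\<in>{r..<?n}. (lborel :: real measure))"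
      by (intro borel_measurable_prod_ennreal measurable_PiM_component ind)
    have "?g (merge {..<r} {r..<?n} (x, y)) =
        f (\<Sum>i<r. x i *\<^sub>R b i) * (\<Prod>i\<in>{r..<?n}. indicator {0..1} (y i))" for y
      by (intro arg_cong2[where f="(*)"] arg_cong[of _ _ f] sum.cong prod.cong) (auto simp: merge_def)
    then show "(\<integral>\<^sup>+y. ?g (merge {..<r} {r..<?n} (x, y)) \<partial>(\<Pi>\<^sub>M i\<in>{r..<?n}. (lborel :: real measure))) =
        f (\<Sum>i<r. x i *\<^sub>R b i) * (\<integral>\<^sup>+y. (\<Prod>i\<in>{r..<?n}. indicator {0..1} (y i)) \<partial>(\<Pi>\<^sub>M i\<in>{r..<?n}. (lborel :: real measure)))"
      by (simp add: nn_integral_cmult)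
  qed
  also have "(\<integral>\<^sup>+y. (\<Prod>i\<in>{r..<?n}. indicator {0..1} (y i)) \<partial>(\<Pi>\<^sub>M i\<in>{r..<?n}. (lborel :: real measure))) = (1::ennreal)"
    by (subst lborel_PiM.product_nn_integral_prod) auto
  finally show ?thesis by simp
qed

text \<open>The prism \<open>L \<times> [0, 1]\<^sup>n\<^sup>-\<^sup>r\<close> over the span \<open>L\<close> of a frame does not depend on the frame.\<close>

lemma nn_integral_frame_change:
  fixes e e' :: "nat \<Rightarrow> 'a::euclidean_space" and f :: "'a \<Rightarrow> ennreal"
  assumes e: "orthonormal_frame r e" and e': "orthonormal_frame r e'"
    and span: "span (e ` {..<r}) = span (e' ` {..<r})" and v: "v \<in> span (e ` {..<r})"
    and [measurable]: "f \<in> borel_measurable borel"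
  shows "(\<integral>\<^sup>+c. f (\<Sum>i<r. c i *\<^sub>R e i) \<partial>(\<Pi>\<^sub>M i\<in>{..<r}. lborel)) =
    (\<integral>\<^sup>+c. f (v + (\<Sum>i<r. c i *\<^sub>R e' i)) \<partial>(\<Pi>\<^sub>M i\<in>{..<r}. lborel))"
proof -
  let ?n = "DIM('a)"
  obtain b where b: "orthonormal_frame ?n b" "\<And>i. i < r \<Longrightarrow> b i = e i" and r: "r \<le> ?n"
    using orthonormal_frame_extend[OF e] by blast
  define b' where "b' i = (if i < r then e' i else b i)" for i
  have b_e: "b i \<bullet> e j = 0" if "r \<le> i" "i < ?n" "j < r" for i j
    using b(1) that r unfolding b(2)[OF that(3), symmetric] by (auto simp: orthonormal_frame_def)
  have perp: "b i \<bullet> w = 0" if "r \<le> i" "i < ?n" "w \<in> span (e ` {..<r})" for i w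
  proof -
    have "orthogonal (b i) w"
      using that by (intro orthogonal_to_span[OF that(3)]) 
        (auto simp: orthogonal_def b_e)
    then show ?thesis by (simp add: orthogonal_def)
  qed
  have e'_span: "e' i \<in> span (e ` {..<r})" if "i < r" for i
    unfolding span using that by (auto intro: span_base)
  have b': "orthonormal_frame ?n b'"
    unfolding orthonormal_frame_def
  proof (intro allI impI)
    fix i j assume "i < ?n" "j < ?n"
    then show "b' i \<bullet> b' j = (if i = j then 1 else 0)"
      using b(1) e' perp[of i "e' j"] perp[of j "e' i"] e'_span
      by (auto simp: b'_def orthonormal_frame_def inner_commute)
  qed
  \<comment> \<open>Both bases share the vectors from index r on; removing these common terms from
    the two full expansions of x leaves equal sums.\<close>
  have proj: "(\<Sum>i<r. (x \<bullet> b i) *\<^sub>R b i) = (\<Sum>i<r. (x \<bullet> b' i) *\<^sub>R b' i)" for x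
  proof -
    have split: "(\<Sum>i<?n. (x \<bullet> a i) *\<^sub>R a i) =
        (\<Sum>i<r. (x \<bullet> a i) *\<^sub>R a i) + (\<Sum>i\<in>{r..<?n}. (x \<bullet> a i) *\<^sub>R a i)" for a :: "nat \<Rightarrow> 'a"
      using r by (subst sum.union_disjoint[symmetric]) (auto intro!: sum.cong)
    have "(\<Sum>i\<in>{r..<?n}. (x \<bullet> b i) *\<^sub>R b i) = (\<Sum>i\<in>{r..<?n}. (x \<bullet> b' i) *\<^sub>R b' i)"
      by (intro sum.cong) (auto simp: b'_def)
    then show ?thesis
      using onb_expand[OF b(1), of x] onb_expand[OF b', of x] split[of b] split[of b']
      by (metis add_right_cancel)
  qed
  define g where "g x = f x" for x
  have [measurable]: "g \<in> borel_measurable borel" by (simp add: g_def[abs_def])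
  let ?F = "\<lambda>x. g (\<Sum>i<r. (x \<bullet> b i) *\<^sub>R b i) *
       (\<Prod>i\<in>{r..<?n}. indicator {0..1} (x \<bullet> b i)) :: ennreal"
  have [measurable]: "?F \<in> borel_measurable borel"
    by (intro borel_measurable_times_ennreal borel_measurable_prod_ennreal) measurable
  have vb: "v \<bullet> b i = 0" if "i \<in> {r..<?n}" for i
    using perp[of i v] that v by (simp add: inner_commute)
  have pv: "(\<Sum>i<r. (v \<bullet> b i) *\<^sub>R b i) = v"
    using frame_expand[OF e v] b(2) by simp
  have "(\<integral>\<^sup>+c. f (\<Sum>i<r. c i *\<^sub>R e i) \<partial>(\<Pi>\<^sub>M i\<in>{..<r}. lborel)) =
      (\<integral>\<^sup>+c. g (\<Sum>i<r. c i *\<^sub>R b i) \<partial>(\<Pi>\<^sub>M i\<in>{..<r}. lborel))"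
    by (simp add: b(2) g_def)
  also have "\<dots> = (\<integral>\<^sup>+x. ?F x \<partial>lborel)"
    by (rule nn_integral_frame[OF b(1) r]) simp
  also have "\<dots> = (\<integral>\<^sup>+x. ?F (x + v) \<partial>lborel)"
    by (rule nn_integral_lborel_translate[symmetric]) simp
  also have "\<dots> = (\<integral>\<^sup>+x. f (v + (\<Sum>i<r. (x \<bullet> b' i) *\<^sub>R b' i)) *
       (\<Prod>i\<in>{r..<?n}. indicator {0..1} (x \<bullet> b' i)) \<partial>lborel)"
    by (intro nn_integral_cong arg_cong2[where f="(*)"] prod.cong refl)
       (simp_all add: inner_add_left scaleR_add_left sum.distrib pv proj vb add.commute g_def, simp add: b'_def)
  also have "\<dots> = (\<integral>\<^sup>+c. f (v + (\<Sum>i<r. c i *\<^sub>R b' i)) \<partial>(\<Pi>\<^sub>M i\<in>{..<r}. lborel))"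
    by (rule nn_integral_frame[OF b' r, symmetric, of "\<lambda>w. f (v + w)"]) measurable
  also have "\<dots> = (\<integral>\<^sup>+c. f (v + (\<Sum>i<r. c i *\<^sub>R e' i)) \<partial>(\<Pi>\<^sub>M i\<in>{..<r}. lborel))"
    by (simp add: b'_def)
  finally show ?thesis .
qed

section \<open>The volume of a simplex in terms of its edges\<close>

lemma gso_inner_lower: "j < k \<Longrightarrow> gso y k \<bullet> y j = 0"
  by (rule gso_perp) (auto intro: span_base)

lemma gso_inner_self: "gso y k \<bullet> y k = (norm (gso y k))\<^sup>2"
  using gso_perp[OF gso_diff_in_span, of y k] by (simp add: inner_diff_right power2_norm_eq_inner)

lemma gso_neq_zero: "gramdet r y \<noteq> 0 \<Longrightarrow> k < r \<Longrightarrow> gso y k \<noteq> 0"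
  unfolding gramdet_def by (metis finite_lessThan lessThan_iff norm_zero power_zero_numeral prod_zero)

text \<open>The difference of the two combinations is paired with the residual at the largest index
  m where the coefficients differ: earlier vectors are orthogonal to that residual, and later
  coefficients agree.\<close>

lemma gramdet_lin_indep:
  assumes "gramdet r y \<noteq> 0" "(\<Sum>k<r. c k *\<^sub>R y k) = (\<Sum>k<r. d k *\<^sub>R y k)" "k < r"
  shows "c k = d k"
proof (rule ccontr)
  assume "c k \<noteq> d k"
  define m where "m = Max {j. j < r \<and> c j \<noteq> d j}"
  have fin: "finite {j. j < r \<and> c j \<noteq> d j}" by simp
  have "m \<in> {j. j < r \<and> c j \<noteq> d j}"
    unfolding m_def using \<open>c k \<noteq> d k\<close> assms(3) by (intro Max_in[OF fin]) auto
  then have m: "m < r" "c m \<noteq> d m" by auto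
  have above: "c j = d j" if "m < j" "j < r" for j
    using that Max_ge[OF fin, of j] unfolding m_def[symmetric] by fastforce
  have "0 = gso y m \<bullet> ((\<Sum>k<r. c k *\<^sub>R y k) - (\<Sum>k<r. d k *\<^sub>R y k))"
    by (simp add: assms(2))
  also have "\<dots> = (\<Sum>k<r. (c k - d k) * (gso y m \<bullet> y k))"
    by (simp add: inner_diff_right inner_sum_right left_diff_distrib sum_subtractf)
  also have "\<dots> = (\<Sum>k<r. if k = m then (c m - d m) * (norm (gso y m))\<^sup>2 else 0)"
  proof (intro sum.cong refl)
    fix j assume "j \<in> {..<r}"
    then show "(c j - d j) * (gso y m \<bullet> y j) = (if j = m then (c m - d m) * (norm (gso y m))\<^sup>2 else 0)"
      using above[of j] gso_inner_lower[of j m y] gso_inner_self[of y m]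
      by (cases j m rule: linorder_cases) auto
  qed
  also have "\<dots> = (c m - d m) * (norm (gso y m))\<^sup>2"
    using m by simp
  finally show False
    using m gso_neq_zero[OF assms(1) m(1)] by simp
qed

lemma dim_span_gso_lt:
  assumes "gramdet r y = 0"
  shows "dim (span (y ` {..<r})) < r"
proof -
  obtain k where k: "k < r" "gso y k = 0"
    using assms unfolding gramdet_def by auto
  have "y k \<in> span (y ` {..<k})"
    using gso_diff_in_span[of y k] k by simp
  also have "\<dots> \<subseteq> span (y ` ({..<r} - {k}))"
    using k by (intro span_mono) auto
  finally have yk: "y k \<in> span (y ` ({..<r} - {k}))" .
  have "y ` {..<r} = insert (y k) (y ` ({..<r} - {k}))"
    using k by auto
  then have "span (y ` {..<r}) = span (y ` ({..<r} - {k}))"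
    using span_redundant[OF yk] by simp
  then have "dim (span (y ` {..<r})) = dim (y ` ({..<r} - {k}))"
    by simp
  also have "\<dots> \<le> card (y ` ({..<r} - {k}))"
    by (rule dim_le_card') simp
  also have "\<dots> \<le> card ({..<r} - {k})"
    by (rule card_image_le) simp
  also have "\<dots> < r" using k by simp
  finally show ?thesis .
qed

definition normalized_gso :: "(nat \<Rightarrow> 'a::euclidean_space) \<Rightarrow> nat \<Rightarrow> 'a" where
  "normalized_gso y k = gso y k /\<^sub>R norm (gso y k)"

lemma frame_normalized_gso:
  assumes "gramdet r y \<noteq> 0" shows "orthonormal_frame r (normalized_gso y)"
  unfolding orthonormal_frame_def
proof (intro allI impI)
  fix i j assume "i < r" "j < r"
  then show "normalized_gso y i \<bullet> normalized_gso y j = (if i = j then 1 else 0)"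
    using gso_neq_zero[OF assms, of i]
    by (cases "i = j") (simp_all add: normalized_gso_def gso_orthogonal' dot_square_norm power2_eq_square)
qed

lemma span_normalized_gso:
  assumes "gramdet r y \<noteq> 0"
  shows "span (normalized_gso y ` {..<r}) = span (y ` {..<r})"
proof -
  have "span (normalized_gso y ` {..<r}) = span (gso y ` {..<r})"
  proof (rule span_eq[THEN iffD2], intro conjI subsetI)
    fix x assume "x \<in> gso y ` {..<r}"
    then obtain j where j: "j < r" "x = gso y j" by auto
    have "norm (gso y j) *\<^sub>R normalized_gso y j \<in> span (normalized_gso y ` {..<r})"
      using j by (intro span_scale span_base) auto
    then show "x \<in> span (normalized_gso y ` {..<r})"
      using j gso_neq_zero[OF assms j(1)] by (simp add: normalized_gso_def)
  next
    fix x assume "x \<in> normalized_gso y ` {..<r}"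
    then show "x \<in> span (gso y ` {..<r})"
      by (auto simp: normalized_gso_def intro!: span_scale intro: span_base)
  qed
  then show ?thesis by (simp only: span_gso)
qed

text \<open>The change of variables from the orthonormal frame to the vectors y, proved without a
  Jacobian matrix. The last coordinate is split off and rescaled by \<open>norm (gso y r)\<close>;
  the component of \<open>y r\<close> along its predecessors is absorbed by a translation of the
  inner integral.\<close>

lemma nn_integral_triangular:
  fixes y :: "nat \<Rightarrow> 'a::euclidean_space" and f :: "'a \<Rightarrow> ennreal"
  assumes "gramdet r y \<noteq> 0" and "f \<in> borel_measurable borel"
  shows "(\<integral>\<^sup>+c. f (\<Sum>i<r. c i *\<^sub>R normalized_gso y i) \<partial>(\<Pi>\<^sub>M i\<in>{..<r}. lborel)) =
    ennreal (\<Prod>k<r. norm (gso y k)) * (\<integral>\<^sup>+u. f (\<Sum>i<r. u i *\<^sub>R y i) \<partial>(\<Pi>\<^sub>M i\<in>{..<r}. lborel))"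
  using assms
proof (induction r arbitrary: f)
  case (Suc r)
  note [measurable] = Suc.prems(2)
  let ?e = "normalized_gso y"
  interpret PiM_r: sigma_finite_measure "\<Pi>\<^sub>M i\<in>{..<r}. (lborel :: real measure)"
    by (rule lborel_PiM.sigma_finite) simp
  have ins: "{..<Suc r} = insert r {..<r}" by auto
  have g0: "gso y r \<noteq> 0" using gso_neq_zero[OF Suc.prems(1)] by simp
  have gr: "gramdet r y \<noteq> 0" using Suc.prems(1) by (simp add: gramdet_def)
  have split: "(\<integral>\<^sup>+c. f (\<Sum>i<Suc r. c i *\<^sub>R a i) \<partial>(\<Pi>\<^sub>M i\<in>{..<Suc r}. lborel)) =
      (\<integral>\<^sup>+t. \<integral>\<^sup>+c. f (t *\<^sub>R a r + (\<Sum>i<r. c i *\<^sub>R a i)) \<partial>(\<Pi>\<^sub>M i\<in>{..<r}. lborel) \<partial>lborel)"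
    for a :: "nat \<Rightarrow> 'a"
  proof -
    have "(\<lambda>c. f (\<Sum>i<Suc r. c i *\<^sub>R a i)) \<in> borel_measurable (\<Pi>\<^sub>M i\<in>insert r {..<r}. lborel)"
      unfolding ins[symmetric] by measurable
    then show ?thesis
      unfolding ins
      by (subst lborel_PiM.product_nn_integral_insert_rev)
        (auto intro!: nn_integral_cong arg_cong[of _ _ f] sum.cong simp: lessThan_Suc)
  qed
  have inner: "(\<integral>\<^sup>+c. f (w + (\<Sum>i<r. c i *\<^sub>R ?e i)) \<partial>(\<Pi>\<^sub>M i\<in>{..<r}. lborel)) =
      ennreal (\<Prod>k<r. norm (gso y k)) *
      (\<integral>\<^sup>+u. f (w + v + (\<Sum>i<r. u i *\<^sub>R y i)) \<partial>(\<Pi>\<^sub>M i\<in>{..<r}. lborel))"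
    if v: "v \<in> span (y ` {..<r})" for v w
  proof -
    have "(\<integral>\<^sup>+c. f (w + (\<Sum>i<r. c i *\<^sub>R ?e i)) \<partial>(\<Pi>\<^sub>M i\<in>{..<r}. lborel)) =
      (\<integral>\<^sup>+c. f (w + (v + (\<Sum>i<r. c i *\<^sub>R ?e i))) \<partial>(\<Pi>\<^sub>M i\<in>{..<r}. lborel))"
      using frame_normalized_gso[OF gr] v span_normalized_gso[OF gr]
      by (intro nn_integral_frame_change[of r ?e ?e v "\<lambda>x. f (w + x)"]) auto
    also have "\<dots> = ennreal (\<Prod>k<r. norm (gso y k)) *
      (\<integral>\<^sup>+u. f (w + (v + (\<Sum>i<r. u i *\<^sub>R y i))) \<partial>(\<Pi>\<^sub>M i\<in>{..<r}. lborel))"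
      by (rule Suc.IH[of "\<lambda>x. f (w + (v + x))"]) (use gr in auto)
    finally show ?thesis by (simp add: add.assoc)
  qed
  let ?P = "ennreal (\<Prod>k<r. norm (gso y k))"
  let ?G = "\<lambda>t. \<integral>\<^sup>+u. f (t *\<^sub>R y r + (\<Sum>i<r. u i *\<^sub>R y i)) \<partial>(\<Pi>\<^sub>M i\<in>{..<r}. lborel)"
  have "(\<integral>\<^sup>+c. f (\<Sum>i<Suc r. c i *\<^sub>R ?e i) \<partial>(\<Pi>\<^sub>M i\<in>{..<Suc r}. lborel)) =
      (\<integral>\<^sup>+t. \<integral>\<^sup>+c. f (t *\<^sub>R ?e r + (\<Sum>i<r. c i *\<^sub>R ?e i)) \<partial>(\<Pi>\<^sub>M i\<in>{..<r}. lborel) \<partial>lborel)"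
    by (rule split)
  also have "\<dots> = norm (gso y r) * (\<integral>\<^sup>+t. \<integral>\<^sup>+c. f (t *\<^sub>R gso y r + (\<Sum>i<r. c i *\<^sub>R ?e i))
       \<partial>(\<Pi>\<^sub>M i\<in>{..<r}. lborel) \<partial>lborel)"
  proof -
    have ng: "(norm (gso y r) * t) *\<^sub>R ?e r = t *\<^sub>R gso y r" for t
      using g0 by (simp add: normalized_gso_def)
    have "(\<lambda>t. \<integral>\<^sup>+c. f (t *\<^sub>R ?e r + (\<Sum>i<r. c i *\<^sub>R ?e i)) \<partial>(\<Pi>\<^sub>M i\<in>{..<r}. lborel)) \<in> borel_measurable borel"
      by measurable
    from nn_integral_real_affine[OF this, of "norm (gso y r)" 0] show ?thesis
      using g0 by (simp add: ng)
  qed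
  also have "(\<lambda>t. \<integral>\<^sup>+c. f (t *\<^sub>R gso y r + (\<Sum>i<r. c i *\<^sub>R ?e i)) \<partial>(\<Pi>\<^sub>M i\<in>{..<r}. lborel)) =
      (\<lambda>t. ?P * ?G t)"
  proof
    fix t
    \<comment> \<open>This is the part of \<open>t *\<^sub>R y r\<close> along the earlier vectors.
      For each fixed t it is a translation inside the inner flat, to which \<open>inner\<close>
      applies.\<close>
    have "t *\<^sub>R (y r - gso y r) \<in> span (y ` {..<r})"
      by (intro span_scale gso_diff_in_span)
    from inner[OF this, of "t *\<^sub>R gso y r"]
    show "(\<integral>\<^sup>+c. f (t *\<^sub>R gso y r + (\<Sum>i<r. c i *\<^sub>R ?e i)) \<partial>(\<Pi>\<^sub>M i\<in>{..<r}. lborel)) = ?P * ?G t"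
      by (simp add: algebra_simps)
  qed
  also have "(\<integral>\<^sup>+t. ?P * ?G t \<partial>lborel) = ?P * (\<integral>\<^sup>+t. ?G t \<partial>lborel)"
    by (rule nn_integral_cmult) measurable
  also have "(\<integral>\<^sup>+t. ?G t \<partial>lborel) = (\<integral>\<^sup>+u. f (\<Sum>i<Suc r. u i *\<^sub>R y i) \<partial>(\<Pi>\<^sub>M i\<in>{..<Suc r}. lborel))"
    by (rule split[symmetric])
  finally show ?case
    by (simp add: ennreal_mult' prod_nonneg mult_ac)
qed simp

text \<open>One factor is the measure of a point, and in \<open>ennreal\<close> a zero factor
  annihilates the infinite ones.\<close>

lemma emeasure_PiM_hyperplane:
  fixes k r :: nat
  assumes "k < r" shows "emeasure (\<Pi>\<^sub>M i\<in>{..<r}. lborel) (\<Pi>\<^sub>E i\<in>{..<r}. if i = k then {0::real} else UNIV) = 0"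
proof -
  have "emeasure (\<Pi>\<^sub>M i\<in>{..<r}. lborel) (\<Pi>\<^sub>E i\<in>{..<r}. if i = k then {0::real} else UNIV) =
      (\<Prod>i<r. emeasure lborel (if i = k then {0::real} else UNIV))"
    by (rule lborel_PiM.emeasure_PiM) auto
  also have "\<dots> = 0"
    using assms by (intro prod_zero) (auto intro!: bexI[of _ k])
  finally show ?thesis .
qed

text \<open>Vertices are numbered from 1 and edges from 0; every edge starts at vertex 1, which
  explains the shift by 2.\<close>

definition simplex_gramdet :: "nat \<Rightarrow> (nat \<Rightarrow> 'a::euclidean_space) \<Rightarrow> real" where
  "simplex_gramdet r x = gramdet r (\<lambda>k. x (k + 2) - x 1)"

lemma simplex_vertex_cases: "1 \<le> i \<Longrightarrow> i \<le> r + 1 \<Longrightarrow> i = 1 \<or> (\<exists>k<r. i = k + (2::nat))"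
  by presburger

text \<open>The points with admissible edge coordinates form a convex set containing the vertices,
  hence the hull; since the edges are independent, no other coordinates describe the same point.
  Conversely, admissible coordinates complete to barycentric weights.\<close>

lemma simplex_hull_coordinates:
  fixes x :: "nat \<Rightarrow> 'a::euclidean_space"
  assumes "simplex_gramdet r x \<noteq> 0"
  shows "x 1 + (\<Sum>k<r. u k *\<^sub>R (x (k + 2) - x 1)) \<in> convex hull (x ` {1..r+1}) \<longleftrightarrow>
    (\<forall>k\<in>{..<r}. 0 \<le> u k) \<and> sum u {..<r} \<le> 1"
proof
  let ?y = "\<lambda>k. x (k + 2) - x 1"
  let ?T = "{x 1 + (\<Sum>k<r. u k *\<^sub>R ?y k) | u. (\<forall>k\<in>{..<r}. 0 \<le> u k) \<and> sum u {..<r} \<le> 1}"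
  have "convex ?T"
  proof (rule convexI)
    fix p q and s t :: real assume "p \<in> ?T" "q \<in> ?T" and st: "0 \<le> s" "0 \<le> t" "s + t = 1"
    then obtain u v where u: "p = x 1 + (\<Sum>k<r. u k *\<^sub>R ?y k)" "\<forall>k\<in>{..<r}. 0 \<le> u k" "sum u {..<r} \<le> 1"
      and v: "q = x 1 + (\<Sum>k<r. v k *\<^sub>R ?y k)" "\<forall>k\<in>{..<r}. 0 \<le> v k" "sum v {..<r} \<le> 1"
      by blast
    let ?w = "\<lambda>k. s * u k + t * v k"
    have "s *\<^sub>R p + t *\<^sub>R q = (s + t) *\<^sub>R x 1 + (\<Sum>k<r. ?w k *\<^sub>R ?y k)"
      by (simp only: u(1) v(1) scaleR_add_left scaleR_add_right scaleR_sum_right scaleR_scaleR sum.distrib add_ac)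
    moreover have "sum ?w {..<r} \<le> 1"
    proof -
      have "sum ?w {..<r} = s * sum u {..<r} + t * sum v {..<r}"
        by (simp add: sum.distrib sum_distrib_left)
      also have "\<dots> \<le> s * 1 + t * 1"
        using u v st by (intro add_mono mult_left_mono) auto
      finally show ?thesis using st by simp
    qed
    moreover have "\<forall>k\<in>{..<r}. 0 \<le> ?w k" using u v st by auto
    ultimately show "s *\<^sub>R p + t *\<^sub>R q \<in> ?T" using st by auto
  qed
  moreover have "x ` {1..r+1} \<subseteq> ?T"
  proof
    fix z assume "z \<in> x ` {1..r+1}"
    then obtain i where i: "z = x i" "1 \<le> i" "i \<le> r + 1" by auto
    define u where "u k = (if k + 2 = i then 1 else 0 :: real)" for k
    have "z = x 1 + (\<Sum>k<r. u k *\<^sub>R ?y k) \<and> sum u {..<r} \<le> 1"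
    proof (cases "i = 1")
      case False
      obtain j where j: "i = j + 2" "j < r"
        using i False that[of "i - 2"] by auto
      have s: "(\<Sum>k<r. u k *\<^sub>R ?y k) = (\<Sum>k<r. if k = j then ?y k else 0)"
        "sum u {..<r} = (\<Sum>k<r. if k = j then 1 else 0)"
        unfolding u_def j by (rule sum.cong; simp)+
      show ?thesis using i(1) j unfolding s by simp
    qed (simp add: i u_def)
    moreover have "\<forall>k\<in>{..<r}. 0 \<le> u k" by (simp add: u_def)
    ultimately show "z \<in> ?T" by blast
  qed
  ultimately have sub: "convex hull (x ` {1..r+1}) \<subseteq> ?T" by (simp add: hull_minimal)
  {
    assume "x 1 + (\<Sum>k<r. u k *\<^sub>R ?y k) \<in> convex hull (x ` {1..r+1})"
    then obtain v where v: "(\<Sum>k<r. u k *\<^sub>R ?y k) = (\<Sum>k<r. v k *\<^sub>R ?y k)"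
      "\<forall>k\<in>{..<r}. 0 \<le> v k" "sum v {..<r} \<le> 1"
      using sub by auto
    have "u k = v k" if "k < r" for k
      using gramdet_lin_indep[OF assms[unfolded simplex_gramdet_def] v(1) that] .
    then show "(\<forall>k\<in>{..<r}. 0 \<le> u k) \<and> sum u {..<r} \<le> 1"
      using v(2,3) by simp
  }
  assume u: "(\<forall>k\<in>{..<r}. 0 \<le> u k) \<and> sum u {..<r} \<le> 1"
  define w where "w i = (if i = 1 then 1 - sum u {..<r} else u (i - 2))" for i
  have set: "{1..r+1} = insert 1 ((\<lambda>k. k + 2) ` {..<r})"
  proof (intro set_eqI iffI)
    fix i assume "i \<in> {1..r+1}"
    then show "i \<in> insert 1 ((\<lambda>k. k + 2) ` {..<r})"
      by (cases "i = 1") (auto intro!: image_eqI[of _ _ "i - 2"])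
  qed auto
  have sum_eq: "(\<Sum>i\<in>{1..r+1}. h i) = h 1 + (\<Sum>k<r. h (k + 2))" for h :: "nat \<Rightarrow> 'b::comm_monoid_add"
    unfolding set by (subst sum.insert) (auto simp: sum.reindex inj_on_def o_def)
  have "(\<Sum>i\<in>{1..r+1}. w i *\<^sub>R x i) \<in> convex hull (x ` {1..r+1})"
  proof (rule convex_sum)
    show "sum w {1..r+1} = 1" unfolding sum_eq by (simp add: w_def)
    show "0 \<le> w i" if "i \<in> {1..r+1}" for i
      using that u by (auto simp: w_def)
  qed (auto simp: hull_inc)
  also have "(\<Sum>i\<in>{1..r+1}. w i *\<^sub>R x i) = x 1 + (\<Sum>k<r. u k *\<^sub>R ?y k)"
    unfolding sum_eq by (simp add: w_def scaleR_diff_right sum_subtractf scaleR_sum_left algebra_simps)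
  finally show "x 1 + (\<Sum>k<r. u k *\<^sub>R ?y k) \<in> convex hull (x ` {1..r+1})" .
qed

text \<open>Shows that the value selected by \<open>THE\<close> in \<open>flat_volume\<close> does
  not depend on the chart. For independent edges the frame is exchanged for the normalised
  residuals, the triangular change of variables yields the product of their norms, and the standard
  simplex contributes 1 / r!. For dependent edges a suitable frame places the simplex in a
  coordinate hyperplane.\<close>

lemma flat_chart_simplex_measure:
  fixes x :: "nat \<Rightarrow> 'a::euclidean_space" and r :: nat
  defines "S \<equiv> convex hull (x ` {1..r+1})"
  assumes e: "orthonormal_frame r e" and S: "S \<subseteq> range (flat_chart r p e)"
  shows "measure (\<Pi>\<^sub>M i\<in>{..<r}. lborel) {c \<in> space (\<Pi>\<^sub>M i\<in>{..<r}. lborel). flat_chart r p e c \<in> S} =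
    sqrt (simplex_gramdet r x) / fact r"
proof -
  let ?M = "\<Pi>\<^sub>M i\<in>{..<r}. (lborel :: real measure)"
  let ?y = "\<lambda>k. x (k + 2) - x 1"
  let ?L = "span (e ` {..<r})"
  have S_borel[measurable]: "S \<in> sets borel"
    unfolding S_def by (intro borel_closed compact_imp_closed finite_imp_compact_convex_hull) auto
  have xS: "x i \<in> S" if "1 \<le> i" "i \<le> r + 1" for i
    using that by (auto simp: S_def intro: hull_inc)
  have px: "x i - p \<in> ?L" if "1 \<le> i" "i \<le> r + 1" for i
    using xS[OF that] S frame_in_span[of _ e r] by (auto simp: flat_chart_def)
  have yL: "?y k \<in> ?L" if "k < r" for k
    using span_diff[OF px[of "k + 2"] px[of 1]] that by simp
  have spanL: "span (?y ` {..<r}) \<subseteq> ?L"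
    using yL by (intro span_minimal) auto
  have vL: "p - x 1 \<in> ?L"
    using span_neg[OF px[of 1]] by simp
  \<comment> \<open>The chart may be replaced by any frame of the same direction space, with the
    origin moved to vertex 1.\<close>
  have em: "emeasure ?M {c \<in> space ?M. flat_chart r p e c \<in> S} =
      (\<integral>\<^sup>+c. indicator S (x 1 + (\<Sum>i<r. c i *\<^sub>R e' i)) \<partial>?M)"
    if e': "orthonormal_frame r e'" "span (e' ` {..<r}) = ?L" for e'
  proof -
    let ?C = "{c \<in> space ?M. flat_chart r p e c \<in> S}"
    have C: "?C \<in> sets ?M"
      unfolding flat_chart_def by measurable
    have "emeasure ?M ?C = (\<integral>\<^sup>+c. indicator ?C c \<partial>?M)"
      by (rule nn_integral_indicator[OF C, symmetric])
    also have "\<dots> = (\<integral>\<^sup>+c. indicator S (x 1 + ((p - x 1) + (\<Sum>i<r. c i *\<^sub>R e i))) \<partial>?M)"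
      by (intro nn_integral_cong) (simp add: indicator_def flat_chart_def)
    also have "\<dots> = (\<integral>\<^sup>+c. indicator S (x 1 + (\<Sum>i<r. c i *\<^sub>R e' i)) \<partial>?M)"
      using e' e vL
      by (intro nn_integral_frame_change[of r e' e "p - x 1" "\<lambda>w. indicator S (x 1 + w)", symmetric])
        (auto intro!: borel_measurable_indicator')
    finally show ?thesis by simp
  qed
  show ?thesis
  proof (cases "simplex_gramdet r x = 0")
    case False
    have gd: "gramdet r ?y \<noteq> 0" using False by (simp add: simplex_gramdet_def)
    have "span (?y ` {..<r}) = ?L"
      using dim_span_gso[OF gd] frame_dim[OF e] spanL by (intro subspace_dim_equal) auto
    then have "emeasure ?M {c \<in> space ?M. flat_chart r p e c \<in> S} =
        (\<integral>\<^sup>+c. indicator S (x 1 + (\<Sum>i<r. c i *\<^sub>R normalized_gso ?y i)) \<partial>?M)"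
      using frame_normalized_gso[OF gd] span_normalized_gso[OF gd] by (intro em) auto
    also have "\<dots> = ennreal (\<Prod>k<r. norm (gso ?y k)) *
        (\<integral>\<^sup>+u. indicator S (x 1 + (\<Sum>k<r. u k *\<^sub>R ?y k)) \<partial>?M)"
      by (rule nn_integral_triangular[OF gd, of "\<lambda>w. indicator S (x 1 + w)"]) measurable
    also have "(\<integral>\<^sup>+u. indicator S (x 1 + (\<Sum>k<r. u k *\<^sub>R ?y k)) \<partial>?M) =
        (\<integral>\<^sup>+u. indicator ({u. (\<forall>k\<in>{..<r}. 0 \<le> u k) \<and> sum u {..<r} \<le> 1} \<inter> space ?M) u \<partial>?M)"
      using simplex_hull_coordinates[OF False]
      by (intro nn_integral_cong) (auto simp: indicator_def S_def)
    also have "\<dots> = emeasure ?M ({u. (\<forall>k\<in>{..<r}. 0 \<le> u k) \<and> sum u {..<r} \<le> 1} \<inter> space ?M)"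
    proof (rule nn_integral_indicator)
      have "{u. (\<forall>k\<in>{..<r}. 0 \<le> u k) \<and> sum u {..<r} \<le> 1} \<inter> space ?M =
        {u \<in> space ?M. (\<forall>k\<in>{..<r}. 0 \<le> u k) \<and> (\<Sum>k<r. u k) \<le> 1}" by auto
      also have "\<dots> \<in> sets ?M" by measurable
      finally show "{u. (\<forall>k\<in>{..<r}. 0 \<le> u k) \<and> sum u {..<r} \<le> 1} \<inter> space ?M \<in> sets ?M" .
    qed
    also have "\<dots> = ennreal (1 / fact r)"
      using emeasure_std_simplex_aux[of "{..<r}" 1] by simp
    finally have "measure ?M {c \<in> space ?M. flat_chart r p e c \<in> S} = (\<Prod>k<r. norm (gso ?y k)) / fact r"
      unfolding measure_def by (simp add: enn2real_mult prod_nonneg)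
    also have "(\<Prod>k<r. norm (gso ?y k)) = sqrt (simplex_gramdet r x)"
      by (simp add: simplex_gramdet_def gramdet_def prod_power_distrib[symmetric] prod_nonneg)
    finally show ?thesis .
  next
    case True
    have lt: "dim (span (?y ` {..<r})) < r"
      using True dim_span_gso_lt by (auto simp: simplex_gramdet_def)
    have dL: "dim ?L = r" by (rule frame_dim[OF e])
    obtain b where b: "orthonormal_frame r b" "span (b ` {..<r}) = ?L"
      "span (b ` {..<dim (span (?y ` {..<r}))}) = span (?y ` {..<r})"
      using adapted_frame[of "span (?y ` {..<r})" ?L] spanL dL by auto
    \<comment> \<open>The edges lie in the span of fewer than r of the first frame vectors, so the
      last coordinate of every point of the simplex vanishes.\<close>
    let ?H = "\<Pi>\<^sub>E i\<in>{..<r}. if i = r - 1 then {0::real} else UNIV"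
    have H: "?H \<in> sets ?M" by (intro sets_PiM_I_finite) auto
    have S_sub: "w - x 1 \<in> span (?y ` {..<r})" if "w \<in> S" for w
    proof -
      let ?A = "(\<lambda>v. x 1 + v) ` span (?y ` {..<r})"
      have "convex ?A" by (intro convex_translation subspace_imp_convex subspace_span)
      moreover have "x i \<in> ?A" if i: "1 \<le> i" "i \<le> r + 1" for i
      proof (cases "i = 1")
        case False
        then obtain k where k: "i = k + 2" "k < r" using simplex_vertex_cases i by metis
        have "x i - x 1 \<in> span (?y ` {..<r})" unfolding k(1) using k(2) by (intro span_base imageI) simp
        then show ?thesis by (intro image_eqI[of _ _ "x i - x 1"]) auto
      qed (auto intro!: image_eqI[of _ _ 0] span_zero)
      ultimately have "S \<subseteq> ?A" unfolding S_def by (intro hull_minimal) auto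
      then show ?thesis using that by auto
    qed
    have "emeasure ?M {c \<in> space ?M. flat_chart r p e c \<in> S} =
        (\<integral>\<^sup>+c. indicator S (x 1 + (\<Sum>i<r. c i *\<^sub>R b i)) \<partial>?M)"
      using em b by simp
    also have "\<dots> \<le> (\<integral>\<^sup>+c. indicator ?H c \<partial>?M)"
    proof (intro nn_integral_mono)
      fix c assume c: "c \<in> space ?M"
      have "c \<in> ?H" if "x 1 + (\<Sum>i<r. c i *\<^sub>R b i) \<in> S"
      proof -
        have *: "(\<Sum>i<r. c i *\<^sub>R b i) \<in> span (b ` {..<dim (span (?y ` {..<r}))})"
          using S_sub[OF that] b(3) by simp
        have "b (r - 1) \<bullet> b j = 0" if "j < dim (span (?y ` {..<r}))" for j
          using b(1) that lt by (auto simp: orthonormal_frame_def)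
        then have "orthogonal (b (r - 1)) (\<Sum>i<r. c i *\<^sub>R b i)"
          by (intro orthogonal_to_span[OF *]) (auto simp: orthogonal_def)
        then have "c (r - 1) = 0"
          using frame_inner_sum[OF b(1), of "r - 1" c] lt by (simp add: orthogonal_def inner_commute)
        then show ?thesis using c by (auto simp: space_PiM PiE_iff)
      qed
      then show "indicator S (x 1 + (\<Sum>i<r. c i *\<^sub>R b i)) \<le> (indicator ?H c :: ennreal)"
        by (auto simp: indicator_def)
    qed
    also have "\<dots> = 0"
      using emeasure_PiM_hyperplane[of "r - 1" r] lt H by simp
    finally show ?thesis by (simp add: measure_def True)
  qed
qed

text \<open>Uniqueness of the value is settled; existence of a chart remains. The bound on r
  guarantees that an orthonormal frame with r members exists.\<close>

theorem simplex_volume_eq: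
  fixes x :: "nat \<Rightarrow> 'a::euclidean_space"
  assumes r: "r \<le> DIM('a)"
  shows "simplex_volume r x = sqrt (simplex_gramdet r x) / fact r"
  unfolding simplex_volume_def flat_volume_def
proof (rule the_equality)
  let ?S = "convex hull (x ` {1..r+1})"
  let ?y = "\<lambda>k. x (k + 2) - x 1"
  \<comment> \<open>The basis is adapted to the span of the edges, whose dimension may be less than
    r; the first r basis vectors then still cover it.\<close>
  obtain b where b: "orthonormal_frame DIM('a) b"
      "span (b ` {..<dim (span (?y ` {..<r}))}) = span (?y ` {..<r})"
    using adapted_frame[of "span (?y ` {..<r})" UNIV, OF subspace_span subspace_UNIV subset_UNIV]
    unfolding dim_UNIV by metis
  have "dim (span (?y ` {..<r})) \<le> r"
    using dim_le_card'[of "?y ` {..<r}"] card_image_le[of "{..<r}" ?y] by simp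
  then have "span (b ` {..<dim (span (?y ` {..<r}))}) \<subseteq> span (b ` {..<r})"
    by (intro span_mono image_mono) (simp only: lessThan_subset_iff)
  then have sub: "span (?y ` {..<r}) \<subseteq> span (b ` {..<r})"
    by (simp only: b(2))
  have fr: "orthonormal_frame r b" by (rule frame_mono[OF b(1) r])
  have "?S \<subseteq> (\<lambda>v. x 1 + v) ` span (b ` {..<r})"
  proof (rule hull_minimal)
    show "x ` {1..r+1} \<subseteq> (\<lambda>v. x 1 + v) ` span (b ` {..<r})"
    proof
      fix z assume "z \<in> x ` {1..r+1}"
      then obtain i where i: "z = x i" "1 \<le> i" "i \<le> r + 1" by auto
      have "x i - x 1 \<in> span (b ` {..<r})"
      proof (cases "i = 1")
        case False
        then obtain k where k: "i = k + 2" "k < r" using simplex_vertex_cases i(2,3) by metis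
        have "x i - x 1 \<in> span (?y ` {..<r})" unfolding k(1) using k(2) by (intro span_base imageI) simp
        then show ?thesis using sub by blast
      qed (simp add: span_zero)
      then show "z \<in> (\<lambda>v. x 1 + v) ` span (b ` {..<r})"
        unfolding i(1) by (intro image_eqI[of _ _ "x i - x 1"]) auto
    qed
  qed (intro convex_translation subspace_imp_convex subspace_span)
  also have "\<dots> \<subseteq> range (flat_chart r (x 1) b)"
  proof
    fix z assume "z \<in> (\<lambda>v. x 1 + v) ` span (b ` {..<r})"
    then obtain v where v: "v \<in> span (b ` {..<r})" "z = x 1 + v" by auto
    then show "z \<in> range (flat_chart r (x 1) b)"
      by (intro image_eqI[of _ _ "\<lambda>i. v \<bullet> b i"]) (simp_all add: flat_chart_def frame_expand[OF fr])
  qed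
  finally have "?S \<subseteq> range (flat_chart r (x 1) b)" .
  then show "\<exists>p e. orthonormal_frame r e \<and> ?S \<subseteq> range (flat_chart r p e) \<and>
      sqrt (simplex_gramdet r x) / fact r = measure (\<Pi>\<^sub>M i\<in>{..<r}. lborel)
        {c \<in> space (\<Pi>\<^sub>M i\<in>{..<r}. lborel). flat_chart r p e c \<in> ?S}"
    using fr flat_chart_simplex_measure[OF fr] by (intro exI[of _ "x 1"] exI[of _ b]) simp
next
  fix v assume "\<exists>p e. orthonormal_frame r e \<and> convex hull (x ` {1..r+1}) \<subseteq> range (flat_chart r p e) \<and>
      v = measure (\<Pi>\<^sub>M i\<in>{..<r}. lborel)
        {c \<in> space (\<Pi>\<^sub>M i\<in>{..<r}. lborel). flat_chart r p e c \<in> convex hull (x ` {1..r+1})}"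
  then show "v = sqrt (simplex_gramdet r x) / fact r"
    using flat_chart_simplex_measure by blast
qed

section \<open>Gaussian simplices\<close>

lemma product_sigma_finite_prob: "(\<And>i. prob_space (M i)) \<Longrightarrow> product_sigma_finite M"
  by (simp add: product_sigma_finite_def prob_space_imp_sigma_finite)

text \<open>It suffices to compare both measures on boxes, where the indicator factorises over the
  coordinates.\<close>

lemma PiM_density:
  fixes g :: "'a \<Rightarrow> ennreal"
  assumes "finite I" "sigma_finite_measure M" "sigma_finite_measure (density M g)"
    and [measurable]: "g \<in> borel_measurable M"
  shows "(\<Pi>\<^sub>M i\<in>I. density M g) = density (\<Pi>\<^sub>M i\<in>I. M) (\<lambda>x. \<Prod>i\<in>I. g (x i))"
proof -
  interpret M: product_sigma_finite "\<lambda>_. M" using assms by (simp add: product_sigma_finite_def)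
  interpret N: product_sigma_finite "\<lambda>_. density M g" using assms by (simp add: product_sigma_finite_def)
  have mg[measurable]: "(\<lambda>x. \<Prod>i\<in>I. g (x i)) \<in> borel_measurable (\<Pi>\<^sub>M i\<in>I. M)"
    by (intro borel_measurable_prod_ennreal measurable_PiM_component) auto
  show ?thesis
  proof (rule N.PiM_eqI[symmetric])
    fix A :: "'b \<Rightarrow> 'a set" assume "\<And>i. i \<in> I \<Longrightarrow> A i \<in> sets (density M g)"
    then have A: "\<And>i. i \<in> I \<Longrightarrow> A i \<in> sets M" by simp
    have "emeasure (density (\<Pi>\<^sub>M i\<in>I. M) (\<lambda>x. \<Prod>i\<in>I. g (x i))) (Pi\<^sub>E I A) =
        (\<integral>\<^sup>+x. (\<Prod>i\<in>I. g (x i)) * indicator (Pi\<^sub>E I A) x \<partial>(\<Pi>\<^sub>M i\<in>I. M))"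
      using A \<open>finite I\<close> by (intro emeasure_density sets_PiM_I_finite) auto
    also have "\<dots> = (\<integral>\<^sup>+x. (\<Prod>i\<in>I. g (x i) * indicator (A i) (x i)) \<partial>(\<Pi>\<^sub>M i\<in>I. M))"
    proof (intro nn_integral_cong)
      fix x assume "x \<in> space (\<Pi>\<^sub>M i\<in>I. M)"
      then have "x \<in> Pi\<^sub>E I A \<longleftrightarrow> (\<forall>i\<in>I. x i \<in> A i)" by (auto simp: space_PiM PiE_iff)
      then have "indicator (Pi\<^sub>E I A) x = (\<Prod>i\<in>I. indicator (A i) (x i) :: ennreal)"
        using \<open>finite I\<close> by (auto simp: indicator_def prod_zero_iff)
      then show "(\<Prod>i\<in>I. g (x i)) * indicator (Pi\<^sub>E I A) x = (\<Prod>i\<in>I. g (x i) * indicator (A i) (x i))"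
        by (simp add: prod.distrib)
    qed
    also have "\<dots> = (\<Prod>i\<in>I. emeasure (density M g) (A i))"
      using A \<open>finite I\<close> by (subst M.product_nn_integral_prod) (auto simp: emeasure_density)
    finally show "emeasure (density (\<Pi>\<^sub>M i\<in>I. M) (\<lambda>x. \<Prod>i\<in>I. g (x i))) (Pi\<^sub>E I A) =
      (\<Prod>i\<in>I. emeasure (density M g) (A i))" .
  qed (use \<open>finite I\<close> in \<open>auto cong: sets_PiM_cong\<close>)
qed

definition gauss_density :: "(real ^ 'n) \<Rightarrow> ennreal" where
  "gauss_density x = ennreal ((2 * pi) powr (- real CARD('n) / 2) * exp (- (norm x)\<^sup>2 / 2))"

lemma gaussian_model_eq: "gaussian_model = density lborel gauss_density"
  by (simp add: gaussian_model_def gauss_density_def[abs_def])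

lemma measurable_gauss_density [measurable]: "gauss_density \<in> borel_measurable borel"
  unfolding gauss_density_def[abs_def] by measurable

lemma sets_gaussian_model [simp, measurable_cong]: "sets gaussian_model = sets borel"
  and space_gaussian_model [simp]: "space gaussian_model = UNIV"
  by (simp_all add: gaussian_model_def)

abbreviation "std_normal \<equiv> density lborel (\<lambda>x. ennreal (std_normal_density x))"

lemma prob_space_std_normal: "prob_space std_normal"
  by (rule prob_space_normal_density) simp

lemma gauss_density_onb:
  fixes b :: "nat \<Rightarrow> real ^ 'n"
  assumes b: "orthonormal_frame CARD('n) b"
  shows "gauss_density (\<Sum>i<CARD('n). c i *\<^sub>R b i) = (\<Prod>i<CARD('n). ennreal (std_normal_density (c i)))"
proof -
  have b': "orthonormal_frame DIM(real^'n) b" using b by simp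
  have "(norm (\<Sum>i<CARD('n). c i *\<^sub>R b i))\<^sup>2 = (\<Sum>i<CARD('n). (c i)\<^sup>2)"
    using onb_norm[OF b', of "\<Sum>i<CARD('n). c i *\<^sub>R b i"] frame_inner_sum[OF b] by simp
  moreover have "(\<Prod>i<CARD('n). std_normal_density (c i)) =
      (2 * pi) powr (- real CARD('n) / 2) * exp (- (\<Sum>i<CARD('n). (c i)\<^sup>2) / 2)"
  proof -
    have "(2 * pi) powr (- real CARD('n) / 2) = ((2 * pi) powr (- (1 / 2))) powr real CARD('n)"
      by (simp add: powr_powr)
    also have "\<dots> = (1 / sqrt (2 * pi)) ^ CARD('n)"
      by (subst powr_realpow) (use powr_half_sqrt[of "2 * pi"] in \<open>simp_all add: powr_minus_divide\<close>)
    finally have c: "(2 * pi) powr (- real CARD('n) / 2) = (1 / sqrt (2 * pi)) ^ CARD('n)" .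
    have "(\<Prod>i<CARD('n). exp (- (c i)\<^sup>2 / 2)) = exp (- (\<Sum>i<CARD('n). (c i)\<^sup>2) / 2)"
      by (simp add: exp_sum[symmetric] sum_negf sum_divide_distrib)
    then show ?thesis
      unfolding std_normal_density_def prod.distrib c by simp
  qed
  ultimately show ?thesis
    by (simp add: gauss_density_def prod_ennreal)
qed

text \<open>Rotation invariance: the Gaussian density factorises in every orthonormal basis, so the
  coordinates in any such basis are independent standard normal variables.\<close>

lemma nn_integral_gaussian_onb:
  fixes b :: "nat \<Rightarrow> real ^ 'n"
  assumes b: "orthonormal_frame CARD('n) b" and [measurable]: "f \<in> borel_measurable borel"
  shows "(\<integral>\<^sup>+x. f x \<partial>gaussian_model) =
    (\<integral>\<^sup>+c. f (\<Sum>i<CARD('n). c i *\<^sub>R b i) \<partial>(\<Pi>\<^sub>M i\<in>{..<CARD('n)}. std_normal))"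
proof -
  let ?n = "CARD('n)"
  have b': "orthonormal_frame DIM(real^'n) b" using b by simp
  have [measurable]: "(\<lambda>x. \<Prod>i<?n. ennreal (std_normal_density (x i))) \<in> borel_measurable (\<Pi>\<^sub>M i\<in>{..<?n}. lborel)"
    by (intro borel_measurable_prod_ennreal measurable_PiM_component) auto
  have "(\<integral>\<^sup>+c. f (\<Sum>i<?n. c i *\<^sub>R b i) \<partial>(\<Pi>\<^sub>M i\<in>{..<?n}. std_normal)) =
      (\<integral>\<^sup>+c. (\<Prod>i<?n. ennreal (std_normal_density (c i))) * f (\<Sum>i<?n. c i *\<^sub>R b i) \<partial>(\<Pi>\<^sub>M i\<in>{..<?n}. lborel))"
    using prob_space_std_normal
    by (subst PiM_density) (auto simp: nn_integral_density prob_space_imp_sigma_finite sigma_finite_lborel)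
  also have "\<dots> = (\<integral>\<^sup>+c. gauss_density (\<Sum>i<?n. c i *\<^sub>R b i) * f (\<Sum>i<?n. c i *\<^sub>R b i) \<partial>(\<Pi>\<^sub>M i\<in>{..<?n}. lborel))"
    by (simp add: gauss_density_onb[OF b])
  also have "\<dots> = (\<integral>\<^sup>+x. gauss_density x * f x \<partial>lborel)"
    using nn_integral_onb[OF b', of "\<lambda>x. gauss_density x * f x"] by simp
  also have "\<dots> = (\<integral>\<^sup>+x. f x \<partial>gaussian_model)"
    unfolding gaussian_model_eq by (simp add: nn_integral_density)
  finally show ?thesis by simp
qed

lemma exists_onb: obtains b :: "nat \<Rightarrow> real ^ 'n" where "orthonormal_frame CARD('n) b"
  using orthonormal_frame_extend[of 0 "\<lambda>_. 0 :: real^'n"] by (auto simp: orthonormal_frame_def)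

lemma prob_space_gaussian_model: "prob_space (gaussian_model :: (real ^ 'n) measure)"
proof -
  obtain b :: "nat \<Rightarrow> real ^ 'n" where b: "orthonormal_frame CARD('n) b" by (rule exists_onb)
  interpret prob_space "\<Pi>\<^sub>M i\<in>{..<CARD('n)}. std_normal"
    by (intro prob_space_PiM prob_space_std_normal)
  have "(\<integral>\<^sup>+x. 1 \<partial>(gaussian_model :: (real ^ 'n) measure)) = 1"
    by (subst nn_integral_gaussian_onb[OF b]) (simp_all add: emeasure_space_1)
  then show ?thesis by (intro prob_spaceI) simp
qed

section \<open>Gram determinants of independent Gaussian vectors\<close>

lemma sets_chi_squared_law [simp, measurable_cong]: "sets (chi_squared_law d) = sets borel"
  by (simp add: chi_squared_law_def)

lemma prob_space_chi_squared_law: "prob_space (chi_squared_law d)"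
  unfolding chi_squared_law_def
  by (intro prob_space.prob_space_distr prob_space_PiM prob_space_std_normal) measurable

text \<open>In an orthonormal basis whose first r members span the previous vectors, the residual of
  w keeps exactly the other coordinates of w. A nonzero Gram determinant makes their number equal to
  n - r.\<close>

lemma nn_integral_gso_gaussian:
  fixes y :: "nat \<Rightarrow> real ^ 'n"
  assumes gd: "gramdet r y \<noteq> 0" and r: "r \<le> CARD('n)" and [measurable]: "f \<in> borel_measurable borel"
  shows "(\<integral>\<^sup>+w. f ((norm (gso (y(r := w)) r))\<^sup>2) \<partial>gaussian_model) = (\<integral>\<^sup>+q. f q \<partial>chi_squared_law (CARD('n) - r))"
proof -
  let ?n = "CARD('n)" and ?N = std_normal
  let ?L = "span (y ` {..<r})"
  obtain b where b: "orthonormal_frame ?n b" "span (b ` {..<r}) = ?L"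
    using adapted_frame[of ?L UNIV, OF subspace_span subspace_UNIV subset_UNIV]
    unfolding dim_span_gso[OF gd] dim_UNIV DIM_cart DIM_real mult_1_right by metis
  have b': "orthonormal_frame DIM(real^'n) b" using b by simp
  have perp: "b i \<bullet> v = 0" if "r \<le> i" "i < ?n" "v \<in> ?L" for i v
  proof -
    have "orthogonal (b i) v"
      using that b(1) unfolding b(2)[symmetric]
      by (intro orthogonal_to_span[of v "b ` {..<r}"]) (auto simp: orthogonal_def orthonormal_frame_def)
    then show ?thesis by (simp add: orthogonal_def)
  qed
  have gso_eq: "gso (y(r := w)) r = (\<Sum>i\<in>{r..<?n}. (w \<bullet> b i) *\<^sub>R b i)" for w
  proof (rule gso_unique)
    have img: "(y(r := w)) ` {..<r} = y ` {..<r}" by auto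
    have "w = (\<Sum>i<?n. (w \<bullet> b i) *\<^sub>R b i)" using onb_expand[OF b', of w] by simp
    also have "\<dots> = (\<Sum>i<r. (w \<bullet> b i) *\<^sub>R b i) + (\<Sum>i\<in>{r..<?n}. (w \<bullet> b i) *\<^sub>R b i)"
      using r by (subst sum.union_disjoint[symmetric]) (auto intro!: sum.cong)
    finally have "w - (\<Sum>i\<in>{r..<?n}. (w \<bullet> b i) *\<^sub>R b i) = (\<Sum>i<r. (w \<bullet> b i) *\<^sub>R b i)"
      by (simp add: algebra_simps)
    also have "\<dots> \<in> ?L" unfolding b(2)[symmetric] by (rule frame_in_span)
    finally show "(y(r := w)) r - (\<Sum>i\<in>{r..<?n}. (w \<bullet> b i) *\<^sub>R b i) \<in> span ((y(r := w)) ` {..<r})"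
      unfolding img by simp
    show "(\<Sum>i\<in>{r..<?n}. (w \<bullet> b i) *\<^sub>R b i) \<bullet> v = 0" if "v \<in> span ((y(r := w)) ` {..<r})" for v
      using that perp unfolding img by (simp add: inner_sum_left)
  qed
  have norm_eq: "(norm (gso (y(r := \<Sum>i<?n. c i *\<^sub>R b i)) r))\<^sup>2 = (\<Sum>i<?n - r. (c (i + r))\<^sup>2)" for c
  proof -
    have "(norm (gso (y(r := \<Sum>i<?n. c i *\<^sub>R b i)) r))\<^sup>2 = (norm (\<Sum>i\<in>{r..<?n}. c i *\<^sub>R b i))\<^sup>2"
      unfolding gso_eq using frame_inner_sum[OF b(1)] by (auto intro!: sum.cong arg_cong[of _ _ norm])
    also have "(\<Sum>i\<in>{r..<?n}. c i *\<^sub>R b i) = (\<Sum>i<?n. (if r \<le> i then c i else 0) *\<^sub>R b i)"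
      by (rule sum.mono_neutral_cong_left) auto
    also have "(norm \<dots>)\<^sup>2 = (\<Sum>i<?n. (if r \<le> i then c i else 0)\<^sup>2)"
      using onb_norm[OF b', of "\<Sum>i<?n. (if r \<le> i then c i else 0) *\<^sub>R b i"] frame_inner_sum[OF b(1)] by simp
    also have "\<dots> = (\<Sum>i\<in>{r..<?n}. (c i)\<^sup>2)"
      by (rule sum.mono_neutral_cong_right) auto
    also have "\<dots> = (\<Sum>i<?n - r. (c (i + r))\<^sup>2)"
      using r by (intro sum.reindex_bij_witness[of _ "\<lambda>i. i + r" "\<lambda>i. i - r"]) auto
    finally show ?thesis .
  qed
  have m[measurable]: "(\<lambda>w. (norm (gso (y(r := w)) r))\<^sup>2) \<in> borel_measurable borel"
    unfolding gso_eq by measurable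
  have "(\<integral>\<^sup>+w. f ((norm (gso (y(r := w)) r))\<^sup>2) \<partial>gaussian_model) =
      (\<integral>\<^sup>+c. f (\<Sum>i<?n - r. (c (i + r))\<^sup>2) \<partial>(\<Pi>\<^sub>M i\<in>{..<?n}. ?N))"
    by (subst nn_integral_gaussian_onb[OF b(1)]) (simp_all add: norm_eq)
  also have "\<dots> = (\<integral>\<^sup>+c. f (\<Sum>i<?n - r. (c i)\<^sup>2) \<partial>distr (\<Pi>\<^sub>M i\<in>{..<?n}. ?N) (\<Pi>\<^sub>M i\<in>{..<?n - r}. ?N)
      (\<lambda>\<omega>. \<lambda>i\<in>{..<?n - r}. \<omega> (i + r)))"
    by (subst nn_integral_distr) (auto intro!: measurable_restrict measurable_component_singleton)
  also have "distr (\<Pi>\<^sub>M i\<in>{..<?n}. ?N) (\<Pi>\<^sub>M i\<in>{..<?n - r}. ?N) (\<lambda>\<omega>. \<lambda>i\<in>{..<?n - r}. \<omega> (i + r)) =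
      (\<Pi>\<^sub>M i\<in>{..<?n - r}. ?N)"
    using prob_space_std_normal by (intro distr_PiM_reindex) auto
  also have "(\<integral>\<^sup>+c. f (\<Sum>i<?n - r. (c i)\<^sup>2) \<partial>(\<Pi>\<^sub>M i\<in>{..<?n - r}. ?N)) = (\<integral>\<^sup>+q. f q \<partial>chi_squared_law (?n - r))"
    unfolding chi_squared_law_def by (subst nn_integral_distr) auto
  finally show ?thesis .
qed

text \<open>Bartlett's decomposition: given the first r vectors, the last squared residual has a
  chi-squared law that does not depend on them, so the factors behave as independent
  variables.\<close>

lemma nn_integral_gramdet_gaussian:
  fixes f :: "real \<Rightarrow> ennreal"
  assumes "r \<le> CARD('n)" and "f \<in> borel_measurable borel"
  shows "(\<integral>\<^sup>+y. f (gramdet r y) \<partial>(\<Pi>\<^sub>M k\<in>{..<r}. (gaussian_model :: (real ^ 'n) measure))) =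
    (\<integral>\<^sup>+q. f (\<Prod>k<r. q k) \<partial>(\<Pi>\<^sub>M k\<in>{..<r}. chi_squared_law (CARD('n) - k)))"
  using assms
proof (induction r arbitrary: f)
  case 0
  then show ?case by (simp add: gramdet_def PiM_empty)
next
  case (Suc r)
  note [measurable] = Suc.prems(2)
  let ?G = "gaussian_model :: (real ^ 'n) measure"
  let ?Q = "\<lambda>k. chi_squared_law (CARD('n) - k)"
  interpret G: product_sigma_finite "\<lambda>_::nat. ?G"
    by (intro product_sigma_finite_prob prob_space_gaussian_model)
  interpret Q: product_sigma_finite ?Q
    by (intro product_sigma_finite_prob prob_space_chi_squared_law)
  interpret Qr: prob_space "?Q r" by (rule prob_space_chi_squared_law)
  have ins: "{..<Suc r} = insert r {..<r}" by auto
  have mS: "(\<lambda>y. f (gramdet (Suc r) y)) \<in> borel_measurable (\<Pi>\<^sub>M k\<in>{..<Suc r}. ?G)"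
    by (rule measurable_compose[OF measurable_gramdet Suc.prems(2)]) auto
  have mr: "(\<lambda>y. gramdet r y) \<in> borel_measurable (\<Pi>\<^sub>M k\<in>{..<r}. ?G)"
    by (rule measurable_gramdet) auto
  have "(\<integral>\<^sup>+y. f (gramdet (Suc r) y) \<partial>(\<Pi>\<^sub>M k\<in>{..<Suc r}. ?G)) =
      (\<integral>\<^sup>+y. \<integral>\<^sup>+w. f (gramdet (Suc r) (y(r := w))) \<partial>?G \<partial>(\<Pi>\<^sub>M k\<in>{..<r}. ?G))"
    unfolding ins using mS[unfolded ins] by (intro G.product_nn_integral_insert) auto
  also have "\<dots> = (\<integral>\<^sup>+y. \<integral>\<^sup>+q. f (gramdet r y * q) \<partial>?Q r \<partial>(\<Pi>\<^sub>M k\<in>{..<r}. ?G))"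
  proof (intro nn_integral_cong)
    fix y :: "nat \<Rightarrow> real ^ 'n"
    have eq: "gramdet (Suc r) (y(r := w)) = gramdet r y * (norm (gso (y(r := w)) r))\<^sup>2" for w
      using gramdet_cong[of r "y(r := w)" y] by (simp add: gramdet_def)
    show "(\<integral>\<^sup>+w. f (gramdet (Suc r) (y(r := w))) \<partial>?G) = (\<integral>\<^sup>+q. f (gramdet r y * q) \<partial>?Q r)"
    \<comment> \<open>In the degenerate case the residual need not have this chi-squared law, but
      both integrands are constantly \<open>f 0\<close>. The degenerate set thus need not be shown
      to be null.\<close>
    proof (cases "gramdet r y = 0")
      case True
      interpret Gp: prob_space ?G by (rule prob_space_gaussian_model)
      show ?thesis using True Gp.emeasure_space_1 Qr.emeasure_space_1 by (simp add: eq)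
    next
      case False
      then show ?thesis
        unfolding eq using Suc.prems(1) by (intro nn_integral_gso_gaussian[of r y "\<lambda>q. f (gramdet r y * q)"]) auto
    qed
  qed
  also have "\<dots> = (\<integral>\<^sup>+x. \<integral>\<^sup>+q. f ((\<Prod>k<r. x k) * q) \<partial>?Q r \<partial>(\<Pi>\<^sub>M k\<in>{..<r}. ?Q k))"
    using Suc.prems(1) by (intro Suc.IH[of "\<lambda>g. \<integral>\<^sup>+q. f (g * q) \<partial>?Q r"]) auto
  also have "\<dots> = (\<integral>\<^sup>+q. f (\<Prod>k<Suc r. q k) \<partial>(\<Pi>\<^sub>M k\<in>{..<Suc r}. ?Q k))"
    unfolding ins
    by (subst Q.product_nn_integral_insert) (auto simp: mult.commute intro!: nn_integral_cong arg_cong[of _ _ f] 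
        prod.cong)
  finally show ?case .
qed

section \<open>Precision-weighted differences of Gaussian vectors\<close>

text \<open>A plane rotation applied blockwise to a pair of vectors is a linear isometry of the
  product space. It preserves Lebesgue measure there, and the product density depends on the norm of
  the pair alone.\<close>

lemma nn_integral_gaussian_rotation:
  fixes f :: "real ^ 'n \<Rightarrow> real ^ 'n \<Rightarrow> ennreal"
  assumes cs: "c\<^sup>2 + s\<^sup>2 = 1" and [measurable]: "(\<lambda>(x, y). f x y) \<in> borel_measurable (borel \<Otimes>\<^sub>M borel)"
  shows "(\<integral>\<^sup>+w. \<integral>\<^sup>+u. f (c *\<^sub>R w - s *\<^sub>R u) (s *\<^sub>R w + c *\<^sub>R u) \<partial>gaussian_model \<partial>gaussian_model) =
    (\<integral>\<^sup>+w. \<integral>\<^sup>+u. f w u \<partial>gaussian_model \<partial>gaussian_model)"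
proof -
  define g where "g z = (case z of (x, y) \<Rightarrow> gauss_density x * gauss_density y * f x y)" for z :: "(real ^ 'n) \<times> (real ^ 'n)"
  have [measurable]: "g \<in> borel_measurable (borel \<Otimes>\<^sub>M borel)"
    unfolding g_def[abs_def] by measurable
  define T where "T z = (c *\<^sub>R fst z - s *\<^sub>R snd z, s *\<^sub>R fst z + c *\<^sub>R snd z)" for z :: "(real ^ 'n) \<times> (real ^ 'n)"
  have [measurable]: "T \<in> borel \<Otimes>\<^sub>M borel \<rightarrow>\<^sub>M borel \<Otimes>\<^sub>M borel"
    unfolding T_def[abs_def] by measurable
  have inner: "(norm (c *\<^sub>R w - s *\<^sub>R u))\<^sup>2 + (norm (s *\<^sub>R w + c *\<^sub>R u))\<^sup>2 = (norm w)\<^sup>2 + (norm u)\<^sup>2" for w u :: "real ^ 'n"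
  proof -
    have "(norm (c *\<^sub>R w - s *\<^sub>R u))\<^sup>2 + (norm (s *\<^sub>R w + c *\<^sub>R u))\<^sup>2 = (c\<^sup>2 + s\<^sup>2) * (w \<bullet> w) + (c\<^sup>2 + s\<^sup>2) * (u \<bullet> u)"
      unfolding power2_norm_eq_inner by (simp add: inner_diff_left inner_diff_right inner_add_left inner_add_right
        power2_eq_square inner_commute algebra_simps)
    then show ?thesis using cs by (simp add: power2_norm_eq_inner)
  qed
  have lin: "linear T"
    unfolding T_def by (intro linearI) (auto simp: algebra_simps)
  have nT: "norm (T z) = norm z" for z
    unfolding norm_prod_def T_def fst_conv snd_conv inner ..
  have gd: "gauss_density (c *\<^sub>R w - s *\<^sub>R u) * gauss_density (s *\<^sub>R w + c *\<^sub>R u) = gauss_density w * gauss_density u" for w u :: "real ^ 'n"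
  proof -
    have *: "gauss_density x * gauss_density y = ennreal (((2 * pi) powr (- real CARD('n) / 2))\<^sup>2 * exp (- ((norm x)\<^sup>2 + (norm y)\<^sup>2) / 2))"
      for x y :: "real ^ 'n"
      by (simp add: gauss_density_def ennreal_mult'[symmetric] power2_eq_square exp_add[symmetric] add_divide_distrib diff_divide_distrib mult_ac)
    show ?thesis unfolding * inner ..
  qed
  have iter: "(\<integral>\<^sup>+w. \<integral>\<^sup>+u. h w u \<partial>gaussian_model \<partial>gaussian_model) =
      (\<integral>\<^sup>+z. (case z of (w, u) \<Rightarrow> gauss_density w * gauss_density u * h w u) \<partial>lborel)"
    if [measurable]: "(\<lambda>(x, y). h x y) \<in> borel_measurable (borel \<Otimes>\<^sub>M borel)" for h :: "real ^ 'n \<Rightarrow> real ^ 'n \<Rightarrow> ennreal"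
  proof -
    have "(\<integral>\<^sup>+w. \<integral>\<^sup>+u. h w u \<partial>gaussian_model \<partial>gaussian_model) =
        (\<integral>\<^sup>+w. gauss_density w * (\<integral>\<^sup>+u. gauss_density u * h w u \<partial>lborel) \<partial>lborel)"
      unfolding gaussian_model_eq by (subst (1 2) nn_integral_density) auto
    also have "\<dots> = (\<integral>\<^sup>+w. \<integral>\<^sup>+u. gauss_density w * gauss_density u * h w u \<partial>lborel \<partial>lborel)"
      by (subst nn_integral_cmult[symmetric]) (auto simp: mult_ac)
    also have "\<dots> = (\<integral>\<^sup>+z. (case z of (w, u) \<Rightarrow> gauss_density w * gauss_density u * h w u) \<partial>(lborel \<Otimes>\<^sub>M lborel))"
      by (subst lborel.nn_integral_fst[symmetric]) auto
    finally show ?thesis by (simp add: lborel_prod)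
  qed
  have "(\<integral>\<^sup>+w. \<integral>\<^sup>+u. f (c *\<^sub>R w - s *\<^sub>R u) (s *\<^sub>R w + c *\<^sub>R u) \<partial>gaussian_model \<partial>gaussian_model) =
      (\<integral>\<^sup>+z. g (T z) \<partial>lborel)"
    by (subst iter) (auto simp: g_def T_def gd case_prod_beta intro!: nn_integral_cong)
  also have "\<dots> = (\<integral>\<^sup>+z. g z \<partial>lborel)"
    by (rule nn_integral_lborel_isometry[OF lin nT]) (simp add: borel_prod[symmetric])
  also have "\<dots> = (\<integral>\<^sup>+w. \<integral>\<^sup>+u. f w u \<partial>gaussian_model \<partial>gaussian_model)"
    by (subst iter) (auto simp: g_def[abs_def])
  finally show ?thesis .
qed

text \<open>\<open>prec t k\<close> is the total precision of independent Gaussian vectors with standard deviations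
  \<open>t 1, \<dots>, t k\<close>, and \<open>wmean t k z\<close> is the precision-weighted mean of the vectors \<open>t i *\<^sub>R z i\<close>.  The
  differences \<open>t (k + 2) *\<^sub>R z (k + 2) - wmean t (k + 1) z\<close> are independent of each other and of the mean.\<close>

definition prec :: "(nat \<Rightarrow> real) \<Rightarrow> nat \<Rightarrow> real" where
  "prec t k = (\<Sum>i\<in>{1..k}. 1 / (t i)\<^sup>2)"

definition wmean :: "(nat \<Rightarrow> real) \<Rightarrow> nat \<Rightarrow> (nat \<Rightarrow> 'a::euclidean_space) \<Rightarrow> 'a" where
  "wmean t k z = (1 / prec t k) *\<^sub>R (\<Sum>i\<in>{1..k}. (1 / t i) *\<^sub>R z i)"

definition wdiff :: "(nat \<Rightarrow> real) \<Rightarrow> (nat \<Rightarrow> 'a::euclidean_space) \<Rightarrow> nat \<Rightarrow> 'a" where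
  "wdiff t z k = t (k + 2) *\<^sub>R z (k + 2) - wmean t (k + 1) z"

lemma prec_Suc: "prec t (Suc k) = prec t k + 1 / (t (Suc k))\<^sup>2"
  by (simp add: prec_def)

lemma prec_pos: "(\<And>i. 0 < t i) \<Longrightarrow> 0 < prec t (Suc k)"
  unfolding prec_def by (intro sum_pos) (auto simp: less_imp_neq[THEN not_sym])

lemma wmean_Suc:
  assumes "\<And>i. 0 < t i"
  shows "wmean t (Suc (Suc k)) z = (1 / prec t (Suc (Suc k))) *\<^sub>R (prec t (Suc k) *\<^sub>R wmean t (Suc k) z + (1 / t (k + 2)) *\<^sub>R z (k + 2))"
proof -
  have "prec t (Suc k) *\<^sub>R wmean t (Suc k) z = (\<Sum>i\<in>{1..Suc k}. (1 / t i) *\<^sub>R z i)"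
    using prec_pos[of t k, OF assms] by (simp add: wmean_def)
  then show ?thesis by (simp add: wmean_def)
qed

lemma wmean_cong: "(\<And>i. 1 \<le> i \<Longrightarrow> i \<le> k \<Longrightarrow> z i = z' i) \<Longrightarrow> wmean t k z = wmean t k z'"
  unfolding wmean_def by (intro arg_cong2[where f=scaleR] sum.cong) auto

lemma wdiff_cong: "(\<And>i. 1 \<le> i \<Longrightarrow> i \<le> k + 2 \<Longrightarrow> z i = z' i) \<Longrightarrow> wdiff t z k = wdiff t z' k"
  unfolding wdiff_def by (intro arg_cong2[where f=minus] wmean_cong arg_cong2[where f=scaleR]) auto

text \<open>The vector \<open>wdiff t z k\<close> differs from the k-th edge by an average of the
  vectors \<open>t i *\<^sub>R z i - t 1 *\<^sub>R z 1\<close> with i \<le> k + 1, each of which is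
  0 or an earlier edge. So the passage from edges to these differences is unitriangular.\<close>

lemma gramdet_wdiff:
  assumes t: "\<And>i. 0 < t i"
  shows "simplex_gramdet r (\<lambda>i. t i *\<^sub>R z i) = gramdet r (wdiff t z)"
  unfolding simplex_gramdet_def
proof (rule gramdet_unitriangular[symmetric])
  fix k assume "k < r"
  let ?y = "\<lambda>k. t (k + 2) *\<^sub>R z (k + 2) - t 1 *\<^sub>R z 1"
  have S: "0 < prec t (k + 1)" using prec_pos[of t k, OF t] by simp
  have "wmean t (k + 1) z - t 1 *\<^sub>R z 1 =
      (1 / prec t (k + 1)) *\<^sub>R (\<Sum>i\<in>{1..k+1}. (1 / (t i)\<^sup>2) *\<^sub>R (t i *\<^sub>R z i - t 1 *\<^sub>R z 1))"
  proof -
    have 1: "(1 / (t i)\<^sup>2) *\<^sub>R (t i *\<^sub>R z i - t 1 *\<^sub>R z 1) = (1 / t i) *\<^sub>R z i - (1 / (t i)\<^sup>2) *\<^sub>R (t 1 *\<^sub>R z 1)" for i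
      using t[of i] by (simp add: scaleR_diff_right power2_eq_square)
    have "(\<Sum>i\<in>{1..k+1}. (1 / (t i)\<^sup>2) *\<^sub>R (t i *\<^sub>R z i - t 1 *\<^sub>R z 1)) =
      (\<Sum>i\<in>{1..k+1}. (1 / t i) *\<^sub>R z i) - prec t (k + 1) *\<^sub>R (t 1 *\<^sub>R z 1)"
      unfolding 1 sum_subtractf prec_def scaleR_sum_left ..
    then show ?thesis using S by (simp add: wmean_def scaleR_diff_right)
  qed
  also have "\<dots> \<in> span (?y ` {..<k})"
  proof (intro span_scale span_sum)
    fix i assume i: "i \<in> {1..k+1}"
    show "t i *\<^sub>R z i - t 1 *\<^sub>R z 1 \<in> span (?y ` {..<k})"
    proof (cases "i = 1")
      case False
      then obtain j where "i = j + 2" "j < k" using simplex_vertex_cases[of i k] i by auto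
      then show ?thesis by (auto intro!: span_base)
    qed (simp add: span_zero)
  qed
  finally have "wmean t (k + 1) z - t 1 *\<^sub>R z 1 \<in> span (?y ` {..<k})" .
  then have "- (wmean t (k + 1) z - t 1 *\<^sub>R z 1) \<in> span (?y ` {..<k})" by (rule span_neg)
  then show "wdiff t z k - ?y k \<in> span (?y ` {..<k})"
    by (simp add: wdiff_def)
qed

text \<open>Here \<open>(1 / sqrt S) *\<^sub>R u\<close> stands for the running mean, of precision
  S, and \<open>t *\<^sub>R w\<close> for the new vector. The numbers c and s are the cosine and
  sine of the rotation that takes w and u to the normalised difference and the normalised updated
  mean.\<close>

lemma wdiff_scaling:
  fixes S t :: real and w u :: "'a::real_vector"
  assumes "0 < S" "0 < t"
  defines "S' \<equiv> S + 1 / t\<^sup>2"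
  defines "c \<equiv> sqrt (S / S')" and "s \<equiv> 1 / (t * sqrt S')"
  shows "c\<^sup>2 + s\<^sup>2 = 1"
    and "t *\<^sub>R w - (1 / sqrt S) *\<^sub>R u = (t * sqrt (S' / S)) *\<^sub>R (c *\<^sub>R w - s *\<^sub>R u)"
    and "(1 / S') *\<^sub>R (S *\<^sub>R ((1 / sqrt S) *\<^sub>R u) + (1 / t) *\<^sub>R w) = (1 / sqrt S') *\<^sub>R (s *\<^sub>R w + c *\<^sub>R u)"
proof -
  have S': "0 < S'" using assms by (simp add: S'_def add_pos_pos)
  have "c\<^sup>2 + s\<^sup>2 = (S + 1 / t\<^sup>2) / S'"
    using assms(1,2) S' by (simp add: c_def s_def power_divide power_mult_distrib add_divide_distrib)
  then show "c\<^sup>2 + s\<^sup>2 = 1" using S' by (simp add: S'_def)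
  have 1: "t * sqrt (S' / S) * c = t" "t * sqrt (S' / S) * s = 1 / sqrt S"
    using assms(1,2) S' by (simp_all add: c_def s_def real_sqrt_divide)
  show "t *\<^sub>R w - (1 / sqrt S) *\<^sub>R u = (t * sqrt (S' / S)) *\<^sub>R (c *\<^sub>R w - s *\<^sub>R u)"
    unfolding scaleR_diff_right scaleR_scaleR 1 ..
  have 2: "1 / sqrt S' * s = 1 / S' * (1 / t)" "1 / sqrt S' * c = 1 / S' * (S * (1 / sqrt S))"
  proof -
    have r: "sqrt S' * sqrt S' = S'" "S / sqrt S = sqrt S" using S' assms(1) by (auto simp: real_div_sqrt)
    have "1 / sqrt S' * s = 1 / (sqrt S' * sqrt S') * (1 / t)" by (simp add: s_def)
    then show "1 / sqrt S' * s = 1 / S' * (1 / t)" by (simp only: r)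
    have "1 / sqrt S' * c = sqrt S / (sqrt S' * sqrt S')" by (simp add: c_def real_sqrt_divide)
    then show "1 / sqrt S' * c = 1 / S' * (S * (1 / sqrt S))" using S' by (simp add: r)
  qed
  show "(1 / S') *\<^sub>R (S *\<^sub>R ((1 / sqrt S) *\<^sub>R u) + (1 / t) *\<^sub>R w) = (1 / sqrt S') *\<^sub>R (s *\<^sub>R w + c *\<^sub>R u)"
    unfolding scaleR_add_right scaleR_scaleR 2 by simp
qed

lemma measurable_wmean:
  assumes "\<And>i. 1 \<le> i \<Longrightarrow> i \<le> k \<Longrightarrow> (\<lambda>x. z x i) \<in> borel_measurable N"
  shows "(\<lambda>x. wmean t k (z x)) \<in> borel_measurable N"
  unfolding wmean_def using assms by (intro borel_measurable_scaleR borel_measurable_sum) auto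

lemma measurable_wdiff:
  assumes "\<And>i. 1 \<le> i \<Longrightarrow> i \<le> k + 2 \<Longrightarrow> (\<lambda>x. z x i) \<in> borel_measurable N"
  shows "(\<lambda>x. wdiff t (z x) k) \<in> borel_measurable N"
  unfolding wdiff_def using assms by (intro borel_measurable_diff borel_measurable_scaleR measurable_wmean) auto

text \<open>The standard deviation of \<open>wdiff t z k\<close>: its variance t^2 + 1 / P, with t
  the new deviation and P the previous precision, equals t^2 (P + 1 / t^2) / P.\<close>

definition wscale :: "(nat \<Rightarrow> real) \<Rightarrow> nat \<Rightarrow> real" where
  "wscale t k = t (k + 2) * sqrt (prec t (k + 2) / prec t (k + 1))"

text \<open>The mean is carried along because the next difference is formed from it. Each new vector
  and the previous mean are turned into a difference and an updated mean by one rotation, which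
  keeps them independent of each other and of the earlier differences.\<close>

lemma nn_integral_wdiff:
  fixes f :: "(nat \<Rightarrow> real ^ 'n) \<times> (real ^ 'n) \<Rightarrow> ennreal"
  assumes t: "\<And>i. 0 < t i"
    and "f \<in> borel_measurable ((\<Pi>\<^sub>M k\<in>{..<r}. borel) \<Otimes>\<^sub>M borel)"
  shows "(\<integral>\<^sup>+z. f (\<lambda>k\<in>{..<r}. wdiff t z k, wmean t (r + 1) z) \<partial>(\<Pi>\<^sub>M i\<in>{1..r+1}. gaussian_model)) =
    (\<integral>\<^sup>+y. \<integral>\<^sup>+u. f (\<lambda>k\<in>{..<r}. wscale t k *\<^sub>R y k, (1 / sqrt (prec t (r + 1))) *\<^sub>R u)
       \<partial>gaussian_model \<partial>(\<Pi>\<^sub>M k\<in>{..<r}. gaussian_model))"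
  using assms(2)
proof (induction r arbitrary: f)
  case 0
  let ?G = "gaussian_model :: (real ^ 'n) measure"
  interpret G: product_sigma_finite "\<lambda>_::nat. ?G"
    by (intro product_sigma_finite_prob prob_space_gaussian_model)
  note [measurable] = 0
  have e: "(\<lambda>_. undefined) \<in> space (\<Pi>\<^sub>M k\<in>{..<0::nat}. (borel :: (real^'n) measure))"
    by (simp add: space_PiM)
  have [measurable]: "(\<lambda>u. f (\<lambda>_. undefined, u)) \<in> borel_measurable borel"
    using measurable_Pair1'[OF e, of borel] 0 by (auto intro: measurable_compose)
  have w: "wmean t 1 z = t 1 *\<^sub>R z 1" for z :: "nat \<Rightarrow> real ^ 'n"
    using t[of 1] by (simp add: wmean_def prec_def power2_eq_square)
  have p: "1 / sqrt (prec t 1) = t 1"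
    using t[of 1] by (simp add: prec_def real_sqrt_divide)
  show ?case
    using G.product_nn_integral_singleton[of "\<lambda>u. f (\<lambda>_. undefined, t 1 *\<^sub>R u)" 1]
    by (simp add: w p[simplified] w[simplified] PiM_empty restrict_def)
next
  case (Suc r)
  let ?G = "gaussian_model :: (real ^ 'n) measure"
  interpret G: product_sigma_finite "\<lambda>_::nat. ?G"
    by (intro product_sigma_finite_prob prob_space_gaussian_model)
  interpret G1: prob_space ?G by (rule prob_space_gaussian_model)
  interpret Gr: prob_space "\<Pi>\<^sub>M k\<in>{..<r}. ?G" by (intro prob_space_PiM prob_space_gaussian_model)
  note [measurable] = Suc.prems
  define q where "q = r + 2"
  define S where "S = prec t (r + 1)"
  define S' where "S' = prec t (r + 2)"
  have S: "0 < S" unfolding S_def using prec_pos[of t r, OF t] by simp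
  have S'_eq: "S' = S + 1 / (t q)\<^sup>2" unfolding S'_def S_def q_def using prec_Suc[of t "Suc r"] by simp
  define c where "c = sqrt (S / S')"
  define s where "s = 1 / (t q * sqrt S')"
  \<comment> \<open>The integrand as a function of the earlier differences y, the new vector w and
    the old mean m, in the form to which the induction hypothesis applies.\<close>
  define h where "h y w m = f (\<lambda>k\<in>{..<Suc r}. if k < r then y k else t q *\<^sub>R w - m,
      (1 / S') *\<^sub>R (S *\<^sub>R m + (1 / t q) *\<^sub>R w))" for y :: "nat \<Rightarrow> real^'n" and w m
  have hm[measurable]: "(\<lambda>x. h (fst x) (fst (snd x)) (snd (snd x))) \<in> borel_measurable ((\<Pi>\<^sub>M k\<in>{..<r}. borel) \<Otimes>\<^sub>M (borel \<Otimes>\<^sub>M borel))"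
  proof -
    have "(\<lambda>x. if k < r then fst x k else t q *\<^sub>R fst (snd x) - snd (snd x)) \<in>
        borel_measurable ((\<Pi>\<^sub>M k\<in>{..<r}. (borel :: (real ^ 'n) measure)) \<Otimes>\<^sub>M (borel \<Otimes>\<^sub>M borel))" for k
      by (cases "k < r") (auto intro: measurable_compose[OF measurable_fst measurable_component_singleton])
    then show ?thesis
      unfolding h_def
      by (intro measurable_compose[OF _ Suc.prems] measurable_Pair measurable_restrict) auto
  qed
  have ins: "{1..Suc r + 1} = insert q {1..r+1}" "{..<Suc r} = insert r {..<r}" by (auto simp: q_def)
  have mL: "(\<lambda>z. f (\<lambda>k\<in>{..<Suc r}. wdiff t z k, wmean t (Suc r + 1) z)) \<in> borel_measurable (\<Pi>\<^sub>M i\<in>{1..Suc r+1}. ?G)"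
    by (intro measurable_compose[OF _ Suc.prems] measurable_Pair measurable_restrict measurable_wdiff measurable_wmean) auto
  have mR: "(\<lambda>y. \<integral>\<^sup>+u. f (\<lambda>k\<in>{..<Suc r}. wscale t k *\<^sub>R y k, (1 / sqrt S') *\<^sub>R u) \<partial>?G) \<in> borel_measurable (\<Pi>\<^sub>M k\<in>{..<Suc r}. ?G)"
    by measurable
  have "(\<integral>\<^sup>+z. f (\<lambda>k\<in>{..<Suc r}. wdiff t z k, wmean t (Suc r + 1) z) \<partial>(\<Pi>\<^sub>M i\<in>{1..Suc r+1}. ?G)) =
      (\<integral>\<^sup>+w. \<integral>\<^sup>+z. f (\<lambda>k\<in>{..<Suc r}. wdiff t (z(q := w)) k, wmean t (Suc r + 1) (z(q := w))) \<partial>(\<Pi>\<^sub>M i\<in>{1..r+1}. ?G) \<partial>?G)"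
    using mL unfolding ins(1) by (intro G.product_nn_integral_insert_rev) (auto simp: q_def)
  also have "\<dots> = (\<integral>\<^sup>+w. \<integral>\<^sup>+z. h (\<lambda>k\<in>{..<r}. wdiff t z k) w (wmean t (r + 1) z) \<partial>(\<Pi>\<^sub>M i\<in>{1..r+1}. ?G) \<partial>?G)"
  proof (intro nn_integral_cong)
    fix w :: "real ^ 'n" and z :: "nat \<Rightarrow> real ^ 'n"
    have m1: "wmean t (r + 1) (z(q := w)) = wmean t (r + 1) z"
      by (rule wmean_cong) (auto simp: q_def)
    have d: "wdiff t (z(q := w)) k = wdiff t z k" if "k < r" for k
      using that by (intro wdiff_cong) (auto simp: q_def)
    have d': "wdiff t (z(q := w)) r = t q *\<^sub>R w - wmean t (r + 1) z"
      using m1 by (simp add: wdiff_def q_def)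
    have m2: "wmean t (Suc r + 1) (z(q := w)) = (1 / S') *\<^sub>R (S *\<^sub>R wmean t (r + 1) z + (1 / t q) *\<^sub>R w)"
      using wmean_Suc[of t r "z(q := w)", OF t] m1 by (simp add: S_def S'_def q_def)
    show "f (\<lambda>k\<in>{..<Suc r}. wdiff t (z(q := w)) k, wmean t (Suc r + 1) (z(q := w))) =
        h (\<lambda>k\<in>{..<r}. wdiff t z k) w (wmean t (r + 1) z)"
      unfolding h_def m2
      by (intro arg_cong[of _ _ f] arg_cong2[where f=Pair] refl restrict_ext) (auto simp: d d' less_Suc_eq)
  qed
  also have "\<dots> = (\<integral>\<^sup>+w. \<integral>\<^sup>+y. \<integral>\<^sup>+u. h (\<lambda>k\<in>{..<r}. wscale t k *\<^sub>R y k) w ((1 / sqrt S) *\<^sub>R u)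
       \<partial>?G \<partial>(\<Pi>\<^sub>M k\<in>{..<r}. ?G) \<partial>?G)"
  proof (rule nn_integral_cong)
    fix w :: "real ^ 'n"
    have "(\<lambda>x. h (fst x) w (snd x)) \<in> borel_measurable ((\<Pi>\<^sub>M k\<in>{..<r}. borel) \<Otimes>\<^sub>M borel)"
      by (rule measurable_compose[OF _ hm, of "\<lambda>x. (fst x, w, snd x)", simplified]) measurable
    from Suc.IH[OF this]
    show "(\<integral>\<^sup>+z. h (\<lambda>k\<in>{..<r}. wdiff t z k) w (wmean t (r + 1) z) \<partial>(\<Pi>\<^sub>M i\<in>{1..r+1}. ?G)) =
      (\<integral>\<^sup>+y. \<integral>\<^sup>+u. h (\<lambda>k\<in>{..<r}. wscale t k *\<^sub>R y k) w ((1 / sqrt S) *\<^sub>R u) \<partial>?G \<partial>(\<Pi>\<^sub>M k\<in>{..<r}. ?G))"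
      unfolding S_def fst_conv snd_conv .
  qed
  \<comment> \<open>Fubini brings the integrals over w and u next to each other, so that the pair
    can be rotated for fixed y.\<close>
  also have "\<dots> = (\<integral>\<^sup>+y. \<integral>\<^sup>+w. \<integral>\<^sup>+u. h (\<lambda>k\<in>{..<r}. wscale t k *\<^sub>R y k) w ((1 / sqrt S) *\<^sub>R u)
       \<partial>?G \<partial>?G \<partial>(\<Pi>\<^sub>M k\<in>{..<r}. ?G))"
  proof (rule pair_sigma_finite.Fubini')
    show "pair_sigma_finite (\<Pi>\<^sub>M k\<in>{..<r}. ?G) ?G"
      by (intro pair_sigma_finite.intro prob_space_imp_sigma_finite prob_space_PiM prob_space_gaussian_model)
    have "(\<lambda>x. h (\<lambda>k\<in>{..<r}. wscale t k *\<^sub>R (fst (fst x)) k) (snd (fst x)) ((1 / sqrt S) *\<^sub>R (snd x))) \<in>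
        borel_measurable (((\<Pi>\<^sub>M k\<in>{..<r}. ?G) \<Otimes>\<^sub>M ?G) \<Otimes>\<^sub>M ?G)"
      by (rule measurable_compose[OF _ hm, of "\<lambda>x. (\<lambda>k\<in>{..<r}. wscale t k *\<^sub>R (fst (fst x)) k, snd (fst x), (1 / sqrt S) *\<^sub>R (snd x))", simplified]) measurable
    then show "(\<lambda>(y, w). \<integral>\<^sup>+u. h (\<lambda>k\<in>{..<r}. wscale t k *\<^sub>R y k) w ((1 / sqrt S) *\<^sub>R u) \<partial>?G)
        \<in> borel_measurable ((\<Pi>\<^sub>M k\<in>{..<r}. ?G) \<Otimes>\<^sub>M ?G)"
      by (simp add: case_prod_beta)
  qed
  also have "\<dots> = (\<integral>\<^sup>+y. \<integral>\<^sup>+w. \<integral>\<^sup>+u. f (\<lambda>k\<in>{..<Suc r}. wscale t k *\<^sub>R (y(r := w)) k, (1 / sqrt S') *\<^sub>R u)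
       \<partial>?G \<partial>?G \<partial>(\<Pi>\<^sub>M k\<in>{..<r}. ?G))"
  proof (rule nn_integral_cong)
    fix y :: "nat \<Rightarrow> real ^ 'n"
    let ?y = "\<lambda>k\<in>{..<r}. wscale t k *\<^sub>R y k"
    let ?F = "\<lambda>w u. f (\<lambda>k\<in>{..<Suc r}. wscale t k *\<^sub>R (y(r := w)) k, (1 / sqrt S') *\<^sub>R u)"
    have ws: "wscale t r = t q * sqrt (S' / S)" by (simp add: wscale_def q_def S'_def S_def)
    note sc = wdiff_scaling[OF S t, of q, folded S'_eq, folded c_def s_def]
    have "h ?y w ((1 / sqrt S) *\<^sub>R u) = ?F (c *\<^sub>R w - s *\<^sub>R u) (s *\<^sub>R w + c *\<^sub>R u)" for w u
      unfolding h_def sc(3)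
      by (intro arg_cong[of _ _ f] arg_cong2[where f=Pair] refl restrict_ext)
         (auto simp: less_Suc_eq sc(2) ws)
    then have "(\<integral>\<^sup>+w. \<integral>\<^sup>+u. h ?y w ((1 / sqrt S) *\<^sub>R u) \<partial>?G \<partial>?G) =
        (\<integral>\<^sup>+w. \<integral>\<^sup>+u. ?F (c *\<^sub>R w - s *\<^sub>R u) (s *\<^sub>R w + c *\<^sub>R u) \<partial>?G \<partial>?G)"
      by simp
    also have "\<dots> = (\<integral>\<^sup>+w. \<integral>\<^sup>+u. ?F w u \<partial>?G \<partial>?G)"
    proof (rule nn_integral_gaussian_rotation[OF sc(1)])
      have "(\<lambda>x. wscale t k *\<^sub>R (y(r := fst x)) k) \<in> borel_measurable (borel \<Otimes>\<^sub>M (borel :: (real ^ 'n) measure))" for k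
        by (cases "k = r") auto
      then show "(\<lambda>(w, u). ?F w u) \<in> borel_measurable (borel \<Otimes>\<^sub>M borel)"
        unfolding case_prod_beta
        by (intro measurable_compose[OF _ Suc.prems] measurable_Pair measurable_restrict) auto
    qed
    finally show "(\<integral>\<^sup>+w. \<integral>\<^sup>+u. h ?y w ((1 / sqrt S) *\<^sub>R u) \<partial>?G \<partial>?G) = (\<integral>\<^sup>+w. \<integral>\<^sup>+u. ?F w u \<partial>?G \<partial>?G)" .
  qed
  also have "\<dots> = (\<integral>\<^sup>+y. \<integral>\<^sup>+u. f (\<lambda>k\<in>{..<Suc r}. wscale t k *\<^sub>R y k, (1 / sqrt S') *\<^sub>R u) \<partial>?G \<partial>(\<Pi>\<^sub>M k\<in>{..<Suc r}. ?G))"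
    using mR unfolding ins(2) by (intro G.product_nn_integral_insert[symmetric]) auto
  finally show ?case
    unfolding S'_def by (simp only: add_2_eq_Suc' Suc_eq_plus1[symmetric])
qed

text \<open>The ratios of precisions telescope to \<open>prec t (r + 1) / prec t 1\<close>, and
  \<open>1 / prec t 1\<close> supplies the missing factor of vertex 1.\<close>

lemma prod_wscale:
  assumes t: "\<And>i. 0 < t i"
  shows "(\<Prod>k<r. (wscale t k)\<^sup>2) = (\<Prod>i\<in>{1..r+1}. (t i)\<^sup>2) * prec t (r + 1)"
proof (induction r)
  case 0
  then show ?case using t[of 1] by (simp add: prec_def)
next
  case (Suc r)
  have "0 < prec t (r + 1)" "0 < prec t (r + 2)" using prec_pos[of t r, OF t] prec_pos[of t "Suc r", OF t] by auto
  then show ?case using Suc by (simp add: wscale_def power_mult_distrib)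
qed

text \<open>The common source for all four models: unit deviations give the Gaussian case, random
  deviations the beta prime case, and the dependence on t drives the comparison of coefficients in
  the beta and spherical cases.\<close>

theorem nn_integral_gaussian_simplex:
  fixes f :: "real \<Rightarrow> ennreal"
  assumes t: "\<And>i. 0 < t i" and r: "r \<le> CARD('n)" and [measurable]: "f \<in> borel_measurable borel"
  shows "(\<integral>\<^sup>+z. f (simplex_gramdet r (\<lambda>i. t i *\<^sub>R z i)) \<partial>(\<Pi>\<^sub>M i\<in>{1..r+1}. (gaussian_model :: (real ^ 'n) measure))) =
    (\<integral>\<^sup>+q. f ((\<Prod>i\<in>{1..r+1}. (t i)\<^sup>2) * prec t (r + 1) * (\<Prod>k<r. q k))
       \<partial>(\<Pi>\<^sub>M k\<in>{..<r}. chi_squared_law (CARD('n) - k)))"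
proof -
  let ?G = "gaussian_model :: (real ^ 'n) measure"
  interpret G1: prob_space ?G by (rule prob_space_gaussian_model)
  have ws: "wscale t k \<noteq> 0" for k
    using t[of "k+2"] prec_pos[of t k, OF t] prec_pos[of t "Suc k", OF t] by (simp add: wscale_def)
  have [measurable]: "(\<lambda>x. f (gramdet r (fst x))) \<in> borel_measurable ((\<Pi>\<^sub>M k\<in>{..<r}. (borel :: (real^'n) measure)) \<Otimes>\<^sub>M (borel :: (real ^ 'n) measure))"
    by (rule measurable_compose[OF measurable_gramdet assms(3)]) measurable
  have "(\<integral>\<^sup>+z. f (simplex_gramdet r (\<lambda>i. t i *\<^sub>R z i)) \<partial>(\<Pi>\<^sub>M i\<in>{1..r+1}. ?G)) =
      (\<integral>\<^sup>+z. f (gramdet r (fst (\<lambda>k\<in>{..<r}. wdiff t z k, wmean t (r + 1) z))) \<partial>(\<Pi>\<^sub>M i\<in>{1..r+1}. ?G))"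
    unfolding gramdet_wdiff[OF t] fst_conv
    by (intro nn_integral_cong arg_cong[of _ _ f] gramdet_cong) auto
  also have "\<dots> = (\<integral>\<^sup>+y. \<integral>\<^sup>+u. f (gramdet r (fst (\<lambda>k\<in>{..<r}. wscale t k *\<^sub>R y k, (1 / sqrt (prec t (r + 1))) *\<^sub>R u)))
       \<partial>?G \<partial>(\<Pi>\<^sub>M k\<in>{..<r}. ?G))"
    by (rule nn_integral_wdiff[OF t]) measurable
  also have "\<dots> = (\<integral>\<^sup>+y. f ((\<Prod>k<r. (wscale t k)\<^sup>2) * gramdet r y) \<partial>(\<Pi>\<^sub>M k\<in>{..<r}. ?G))"
  proof (rule nn_integral_cong)
    fix y :: "nat \<Rightarrow> real ^ 'n"
    have "gramdet r (\<lambda>k\<in>{..<r}. wscale t k *\<^sub>R y k) = gramdet r (\<lambda>k. wscale t k *\<^sub>R y k)"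
      by (rule gramdet_cong) simp
    also have "\<dots> = (\<Prod>k<r. (wscale t k)\<^sup>2) * gramdet r y"
      by (rule gramdet_scale) (rule ws)
    finally show "(\<integral>\<^sup>+u. f (gramdet r (fst (\<lambda>k\<in>{..<r}. wscale t k *\<^sub>R y k, (1 / sqrt (prec t (r + 1))) *\<^sub>R u))) \<partial>?G) =
        f ((\<Prod>k<r. (wscale t k)\<^sup>2) * gramdet r y)"
      using G1.emeasure_space_1 by simp
  qed
  also have "\<dots> = (\<integral>\<^sup>+q. f ((\<Prod>k<r. (wscale t k)\<^sup>2) * (\<Prod>k<r. q k)) \<partial>(\<Pi>\<^sub>M k\<in>{..<r}. chi_squared_law (CARD('n) - k)))"
    by (rule nn_integral_gramdet_gaussian[OF r]) measurable
  finally show ?thesis unfolding prod_wscale[OF t] .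
qed

section \<open>Gamma mixtures\<close>

definition gamma_law :: "real \<Rightarrow> real measure" where
  "gamma_law a = density lborel (\<lambda>t. ennreal (indicator {0<..} t * (t powr (a - 1) * exp (- t) / Gamma a)))"

lemma sets_gamma_law [simp, measurable_cong]: "sets (gamma_law a) = sets borel"
  by (simp add: gamma_law_def)

lemma space_gamma_law [simp]: "space (gamma_law a) = UNIV"
  by (simp add: gamma_law_def)

lemma sets_beta_prime_law [simp, measurable_cong]: "sets (beta_prime_law a b) = sets borel"
  by (simp add: beta_prime_law_def)

lemma sets_beta_law [simp, measurable_cong]: "sets (beta_law a b) = sets borel"
  by (simp add: beta_law_def)

lemma nn_integral_powr_exp:
  assumes s: "0 < s" and c: "0 < c"
  shows "(\<integral>\<^sup>+t. ennreal (indicator {0<..} t * (t powr (s - 1) * exp (- (c * t)))) \<partial>lborel) = ennreal (Gamma s / c powr s)"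
proof -
  have 1: "(\<integral>\<^sup>+t. ennreal (indicator {0<..} t * (t powr (s - 1) * exp (- t))) \<partial>lborel) = ennreal (Gamma s)"
    unfolding Gamma_conv_nn_integral_real[OF s]
    by (intro nn_integral_cong arg_cong[of _ _ ennreal]) (auto simp: indicator_def exp_minus field_simps)
  have "(\<integral>\<^sup>+t. ennreal (indicator {0<..} t * (t powr (s - 1) * exp (- (c * t)))) \<partial>lborel) =
      \<bar>1 / c\<bar> * (\<integral>\<^sup>+t. ennreal (indicator {0<..} (0 + 1 / c * t) * ((0 + 1 / c * t) powr (s - 1) * exp (- (c * (0 + 1 / c * t))))) \<partial>lborel)"
    using c by (intro nn_integral_real_affine) auto
  also have "(\<integral>\<^sup>+t. ennreal (indicator {0<..} (0 + 1 / c * t) * ((0 + 1 / c * t) powr (s - 1) * exp (- (c * (0 + 1 / c * t))))) \<partial>lborel)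
      = (\<integral>\<^sup>+t. ennreal ((1 / c) powr (s - 1)) * ennreal (indicator {0<..} t * (t powr (s - 1) * exp (- t))) \<partial>lborel)"
    using c by (intro nn_integral_cong) (auto simp: ennreal_mult'[symmetric] indicator_def powr_mult powr_divide zero_less_divide_iff intro!: arg_cong[of _ _ ennreal])
  also have "\<dots> = ennreal ((1 / c) powr (s - 1)) * ennreal (Gamma s)"
    by (subst nn_integral_cmult) (auto simp: 1)
  also have "ennreal \<bar>1 / c\<bar> * \<dots> = ennreal (Gamma s / c powr s)"
  proof -
    have "c powr s = c powr (s - 1) * c" using c by (simp add: powr_diff)
    then have "1 / c * ((1 / c) powr (s - 1) * Gamma s) = Gamma s / c powr s"
      using c by (simp add: powr_divide field_simps)
    then show ?thesis using c Gamma_real_pos[OF s] by (simp add: ennreal_mult'[symmetric])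
  qed
  finally show ?thesis .
qed

lemma nn_integral_gamma_law:
  assumes [measurable]: "f \<in> borel_measurable borel"
  shows "(\<integral>\<^sup>+t. f t \<partial>gamma_law a) = (\<integral>\<^sup>+t. ennreal (indicator {0<..} t * (t powr (a - 1) * exp (- t) / Gamma a)) * f t \<partial>lborel)"
  unfolding gamma_law_def by (subst nn_integral_density) auto

lemma nn_integral_beta_prime_law:
  assumes [measurable]: "f \<in> borel_measurable borel"
  shows "(\<integral>\<^sup>+t. f t \<partial>beta_prime_law a b) = (\<integral>\<^sup>+t. ennreal (indicator {0<..} t *
       (Gamma (a + b) / (Gamma a * Gamma b) * t powr (a - 1) * (1 + t) powr (- a - b))) * f t \<partial>lborel)"
  unfolding beta_prime_law_def by (subst nn_integral_density) auto

lemma prob_space_gamma_law: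
  assumes "0 < a" shows "prob_space (gamma_law a)"
proof (rule prob_spaceI)
  have "emeasure (gamma_law a) (space (gamma_law a)) = (\<integral>\<^sup>+t. 1 \<partial>gamma_law a)" by simp
  also have "\<dots> = (\<integral>\<^sup>+t. ennreal (1 / Gamma a) * ennreal (indicator {0<..} t * (t powr (a - 1) * exp (- (1 * t)))) \<partial>lborel)"
    using Gamma_real_pos[OF assms] by (subst nn_integral_gamma_law) (auto simp: ennreal_mult'[symmetric] intro!: nn_integral_cong)
  also have "\<dots> = ennreal (1 / Gamma a) * ennreal (Gamma a / 1 powr a)"
    using assms by (subst nn_integral_cmult, simp, subst nn_integral_powr_exp) auto
  also have "\<dots> = 1" using Gamma_real_pos[OF assms] by (simp add: ennreal_mult'[symmetric])
  finally show "emeasure (gamma_law a) (space (gamma_law a)) = 1" .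
qed

lemma AE_gamma_law_pos: "AE t in gamma_law a. 0 < t"
  unfolding gamma_law_def by (subst AE_density) (auto simp: indicator_def)

lemma nn_integral_gamma_law_cong:
  assumes "\<And>t. 0 < t \<Longrightarrow> f t = g t"
  shows "(\<integral>\<^sup>+t. f t \<partial>gamma_law a) = (\<integral>\<^sup>+t. g t \<partial>gamma_law a)"
  using AE_gamma_law_pos[of a] assms by (intro nn_integral_cong_AE) (auto elim!: eventually_mono)

lemma nn_integral_beta_prime_law_cong:
  assumes "\<And>t. 0 < t \<Longrightarrow> f t = g t"
  shows "(\<integral>\<^sup>+t. f t \<partial>beta_prime_law a b) = (\<integral>\<^sup>+t. g t \<partial>beta_prime_law a b)"
proof -
  have "AE t in beta_prime_law a b. 0 < t"
    unfolding beta_prime_law_def by (subst AE_density) (auto simp: indicator_def)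
  then show ?thesis using assms by (intro nn_integral_cong_AE) (auto elim!: eventually_mono)
qed

text \<open>The independence of sum and ratio of Gamma variables comes from two one-dimensional
  scalings, x = y v for fixed y and then s = (1 + v) y for fixed v, with Fubini in between.\<close>

lemma nn_integral_gamma_sum_ratio:
  fixes f :: "real \<Rightarrow> real \<Rightarrow> ennreal"
  assumes a: "0 < a" and b: "0 < b" and f: "(\<lambda>(x, y). f x y) \<in> borel_measurable (borel \<Otimes>\<^sub>M borel)"
  shows "(\<integral>\<^sup>+x. \<integral>\<^sup>+y. f (x + y) (x / y) \<partial>gamma_law b \<partial>gamma_law a) =
    (\<integral>\<^sup>+s. \<integral>\<^sup>+v. f s v \<partial>beta_prime_law a b \<partial>gamma_law (a + b))"
proof -
  note [measurable] = f
  define ga where "ga c t = indicator {0<..} t * (t powr (c - 1) * exp (- t) / Gamma c)" for c t :: real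
  have ga_m[measurable]: "ga c \<in> borel_measurable borel" for c unfolding ga_def[abs_def] by measurable
  have ga0: "0 \<le> ga c t" if "0 < c" for c t using Gamma_real_pos[OF that] by (simp add: ga_def indicator_def)
  define bp where "bp t = indicator {0<..} t * (Gamma (a + b) / (Gamma a * Gamma b) * t powr (a - 1) * (1 + t) powr (- a - b))" for t :: real
  have [measurable]: "bp \<in> borel_measurable borel" unfolding bp_def[abs_def] by measurable
  have Gp: "0 < Gamma a" "0 < Gamma b" "0 < Gamma (a + b)" using a b by (auto intro: Gamma_real_pos)
  have bp0: "0 \<le> bp t" for t using Gp by (simp add: bp_def indicator_def)
  have nga: "(\<integral>\<^sup>+t. h t \<partial>gamma_law c) = (\<integral>\<^sup>+t. ennreal (ga c t) * h t \<partial>lborel)" if "h \<in> borel_measurable borel" for c and h :: "real \<Rightarrow> ennreal"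
    unfolding ga_def by (rule nn_integral_gamma_law[OF that])
  have nbp: "(\<integral>\<^sup>+t. h t \<partial>beta_prime_law a b) = (\<integral>\<^sup>+t. ennreal (bp t) * h t \<partial>lborel)" if "h \<in> borel_measurable borel" for h :: "real \<Rightarrow> ennreal"
    unfolding bp_def by (rule nn_integral_beta_prime_law[OF that])
  \<comment> \<open>The factors y and 1 + v are the Jacobians of the two scalings.\<close>
  have key: "y * (ga a (y * v) * ga b y) = (1 + v) * (ga (a + b) ((1 + v) * y) * bp v)" if "0 < y" for y v
  proof (cases "0 < v")
    case True
    have "y * ((y * v) powr (a - 1) * exp (- (y * v)) / Gamma a * (y powr (b - 1) * exp (- y) / Gamma b)) =
        y * y powr (a - 1) * y powr (b - 1) * v powr (a - 1) * (exp (- (y * v)) * exp (- y)) / (Gamma a * Gamma b)"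
      using that True by (simp add: powr_mult field_simps)
    also have "y * y powr (a - 1) * y powr (b - 1) = y powr (a + b - 1)"
      using that by (simp add: powr_mult_base flip: powr_add) (simp add: algebra_simps)
    also have "exp (- (y * v)) * exp (- y) = exp (- ((1 + v) * y))"
      by (simp add: exp_add[symmetric] algebra_simps)
    also have "y powr (a + b - 1) = (1 + v) * (((1 + v) * y) powr (a + b - 1) * (1 + v) powr (- a - b))"
    proof -
      have "(1 + v) * ((1 + v) powr (a + b - 1) * (1 + v) powr (- a - b)) = 1"
        using True by (simp flip: powr_add)
      then have "y powr (a + b - 1) = (1 + v) * ((1 + v) powr (a + b - 1) * (1 + v) powr (- a - b)) * y powr (a + b - 1)" by simp
      also have "\<dots> = (1 + v) * (((1 + v) * y) powr (a + b - 1) * (1 + v) powr (- a - b))"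
        using that True by (simp add: powr_mult)
      finally show ?thesis .
    qed
    finally show ?thesis
      using that True Gp by (simp add: ga_def bp_def add_pos_pos)
  next
    case False
    then have "\<not> 0 < y * v" using that by (simp add: zero_less_mult_iff)
    with False show ?thesis by (simp add: ga_def bp_def)
  qed
  let ?E = "\<lambda>x. ennreal x"
  have "(\<integral>\<^sup>+x. \<integral>\<^sup>+y. f (x + y) (x / y) \<partial>gamma_law b \<partial>gamma_law a) =
      (\<integral>\<^sup>+x. \<integral>\<^sup>+y. ?E (ga a x) * (?E (ga b y) * f (x + y) (x / y)) \<partial>lborel \<partial>lborel)"
    by (simp add: nga nn_integral_cmult)
  also have "\<dots> = (\<integral>\<^sup>+y. \<integral>\<^sup>+x. ?E (ga a x) * (?E (ga b y) * f (x + y) (x / y)) \<partial>lborel \<partial>lborel)"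
    by (rule lborel_pair.Fubini') simp
  also have "\<dots> = (\<integral>\<^sup>+y. \<integral>\<^sup>+v. ?E (1 + v) * (?E (ga (a + b) ((1 + v) * y)) * ?E (bp v)) * f ((1 + v) * y) v \<partial>lborel \<partial>lborel)"
  proof (rule nn_integral_cong)
    fix y :: real
    show "(\<integral>\<^sup>+x. ?E (ga a x) * (?E (ga b y) * f (x + y) (x / y)) \<partial>lborel) =
        (\<integral>\<^sup>+v. ?E (1 + v) * (?E (ga (a + b) ((1 + v) * y)) * ?E (bp v)) * f ((1 + v) * y) v \<partial>lborel)"
    proof (cases "0 < y")
      case True
      have "(\<integral>\<^sup>+x. ?E (ga a x) * (?E (ga b y) * f (x + y) (x / y)) \<partial>lborel) =
          ?E \<bar>y\<bar> * (\<integral>\<^sup>+v. ?E (ga a (0 + y * v)) * (?E (ga b y) * f (0 + y * v + y) ((0 + y * v) / y)) \<partial>lborel)"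
        using True by (intro nn_integral_real_affine) auto
      also have "\<dots> = (\<integral>\<^sup>+v. ?E y * (?E (ga a (y * v)) * (?E (ga b y) * f (y * v + y) v)) \<partial>lborel)"
        using True by (subst nn_integral_cmult[symmetric]) auto
      also have "\<dots> = (\<integral>\<^sup>+v. ?E (1 + v) * (?E (ga (a + b) ((1 + v) * y)) * ?E (bp v)) * f ((1 + v) * y) v \<partial>lborel)"
      proof (rule nn_integral_cong)
        fix v :: real
        have yv: "y * v + y = (1 + v) * y" by (simp add: algebra_simps)
        have "?E y * (?E (ga a (y * v)) * (?E (ga b y) * f (y * v + y) v)) = ?E (y * (ga a (y * v) * ga b y)) * f ((1 + v) * y) v"
          unfolding yv using True ga0[OF a] ga0[OF b] by (simp add: ennreal_mult' mult_ac)
        also have "\<dots> = ?E (1 + v) * (?E (ga (a + b) ((1 + v) * y)) * ?E (bp v)) * f ((1 + v) * y) v"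
        proof (cases "0 < v")
          case True
          then show ?thesis unfolding key[OF \<open>0 < y\<close>]
            using ga0[of "a + b"] a b bp0 by (simp add: ennreal_mult')
        next
          case False
          then show ?thesis unfolding key[OF \<open>0 < y\<close>] by (simp add: bp_def)
        qed
        finally show "?E y * (?E (ga a (y * v)) * (?E (ga b y) * f (y * v + y) v)) =
          ?E (1 + v) * (?E (ga (a + b) ((1 + v) * y)) * ?E (bp v)) * f ((1 + v) * y) v" .
      qed
      finally show ?thesis .
    next
      case False
      have "?E (1 + v) * (?E (ga (a + b) ((1 + v) * y)) * ?E (bp v)) * f ((1 + v) * y) v = 0" for v
        using False by (cases "0 < v") (auto simp: ga_def bp_def zero_less_mult_iff)
      moreover have "ga b y = 0" using False by (simp add: ga_def)
      ultimately show ?thesis by (simp only:) simp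
    qed
  qed
  also have "\<dots> = (\<integral>\<^sup>+v. \<integral>\<^sup>+y. ?E (1 + v) * (?E (ga (a + b) ((1 + v) * y)) * ?E (bp v)) * f ((1 + v) * y) v \<partial>lborel \<partial>lborel)"
    by (rule lborel_pair.Fubini') simp
  also have "\<dots> = (\<integral>\<^sup>+v. \<integral>\<^sup>+s. ?E (ga (a + b) s) * (?E (bp v) * f s v) \<partial>lborel \<partial>lborel)"
  proof (rule nn_integral_cong)
    fix v :: real
    show "(\<integral>\<^sup>+y. ?E (1 + v) * (?E (ga (a + b) ((1 + v) * y)) * ?E (bp v)) * f ((1 + v) * y) v \<partial>lborel) =
        (\<integral>\<^sup>+s. ?E (ga (a + b) s) * (?E (bp v) * f s v) \<partial>lborel)"
    proof (cases "0 < v")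
      case True
      have "(\<integral>\<^sup>+s. ?E (ga (a + b) s) * (?E (bp v) * f s v) \<partial>lborel) =
          ?E \<bar>1 + v\<bar> * (\<integral>\<^sup>+y. ?E (ga (a + b) (0 + (1 + v) * y)) * (?E (bp v) * f (0 + (1 + v) * y) v) \<partial>lborel)"
        using True by (intro nn_integral_real_affine) auto
      also have "\<dots> = (\<integral>\<^sup>+y. ?E (1 + v) * (?E (ga (a + b) ((1 + v) * y)) * ?E (bp v)) * f ((1 + v) * y) v \<partial>lborel)"
        using True by (subst nn_integral_cmult[symmetric]) (auto simp: mult_ac)
      finally show ?thesis by simp
    qed (simp add: bp_def)
  qed
  also have "\<dots> = (\<integral>\<^sup>+s. \<integral>\<^sup>+v. ?E (ga (a + b) s) * (?E (bp v) * f s v) \<partial>lborel \<partial>lborel)"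
    by (rule lborel_pair.Fubini') simp
  also have "\<dots> = (\<integral>\<^sup>+s. \<integral>\<^sup>+v. f s v \<partial>beta_prime_law a b \<partial>gamma_law (a + b))"
  proof -
    have 1: "(\<integral>\<^sup>+v. f s v \<partial>beta_prime_law a b) = (\<integral>\<^sup>+v. ?E (bp v) * f s v \<partial>lborel)" for s
      by (rule nbp) measurable
    show ?thesis unfolding 1 by (subst nga) (auto simp: nn_integral_cmult)
  qed
  finally show ?thesis .
qed

text \<open>The normalising constant comes for free: with integrand 1, the sum-ratio identity
  compares this mass with masses of Gamma laws.\<close>

lemma prob_space_beta_prime_law:
  assumes "0 < a" "0 < b" shows "prob_space (beta_prime_law a b)"
proof (rule prob_spaceI)
  interpret A: prob_space "gamma_law a" by (rule prob_space_gamma_law) fact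
  interpret B: prob_space "gamma_law b" by (rule prob_space_gamma_law) fact
  interpret AB: prob_space "gamma_law (a + b)" by (rule prob_space_gamma_law) (use assms in simp)
  have "(\<integral>\<^sup>+s. \<integral>\<^sup>+v. 1 \<partial>beta_prime_law a b \<partial>gamma_law (a + b)) = 1"
    using nn_integral_gamma_sum_ratio[of a b "\<lambda>_ _. 1"] assms A.emeasure_space_1 B.emeasure_space_1 by simp
  then show "emeasure (beta_prime_law a b) (space (beta_prime_law a b)) = 1"
    using AB.emeasure_space_1 by simp
qed

lemma nn_integral_gamma_sum:
  assumes "0 < a" "0 < b" and [measurable]: "f \<in> borel_measurable borel"
  shows "(\<integral>\<^sup>+x. \<integral>\<^sup>+y. f (x + y) \<partial>gamma_law b \<partial>gamma_law a) = (\<integral>\<^sup>+s. f s \<partial>gamma_law (a + b))"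
proof -
  interpret prob_space "beta_prime_law a b" by (rule prob_space_beta_prime_law) fact+
  show ?thesis
    using nn_integral_gamma_sum_ratio[of a b "\<lambda>s v. f s"] assms emeasure_space_1 by simp
qed

lemma nn_integral_gamma_ratio:
  assumes "0 < a" "0 < b" and [measurable]: "f \<in> borel_measurable borel"
  shows "(\<integral>\<^sup>+x. \<integral>\<^sup>+y. f (x / y) \<partial>gamma_law b \<partial>gamma_law a) = (\<integral>\<^sup>+v. f v \<partial>beta_prime_law a b)"
proof -
  interpret prob_space "gamma_law (a + b)" by (rule prob_space_gamma_law) (use assms in simp)
  show ?thesis
    using nn_integral_gamma_sum_ratio[of a b "\<lambda>s v. f v"] assms emeasure_space_1 by simp
qed

section \<open>Chi-squared laws as Gamma laws\<close>

text \<open>Serves to carry the substitution rule from compact intervals to the half-line.\<close>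

lemma nn_integral_SUP_atLeastAtMost:
  fixes F :: "real \<Rightarrow> ennreal" and c :: "nat \<Rightarrow> real"
  assumes [measurable]: "F \<in> borel_measurable borel" and c: "incseq c" "\<And>x. \<exists>n. x \<le> c n"
  shows "(SUP n. \<integral>\<^sup>+x. F x * indicator {0..c n} x \<partial>lborel) = (\<integral>\<^sup>+x. F x * indicator {0..} x \<partial>lborel)"
proof -
  have "(SUP n. \<integral>\<^sup>+x. F x * indicator {0..c n} x \<partial>lborel) = (\<integral>\<^sup>+x. (SUP n. F x * indicator {0..c n} x) \<partial>lborel)"
  proof (rule nn_integral_monotone_convergence_SUP[symmetric])
    show "incseq (\<lambda>n x. F x * indicator {0..c n} x)"
      using c(1) by (auto simp: incseq_def le_fun_def indicator_def intro: order_trans)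
  qed simp
  also have "\<dots> = (\<integral>\<^sup>+x. F x * indicator {0..} x \<partial>lborel)"
  proof (rule nn_integral_cong, rule antisym)
    fix x :: real
    show "(SUP n. F x * indicator {0..c n} x) \<le> F x * indicator {0..} x"
      by (intro SUP_least) (auto simp: indicator_def)
    obtain n where "x \<le> c n" using c(2) by blast
    then show "F x * indicator {0..} x \<le> (SUP n. F x * indicator {0..c n} x)"
      by (intro SUP_upper2[of n]) (auto simp: indicator_def)
  qed
  finally show ?thesis .
qed

text \<open>The even density folds the line onto the positive half-line with a factor 2; there t =
  z^2 / 2 is substituted on each interval from 0 to n, and n tends to infinity.\<close>

lemma nn_integral_std_normal_square:
  fixes f :: "real \<Rightarrow> ennreal"
  assumes [measurable]: "f \<in> borel_measurable borel"
  shows "(\<integral>\<^sup>+z. f (z\<^sup>2) \<partial>std_normal) = (\<integral>\<^sup>+t. f (2 * t) \<partial>gamma_law (1 / 2))"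
proof -
  define h where "h z = ennreal (std_normal_density z) * f (z\<^sup>2)" for z
  have [measurable]: "h \<in> borel_measurable borel" unfolding h_def[abs_def] by measurable
  define F where "F t = ennreal (indicator {0<..} t * (t powr (1 / 2 - 1) * exp (- t) / Gamma (1 / 2))) * f (2 * t)" for t
  have [measurable]: "F \<in> borel_measurable borel" unfolding F_def[abs_def] by measurable
  have key: "F (z\<^sup>2 / 2) * ennreal z * indicator {0..b} z = 2 * h z * indicator {0..b} z" if "z \<noteq> 0" for z b :: real
  proof (cases "0 < z")
    case True
    have "(z\<^sup>2 / 2) powr (1 / 2 - 1) * z = sqrt 2"
    proof -
      have "(z\<^sup>2 / 2) powr (1 / 2 - 1) = 1 / sqrt (z\<^sup>2 / 2)"
        using True powr_half_sqrt[of "z\<^sup>2 / 2"] by (simp add: powr_minus_divide)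
      then show ?thesis using True by (simp add: real_sqrt_divide)
    qed
    then have "(z\<^sup>2 / 2) powr (1 / 2 - 1) * exp (- (z\<^sup>2 / 2)) / Gamma (1 / 2) * z = sqrt 2 * exp (- (z\<^sup>2 / 2)) / sqrt pi"
      by (simp add: Gamma_one_half_real field_simps)
    also have "\<dots> = 2 * std_normal_density z"
    proof -
      have "2 / sqrt (2 * pi) = sqrt 2 / sqrt pi" by (simp add: real_sqrt_mult field_simps)
      then show ?thesis by (simp add: std_normal_density_def field_simps)
    qed
    finally have *: "(z\<^sup>2 / 2) powr (1 / 2 - 1) * exp (- (z\<^sup>2 / 2)) / Gamma (1 / 2) * z = 2 * std_normal_density z" .
    have "F (z\<^sup>2 / 2) * ennreal z = ennreal ((z\<^sup>2 / 2) powr (1 / 2 - 1) * exp (- (z\<^sup>2 / 2)) / Gamma (1 / 2) * z) * f (z\<^sup>2)"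
    proof -
      let ?A = "(z\<^sup>2 / 2) powr (1 / 2 - 1) * exp (- (z\<^sup>2 / 2)) / Gamma (1 / 2)"
      have "F (z\<^sup>2 / 2) = ennreal ?A * f (z\<^sup>2)"
        using True by (simp add: F_def)
      moreover have "ennreal (?A * z) = ennreal ?A * ennreal z"
        by (rule ennreal_mult'') (use True in simp)
      ultimately show ?thesis by (simp only: mult_ac)
    qed
    also have "\<dots> = 2 * h z"
      unfolding * h_def by (simp add: ennreal_mult' mult_ac)
    finally show ?thesis by simp
  qed (use that in simp)
  have neg: "(\<integral>\<^sup>+z. h z * indicator {..<0} z \<partial>lborel) = (\<integral>\<^sup>+z. h z * indicator {0<..} z \<partial>lborel)"
    using nn_integral_real_affine[of "\<lambda>z. h z * indicator {0<..} z" "-1" 0]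
    by (simp add: h_def std_normal_density_def indicator_def)
  have "(\<integral>\<^sup>+z. f (z\<^sup>2) \<partial>std_normal) = (\<integral>\<^sup>+z. h z \<partial>lborel)"
    unfolding h_def by (simp add: nn_integral_density)
  also have "\<dots> = (\<integral>\<^sup>+z. h z * indicator {0<..} z + h z * indicator {..<0} z \<partial>lborel)"
    by (intro nn_integral_cong_AE, use AE_lborel_singleton[of "0::real"] in eventually_elim) (auto simp: indicator_def)
  also have "\<dots> = (\<integral>\<^sup>+z. 2 * (h z * indicator {0<..} z) \<partial>lborel)"
    by (subst nn_integral_add) (auto simp: neg nn_integral_cmult mult_2[symmetric])
  also have "\<dots> = (\<integral>\<^sup>+z. 2 * h z * indicator {0..} z \<partial>lborel)"
    by (intro nn_integral_cong_AE, use AE_lborel_singleton[of "0::real"] in eventually_elim) (auto simp: indicator_def)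
  also have "\<dots> = (SUP n. \<integral>\<^sup>+z. 2 * h z * indicator {0..real n} z \<partial>lborel)"
    by (rule nn_integral_SUP_atLeastAtMost[symmetric]) (auto simp: incseq_def intro: real_arch_simple)
  also have "\<dots> = (SUP n. \<integral>\<^sup>+t. F t * indicator {0..(real n)\<^sup>2 / 2} t \<partial>lborel)"
  proof (rule SUP_cong[OF refl])
    fix n :: nat
    show "(\<integral>\<^sup>+z. 2 * h z * indicator {0..real n} z \<partial>lborel) = (\<integral>\<^sup>+t. F t * indicator {0..(real n)\<^sup>2 / 2} t \<partial>lborel)"
    proof (cases "n = 0")
      case False
      have "(\<integral>\<^sup>+t. F t * indicator {0\<^sup>2 / 2..(real n)\<^sup>2 / 2} t \<partial>lborel) =
          (\<integral>\<^sup>+z. F (z\<^sup>2 / 2) * ennreal z * indicator {0..real n} z \<partial>lborel)"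
        using False by (intro nn_integral_substitution_aux) (auto intro!: derivative_eq_intros continuous_intros)
      also have "\<dots> = (\<integral>\<^sup>+z. 2 * h z * indicator {0..real n} z \<partial>lborel)"
        by (intro nn_integral_cong_AE, use AE_lborel_singleton[of "0::real"] in eventually_elim) (rule key, simp)
      finally show ?thesis by simp
    next
      case True
      have "(\<integral>\<^sup>+z. g z * indicator {0..0} z \<partial>lborel) = 0" for g :: "real \<Rightarrow> ennreal"
        by (subst nn_integral_cong_AE[of _ "\<lambda>_. 0"], use AE_lborel_singleton[of "0::real"] in eventually_elim) (auto simp: indicator_def)
      then show ?thesis using True by simp
    qed
  qed
  also have "\<dots> = (\<integral>\<^sup>+t. F t * indicator {0..} t \<partial>lborel)"
  proof (rule nn_integral_SUP_atLeastAtMost)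
    show "incseq (\<lambda>n. (real n)\<^sup>2 / 2)" by (auto simp: incseq_def intro!: divide_right_mono power_mono)
    fix x :: real
    obtain n where n: "2 * \<bar>x\<bar> + 1 \<le> real n" using real_arch_simple by blast
    then have "1 * real n \<le> real n * real n" by (intro mult_right_mono) auto
    then show "\<exists>n. x \<le> (real n)\<^sup>2 / 2"
      using n by (intro exI[of _ n]) (simp add: power2_eq_square)
  qed simp
  also have "\<dots> = (\<integral>\<^sup>+t. f (2 * t) \<partial>gamma_law (1 / 2))"
    by (subst nn_integral_gamma_law) (auto simp: F_def indicator_def intro!: nn_integral_cong)
  finally show ?thesis .
qed

lemma nn_integral_chi_squared_law:
  fixes f :: "real \<Rightarrow> ennreal"
  assumes "1 \<le> d" and "f \<in> borel_measurable borel"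
  shows "(\<integral>\<^sup>+q. f q \<partial>chi_squared_law d) = (\<integral>\<^sup>+t. f (2 * t) \<partial>gamma_law (real d / 2))"
  using assms
proof (induction d arbitrary: f rule: nat_induct_at_least)
  case base
  note [measurable] = base
  interpret N: product_sigma_finite "\<lambda>_::nat. std_normal"
    by (intro product_sigma_finite_prob prob_space_std_normal)
  have "(\<integral>\<^sup>+q. f q \<partial>chi_squared_law 1) = (\<integral>\<^sup>+z. f (\<Sum>i<1. (z i)\<^sup>2) \<partial>(\<Pi>\<^sub>M i\<in>{..<1::nat}. std_normal))"
    unfolding chi_squared_law_def by (subst nn_integral_distr) auto
  also have "\<dots> = (\<integral>\<^sup>+z. f ((z 0)\<^sup>2) \<partial>(\<Pi>\<^sub>M i\<in>{0::nat}. std_normal))"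
    by (simp add: lessThan_Suc)
  also have "\<dots> = (\<integral>\<^sup>+z. f (z\<^sup>2) \<partial>std_normal)"
    by (rule N.product_nn_integral_singleton) measurable
  finally show ?case by (simp add: nn_integral_std_normal_square)
next
  case (Suc d)
  note [measurable] = Suc.prems
  interpret N: product_sigma_finite "\<lambda>_::nat. std_normal"
    by (intro product_sigma_finite_prob prob_space_std_normal)
  interpret G: prob_space "gamma_law (1 / 2)" by (rule prob_space_gamma_law) simp
  have ins: "{..<Suc d} = insert d {..<d}" by auto
  have "(\<integral>\<^sup>+q. f q \<partial>chi_squared_law (Suc d)) = (\<integral>\<^sup>+z. f (\<Sum>i<Suc d. (z i)\<^sup>2) \<partial>(\<Pi>\<^sub>M i\<in>{..<Suc d}. std_normal))"
    unfolding chi_squared_law_def by (subst nn_integral_distr) auto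
  also have "\<dots> = (\<integral>\<^sup>+z. \<integral>\<^sup>+w. f ((\<Sum>i<d. (z i)\<^sup>2) + w\<^sup>2) \<partial>std_normal \<partial>(\<Pi>\<^sub>M i\<in>{..<d}. std_normal))"
    unfolding ins by (subst N.product_nn_integral_insert)
      (auto intro!: nn_integral_cong arg_cong[of _ _ f] sum.cong simp: add.commute)
  also have "\<dots> = (\<integral>\<^sup>+z. \<integral>\<^sup>+t. f ((\<Sum>i<d. (z i)\<^sup>2) + 2 * t) \<partial>gamma_law (1 / 2) \<partial>(\<Pi>\<^sub>M i\<in>{..<d}. std_normal))"
    using nn_integral_std_normal_square[of "\<lambda>w. f (s + w)" for s] by simp
  also have "\<dots> = (\<integral>\<^sup>+q. \<integral>\<^sup>+t. f (q + 2 * t) \<partial>gamma_law (1 / 2) \<partial>chi_squared_law d)"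
    unfolding chi_squared_law_def by (subst nn_integral_distr) auto
  also have "\<dots> = (\<integral>\<^sup>+s. \<integral>\<^sup>+t. f (2 * s + 2 * t) \<partial>gamma_law (1 / 2) \<partial>gamma_law (real d / 2))"
    by (rule Suc.IH) measurable
  also have "\<dots> = (\<integral>\<^sup>+s. f (2 * s) \<partial>gamma_law (real d / 2 + 1 / 2))"
    using Suc.hyps nn_integral_gamma_sum[of "real d / 2" "1 / 2" "\<lambda>s. f (2 * s)"] by (simp add: algebra_simps)
  finally show ?case by (simp add: add_divide_distrib algebra_simps)
qed

section \<open>Products of mixtures and the Dirichlet decomposition\<close>

text \<open>Collects the mixing variables of all coordinates in one outer integral, so that a result
  for fixed scales can be applied inside. In the induction, Fubini moves the mixing variable of the
  new coordinate past the inner variables of the old ones.\<close>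

lemma nn_integral_PiM_mixture:
  assumes "finite I" and A: "\<And>i. prob_space (A i)" and B: "\<And>i. prob_space (B i)" and P: "\<And>i. prob_space (P i)"
    and \<phi>: "\<And>i. i \<in> I \<Longrightarrow> (\<lambda>(a, b). \<phi> i a b) \<in> A i \<Otimes>\<^sub>M B i \<rightarrow>\<^sub>M P i"
    and mix: "\<And>i f. i \<in> I \<Longrightarrow> f \<in> borel_measurable (P i) \<Longrightarrow>
      (\<integral>\<^sup>+x. f x \<partial>P i) = (\<integral>\<^sup>+a. \<integral>\<^sup>+b. f (\<phi> i a b) \<partial>B i \<partial>A i)"
    and "f \<in> borel_measurable (Pi\<^sub>M I P)"
  shows "(\<integral>\<^sup>+x. f x \<partial>Pi\<^sub>M I P) = (\<integral>\<^sup>+a. \<integral>\<^sup>+b. f (\<lambda>i\<in>I. \<phi> i (a i) (b i)) \<partial>Pi\<^sub>M I B \<partial>Pi\<^sub>M I A)"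
  using assms(1,5,6,7)
proof (induction I arbitrary: f rule: finite_induct)
  case empty
  then show ?case by (simp add: PiM_empty restrict_def nn_integral_count_space_finite)
next
  case (insert i I)
  note m = insert.prems(3)
  interpret A: product_sigma_finite A by (rule product_sigma_finite_prob[OF A])
  interpret B: product_sigma_finite B by (rule product_sigma_finite_prob[OF B])
  interpret P: product_sigma_finite P by (rule product_sigma_finite_prob[OF P])
  note sA = prob_space_imp_sigma_finite[OF A, of i]
  note sB = prob_space_imp_sigma_finite[OF B, of i]
  have sBI: "sigma_finite_measure (Pi\<^sub>M I B)"
    by (intro prob_space_imp_sigma_finite prob_space_PiM B)
  have sBiI: "sigma_finite_measure (Pi\<^sub>M (insert i I) B)"
    by (intro prob_space_imp_sigma_finite prob_space_PiM B)
  have \<phi>m: "(\<lambda>x. \<phi> j (u x) (v x)) \<in> N \<rightarrow>\<^sub>M P j"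
    if "j \<in> insert i I" "u \<in> N \<rightarrow>\<^sub>M A j" "v \<in> N \<rightarrow>\<^sub>M B j" for j u v and N :: "'z measure"
    using measurable_compose[OF measurable_Pair[OF that(2,3)] insert.prems(1)[OF that(1)]] by simp
  let ?c = "\<lambda>J a b. \<lambda>j\<in>J. \<phi> j (a j) (b j)"
  have upd: "?c (insert i I) (a(i := u)) (b(i := v)) = (?c I a b)(i := \<phi> i u v)" for a b u v
    using insert.hyps(2) by (auto simp: restrict_def fun_eq_iff)
  have m0: "(\<lambda>(x, y). f (x(i := y))) \<in> borel_measurable (Pi\<^sub>M I P \<Otimes>\<^sub>M P i)"
    using measurable_compose[OF measurable_add_dim m] by (simp only: case_prod_unfold fst_conv snd_conv)
  have m1: "(\<lambda>x. f ((?c I (fst (fst x)) (snd (fst x)))(i := \<phi> i (fst (snd x)) (snd (snd x))))) \<in>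
      borel_measurable ((Pi\<^sub>M I A \<Otimes>\<^sub>M Pi\<^sub>M I B) \<Otimes>\<^sub>M (A i \<Otimes>\<^sub>M B i))"
    (is "?F \<in> _")
  proof -
    have "(\<lambda>x. (?c I (fst (fst x)) (snd (fst x)), \<phi> i (fst (snd x)) (snd (snd x)))) \<in>
      ((Pi\<^sub>M I A \<Otimes>\<^sub>M Pi\<^sub>M I B) \<Otimes>\<^sub>M (A i \<Otimes>\<^sub>M B i)) \<rightarrow>\<^sub>M Pi\<^sub>M I P \<Otimes>\<^sub>M P i"
      by (intro measurable_Pair measurable_restrict \<phi>m) auto
    from measurable_compose[OF this m0] show ?thesis by simp
  qed
  have "(\<integral>\<^sup>+x. f x \<partial>Pi\<^sub>M (insert i I) P) = (\<integral>\<^sup>+x. \<integral>\<^sup>+y. f (x(i := y)) \<partial>P i \<partial>Pi\<^sub>M I P)"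
    by (rule P.product_nn_integral_insert[OF insert.hyps(1,2) m])
  also have "\<dots> = (\<integral>\<^sup>+x. \<integral>\<^sup>+u. \<integral>\<^sup>+v. f (x(i := \<phi> i u v)) \<partial>B i \<partial>A i \<partial>Pi\<^sub>M I P)"
  proof (rule nn_integral_cong)
    fix x assume x: "x \<in> space (Pi\<^sub>M I P)"
    have "(\<lambda>y. f (x(i := y))) \<in> borel_measurable (P i)"
      using measurable_compose[OF measurable_Pair1'[OF x] m0] by simp
    then show "(\<integral>\<^sup>+y. f (x(i := y)) \<partial>P i) = (\<integral>\<^sup>+u. \<integral>\<^sup>+v. f (x(i := \<phi> i u v)) \<partial>B i \<partial>A i)"
      by (intro insert.prems(2)) simp
  qed
  also have "\<dots> = (\<integral>\<^sup>+a. \<integral>\<^sup>+b. \<integral>\<^sup>+u. \<integral>\<^sup>+v. f ((?c I a b)(i := \<phi> i u v)) \<partial>B i \<partial>A i \<partial>Pi\<^sub>M I B \<partial>Pi\<^sub>M I A)"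
  proof (rule insert.IH)
    have "(\<lambda>x. f ((fst (fst x))(i := \<phi> i (snd (fst x)) (snd x)))) \<in> borel_measurable ((Pi\<^sub>M I P \<Otimes>\<^sub>M A i) \<Otimes>\<^sub>M B i)"
    proof -
      have "(\<lambda>x. (fst (fst x), \<phi> i (snd (fst x)) (snd x))) \<in> ((Pi\<^sub>M I P \<Otimes>\<^sub>M A i) \<Otimes>\<^sub>M B i) \<rightarrow>\<^sub>M Pi\<^sub>M I P \<Otimes>\<^sub>M P i"
        by (intro measurable_Pair \<phi>m) auto
      from measurable_compose[OF this m0] show ?thesis by simp
    qed
    then have "(\<lambda>x. \<integral>\<^sup>+v. f ((fst x)(i := \<phi> i (snd x) v)) \<partial>B i) \<in> borel_measurable (Pi\<^sub>M I P \<Otimes>\<^sub>M A i)"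
      by (intro sigma_finite_measure.borel_measurable_nn_integral[OF sB]) (simp only: case_prod_unfold fst_conv snd_conv)
    then show "(\<lambda>x. \<integral>\<^sup>+u. \<integral>\<^sup>+v. f (x(i := \<phi> i u v)) \<partial>B i \<partial>A i) \<in> borel_measurable (Pi\<^sub>M I P)"
      by (intro sigma_finite_measure.borel_measurable_nn_integral[OF sA]) (simp only: case_prod_unfold fst_conv snd_conv)
  qed (use insert.prems in auto)
  also have "\<dots> = (\<integral>\<^sup>+a. \<integral>\<^sup>+u. \<integral>\<^sup>+b. \<integral>\<^sup>+v. f ((?c I a b)(i := \<phi> i u v)) \<partial>B i \<partial>Pi\<^sub>M I B \<partial>A i \<partial>Pi\<^sub>M I A)"
  proof (rule nn_integral_cong)
    fix a assume a: "a \<in> space (Pi\<^sub>M I A)"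
    have "(\<lambda>x. ((a, snd (fst x)), (fst (fst x), snd x))) \<in> ((A i \<Otimes>\<^sub>M Pi\<^sub>M I B) \<Otimes>\<^sub>M B i) \<rightarrow>\<^sub>M ((Pi\<^sub>M I A \<Otimes>\<^sub>M Pi\<^sub>M I B) \<Otimes>\<^sub>M (A i \<Otimes>\<^sub>M B i))"
      using a by (intro measurable_Pair) auto
    from measurable_compose[OF this m1]
    have mm: "(\<lambda>(u, b). \<integral>\<^sup>+v. f ((?c I a b)(i := \<phi> i u v)) \<partial>B i) \<in> borel_measurable (A i \<Otimes>\<^sub>M Pi\<^sub>M I B)"
      unfolding case_prod_beta by (intro sigma_finite_measure.borel_measurable_nn_integral[OF sB]) (simp only: case_prod_unfold fst_conv snd_conv)
    show "(\<integral>\<^sup>+b. \<integral>\<^sup>+u. \<integral>\<^sup>+v. f ((?c I a b)(i := \<phi> i u v)) \<partial>B i \<partial>A i \<partial>Pi\<^sub>M I B) =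
        (\<integral>\<^sup>+u. \<integral>\<^sup>+b. \<integral>\<^sup>+v. f ((?c I a b)(i := \<phi> i u v)) \<partial>B i \<partial>Pi\<^sub>M I B \<partial>A i)"
      by (rule pair_sigma_finite.Fubini'[OF pair_sigma_finite.intro mm])
        (rule sA sBI)+
  qed
  also have "\<dots> = (\<integral>\<^sup>+a. \<integral>\<^sup>+u. \<integral>\<^sup>+b. f (?c (insert i I) (a(i := u)) b) \<partial>Pi\<^sub>M (insert i I) B \<partial>A i \<partial>Pi\<^sub>M I A)"
  proof (intro nn_integral_cong)
    fix a u assume a: "a \<in> space (Pi\<^sub>M I A)" and u: "u \<in> space (A i)"
    have "(\<lambda>b. ?c (insert i I) (a(i := u)) b) \<in> Pi\<^sub>M (insert i I) B \<rightarrow>\<^sub>M Pi\<^sub>M (insert i I) P"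
    proof (intro measurable_restrict \<phi>m)
      fix j assume j: "j \<in> insert i I"
      have "(a(i := u)) j \<in> space (A j)" using a u j by (auto simp: space_PiM PiE_iff)
      then show "(\<lambda>b. (a(i := u)) j) \<in> Pi\<^sub>M (insert i I) B \<rightarrow>\<^sub>M A j" by simp
    qed auto
    from measurable_compose[OF this m]
    show "(\<integral>\<^sup>+b. \<integral>\<^sup>+v. f ((?c I a b)(i := \<phi> i u v)) \<partial>B i \<partial>Pi\<^sub>M I B) =
        (\<integral>\<^sup>+b. f (?c (insert i I) (a(i := u)) b) \<partial>Pi\<^sub>M (insert i I) B)"
      unfolding upd[symmetric] by (rule B.product_nn_integral_insert[symmetric, OF insert.hyps(1,2)])
  qed
  also have "\<dots> = (\<integral>\<^sup>+a. \<integral>\<^sup>+b. f (?c (insert i I) a b) \<partial>Pi\<^sub>M (insert i I) B \<partial>Pi\<^sub>M (insert i I) A)"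
  proof (rule A.product_nn_integral_insert[symmetric, OF insert.hyps(1,2)])
    have "(\<lambda>x. ?c (insert i I) (fst x) (snd x)) \<in> (Pi\<^sub>M (insert i I) A \<Otimes>\<^sub>M Pi\<^sub>M (insert i I) B) \<rightarrow>\<^sub>M Pi\<^sub>M (insert i I) P"
      by (intro measurable_restrict \<phi>m) auto
    from measurable_compose[OF this m]
    show "(\<lambda>a. \<integral>\<^sup>+b. f (?c (insert i I) a b) \<partial>Pi\<^sub>M (insert i I) B) \<in> borel_measurable (Pi\<^sub>M (insert i I) A)"
      by (intro sigma_finite_measure.borel_measurable_nn_integral[OF sBiI]) (simp only: case_prod_unfold fst_conv snd_conv)
  qed
  finally show ?case .
qed

text \<open>The sum T of independent Gamma variables of equal shape is independent of the
  proportions h / T, so the product is T^r times an independent variable. Its law \<kappa>, that of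
  the product of Dirichlet coordinates, is only shown to exist: it enters both sides of the beta
  prime identity in the same way.\<close>

lemma dirichlet_decomposition:
  assumes \<alpha>: "0 < \<alpha>" and r: "1 \<le> r"
  shows "\<exists>\<kappa>. prob_space \<kappa> \<and> sets \<kappa> = sets (borel :: real measure) \<and>
    (\<forall>F :: real \<Rightarrow> real \<Rightarrow> ennreal. (\<lambda>(x, y). F x y) \<in> borel_measurable (borel \<Otimes>\<^sub>M borel) \<longrightarrow>
      (\<integral>\<^sup>+h. F (\<Sum>i\<in>{1..r}. h i) (\<Prod>i\<in>{1..r}. h i) \<partial>(\<Pi>\<^sub>M i\<in>{1..r}. gamma_law \<alpha>)) =
      (\<integral>\<^sup>+T. \<integral>\<^sup>+q. F T (T ^ r * q) \<partial>\<kappa> \<partial>gamma_law (real r * \<alpha>)))"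
  using r
proof (induction r rule: nat_induct_at_least)
  case base
  interpret P: product_sigma_finite "\<lambda>_::nat. gamma_law \<alpha>"
    by (intro product_sigma_finite_prob prob_space_gamma_law \<alpha>)
  have "prob_space (return borel (1::real))" by (rule prob_space_return) simp
  moreover have "(\<integral>\<^sup>+h. F (\<Sum>i\<in>{1..1}. h i) (\<Prod>i\<in>{1..1}. h i) \<partial>(\<Pi>\<^sub>M i\<in>{1..1::nat}. gamma_law \<alpha>)) =
      (\<integral>\<^sup>+T. \<integral>\<^sup>+q. F T (T ^ 1 * q) \<partial>return borel 1 \<partial>gamma_law (real 1 * \<alpha>))"
    if [measurable]: "(\<lambda>(x, y). F x y) \<in> borel_measurable (borel \<Otimes>\<^sub>M borel)" for F :: "real \<Rightarrow> real \<Rightarrow> ennreal"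
    using P.product_nn_integral_singleton[of "\<lambda>h. F h h" 1] by (simp add: nn_integral_return)
  ultimately show ?case by (intro exI[of _ "return borel 1"]) simp
next
  case (Suc r)
  then obtain \<kappa> where \<kappa>: "prob_space \<kappa>" "sets \<kappa> = sets (borel :: real measure)"
    "\<And>F :: real \<Rightarrow> real \<Rightarrow> ennreal. (\<lambda>(x, y). F x y) \<in> borel_measurable (borel \<Otimes>\<^sub>M borel) \<Longrightarrow>
      (\<integral>\<^sup>+h. F (\<Sum>i\<in>{1..r}. h i) (\<Prod>i\<in>{1..r}. h i) \<partial>(\<Pi>\<^sub>M i\<in>{1..r}. gamma_law \<alpha>)) =
      (\<integral>\<^sup>+T. \<integral>\<^sup>+q. F T (T ^ r * q) \<partial>\<kappa> \<partial>gamma_law (real r * \<alpha>))" by blast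
  note [measurable_cong] = \<kappa>(2)
  have r\<alpha>: "0 < real r * \<alpha>" using Suc.hyps \<alpha> by simp
  interpret K: prob_space \<kappa> by fact
  interpret G: prob_space "gamma_law \<alpha>" by (rule prob_space_gamma_law[OF \<alpha>])
  interpret Gr: prob_space "gamma_law (real r * \<alpha>)" by (rule prob_space_gamma_law[OF r\<alpha>])
  interpret BP: prob_space "beta_prime_law \<alpha> (real r * \<alpha>)" by (rule prob_space_beta_prime_law[OF \<alpha> r\<alpha>])
  interpret P: product_sigma_finite "\<lambda>_::nat. gamma_law \<alpha>"
    by (intro product_sigma_finite_prob prob_space_gamma_law \<alpha>)
  interpret BPK: pair_prob_space "beta_prime_law \<alpha> (real r * \<alpha>)" \<kappa> ..
  \<comment> \<open>For a new variable x and the old sum T, put s = x + T and v = x / T. Then T = s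
    / (1 + v) and x = v T, so x T^r q = s^(r + 1) (1 / (1 + v))^(r + 1) v q.\<close>
  let ?g = "\<lambda>(v, q). (1 / (1 + v)) ^ Suc r * v * q :: real"
  define \<kappa>' where "\<kappa>' = distr (beta_prime_law \<alpha> (real r * \<alpha>) \<Otimes>\<^sub>M \<kappa>) borel ?g"
  have "prob_space \<kappa>'" unfolding \<kappa>'_def by (rule BPK.prob_space_distr) measurable
  moreover have "sets \<kappa>' = sets borel" by (simp add: \<kappa>'_def)
  moreover have "(\<integral>\<^sup>+h. F (\<Sum>i\<in>{1..Suc r}. h i) (\<Prod>i\<in>{1..Suc r}. h i) \<partial>(\<Pi>\<^sub>M i\<in>{1..Suc r}. gamma_law \<alpha>)) =
      (\<integral>\<^sup>+T. \<integral>\<^sup>+q. F T (T ^ Suc r * q) \<partial>\<kappa>' \<partial>gamma_law (real (Suc r) * \<alpha>))"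
    if [measurable]: "(\<lambda>(x, y). F x y) \<in> borel_measurable (borel \<Otimes>\<^sub>M borel)" for F :: "real \<Rightarrow> real \<Rightarrow> ennreal"
  proof -
    have ins: "{1..Suc r} = insert (Suc r) {1..r}" by auto
    have "(\<integral>\<^sup>+h. F (\<Sum>i\<in>{1..Suc r}. h i) (\<Prod>i\<in>{1..Suc r}. h i) \<partial>(\<Pi>\<^sub>M i\<in>{1..Suc r}. gamma_law \<alpha>)) =
        (\<integral>\<^sup>+x. \<integral>\<^sup>+h. F (x + (\<Sum>i\<in>{1..r}. h i)) (x * (\<Prod>i\<in>{1..r}. h i)) \<partial>(\<Pi>\<^sub>M i\<in>{1..r}. gamma_law \<alpha>) \<partial>gamma_law \<alpha>)"
    proof -
      have "(\<integral>\<^sup>+h. F (\<Sum>i\<in>insert (Suc r) {1..r}. h i) (\<Prod>i\<in>insert (Suc r) {1..r}. h i) \<partial>(\<Pi>\<^sub>M i\<in>insert (Suc r) {1..r}. gamma_law \<alpha>)) =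
        (\<integral>\<^sup>+x. \<integral>\<^sup>+h. F (\<Sum>i\<in>insert (Suc r) {1..r}. (h(Suc r := x)) i) (\<Prod>i\<in>insert (Suc r) {1..r}. (h(Suc r := x)) i) \<partial>(\<Pi>\<^sub>M i\<in>{1..r}. gamma_law \<alpha>) \<partial>gamma_law \<alpha>)"
        by (rule P.product_nn_integral_insert_rev) (simp, simp, measurable)
      also have "\<dots> = (\<integral>\<^sup>+x. \<integral>\<^sup>+h. F (x + (\<Sum>i\<in>{1..r}. h i)) (x * (\<Prod>i\<in>{1..r}. h i)) \<partial>(\<Pi>\<^sub>M i\<in>{1..r}. gamma_law \<alpha>) \<partial>gamma_law \<alpha>)"
        by (intro nn_integral_cong) (auto intro!: arg_cong2[where f=F] sum.cong prod.cong)
      finally show ?thesis by (simp only: ins)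
    qed
    also have "\<dots> = (\<integral>\<^sup>+x. \<integral>\<^sup>+T. \<integral>\<^sup>+q. F (x + T) (x * (T ^ r * q)) \<partial>\<kappa> \<partial>gamma_law (real r * \<alpha>) \<partial>gamma_law \<alpha>)"
      using \<kappa>(3)[of "\<lambda>T q. F (x + T) (x * q)" for x] by simp
    also have "\<dots> = (\<integral>\<^sup>+x. \<integral>\<^sup>+T. \<integral>\<^sup>+q. F (x + T) ((x + T) ^ Suc r * ((1 / (1 + x / T)) ^ Suc r * (x / T) * q)) \<partial>\<kappa> \<partial>gamma_law (real r * \<alpha>) \<partial>gamma_law \<alpha>)"
    proof (intro nn_integral_gamma_law_cong nn_integral_cong)
      fix x T q :: real assume "0 < x" "0 < T"
      then have "(x + T) * (1 / (1 + x / T)) = T" by (simp add: field_simps)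
      then have "(x + T) ^ Suc r * ((1 / (1 + x / T)) ^ Suc r * (x / T) * q) = T ^ Suc r * (x / T) * q"
        by (simp only: mult.assoc[symmetric] power_mult_distrib[symmetric])
      also have "\<dots> = x * (T ^ r * q)" using \<open>0 < T\<close> by simp
      finally show "F (x + T) (x * (T ^ r * q)) = F (x + T) ((x + T) ^ Suc r * ((1 / (1 + x / T)) ^ Suc r * (x / T) * q))"
        by simp
    qed
    also have "\<dots> = (\<integral>\<^sup>+s. \<integral>\<^sup>+v. \<integral>\<^sup>+q. F s (s ^ Suc r * ((1 / (1 + v)) ^ Suc r * v * q)) \<partial>\<kappa> \<partial>beta_prime_law \<alpha> (real r * \<alpha>) \<partial>gamma_law (\<alpha> + real r * \<alpha>))"
      by (rule nn_integral_gamma_sum_ratio[OF \<alpha> r\<alpha>, of "\<lambda>s v. \<integral>\<^sup>+q. F s (s ^ Suc r * ((1 / (1 + v)) ^ Suc r * v * q)) \<partial>\<kappa>"]) measurable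
    also have "\<dots> = (\<integral>\<^sup>+T. \<integral>\<^sup>+q. F T (T ^ Suc r * q) \<partial>\<kappa>' \<partial>gamma_law (real (Suc r) * \<alpha>))"
    proof -
      have "(\<integral>\<^sup>+q. F s (s ^ Suc r * q) \<partial>\<kappa>') = (\<integral>\<^sup>+v. \<integral>\<^sup>+q. F s (s ^ Suc r * ((1 / (1 + v)) ^ Suc r * v * q)) \<partial>\<kappa> \<partial>beta_prime_law \<alpha> (real r * \<alpha>))" for s
        unfolding \<kappa>'_def by (subst nn_integral_distr, measurable, subst K.nn_integral_fst[symmetric]) (auto simp: mult_ac)
      moreover have "\<alpha> + real r * \<alpha> = real (Suc r) * \<alpha>" by (simp add: algebra_simps)
      ultimately show ?thesis by simp
    qed
    finally show ?thesis .
  qed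
  ultimately show ?case by blast
qed

section \<open>The models as Gaussian mixtures\<close>

lemma nn_integral_lborel_scale:
  fixes f :: "'a::euclidean_space \<Rightarrow> ennreal"
  assumes [measurable]: "f \<in> borel_measurable borel" and c: "0 < c"
  shows "(\<integral>\<^sup>+x. f x \<partial>lborel) = ennreal (c ^ DIM('a)) * (\<integral>\<^sup>+x. f (c *\<^sub>R x) \<partial>lborel)"
proof -
  have "(\<integral>\<^sup>+x. f x \<partial>lborel) = (\<integral>\<^sup>+x. f x \<partial>density (distr lborel borel (\<lambda>x. 0 + c *\<^sub>R x)) (\<lambda>_. ennreal (\<bar>c\<bar> ^ DIM('a))))"
    using lborel_affine[of c "0::'a"] c by simp
  also have "\<dots> = ennreal (c ^ DIM('a)) * (\<integral>\<^sup>+x. f (c *\<^sub>R x) \<partial>lborel)"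
    using c by (simp add: nn_integral_density nn_integral_distr nn_integral_cmult)
  finally show ?thesis .
qed

lemma sets_beta_prime_model [simp, measurable_cong]: "sets (beta_prime_model \<nu>) = sets borel"
  and sets_beta_model [simp, measurable_cong]: "sets (beta_model \<nu>) = sets borel"
  and sets_spherical_model [simp, measurable_cong]: "sets spherical_model = sets borel"
  by (simp_all add: beta_prime_model_def beta_model_def spherical_model_def)

text \<open>Positivity of n keeps the case h = 0 true: \<open>0 ^ 0\<close> is 1, whereas
  \<open>0 powr 0\<close> is 0.\<close>

lemma sqrt_powr:
  fixes h :: real
  assumes "0 < n" "0 \<le> h"
  shows "sqrt h ^ n = h powr (real n / 2)"
proof (cases "h = 0")
  case False
  then have h: "0 < h" using assms by simp
  have "sqrt h ^ n = sqrt h powr real n" using h by (subst powr_realpow) simp_all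
  also have "\<dots> = (h powr (1 / 2)) powr real n" using h by (simp only: powr_half_sqrt[OF less_imp_le])
  also have "\<dots> = h powr (real n / 2)" by (simp add: powr_powr)
  finally show ?thesis .
qed (use assms in simp)

text \<open>The multivariate t representation. For fixed x, the scaled Gaussian density times the
  Gamma density in h is a multiple of h^((n + \<nu>) / 2 - 1) exp(-(1 + |x|^2) h), and its integral
  produces the power of 1 + |x|^2.\<close>

lemma nn_integral_beta_prime_model:
  fixes f :: "real ^ 'n \<Rightarrow> ennreal"
  assumes \<nu>: "0 < \<nu>" and [measurable]: "f \<in> borel_measurable borel"
  shows "(\<integral>\<^sup>+x. f x \<partial>beta_prime_model \<nu>) =
    (\<integral>\<^sup>+h. \<integral>\<^sup>+z. f ((1 / sqrt (2 * h)) *\<^sub>R z) \<partial>gaussian_model \<partial>gamma_law (\<nu> / 2))"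
proof -
  let ?n = "CARD('n)"
  define ga where "ga t = ennreal (indicator {0<..} t * (t powr (\<nu> / 2 - 1) * exp (- t) / Gamma (\<nu> / 2)))" for t :: real
  have [measurable]: "ga \<in> borel_measurable borel" unfolding ga_def[abs_def] by measurable
  have G: "0 < Gamma (\<nu> / 2)" using \<nu> by (intro Gamma_real_pos) simp
  let ?s = "(real ?n + \<nu>) / 2"
  have inner: "(\<integral>\<^sup>+z. f ((1 / sqrt (2 * h)) *\<^sub>R z) \<partial>gaussian_model) =
      (\<integral>\<^sup>+x. ennreal (sqrt (2 * h) ^ ?n) * gauss_density (sqrt (2 * h) *\<^sub>R x) * f x \<partial>lborel)" if h: "0 < h" for h :: real
  proof -
    have "(\<integral>\<^sup>+z. f ((1 / sqrt (2 * h)) *\<^sub>R z) \<partial>gaussian_model) =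
        (\<integral>\<^sup>+z. gauss_density z * f ((1 / sqrt (2 * h)) *\<^sub>R z) \<partial>lborel)"
      unfolding gaussian_model_eq by (simp add: nn_integral_density)
    also have "\<dots> = ennreal (sqrt (2 * h) ^ DIM(real ^ 'n)) *
        (\<integral>\<^sup>+x. gauss_density (sqrt (2 * h) *\<^sub>R x) * f ((1 / sqrt (2 * h)) *\<^sub>R (sqrt (2 * h) *\<^sub>R x)) \<partial>lborel)"
      using h by (intro nn_integral_lborel_scale) auto
    also have "\<dots> = (\<integral>\<^sup>+x. ennreal (sqrt (2 * h) ^ ?n) * gauss_density (sqrt (2 * h) *\<^sub>R x) * f x \<partial>lborel)"
      using h by (subst nn_integral_cmult[symmetric]) (auto simp: mult_ac)
    finally show ?thesis .
  qed
  have "(\<integral>\<^sup>+h. \<integral>\<^sup>+z. f ((1 / sqrt (2 * h)) *\<^sub>R z) \<partial>gaussian_model \<partial>gamma_law (\<nu> / 2)) =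
      (\<integral>\<^sup>+h. \<integral>\<^sup>+x. ennreal (sqrt (2 * h) ^ ?n) * gauss_density (sqrt (2 * h) *\<^sub>R x) * f x \<partial>lborel \<partial>gamma_law (\<nu> / 2))"
    by (rule nn_integral_gamma_law_cong[OF inner])
  also have "\<dots> = (\<integral>\<^sup>+h. \<integral>\<^sup>+x. ga h * (ennreal (sqrt (2 * h) ^ ?n) * gauss_density (sqrt (2 * h) *\<^sub>R x) * f x) \<partial>lborel \<partial>lborel)"
    by (subst nn_integral_gamma_law, measurable) (simp only: ga_def[symmetric], simp add: nn_integral_cmult)
  also have "\<dots> = (\<integral>\<^sup>+x. \<integral>\<^sup>+h. ga h * (ennreal (sqrt (2 * h) ^ ?n) * gauss_density (sqrt (2 * h) *\<^sub>R x) * f x) \<partial>lborel \<partial>lborel)"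
    by (rule lborel_pair.Fubini') simp
  also have "\<dots> = (\<integral>\<^sup>+x. ennreal (pi powr (- real ?n / 2) * (Gamma ?s / Gamma (\<nu> / 2)) * (1 + (norm x)\<^sup>2) powr (- (real ?n + \<nu>) / 2)) * f x \<partial>lborel)"
  proof (rule nn_integral_cong)
    fix x :: "real ^ 'n"
    let ?c = "1 + (norm x)\<^sup>2"
    have c: "0 < ?c" by (simp add: add_pos_nonneg)
    let ?K = "pi powr (- real ?n / 2) / Gamma (\<nu> / 2)"
    have eq: "ga h * (ennreal (sqrt (2 * h) ^ ?n) * gauss_density (sqrt (2 * h) *\<^sub>R x) * f x) =
        ennreal ?K * ennreal (indicator {0<..} h * (h powr (?s - 1) * exp (- (?c * h)))) * f x" for h
    proof (cases "0 < h")
      case True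
      have 1: "sqrt (2 * h) ^ ?n * (2 * pi) powr (- real ?n / 2) = h powr (real ?n / 2) * pi powr (- real ?n / 2)"
      proof -
        have "sqrt (2 * h) ^ ?n * (2 * pi) powr (- real ?n / 2) =
            (2 powr (real ?n / 2) * 2 powr (- real ?n / 2)) * (h powr (real ?n / 2) * pi powr (- real ?n / 2))"
        proof -
          have "sqrt (2 * h) ^ ?n = 2 powr (real ?n / 2) * h powr (real ?n / 2)"
            using True sqrt_powr[OF zero_less_card_finite, of "2 * h"] by (simp add: powr_mult)
          moreover have "(2 * pi) powr (- real ?n / 2) = 2 powr (- real ?n / 2) * pi powr (- real ?n / 2)"
            by (rule powr_mult)
          ultimately show ?thesis by (simp only: mult_ac)
        qed
        also have "(2::real) powr (real ?n / 2) * 2 powr (- real ?n / 2) = 1"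
          by (simp flip: powr_add)
        finally show ?thesis by simp
      qed
      define v where "v = sqrt (2 * h) *\<^sub>R x"
      have 2: "(norm (v))\<^sup>2 / 2 = h * (norm x)\<^sup>2"
        using True by (simp add: v_def power_mult_distrib)
      have "h powr (\<nu> / 2 - 1) * exp (- h) / Gamma (\<nu> / 2) * (sqrt (2 * h) ^ ?n * ((2 * pi) powr (- real ?n / 2) * exp (- (norm (v))\<^sup>2 / 2)))
        = (sqrt (2 * h) ^ ?n * (2 * pi) powr (- real ?n / 2)) * h powr (\<nu> / 2 - 1) * (exp (- h) * exp (- ((norm (v))\<^sup>2 / 2))) / Gamma (\<nu> / 2)"
        by (simp add: mult_ac)
      also have "\<dots> = ?K * ((h powr (real ?n / 2) * h powr (\<nu> / 2 - 1)) * (exp (- h) * exp (- (h * (norm x)\<^sup>2))))"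
        unfolding 1 2 by (simp add: mult_ac)
      also have "h powr (real ?n / 2) * h powr (\<nu> / 2 - 1) = h powr (?s - 1)"
        unfolding powr_add[symmetric] by (simp add: add_divide_distrib add_diff_eq)
      also have "exp (- h) * exp (- (h * (norm x)\<^sup>2)) = exp (- (?c * h))"
        unfolding mult_exp_exp by (simp add: algebra_simps)
      finally have 3: "h powr (\<nu> / 2 - 1) * exp (- h) / Gamma (\<nu> / 2) * (sqrt (2 * h) ^ ?n * ((2 * pi) powr (- real ?n / 2) * exp (- (norm (v))\<^sup>2 / 2)))
        = ?K * (h powr (?s - 1) * exp (- (?c * h)))" .
      have ge: "0 \<le> h powr (\<nu> / 2 - 1) * exp (- h) / Gamma (\<nu> / 2)" "0 \<le> sqrt (2 * h) ^ ?n" "0 \<le> ?K" using G True by simp_all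
      have "ga h * (ennreal (sqrt (2 * h) ^ ?n) * gauss_density (v)) =
        ennreal (h powr (\<nu> / 2 - 1) * exp (- h) / Gamma (\<nu> / 2) * (sqrt (2 * h) ^ ?n * ((2 * pi) powr (- real ?n / 2) * exp (- (norm (v))\<^sup>2 / 2))))"
        unfolding ennreal_mult'[OF ge(1)] ennreal_mult'[OF ge(2)] gauss_density_def using True by (simp add: ga_def)
      also have "\<dots> = ennreal ?K * ennreal (indicator {0<..} h * (h powr (?s - 1) * exp (- (?c * h))))"
        unfolding 3 ennreal_mult'[OF ge(3)] using True by simp
      finally show ?thesis by (simp only: mult.assoc[symmetric] v_def)
    qed (simp add: ga_def)
    have "(\<integral>\<^sup>+h. ga h * (ennreal (sqrt (2 * h) ^ ?n) * gauss_density (sqrt (2 * h) *\<^sub>R x) * f x) \<partial>lborel) =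
        ennreal ?K * ennreal (Gamma ?s / ?c powr ?s) * f x"
    proof -
      have s: "0 < ?s" using \<nu> by (simp add: add_nonneg_pos)
      show ?thesis
        unfolding eq
        by (subst nn_integral_multc, simp, subst nn_integral_cmult, simp, subst nn_integral_powr_exp[OF s c]) (rule refl)
    qed
    also have "ennreal ?K * ennreal (Gamma ?s / ?c powr ?s) = ennreal (pi powr (- real ?n / 2) * (Gamma ?s / Gamma (\<nu> / 2)) * ?c powr (- (real ?n + \<nu>) / 2))"
    proof -
      have "?c powr (- (real ?n + \<nu>) / 2) = 1 / ?c powr ?s" by (simp only: minus_divide_left[symmetric] powr_minus_divide)
      then have "pi powr (- real ?n / 2) * (Gamma ?s / Gamma (\<nu> / 2)) * ?c powr (- (real ?n + \<nu>) / 2) = ?K * (Gamma ?s / ?c powr ?s)"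
        by simp
      moreover have "0 \<le> ?K" using G by simp
      ultimately show ?thesis by (simp only: ennreal_mult')
    qed
    finally show "(\<integral>\<^sup>+h. ga h * (ennreal (sqrt (2 * h) ^ ?n) * gauss_density (sqrt (2 * h) *\<^sub>R x) * f x) \<partial>lborel) =
       ennreal (pi powr (- real ?n / 2) * (Gamma ?s / Gamma (\<nu> / 2)) * ?c powr (- (real ?n + \<nu>) / 2)) * f x" .
  qed
  also have "\<dots> = (\<integral>\<^sup>+x. f x \<partial>beta_prime_model \<nu>)"
    unfolding beta_prime_model_def by (simp add: nn_integral_density)
  finally show ?thesis by simp
qed

lemma prob_space_beta_prime_model:
  assumes "0 < \<nu>" shows "prob_space (beta_prime_model \<nu> :: (real ^ 'n) measure)"
proof (rule prob_spaceI)
  interpret G: prob_space "gaussian_model :: (real ^ 'n) measure" by (rule prob_space_gaussian_model)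
  interpret H: prob_space "gamma_law (\<nu> / 2)" by (rule prob_space_gamma_law) (use assms in simp)
  show "emeasure (beta_prime_model \<nu> :: (real ^ 'n) measure) (space (beta_prime_model \<nu>)) = 1"
    using nn_integral_beta_prime_model[OF assms, of "\<lambda>_::real^'n. 1"] G.emeasure_space_1 H.emeasure_space_1 by simp
qed

text \<open>If \<open>X\<close> has law \<open>P\<close> and \<open>R\<^sup>2 / 2\<close> is an independent variable with the Gamma distribution of
  shape \<open>a\<close>, then \<open>R *\<^sub>R X\<close> is standard Gaussian.\<close>

definition gaussian_radial :: "real \<Rightarrow> (real ^ 'n) measure \<Rightarrow> bool" where
  "gaussian_radial a P \<longleftrightarrow> 0 < a \<and> prob_space P \<and> sets P = sets borel \<and> (AE x in P. norm x \<le> 1) \<and>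
    (\<forall>f \<in> borel_measurable borel. (\<integral>\<^sup>+z. f z \<partial>gaussian_model) =
      (\<integral>\<^sup>+\<rho>. \<integral>\<^sup>+x. f (sqrt (2 * \<rho>) *\<^sub>R x) \<partial>P \<partial>gamma_law a))"

text \<open>For fixed y the beta density restricts \<rho> to \<rho> > s with s = |y|^2 / 2. The
  shape (n + \<nu>) / 2 is the one for which the powers of \<rho> combine to (\<rho> - s)^(\<nu> / 2
  - 1), so a shifted Gamma integral leaves the factor exp(-s).\<close>

lemma nn_integral_gaussian_beta_model:
  fixes f :: "real ^ 'n \<Rightarrow> ennreal"
  assumes \<nu>: "0 < \<nu>" and [measurable]: "f \<in> borel_measurable borel"
  shows "(\<integral>\<^sup>+z. f z \<partial>gaussian_model) =
    (\<integral>\<^sup>+\<rho>. \<integral>\<^sup>+x. f (sqrt (2 * \<rho>) *\<^sub>R x) \<partial>beta_model \<nu> \<partial>gamma_law ((real CARD('n) + \<nu>) / 2))"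
proof -
  let ?n = "CARD('n)"
  let ?a = "(real ?n + \<nu>) / 2"
  define ga where "ga t = ennreal (indicator {0<..} t * (t powr (?a - 1) * exp (- t) / Gamma ?a))" for t :: real
  have [measurable]: "ga \<in> borel_measurable borel" unfolding ga_def[abs_def] by measurable
  define be where "be x = ennreal (indicator {x. norm x < 1} x * (pi powr (- real ?n / 2) * (Gamma ?a / Gamma (\<nu> / 2)) *
        (1 - (norm x)\<^sup>2) powr ((\<nu> - 2) / 2)))" for x :: "real ^ 'n"
  have [measurable]: "be \<in> borel_measurable borel" unfolding be_def[abs_def] by measurable
  have G: "0 < Gamma (\<nu> / 2)" "0 < Gamma ?a" using \<nu> by (auto intro!: Gamma_real_pos add_nonneg_pos divide_pos_pos)
  have bm: "beta_model \<nu> = density lborel be" by (simp add: beta_model_def be_def[abs_def])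
  have inner: "(\<integral>\<^sup>+x. f (sqrt (2 * \<rho>) *\<^sub>R x) \<partial>beta_model \<nu>) =
      (\<integral>\<^sup>+y. ennreal ((1 / sqrt (2 * \<rho>)) ^ ?n) * be ((1 / sqrt (2 * \<rho>)) *\<^sub>R y) * f y \<partial>lborel)" if \<rho>: "0 < \<rho>" for \<rho> :: real
  proof -
    have "(\<integral>\<^sup>+x. f (sqrt (2 * \<rho>) *\<^sub>R x) \<partial>beta_model \<nu>) = (\<integral>\<^sup>+x. be x * f (sqrt (2 * \<rho>) *\<^sub>R x) \<partial>lborel)"
      unfolding bm by (simp add: nn_integral_density)
    also have "\<dots> = ennreal ((1 / sqrt (2 * \<rho>)) ^ DIM(real ^ 'n)) *
        (\<integral>\<^sup>+y. be ((1 / sqrt (2 * \<rho>)) *\<^sub>R y) * f (sqrt (2 * \<rho>) *\<^sub>R ((1 / sqrt (2 * \<rho>)) *\<^sub>R y)) \<partial>lborel)"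
      using \<rho> by (intro nn_integral_lborel_scale) auto
    also have "\<dots> = (\<integral>\<^sup>+y. ennreal ((1 / sqrt (2 * \<rho>)) ^ ?n) * be ((1 / sqrt (2 * \<rho>)) *\<^sub>R y) * f y \<partial>lborel)"
      using \<rho> by (subst nn_integral_cmult[symmetric]) (auto simp: mult_ac)
    finally show ?thesis .
  qed
  have "(\<integral>\<^sup>+\<rho>. \<integral>\<^sup>+x. f (sqrt (2 * \<rho>) *\<^sub>R x) \<partial>beta_model \<nu> \<partial>gamma_law ?a) =
      (\<integral>\<^sup>+\<rho>. \<integral>\<^sup>+y. ennreal ((1 / sqrt (2 * \<rho>)) ^ ?n) * be ((1 / sqrt (2 * \<rho>)) *\<^sub>R y) * f y \<partial>lborel \<partial>gamma_law ?a)"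
    by (rule nn_integral_gamma_law_cong[OF inner])
  also have "\<dots> = (\<integral>\<^sup>+\<rho>. \<integral>\<^sup>+y. ga \<rho> * (ennreal ((1 / sqrt (2 * \<rho>)) ^ ?n) * be ((1 / sqrt (2 * \<rho>)) *\<^sub>R y) * f y) \<partial>lborel \<partial>lborel)"
    by (subst nn_integral_gamma_law, measurable) (simp only: ga_def[symmetric], simp add: nn_integral_cmult)
  also have "\<dots> = (\<integral>\<^sup>+y. \<integral>\<^sup>+\<rho>. ga \<rho> * (ennreal ((1 / sqrt (2 * \<rho>)) ^ ?n) * be ((1 / sqrt (2 * \<rho>)) *\<^sub>R y) * f y) \<partial>lborel \<partial>lborel)"
    by (rule lborel_pair.Fubini') simp
  also have "\<dots> = (\<integral>\<^sup>+y. gauss_density y * f y \<partial>lborel)"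
  proof (rule nn_integral_cong)
    fix y :: "real ^ 'n"
    define s where "s = (norm y)\<^sup>2 / 2"
    have s: "0 \<le> s" by (simp add: s_def)
    let ?K = "(2 * pi) powr (- real ?n / 2) / Gamma (\<nu> / 2)"
    have eq: "ga \<rho> * (ennreal ((1 / sqrt (2 * \<rho>)) ^ ?n) * be ((1 / sqrt (2 * \<rho>)) *\<^sub>R y) * f y) =
        ennreal (?K * exp (- s)) * ennreal (indicator {0<..} (\<rho> - s) * ((\<rho> - s) powr (\<nu> / 2 - 1) * exp (- (1 * (\<rho> - s))))) * f y" for \<rho>
    proof (cases "s < \<rho>")
      case True
      then have \<rho>: "0 < \<rho>" using s by simp
      define u where "u = (1 / sqrt (2 * \<rho>)) *\<^sub>R y"
      have nrm: "(norm u)\<^sup>2 = s / \<rho>"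
        using \<rho> by (simp add: u_def s_def power_mult_distrib power_divide)
      then have lt: "norm u < 1"
        using True \<rho> by (metis abs_norm_cancel abs_square_less_1 divide_less_eq_1_pos)
      have 1: "(1 / sqrt (2 * \<rho>)) ^ ?n * pi powr (- real ?n / 2) = (2 * pi) powr (- real ?n / 2) * \<rho> powr (- real ?n / 2)"
      proof -
        have "(1 / sqrt (2 * \<rho>)) ^ ?n = (2 * \<rho>) powr (- real ?n / 2)"
          using \<rho> by (simp only: power_one_over sqrt_powr[OF zero_less_card_finite, of "2 * \<rho>"] minus_divide_left[symmetric] powr_minus_divide)
        then show ?thesis using \<rho> by (simp add: powr_mult mult_ac)
      qed
      have 2: "\<rho> powr (?a - 1) * \<rho> powr (- real ?n / 2) * (1 - s / \<rho>) powr ((\<nu> - 2) / 2) = (\<rho> - s) powr (\<nu> / 2 - 1)"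
      proof -
        have "\<rho> powr (?a - 1) * \<rho> powr (- real ?n / 2) = \<rho> powr (\<nu> / 2 - 1)"
          by (simp add: powr_add[symmetric] add_divide_distrib)
        moreover have "\<rho> powr (\<nu> / 2 - 1) * (1 - s / \<rho>) powr (\<nu> / 2 - 1) = (\<rho> * (1 - s / \<rho>)) powr (\<nu> / 2 - 1)"
          using True \<rho> by (subst powr_mult) (auto simp: field_simps)
        moreover have "\<rho> * (1 - s / \<rho>) = \<rho> - s" using \<rho> by (simp add: field_simps)
        moreover have "(\<nu> - 2) / 2 = \<nu> / 2 - 1" by simp
        ultimately show ?thesis by (simp only:)
      qed
      have 3: "exp (- \<rho>) = exp (- s) * exp (- (1 * (\<rho> - s)))" by (simp add: exp_add[symmetric])
      have "\<rho> powr (?a - 1) * exp (- \<rho>) / Gamma ?a * ((1 / sqrt (2 * \<rho>)) ^ ?n * (pi powr (- real ?n / 2) * (Gamma ?a / Gamma (\<nu> / 2)) * (1 - s / \<rho>) powr ((\<nu> - 2) / 2))) =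
          ((1 / sqrt (2 * \<rho>)) ^ ?n * pi powr (- real ?n / 2)) * \<rho> powr (?a - 1) * (1 - s / \<rho>) powr ((\<nu> - 2) / 2) * exp (- \<rho>) / Gamma (\<nu> / 2)"
        using G by (simp add: field_simps)
      also have "\<dots> = ?K * exp (- s) * ((\<rho> powr (?a - 1) * \<rho> powr (- real ?n / 2) * (1 - s / \<rho>) powr ((\<nu> - 2) / 2)) * exp (- (1 * (\<rho> - s))))"
        unfolding 1 3 by (simp add: mult_ac)
      also have "\<dots> = ?K * exp (- s) * ((\<rho> - s) powr (\<nu> / 2 - 1) * exp (- (1 * (\<rho> - s))))"
        unfolding 2 ..
      finally have 4: "\<rho> powr (?a - 1) * exp (- \<rho>) / Gamma ?a * ((1 / sqrt (2 * \<rho>)) ^ ?n * (pi powr (- real ?n / 2) * (Gamma ?a / Gamma (\<nu> / 2)) * (1 - s / \<rho>) powr ((\<nu> - 2) / 2))) = \<dots>" .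
      have ge: "0 \<le> \<rho> powr (?a - 1) * exp (- \<rho>) / Gamma ?a" "0 \<le> (1 / sqrt (2 * \<rho>)) ^ ?n" "0 \<le> ?K * exp (- s)" using G \<rho> by simp_all
      have "ga \<rho> * (ennreal ((1 / sqrt (2 * \<rho>)) ^ ?n) * be u) =
        ennreal (\<rho> powr (?a - 1) * exp (- \<rho>) / Gamma ?a * ((1 / sqrt (2 * \<rho>)) ^ ?n * (pi powr (- real ?n / 2) * (Gamma ?a / Gamma (\<nu> / 2)) * (1 - s / \<rho>) powr ((\<nu> - 2) / 2))))"
        unfolding ennreal_mult'[OF ge(1)] ennreal_mult'[OF ge(2)] using \<rho> lt by (simp add: ga_def be_def nrm)
      also have "\<dots> = ennreal (?K * exp (- s)) * ennreal (indicator {0<..} (\<rho> - s) * ((\<rho> - s) powr (\<nu> / 2 - 1) * exp (- (1 * (\<rho> - s)))))"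
        unfolding 4 ennreal_mult'[OF ge(3)] using True by simp
      finally show ?thesis by (simp only: mult.assoc[symmetric] u_def)
    next
      case False
      have "ga \<rho> * be ((1 / sqrt (2 * \<rho>)) *\<^sub>R y) = 0"
      proof (cases "0 < \<rho>")
        case True
        have "(norm ((1 / sqrt (2 * \<rho>)) *\<^sub>R y))\<^sup>2 = s / \<rho>"
          using True by (simp add: s_def power_mult_distrib power_divide)
        then have "\<not> norm ((1 / sqrt (2 * \<rho>)) *\<^sub>R y) < 1"
          using True False by (metis abs_norm_cancel abs_square_less_1 divide_less_eq_1_pos)
        then show ?thesis by (simp add: be_def)
      qed (simp add: ga_def)
      then have "ga \<rho> * (ennreal ((1 / sqrt (2 * \<rho>)) ^ ?n) * be ((1 / sqrt (2 * \<rho>)) *\<^sub>R y) * f y) = 0"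
        by (auto simp: mult_eq_0_iff)
      then show ?thesis using False by simp
    qed
    have tr: "(\<integral>\<^sup>+\<rho>. ennreal (indicator {0<..} (\<rho> - s) * ((\<rho> - s) powr (\<nu> / 2 - 1) * exp (- (1 * (\<rho> - s))))) \<partial>lborel) =
        ennreal (Gamma (\<nu> / 2))"
      using nn_integral_lborel_translate[of "\<lambda>t. ennreal (indicator {0<..} t * (t powr (\<nu> / 2 - 1) * exp (- (1 * t))))" "- s"]
        nn_integral_powr_exp[of "\<nu> / 2" 1] \<nu> by simp
    have "(\<integral>\<^sup>+\<rho>. ga \<rho> * (ennreal ((1 / sqrt (2 * \<rho>)) ^ ?n) * be ((1 / sqrt (2 * \<rho>)) *\<^sub>R y) * f y) \<partial>lborel) =
        ennreal (?K * exp (- s)) * ennreal (Gamma (\<nu> / 2)) * f y"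
      unfolding eq by (subst nn_integral_multc, simp, subst nn_integral_cmult, simp, subst tr) simp
    also have "ennreal (?K * exp (- s)) * ennreal (Gamma (\<nu> / 2)) = gauss_density y"
      using G by (simp add: ennreal_mult'[symmetric] gauss_density_def s_def)
    finally show "(\<integral>\<^sup>+\<rho>. ga \<rho> * (ennreal ((1 / sqrt (2 * \<rho>)) ^ ?n) * be ((1 / sqrt (2 * \<rho>)) *\<^sub>R y) * f y) \<partial>lborel) = gauss_density y * f y" .
  qed
  also have "\<dots> = (\<integral>\<^sup>+z. f z \<partial>gaussian_model)"
    unfolding gaussian_model_eq by (simp add: nn_integral_density)
  finally show ?thesis by simp
qed

lemma gaussian_radial_beta_model:
  assumes \<nu>: "0 < \<nu>"
  shows "gaussian_radial ((real CARD('n) + \<nu>) / 2) (beta_model \<nu> :: (real ^ 'n) measure)"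
proof -
  let ?a = "(real CARD('n) + \<nu>) / 2" and ?P = "beta_model \<nu> :: (real ^ 'n) measure"
  have a: "0 < ?a" using \<nu> by (simp add: add_nonneg_pos)
  interpret G: prob_space "gaussian_model :: (real ^ 'n) measure" by (rule prob_space_gaussian_model)
  interpret H: prob_space "gamma_law ?a" by (rule prob_space_gamma_law[OF a])
  \<comment> \<open>The decomposition with integrand 1 shows that the beta density is
    normalised.\<close>
  have eq: "(\<integral>\<^sup>+z. 1 \<partial>(gaussian_model :: (real ^ 'n) measure)) = (\<integral>\<^sup>+\<rho>. \<integral>\<^sup>+x. 1 \<partial>?P \<partial>gamma_law ?a)"
    by (rule nn_integral_gaussian_beta_model[OF \<nu>]) measurable
  have P: "prob_space ?P"
  proof (rule prob_spaceI)
    show "emeasure ?P (space ?P) = 1"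
      using eq G.emeasure_space_1 H.emeasure_space_1 by simp
  qed
  have ae: "AE x in ?P. norm x \<le> 1"
    unfolding beta_model_def by (subst AE_density, measurable) (simp add: indicator_def)
  show ?thesis
    unfolding gaussian_radial_def
  proof (intro conjI ballI)
    fix f :: "real ^ 'n \<Rightarrow> ennreal" assume "f \<in> borel_measurable borel"
    then show "(\<integral>\<^sup>+z. f z \<partial>gaussian_model) = (\<integral>\<^sup>+\<rho>. \<integral>\<^sup>+x. f (sqrt (2 * \<rho>) *\<^sub>R x) \<partial>?P \<partial>gamma_law ?a)"
      by (rule nn_integral_gaussian_beta_model[OF \<nu>])
  qed (rule a P ae sets_beta_model)+
qed

section \<open>The spherical model through the unit ball\<close>

abbreviation "unit_ball_law \<equiv> uniform_measure lborel (ball (0 :: real ^ 'n) 1)"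

lemma emeasure_unit_ball: "emeasure lborel (ball (0 :: real ^ 'n) 1) \<noteq> 0" "emeasure lborel (ball (0 :: real ^ 'n) 1) \<noteq> \<infinity>"
  using emeasure_lborel_ball_finite[of "0 :: real ^ 'n" 1] content_ball_pos[of 1 "0 :: real ^ 'n"]
  by (auto simp: measure_def)

lemma prob_space_unit_ball_law: "prob_space (unit_ball_law :: (real ^ 'n) measure)"
  by (intro prob_space_uniform_measure emeasure_unit_ball)

text \<open>For \<nu> = 2 the exponent vanishes and the density is constant on the ball; the
  constant is identified by total mass 1, without a formula for the volume of the ball. The Gaussian
  decomposition thereby becomes available for uniform points of the ball.\<close>

lemma beta_model_2: "beta_model 2 = (unit_ball_law :: (real ^ 'n) measure)"
proof -
  interpret prob_space "beta_model 2 :: (real ^ 'n) measure"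
    using gaussian_radial_beta_model[of 2, where 'n='n] by (simp add: gaussian_radial_def)
  define c where "c = pi powr (- real CARD('n) / 2) * (Gamma ((real CARD('n) + 2) / 2) / Gamma (2 / 2))"
  have b: "beta_model 2 = density lborel (\<lambda>x :: real ^ 'n. ennreal c * indicator (ball 0 1) x)"
    unfolding beta_model_def
  proof (intro arg_cong2[where f=density] refl ext)
    fix x :: "real ^ 'n"
    have "(norm x)\<^sup>2 < 1" if "norm x < 1"
      using that abs_square_less_1[of "norm x"] by simp
    then show "ennreal (indicator {x. norm x < 1} x * (pi powr (- real CARD('n) / 2) *
        (Gamma ((real CARD('n) + 2) / 2) / Gamma (2 / 2)) * (1 - (norm x)\<^sup>2) powr ((2 - 2) / 2))) =
        ennreal c * indicator (ball 0 1) x"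
      by (cases "norm x < 1") (simp_all add: c_def)
  qed
  have "1 = emeasure (beta_model 2) (UNIV :: (real ^ 'n) set)"
    using emeasure_space_1 by (simp add: beta_model_def)
  also have "\<dots> = ennreal c * emeasure lborel (ball (0 :: real ^ 'n) 1)"
  proof -
    have m: "(\<lambda>x :: real ^ 'n. ennreal c * indicator (ball 0 1) x) \<in> borel_measurable lborel"
      by (intro borel_measurable_times_ennreal borel_measurable_const borel_measurable_indicator) simp
    have "emeasure (density lborel (\<lambda>x :: real ^ 'n. ennreal c * indicator (ball 0 1) x)) UNIV =
        (\<integral>\<^sup>+x. ennreal c * indicator (ball (0 :: real ^ 'n) 1) x \<partial>lborel)"
      by (subst emeasure_density[OF m]) simp_all
    also have "\<dots> = ennreal c * emeasure lborel (ball (0 :: real ^ 'n) 1)"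
      by (rule nn_integral_cmult_indicator) simp
    finally show ?thesis unfolding b .
  qed
  finally have "ennreal c = 1 / emeasure lborel (ball (0 :: real ^ 'n) 1)"
    using emeasure_unit_ball[where 'n='n] by (metis ennreal_mult_divide_eq infinity_ennreal_def)
  then show ?thesis
    unfolding b uniform_measure_def by (simp add: ennreal_times_divide mult.commute)
qed

lemma emeasure_cone_scale:
  fixes B :: "(real ^ 'n) set"
  assumes [measurable]: "B \<in> sets borel" and t: "0 < t"
  shows "emeasure lborel {u. norm u < t \<and> u /\<^sub>R norm u \<in> B} = ennreal (t ^ CARD('n)) * emeasure lborel {u. norm u < 1 \<and> u /\<^sub>R norm u \<in> B}"
proof -
  have m: "{u. norm u < s \<and> u /\<^sub>R norm u \<in> B} \<in> sets borel" for s :: real by measurable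
  have "emeasure lborel {u. norm u < t \<and> u /\<^sub>R norm u \<in> B} = (\<integral>\<^sup>+x. indicator {u. norm u < t \<and> u /\<^sub>R norm u \<in> B} x \<partial>lborel)"
    using m by simp
  also have "\<dots> = ennreal (t ^ DIM(real ^ 'n)) * (\<integral>\<^sup>+x. indicator {u. norm u < t \<and> u /\<^sub>R norm u \<in> B} (t *\<^sub>R x) \<partial>lborel)"
    by (rule nn_integral_lborel_scale[OF _ t]) (rule borel_measurable_indicator[OF m])
  also have "(\<lambda>x. indicator {u. norm u < t \<and> u /\<^sub>R norm u \<in> B} (t *\<^sub>R x)) = (indicator {u. norm u < 1 \<and> u /\<^sub>R norm u \<in> B} :: real ^ 'n \<Rightarrow> ennreal)"
  proof
    fix x :: "real ^ 'n"
    have "(t *\<^sub>R x) /\<^sub>R norm (t *\<^sub>R x) = x /\<^sub>R norm x"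
      using t by (cases "x = 0") simp_all
    moreover have "norm (t *\<^sub>R x) < t \<longleftrightarrow> norm x < 1" using t by simp
    ultimately show "indicator {u. norm u < t \<and> u /\<^sub>R norm u \<in> B} (t *\<^sub>R x) =
        (indicator {u. norm u < 1 \<and> u /\<^sub>R norm u \<in> B} x :: ennreal)"
      by (simp only: indicator_def mem_Collect_eq)
  qed
  finally show ?thesis using m by simp
qed

text \<open>By homogeneity, for 0 < t \<le> 1 the points of norm below t carry the fraction t^n of
  the mass of the cone over any set of directions. The fraction does not depend on the set, so norm
  and direction are independent.\<close>

lemma unit_ball_radius_direction:
  fixes B :: "(real ^ 'n) set"
  assumes [measurable]: "B \<in> sets borel"
  shows "emeasure unit_ball_law {u. norm u < t \<and> u /\<^sub>R norm u \<in> B} =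
    emeasure unit_ball_law {u :: real ^ 'n. norm u < t} * emeasure unit_ball_law {u. u /\<^sub>R norm u \<in> B}"
proof -
  let ?U = "unit_ball_law :: (real ^ 'n) measure"
  interpret prob_space ?U by (rule prob_space_unit_ball_law)
  have key: "emeasure ?U {u. norm u < t \<and> u /\<^sub>R norm u \<in> C} = (if t \<le> 0 then 0 else if t \<le> 1 then ennreal (t ^ CARD('n)) else 1) * emeasure ?U {u. u /\<^sub>R norm u \<in> C}"
    if C[measurable]: "C \<in> sets borel" for C :: "(real ^ 'n) set"
  proof -
    have e: "emeasure ?U A = emeasure lborel (ball 0 1 \<inter> A) / emeasure lborel (ball (0 :: real ^ 'n) 1)" if "A \<in> sets borel" for A
      using that by (intro emeasure_uniform_measure) auto
    consider "t \<le> 0" | "0 < t" "t \<le> 1" | "1 < t" by linarith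
    then show ?thesis
    proof cases
      case 1
      then have "{u :: real ^ 'n. norm u < t \<and> u /\<^sub>R norm u \<in> C} = {}"
        by (auto simp: not_less intro: order_trans)
      then show ?thesis using 1 by (simp only: emeasure_empty if_True mult_zero_left)
    next
      case 2
      have 3: "ball 0 1 \<inter> {u. norm u < t \<and> u /\<^sub>R norm u \<in> C} = {u. norm u < t \<and> u /\<^sub>R norm u \<in> C}"
        "ball 0 1 \<inter> {u. u /\<^sub>R norm u \<in> C} = {u. norm u < 1 \<and> u /\<^sub>R norm u \<in> C}" using 2 by auto
      have "emeasure ?U {u. norm u < t \<and> u /\<^sub>R norm u \<in> C} = ennreal (t ^ CARD('n)) * emeasure lborel {u. norm u < 1 \<and> u /\<^sub>R norm u \<in> C} / emeasure lborel (ball (0 :: real ^ 'n) 1)"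
        by (subst e, measurable) (simp only: 3 emeasure_cone_scale[OF C 2(1)])
      also have "\<dots> = ennreal (t ^ CARD('n)) * emeasure ?U {u. u /\<^sub>R norm u \<in> C}"
        by (subst e, measurable) (simp only: 3 ennreal_times_divide)
      finally show ?thesis using 2 by simp
    next
      case 3
      have 4: "ball 0 1 \<inter> {u. norm u < t \<and> u /\<^sub>R norm u \<in> C} = ball 0 1 \<inter> {u. u /\<^sub>R norm u \<in> C}" using 3 by auto
      have "emeasure ?U {u. norm u < t \<and> u /\<^sub>R norm u \<in> C} = emeasure ?U {u. u /\<^sub>R norm u \<in> C}"
        by (subst (1 2) e, measurable) (simp only: 4)
      then show ?thesis using 3 by simp
    qed
  qed
  have "emeasure ?U {u. norm u < t} = (if t \<le> 0 then 0 else if t \<le> 1 then ennreal (t ^ CARD('n)) else 1)"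
    using key[of UNIV] emeasure_space_1 by simp
  then show ?thesis using key[OF assms] by simp
qed

text \<open>For a fixed set of directions, the joint measure \<open>?M1\<close> and the product
  measure \<open>?M2\<close> are finite measures of the radius that agree on half-lines. These form
  an intersection-stable generator, so the two agree on all Borel sets.\<close>

lemma unit_ball_polar:
  "distr (unit_ball_law :: (real ^ 'n) measure) borel norm \<Otimes>\<^sub>M (spherical_model :: (real ^ 'n) measure) =
    distr unit_ball_law (borel \<Otimes>\<^sub>M borel) (\<lambda>u. (norm u, u /\<^sub>R norm u))"
proof -
  let ?U = "unit_ball_law :: (real ^ 'n) measure" and ?S = "spherical_model :: (real ^ 'n) measure"
  interpret prob_space ?U by (rule prob_space_unit_ball_law)
  have mU: "measurable ?U N = measurable borel N" for N :: "'z measure"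
    by (intro measurable_cong_sets) auto
  interpret N: prob_space "distr ?U borel norm"
    by (rule prob_space_distr) (simp add: mU)
  interpret S: prob_space "spherical_model :: (real ^ 'n) measure"
    unfolding spherical_model_def by (rule prob_space_distr) (simp add: mU)
  show ?thesis
  proof (rule pair_measure_eqI)
    fix A :: "real set" and B :: "(real ^ 'n) set"
    assume "A \<in> sets (distr ?U borel norm)" and "B \<in> sets spherical_model"
    then have A[measurable]: "A \<in> sets borel" and B[measurable]: "B \<in> sets borel" by simp_all
    define C where "C = {u :: real ^ 'n. u /\<^sub>R norm u \<in> B}"
    have [measurable]: "C \<in> sets borel" unfolding C_def by measurable
    let ?M1 = "distr (density ?U (indicator C)) borel norm"
    let ?M2 = "scale_measure (emeasure ?U C) (distr ?U borel norm)"
    have mD: "measurable (density ?U (indicator C)) N = measurable borel N" for N :: "'z measure"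
      by (intro measurable_cong_sets) auto
    have em1: "emeasure ?M1 X = emeasure ?U ({u. norm u \<in> X} \<inter> C)" if [measurable]: "X \<in> sets borel" for X
    proof -
      have "emeasure ?M1 X = emeasure (density ?U (indicator C)) {u. norm u \<in> X}"
        by (subst emeasure_distr) (auto simp: mD vimage_def)
      also have "\<dots> = (\<integral>\<^sup>+u. indicator C u * indicator {u. norm u \<in> X} u \<partial>?U)"
        by (intro emeasure_density) (auto simp: mU)
      also have "\<dots> = (\<integral>\<^sup>+u. indicator ({u. norm u \<in> X} \<inter> C) u \<partial>?U)"
        by (intro nn_integral_cong) (auto simp: indicator_def)
      also have "\<dots> = emeasure ?U ({u. norm u \<in> X} \<inter> C)" by (intro nn_integral_indicator) simp
      finally show ?thesis .
    qed
    have em2: "emeasure ?M2 X = emeasure ?U C * emeasure ?U {u. norm u \<in> X}" if [measurable]: "X \<in> sets borel" for X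
      by (simp add: emeasure_distr mU vimage_def)
    have "?M1 = ?M2"
    proof (rule measure_eqI_generator_eq[where E="range lessThan" and \<Omega>=UNIV and A="\<lambda>i. {..<real i}"])
      show "Int_stable (range lessThan :: real set set)"
      proof -
        have "{..<a} \<inter> {..<b} = {..<min a b}" for a b :: real by auto
        then show ?thesis by (auto simp: Int_stable_def)
      qed
      show "emeasure ?M1 X = emeasure ?M2 X" if "X \<in> range lessThan" for X
      proof -
        from that obtain t where X: "X = {..<t}" by (rule rangeE)
        have mX: "X \<in> sets borel" by (simp add: X)
        have X1: "{u :: real ^ 'n. norm u \<in> X} \<inter> C = {u. norm u < t \<and> u /\<^sub>R norm u \<in> B}"
          by (auto simp: X C_def)
        have X2: "{u :: real ^ 'n. norm u \<in> X} = {u. norm u < t}" by (simp add: X)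
        have "emeasure ?U {u. norm u < t \<and> u /\<^sub>R norm u \<in> B} = emeasure ?U {u. norm u < t} * emeasure ?U C"
          unfolding C_def by (rule unit_ball_radius_direction[OF B])
        then show ?thesis
          unfolding em1[OF mX] em2[OF mX] X1 unfolding X2 by (simp only: mult.commute)
      qed
      show "sets ?M1 = sigma_sets UNIV (range lessThan)" "sets ?M2 = sigma_sets UNIV (range lessThan)"
      proof -
        have "sets (borel :: real measure) = sigma_sets UNIV (range lessThan)"
          by (subst borel_Iio) simp
        then show "sets ?M1 = sigma_sets UNIV (range lessThan)" "sets ?M2 = sigma_sets UNIV (range lessThan)"
          by (simp_all only: sets_distr sets_scale_measure)
      qed
      show "(\<Union>i. {..<real i}) = UNIV"
      proof (intro set_eqI iffI UNIV_I)
        fix x :: real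
        obtain i where "x < real i" using reals_Archimedean2 by blast
        then show "x \<in> (\<Union>i. {..<real i})" by blast
      qed
      show "emeasure ?M1 {..<real i} \<noteq> \<infinity>" for i
      proof -
        have "{..<real i} \<in> sets borel" by simp
        from em1[OF this] show ?thesis unfolding infinity_ennreal_def by (simp only: emeasure_finite not_False_eq_True)
      qed
    qed (simp, blast)
    then have "emeasure ?M1 A = emeasure ?M2 A" by (rule arg_cong)
    then have 1: "emeasure ?U ({u. norm u \<in> A} \<inter> C) = emeasure ?U C * emeasure ?U {u. norm u \<in> A}"
      by (simp only: em1[OF A] em2[OF A])
    have "emeasure (distr ?U borel norm) A * emeasure spherical_model B = emeasure ?U {u. norm u \<in> A} * emeasure ?U C"
    proof -
      have "emeasure (distr ?U borel norm) A = emeasure ?U {u. norm u \<in> A}"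
        by (subst emeasure_distr) (simp_all add: mU vimage_def)
      moreover have "emeasure ?S B = emeasure ?U C"
        unfolding spherical_model_def C_def by (subst emeasure_distr) (simp_all add: mU vimage_def)
      ultimately show ?thesis by (simp only:)
    qed
    also have "\<dots> = emeasure ?U ({u. norm u \<in> A} \<inter> C)" using 1 by (simp add: mult.commute)
    also have "\<dots> = emeasure (distr ?U (borel \<Otimes>\<^sub>M borel) (\<lambda>u. (norm u, u /\<^sub>R norm u))) (A \<times> B)"
    proof -
      have "(\<lambda>u. (norm u, u /\<^sub>R norm u)) -` (A \<times> B) \<inter> space ?U = {u. norm u \<in> A} \<inter> C"
        by (auto simp: C_def)
      moreover have "A \<times> B \<in> sets (borel \<Otimes>\<^sub>M borel)" by simp
      ultimately show ?thesis by (subst emeasure_distr) (simp_all only: mU, measurable)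
    qed
    finally show "emeasure (distr ?U borel norm) A * emeasure spherical_model B =
      emeasure (distr ?U (borel \<Otimes>\<^sub>M borel) (\<lambda>u. (norm u, u /\<^sub>R norm u))) (A \<times> B)" .
  next
    show "sets (distr ?U borel norm \<Otimes>\<^sub>M (spherical_model :: (real ^ 'n) measure)) = sets (distr ?U (borel \<Otimes>\<^sub>M borel) (\<lambda>u. (norm u, u /\<^sub>R norm u)))"
    proof -
      have "sets (distr ?U borel norm) = sets borel" "sets ?S = sets borel"
        by (rule sets_distr) (rule sets_spherical_model)
      from sets_pair_measure_cong[OF this] show ?thesis by (simp only: sets_distr)
    qed
  qed (rule N.sigma_finite_measure_axioms S.sigma_finite_measure_axioms)+
qed

lemma prob_space_spherical_model: "prob_space (spherical_model :: (real ^ 'n) measure)"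
proof -
  interpret prob_space "unit_ball_law :: (real ^ 'n) measure" by (rule prob_space_unit_ball_law)
  show ?thesis unfolding spherical_model_def by (rule prob_space_distr) (simp add: measurable_cong_sets[of "unit_ball_law" borel])
qed

lemma gso_0: "gso y 0 = y 0"
  by (subst gso.simps) simp

text \<open>The first residual is the vector itself, so this is the chi-squared law of residuals
  with no previous vectors.\<close>

lemma nn_integral_gaussian_norm:
  fixes f :: "real \<Rightarrow> ennreal"
  assumes [measurable]: "f \<in> borel_measurable borel"
  shows "(\<integral>\<^sup>+z. f ((norm z)\<^sup>2) \<partial>(gaussian_model :: (real ^ 'n) measure)) = (\<integral>\<^sup>+t. f (2 * t) \<partial>gamma_law (real CARD('n) / 2))"
proof -
  have "(\<integral>\<^sup>+w. f ((norm (gso ((\<lambda>_. 0 :: real ^ 'n)(0 := w)) 0))\<^sup>2) \<partial>gaussian_model) = (\<integral>\<^sup>+q. f q \<partial>chi_squared_law (CARD('n) - 0))"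
    by (rule nn_integral_gso_gaussian) (auto simp: gramdet_def)
  also have "\<dots> = (\<integral>\<^sup>+t. f (2 * t) \<partial>gamma_law (real CARD('n) / 2))"
    using nn_integral_chi_squared_law[of "CARD('n)" f] by (simp add: Suc_leI)
  finally show ?thesis by (simp add: gso_0)
qed

text \<open>A Gaussian vector is a radius times a uniform point of the ball, and that point is its
  norm times an independent uniform direction. Radius and norm recombine to the norm of the Gaussian
  vector, whose square is chi-squared.\<close>

lemma gaussian_radial_spherical_model:
  "gaussian_radial (real CARD('n) / 2) (spherical_model :: (real ^ 'n) measure)"
proof -
  let ?U = "unit_ball_law :: (real ^ 'n) measure" and ?S = "spherical_model :: (real ^ 'n) measure"
  let ?G = "gaussian_model :: (real ^ 'n) measure"
  let ?c = "(real CARD('n) + 2) / 2"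
  interpret U: prob_space ?U by (rule prob_space_unit_ball_law)
  interpret S: prob_space ?S by (rule prob_space_spherical_model)
  have mU: "measurable ?U N = measurable borel N" for N :: "'z measure"
    by (intro measurable_cong_sets) auto
  have GU: "(\<integral>\<^sup>+z. f z \<partial>?G) = (\<integral>\<^sup>+\<rho>. \<integral>\<^sup>+u. f (sqrt (2 * \<rho>) *\<^sub>R u) \<partial>?U \<partial>gamma_law ?c)"
    if "f \<in> borel_measurable borel" for f :: "real ^ 'n \<Rightarrow> ennreal"
    using nn_integral_gaussian_beta_model[of 2 f] that by (simp add: beta_model_2)
  have polar: "(\<integral>\<^sup>+u. f (c *\<^sub>R u) \<partial>?U) = (\<integral>\<^sup>+u. \<integral>\<^sup>+x. f (norm (c *\<^sub>R u) *\<^sub>R x) \<partial>?S \<partial>?U)"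
    if [measurable]: "f \<in> borel_measurable borel" and c: "0 \<le> c" for f :: "real ^ 'n \<Rightarrow> ennreal" and c :: real
  proof -
    let ?h = "\<lambda>(s, x). f ((c * s) *\<^sub>R x) :: ennreal"
    have "(\<integral>\<^sup>+u. f (c *\<^sub>R u) \<partial>?U) = (\<integral>\<^sup>+u. ?h (norm u, u /\<^sub>R norm u) \<partial>?U)"
    proof (rule nn_integral_cong)
      fix u :: "real ^ 'n"
      have "(c * norm u) *\<^sub>R (u /\<^sub>R norm u) = c *\<^sub>R u" by (cases "u = 0") simp_all
      then show "f (c *\<^sub>R u) = ?h (norm u, u /\<^sub>R norm u)" by (simp only: prod.case)
    qed
    also have "\<dots> = (\<integral>\<^sup>+z. ?h z \<partial>distr ?U (borel \<Otimes>\<^sub>M borel) (\<lambda>u. (norm u, u /\<^sub>R norm u)))"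
      by (rule nn_integral_distr[symmetric]) (simp_all add: mU)
    also have "\<dots> = (\<integral>\<^sup>+z. ?h z \<partial>(distr ?U borel norm \<Otimes>\<^sub>M ?S))"
      by (simp only: unit_ball_polar)
    also have "\<dots> = (\<integral>\<^sup>+s. \<integral>\<^sup>+x. ?h (s, x) \<partial>?S \<partial>distr ?U borel norm)"
      by (rule S.nn_integral_fst[symmetric]) measurable
    also have "\<dots> = (\<integral>\<^sup>+u. \<integral>\<^sup>+x. ?h (norm u, x) \<partial>?S \<partial>?U)"
      by (rule nn_integral_distr) (simp_all add: mU)
    finally show ?thesis using c by simp
  qed
  have main: "(\<integral>\<^sup>+z. f z \<partial>?G) = (\<integral>\<^sup>+\<rho>. \<integral>\<^sup>+x. f (sqrt (2 * \<rho>) *\<^sub>R x) \<partial>?S \<partial>gamma_law (real CARD('n) / 2))"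
    if f: "f \<in> borel_measurable borel" for f :: "real ^ 'n \<Rightarrow> ennreal"
  proof -
    note [measurable] = f
    have "(\<integral>\<^sup>+z. f z \<partial>?G) = (\<integral>\<^sup>+\<rho>. \<integral>\<^sup>+u. f (sqrt (2 * \<rho>) *\<^sub>R u) \<partial>?U \<partial>gamma_law ?c)" by (rule GU) simp
    also have "\<dots> = (\<integral>\<^sup>+\<rho>. \<integral>\<^sup>+u. \<integral>\<^sup>+x. f (norm (sqrt (2 * \<rho>) *\<^sub>R u) *\<^sub>R x) \<partial>?S \<partial>?U \<partial>gamma_law ?c)"
      by (rule nn_integral_gamma_law_cong, rule polar[OF f]) simp
    also have "\<dots> = (\<integral>\<^sup>+z. \<integral>\<^sup>+x. f (norm z *\<^sub>R x) \<partial>?S \<partial>?G)"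
      by (rule GU[symmetric]) measurable
    also have "\<dots> = (\<integral>\<^sup>+z. \<integral>\<^sup>+x. f (sqrt ((norm z)\<^sup>2) *\<^sub>R x) \<partial>?S \<partial>?G)" by simp
    also have "\<dots> = (\<integral>\<^sup>+t. \<integral>\<^sup>+x. f (sqrt (2 * t) *\<^sub>R x) \<partial>?S \<partial>gamma_law (real CARD('n) / 2))"
      by (rule nn_integral_gaussian_norm[of "\<lambda>q. \<integral>\<^sup>+x. f (sqrt q *\<^sub>R x) \<partial>?S"]) measurable
    finally show ?thesis .
  qed
  have ae: "AE x in ?S. norm x \<le> 1"
  proof -
    have "norm (x /\<^sub>R norm x) \<le> 1" for x :: "real ^ 'n" by (cases "x = 0") simp_all
    then show ?thesis
      unfolding spherical_model_def by (subst AE_distr_iff) (simp_all add: mU del: norm_scaleR)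
  qed
  show ?thesis
    unfolding gaussian_radial_def
    by (intro conjI ballI main) (simp_all add: ae S.prob_space_axioms)
qed

section \<open>Moments of the squared volume in the beta and spherical models\<close>

lemma nn_integral_gamma_law_powr:
  assumes a: "0 < a" and s: "0 \<le> s"
  shows "(\<integral>\<^sup>+t. ennreal (t powr s) \<partial>gamma_law a) = ennreal (Gamma (a + s) / Gamma a)"
proof -
  have G: "0 < Gamma a" using a by (rule Gamma_real_pos)
  have "(\<integral>\<^sup>+t. ennreal (t powr s) \<partial>gamma_law a) =
      (\<integral>\<^sup>+t. ennreal (1 / Gamma a) * ennreal (indicator {0<..} t * (t powr (a + s - 1) * exp (- (1 * t)))) \<partial>lborel)"
  proof (subst nn_integral_gamma_law, simp, rule nn_integral_cong)
    fix t :: real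
    have "t powr (a - 1) * t powr s = t powr (a + s - 1)"
      by (simp add: powr_add[symmetric] algebra_simps)
    then have "(t powr (a - 1) * exp (- t) / Gamma a) * t powr s = 1 / Gamma a * (t powr (a + s - 1) * exp (- (1 * t)))"
      by (simp add: mult_ac)
    then show "ennreal (indicator {0<..} t * (t powr (a - 1) * exp (- t) / Gamma a)) * ennreal (t powr s) =
        ennreal (1 / Gamma a) * ennreal (indicator {0<..} t * (t powr (a + s - 1) * exp (- (1 * t))))"
      using G by (cases "0 < t") (simp_all add: ennreal_mult'[symmetric] ennreal_mult''[symmetric])
  qed
  also have "\<dots> = ennreal (1 / Gamma a) * ennreal (Gamma (a + s))"
    using a s by (subst nn_integral_cmult, simp, subst nn_integral_powr_exp) auto
  finally show ?thesis using G by (simp add: ennreal_mult'[symmetric])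
qed

lemma nn_integral_gamma_law_sqrt_power:
  assumes a: "0 < a"
  shows "(\<integral>\<^sup>+t. ennreal (sqrt t ^ m) \<partial>gamma_law a) = ennreal (Gamma (a + real m / 2) / Gamma a)"
proof -
  have "(\<integral>\<^sup>+t. ennreal (sqrt t ^ m) \<partial>gamma_law a) = (\<integral>\<^sup>+t. ennreal (t powr (real m / 2)) \<partial>gamma_law a)"
  proof (rule nn_integral_gamma_law_cong)
    fix t :: real assume "0 < t"
    then show "ennreal (sqrt t ^ m) = ennreal (t powr (real m / 2))"
      by (cases "m = 0") (simp_all add: sqrt_powr)
  qed
  then show ?thesis using nn_integral_gamma_law_powr[OF a, of "real m / 2"] by simp
qed

lemma gamma_law_sqrt_moment:
  assumes a: "0 < a"
  shows "integrable (gamma_law a) (\<lambda>t. sqrt t ^ m)" "(\<integral>t. sqrt t ^ m \<partial>gamma_law a) = Gamma (a + real m / 2) / Gamma a"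
proof -
  have ae: "AE t in gamma_law a. 0 \<le> sqrt t ^ m"
    using AE_gamma_law_pos[of a] by eventually_elim simp
  have G: "0 < Gamma a" "0 < Gamma (a + real m / 2)" using a by (auto intro!: Gamma_real_pos add_pos_nonneg)
  show "integrable (gamma_law a) (\<lambda>t. sqrt t ^ m)"
    by (rule integrableI_nonneg[OF _ ae]) (simp_all add: nn_integral_gamma_law_sqrt_power[OF a])
  show "(\<integral>t. sqrt t ^ m \<partial>gamma_law a) = Gamma (a + real m / 2) / Gamma a"
    by (subst integral_eq_nn_integral[OF _ ae]) (use G in \<open>simp_all add: nn_integral_gamma_law_sqrt_power[OF a]\<close>)
qed

text \<open>A nonzero polynomial has finitely many roots, so positive scales, the only ones covered
  by the Gaussian theorem, suffice.\<close>

lemma polyfun_eq_coeffs_pos: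
  fixes u v :: "nat \<Rightarrow> real"
  assumes "\<And>s. 0 < s \<Longrightarrow> (\<Sum>m\<le>N. u m * s ^ m) = (\<Sum>m\<le>N. v m * s ^ m)" and "m \<le> N"
  shows "u m = v m"
proof (rule ccontr)
  assume "u m \<noteq> v m"
  then have "u m - v m \<noteq> 0" by simp
  from polyfun_roots_finite[of "\<lambda>i. u i - v i" m N, OF this assms(2)]
  have fin: "finite {z. (\<Sum>i\<le>N. (u i - v i) * z ^ i) = 0}" .
  have "{0<..} \<subseteq> {z. (\<Sum>i\<le>N. (u i - v i) * z ^ i) = 0}"
    using assms(1) by (auto simp: left_diff_distrib sum_subtractf)
  then have "finite {0::real<..}" using fin by (rule finite_subset)
  then show False using infinite_Ioi by blast
qed

text \<open>With variance 1/2 per coordinate the squared radius is the Gamma variable itself, which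
  keeps powers of 2 out of the moment formulas.\<close>

definition half_gaussian :: "(real ^ 'n) measure" where
  "half_gaussian = distr gaussian_model borel (\<lambda>z. (1 / sqrt 2) *\<^sub>R z)"

lemma sets_half_gaussian [simp, measurable_cong]: "sets half_gaussian = sets borel"
  by (simp add: half_gaussian_def)

lemma prob_space_half_gaussian: "prob_space (half_gaussian :: (real ^ 'n) measure)"
  unfolding half_gaussian_def by (rule prob_space.prob_space_distr[OF prob_space_gaussian_model]) simp

lemma nn_integral_half_gaussian:
  fixes P :: "(real ^ 'n) measure"
  assumes gr: "gaussian_radial a P" and f[measurable]: "f \<in> borel_measurable borel"
  shows "(\<integral>\<^sup>+z. f z \<partial>half_gaussian) = (\<integral>\<^sup>+\<rho>. \<integral>\<^sup>+x. f (sqrt \<rho> *\<^sub>R x) \<partial>P \<partial>gamma_law a)"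
proof -
  have "(\<integral>\<^sup>+z. f z \<partial>half_gaussian) = (\<integral>\<^sup>+z. f ((1 / sqrt 2) *\<^sub>R z) \<partial>gaussian_model)"
    unfolding half_gaussian_def by (rule nn_integral_distr) simp_all
  also have "\<dots> = (\<integral>\<^sup>+\<rho>. \<integral>\<^sup>+x. f ((1 / sqrt 2) *\<^sub>R sqrt (2 * \<rho>) *\<^sub>R x) \<partial>P \<partial>gamma_law a)"
  proof -
    have "(\<lambda>z. f ((1 / sqrt 2) *\<^sub>R z)) \<in> borel_measurable borel" by measurable
    then show ?thesis using gr unfolding gaussian_radial_def by blast
  qed
  also have "\<dots> = (\<integral>\<^sup>+\<rho>. \<integral>\<^sup>+x. f (sqrt \<rho> *\<^sub>R x) \<partial>P \<partial>gamma_law a)"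
    by (simp add: real_sqrt_mult)
  finally show ?thesis .
qed

text \<open>Replacing a Gaussian coordinate \<open>R *\<^sub>R x\<close> by \<open>x\<close> divides the coefficient of each power of the
  scale \<open>s\<close> by the corresponding moment of \<open>R\<close>.\<close>

lemma radial_coefficient_step:
  fixes P :: "(real ^ 'n) measure" and g :: "'y \<Rightarrow> real ^ 'n \<Rightarrow> real" and c :: "nat \<Rightarrow> 'y \<Rightarrow> real ^ 'n \<Rightarrow> real"
  assumes gr: "gaussian_radial a P" and \<Omega>: "prob_space \<Omega>"
    and g[measurable]: "(\<lambda>(y, x). g y x) \<in> borel_measurable (\<Omega> \<Otimes>\<^sub>M borel)" and g0: "\<And>y x. 0 \<le> g y x"
    and c: "\<And>m. m \<le> N \<Longrightarrow> integrable (\<Omega> \<Otimes>\<^sub>M P) (\<lambda>(y, x). c m y x)"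
    and poly: "\<And>y x s. g y (s *\<^sub>R x) = (\<Sum>m\<le>N. c m y x * s ^ m)"
    and h: "\<And>s. 0 < s \<Longrightarrow> (\<integral>\<^sup>+y. \<integral>\<^sup>+z. ennreal (g y (s *\<^sub>R z)) \<partial>half_gaussian \<partial>\<Omega>) = ennreal (\<Sum>m\<le>N. h m * s ^ m)"
    and h0: "\<And>s. 0 < s \<Longrightarrow> 0 \<le> (\<Sum>m\<le>N. h m * s ^ m)"
  shows "(\<integral>\<^sup>+y. \<integral>\<^sup>+x. ennreal (g y x) \<partial>P \<partial>\<Omega>) = ennreal (\<Sum>m\<le>N. h m * (Gamma a / Gamma (a + real m / 2)))"
proof -
  have a: "0 < a" and P: "prob_space P" and setsP: "sets P = sets borel"
    using gr by (auto simp: gaussian_radial_def)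
  note [measurable_cong] = setsP
  interpret P: prob_space P by fact
  interpret \<Omega>: prob_space \<Omega> by fact
  interpret OP: pair_prob_space \<Omega> P ..
  interpret R: prob_space "gamma_law a" by (rule prob_space_gamma_law[OF a])
  define b where "b m = (\<integral>z. (case z of (y, x) \<Rightarrow> c m y x) \<partial>(\<Omega> \<Otimes>\<^sub>M P))" for m
  define \<mu> where "\<mu> m = Gamma (a + real m / 2) / Gamma a" for m :: nat
  have \<mu>: "0 < \<mu> m" for m
    unfolding \<mu>_def using a by (intro divide_pos_pos Gamma_real_pos add_pos_nonneg) auto
  have int: "integrable (\<Omega> \<Otimes>\<^sub>M P) (\<lambda>z. \<Sum>m\<le>N. (case z of (y, x) \<Rightarrow> c m y x) * s ^ m)" for s
    by (intro Bochner_Integration.integrable_sum integrable_mult_left) (auto intro: c)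
  have gz: "g (fst z) (s *\<^sub>R snd z) = (\<Sum>m\<le>N. (case z of (y, x) \<Rightarrow> c m y x) * s ^ m)" for z s
    by (simp add: poly case_prod_beta)
  have val: "(\<integral>z. g (fst z) (s *\<^sub>R snd z) \<partial>(\<Omega> \<Otimes>\<^sub>M P)) = (\<Sum>m\<le>N. b m * s ^ m)" for s
    unfolding gz b_def using c by (subst Bochner_Integration.integral_sum) auto
  have pX0: "0 \<le> (\<Sum>m\<le>N. b m * s ^ m)" for s
    unfolding val[symmetric] by (rule integral_nonneg_AE) (simp add: g0)
  have pX: "(\<integral>\<^sup>+y. \<integral>\<^sup>+x. ennreal (g y (s *\<^sub>R x)) \<partial>P \<partial>\<Omega>) = ennreal (\<Sum>m\<le>N. b m * s ^ m)" for s
  proof -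
    have "(\<integral>\<^sup>+y. \<integral>\<^sup>+x. ennreal (g y (s *\<^sub>R x)) \<partial>P \<partial>\<Omega>) = (\<integral>\<^sup>+z. ennreal (g (fst z) (s *\<^sub>R snd z)) \<partial>(\<Omega> \<Otimes>\<^sub>M P))"
      by (subst P.nn_integral_fst[symmetric]) auto
    also have "\<dots> = ennreal (\<integral>z. g (fst z) (s *\<^sub>R snd z) \<partial>(\<Omega> \<Otimes>\<^sub>M P))"
      by (rule nn_integral_eq_integral) (use int[of s] in \<open>simp_all add: gz[symmetric] g0\<close>)
    finally show ?thesis by (simp only: val)
  qed
  have "(\<Sum>m\<le>N. (b m * \<mu> m) * s ^ m) = (\<Sum>m\<le>N. h m * s ^ m)" if s: "0 < s" for s
  proof -
    have "ennreal (\<Sum>m\<le>N. h m * s ^ m) = (\<integral>\<^sup>+y. \<integral>\<^sup>+z. ennreal (g y (s *\<^sub>R z)) \<partial>half_gaussian \<partial>\<Omega>)"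
      by (rule h[OF s, symmetric])
    also have "\<dots> = (\<integral>\<^sup>+y. \<integral>\<^sup>+\<rho>. \<integral>\<^sup>+x. ennreal (g y (s *\<^sub>R sqrt \<rho> *\<^sub>R x)) \<partial>P \<partial>gamma_law a \<partial>\<Omega>)"
      by (intro nn_integral_cong nn_integral_half_gaussian[OF gr]) measurable
    also have "\<dots> = (\<integral>\<^sup>+\<rho>. \<integral>\<^sup>+y. \<integral>\<^sup>+x. ennreal (g y (s *\<^sub>R sqrt \<rho> *\<^sub>R x)) \<partial>P \<partial>\<Omega> \<partial>gamma_law a)"
      by (rule pair_sigma_finite.Fubini'[OF pair_sigma_finite.intro[OF R.sigma_finite_measure_axioms \<Omega>.sigma_finite_measure_axioms]]) measurable
    also have "\<dots> = (\<integral>\<^sup>+\<rho>. ennreal (\<Sum>m\<le>N. b m * (s * sqrt \<rho>) ^ m) \<partial>gamma_law a)"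
      by (simp add: pX)
    also have "\<dots> = ennreal (\<integral>\<rho>. (\<Sum>m\<le>N. b m * (s * sqrt \<rho>) ^ m) \<partial>gamma_law a)"
    proof (rule nn_integral_eq_integral)
      show "integrable (gamma_law a) (\<lambda>\<rho>. \<Sum>m\<le>N. b m * (s * sqrt \<rho>) ^ m)"
        unfolding power_mult_distrib
        by (intro Bochner_Integration.integrable_sum integrable_mult_right gamma_law_sqrt_moment a)
    qed (simp add: pX0)
    also have "(\<integral>\<rho>. (\<Sum>m\<le>N. b m * (s * sqrt \<rho>) ^ m) \<partial>gamma_law a) = (\<Sum>m\<le>N. (b m * \<mu> m) * s ^ m)"
    proof -
      have "(\<integral>\<rho>. (\<Sum>m\<le>N. b m * (s * sqrt \<rho>) ^ m) \<partial>gamma_law a) = (\<integral>\<rho>. (\<Sum>m\<le>N. (b m * s ^ m) * sqrt \<rho> ^ m) \<partial>gamma_law a)"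
        by (simp add: power_mult_distrib mult_ac)
      also have "\<dots> = (\<Sum>m\<le>N. (b m * s ^ m) * \<mu> m)"
        by (subst Bochner_Integration.integral_sum) (auto simp: gamma_law_sqrt_moment[OF a] \<mu>_def)
      finally show ?thesis by (simp add: mult_ac)
    qed
    finally have "ennreal (\<Sum>m\<le>N. h m * s ^ m) = ennreal (\<Sum>m\<le>N. (b m * \<mu> m) * s ^ m)" .
    \<comment> \<open>\<open>ennreal\<close> is injective only on nonnegative reals, so both
      polynomial values must be known to be nonnegative.\<close>
    moreover have "0 \<le> (\<Sum>m\<le>N. (b m * \<mu> m) * s ^ m)"
    proof -
      have "0 \<le> (\<integral>\<rho>. (\<Sum>m\<le>N. b m * (s * sqrt \<rho>) ^ m) \<partial>gamma_law a)"
        by (rule integral_nonneg_AE) (simp add: pX0)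
      also have "\<dots> = (\<integral>\<rho>. (\<Sum>m\<le>N. (b m * s ^ m) * sqrt \<rho> ^ m) \<partial>gamma_law a)"
        by (simp add: power_mult_distrib mult_ac)
      also have "\<dots> = (\<Sum>m\<le>N. (b m * s ^ m) * \<mu> m)"
        by (subst Bochner_Integration.integral_sum) (auto simp: gamma_law_sqrt_moment[OF a] \<mu>_def)
      finally show ?thesis by (simp add: mult_ac)
    qed
    ultimately show ?thesis using h0[OF s] by (simp add: ennreal_inj)
  qed
  then have bh: "b m * \<mu> m = h m" if "m \<le> N" for m
    by (rule polyfun_eq_coeffs_pos[OF _ that])
  have "b m = h m * (Gamma a / Gamma (a + real m / 2))" if "m \<le> N" for m
  proof -
    have "0 < Gamma (a + real m / 2)" using a by (intro Gamma_real_pos add_pos_nonneg) auto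
    then have "\<mu> m * (Gamma a / Gamma (a + real m / 2)) = 1"
      unfolding \<mu>_def using Gamma_real_pos[OF a] by simp
    then show ?thesis
      unfolding bh[OF that, symmetric] by (simp only: mult.assoc mult_1_right)
  qed
  then have "(\<Sum>m\<le>N. b m * 1 ^ m) = (\<Sum>m\<le>N. h m * (Gamma a / Gamma (a + real m / 2)))"
    by (intro sum.cong) auto
  then show ?thesis using pX[of 1] by simp
qed

section \<open>The determinant as a function of one vertex\<close>

text \<open>The last residual is the projection onto the orthogonal complement of the earlier
  vectors, hence linear in the last vector.\<close>

lemma gso_affine_last:
  "gso (y(k := s *\<^sub>R u - v)) k = s *\<^sub>R gso (y(k := u)) k - gso (y(k := v)) k"
proof (rule gso_unique)
  have img: "(y(k := w)) ` {..<k} = y ` {..<k}" for w by auto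
  have d: "w - gso (y(k := w)) k \<in> span (y ` {..<k})" for w
    using gso_diff_in_span[of "y(k := w)" k] unfolding img by simp
  have "(s *\<^sub>R u - v) - (s *\<^sub>R gso (y(k := u)) k - gso (y(k := v)) k) =
      s *\<^sub>R (u - gso (y(k := u)) k) - (v - gso (y(k := v)) k)" by (simp add: algebra_simps)
  also have "\<dots> \<in> span (y ` {..<k})" by (intro span_diff span_scale d)
  finally show "(y(k := s *\<^sub>R u - v)) k - (s *\<^sub>R gso (y(k := u)) k - gso (y(k := v)) k) \<in> span ((y(k := s *\<^sub>R u - v)) ` {..<k})"
    unfolding img by simp
  show "(s *\<^sub>R gso (y(k := u)) k - gso (y(k := v)) k) \<bullet> w = 0" if "w \<in> span ((y(k := s *\<^sub>R u - v)) ` {..<k})" for w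
    using that gso_perp[of w "y(k := u)" k] gso_perp[of w "y(k := v)" k] unfolding img
    by (simp add: inner_diff_left)
qed

text \<open>The volume depends on the vertices only as a set. Symmetry under permutations, which
  Gram-Schmidt hides by singling out vertex 1 and an order of the edges, is thus read off from the
  geometric definition.\<close>

lemma simplex_gramdet_set_cong:
  fixes x z :: "nat \<Rightarrow> 'a::euclidean_space"
  assumes "r \<le> DIM('a)" "x ` {1..r+1} = z ` {1..r+1}"
  shows "simplex_gramdet r x = simplex_gramdet r z"
proof -
  have "simplex_volume r x = simplex_volume r z"
    unfolding simplex_volume_def assms(2) ..
  then show ?thesis unfolding simplex_volume_eq[OF assms(1)] by simp
qed

text \<open>The last vertex enters only through the last residual, which is affine in its scale; the
  squared norm is then quadratic. A transposition of vertices reduces every other vertex, including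
  the base vertex 1, to this case.\<close>

lemma simplex_gramdet_quadratic:
  fixes x :: "nat \<Rightarrow> 'a::euclidean_space"
  assumes r: "1 \<le> r" "r \<le> DIM('a)" and i: "i \<in> {1..r+1}"
  obtains \<alpha> \<beta> \<gamma> where "\<And>s. simplex_gramdet r (x(i := s *\<^sub>R x i)) = \<alpha> * s\<^sup>2 + \<beta> * s + \<gamma>"
proof -
  obtain k where k: "r = Suc k" using r by (cases r) auto
  have last: "\<exists>\<alpha> \<beta> \<gamma>. \<forall>s. simplex_gramdet r (z(r + 1 := s *\<^sub>R z (r + 1))) = \<alpha> * s\<^sup>2 + \<beta> * s + \<gamma>" for z :: "nat \<Rightarrow> 'a"
  proof -
    define y where "y = (\<lambda>j. z (j + 2) - z 1)"
    define p where "p = gso (y(k := z (r + 1))) k"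
    define q where "q = gso (y(k := z 1)) k"
    have eq: "(\<lambda>j. (z(r + 1 := s *\<^sub>R z (r + 1))) (j + 2) - (z(r + 1 := s *\<^sub>R z (r + 1))) 1) = y(k := s *\<^sub>R z (r + 1) - z 1)" for s
      by (auto simp: y_def k fun_eq_iff)
    have "simplex_gramdet r (z(r + 1 := s *\<^sub>R z (r + 1))) = gramdet k y * (norm (s *\<^sub>R p - q))\<^sup>2" for s
    proof -
      have "gramdet k (y(k := w)) = gramdet k y" for w by (rule gramdet_cong) simp
      then show ?thesis
        unfolding simplex_gramdet_def eq unfolding k gramdet_def[of "Suc k"]
        by (simp add: gramdet_def gso_affine_last p_def q_def k)
    qed
    also have "\<And>s. gramdet k y * (norm (s *\<^sub>R p - q))\<^sup>2 =
        (gramdet k y * (p \<bullet> p)) * s\<^sup>2 + (- 2 * gramdet k y * (p \<bullet> q)) * s + gramdet k y * (q \<bullet> q)"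
      unfolding power2_norm_eq_inner
      by (simp add: inner_diff_left inner_diff_right power2_eq_square inner_commute algebra_simps)
    finally show ?thesis by blast
  qed
  define \<pi> where "\<pi> = Transposition.transpose i (r + 1)"
  have \<pi>: "\<pi> ` {1..r+1} = {1..r+1}"
    unfolding \<pi>_def using i by (intro transpose_image_eq) auto
  have "simplex_gramdet r (x(i := s *\<^sub>R x i)) = simplex_gramdet r ((x \<circ> \<pi>)(r + 1 := s *\<^sub>R (x \<circ> \<pi>) (r + 1)))" for s
  proof (rule simplex_gramdet_set_cong[OF r(2)])
    have "(x \<circ> \<pi>)(r + 1 := s *\<^sub>R (x \<circ> \<pi>) (r + 1)) = x(i := s *\<^sub>R x i) \<circ> \<pi>"
      by (auto simp: fun_eq_iff \<pi>_def Transposition.transpose_def)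
    then show "x(i := s *\<^sub>R x i) ` {1..r+1} = (x \<circ> \<pi>)(r + 1 := s *\<^sub>R (x \<circ> \<pi>) (r + 1)) ` {1..r+1}"
      by (simp only: image_comp[symmetric] \<pi>)
  qed
  with last[of "x \<circ> \<pi>"] show ?thesis using that by metis
qed

lemma simplex_gramdet_nonneg: "0 \<le> simplex_gramdet r x"
  by (simp add: simplex_gramdet_def gramdet_nonneg)

text \<open>A crude bound in product form, so that it can be integrated vertex by vertex and becomes
  a constant when all vertices lie in the unit ball.\<close>

lemma simplex_gramdet_le:
  "simplex_gramdet r x \<le> (\<Prod>i\<in>{1..r+1}. 1 + norm (x i)) ^ (2 * r)"
proof -
  let ?W = "\<Prod>i\<in>{1..r+1}. 1 + norm (x i)"
  have "(norm (gso (\<lambda>k. x (k + 2) - x 1) k))\<^sup>2 \<le> ?W\<^sup>2" if "k < r" for k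
  proof (rule power_mono)
    have "norm (gso (\<lambda>k. x (k + 2) - x 1) k) \<le> norm (x (k + 2) - x 1)" by (rule norm_gso_le)
    also have "\<dots> \<le> norm (x (k + 2)) + norm (x 1)" by (rule norm_triangle_ineq4)
    also have "\<dots> \<le> (1 + norm (x (k + 2))) * (1 + norm (x 1))"
      by (simp add: algebra_simps)
    also have "\<dots> = (\<Prod>i\<in>{1, k + 2}. 1 + norm (x i))" by simp
    also have "\<dots> \<le> ?W"
      using that by (intro prod_mono2) auto
    finally show "norm (gso (\<lambda>k. x (k + 2) - x 1) k) \<le> ?W" .
  qed simp
  then have "simplex_gramdet r x \<le> (\<Prod>k<r. ?W\<^sup>2)"
    unfolding simplex_gramdet_def gramdet_def by (intro prod_mono) auto
  also have "\<dots> = ?W ^ (2 * r)" by (simp add: power_mult)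
  finally show ?thesis .
qed

text \<open>The sum of absolute values of coefficients is submultiplicative. The bound makes the
  coefficients of the expanded k-th power integrable.\<close>

lemma coeff_quadratic_power_le:
  fixes \<alpha> \<beta> \<gamma> :: real
  shows "\<bar>coeff ([:\<gamma>, \<beta>, \<alpha>:] ^ k) m\<bar> \<le> (\<bar>\<gamma>\<bar> + \<bar>\<beta>\<bar> + \<bar>\<alpha>\<bar>) ^ k"
proof (induction k arbitrary: m)
  case 0
  then show ?case by (simp add: coeff_1)
next
  case (Suc k)
  let ?q = "[:\<gamma>, \<beta>, \<alpha>:] ^ k" and ?B = "(\<bar>\<gamma>\<bar> + \<bar>\<beta>\<bar> + \<bar>\<alpha>\<bar>) ^ k"
  define q1 where "q1 = (case m of 0 \<Rightarrow> 0 | Suc j \<Rightarrow> coeff ?q j)"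
  define q2 where "q2 = (case m of 0 \<Rightarrow> 0 | Suc 0 \<Rightarrow> 0 | Suc (Suc j) \<Rightarrow> coeff ?q j)"
  have B0: "0 \<le> ?B" by simp
  have q: "\<bar>q1\<bar> \<le> ?B" "\<bar>q2\<bar> \<le> ?B"
    using Suc B0 by (auto simp: q1_def q2_def split: nat.splits)
  have "coeff ([:\<gamma>, \<beta>, \<alpha>:] ^ Suc k) m = \<gamma> * coeff ?q m + \<beta> * q1 + \<alpha> * q2"
    by (auto simp: q1_def q2_def mult_pCons_left coeff_pCons split: nat.splits)
  also have "\<bar>\<dots>\<bar> \<le> \<bar>\<gamma>\<bar> * \<bar>coeff ?q m\<bar> + \<bar>\<beta>\<bar> * \<bar>q1\<bar> + \<bar>\<alpha>\<bar> * \<bar>q2\<bar>"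
    by (simp add: abs_mult[symmetric])
  also have "\<dots> \<le> \<bar>\<gamma>\<bar> * ?B + \<bar>\<beta>\<bar> * ?B + \<bar>\<alpha>\<bar> * ?B"
    using Suc q by (intro add_mono mult_left_mono) auto
  finally show ?case by (simp add: algebra_simps)
qed

lemma measurable_coeff_quadratic_power:
  assumes [measurable]: "\<alpha> \<in> borel_measurable M" "\<beta> \<in> borel_measurable M" "\<gamma> \<in> borel_measurable M"
  shows "(\<lambda>x. coeff ([:\<gamma> x, \<beta> x, \<alpha> x:] ^ k) m :: real) \<in> borel_measurable M"
proof (induction k arbitrary: m)
  case (Suc k)
  note [measurable] = Suc
  have "(\<lambda>x. coeff ([:\<gamma> x, \<beta> x, \<alpha> x:] ^ Suc k) m) = (\<lambda>x. \<gamma> x * coeff ([:\<gamma> x, \<beta> x, \<alpha> x:] ^ k) m +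
      \<beta> x * (if m = 0 then 0 else coeff ([:\<gamma> x, \<beta> x, \<alpha> x:] ^ k) (m - 1)) +
      \<alpha> x * (if m < 2 then 0 else coeff ([:\<gamma> x, \<beta> x, \<alpha> x:] ^ k) (m - 2)))"
    by (auto simp: fun_eq_iff mult_pCons_left coeff_pCons split: nat.splits)
  then show ?case by simp
qed simp

lemma poly_quadratic_power:
  fixes \<alpha> \<beta> \<gamma> s :: real
  shows "(\<alpha> * s\<^sup>2 + \<beta> * s + \<gamma>) ^ k = (\<Sum>m\<le>2 * k. coeff ([:\<gamma>, \<beta>, \<alpha>:] ^ k) m * s ^ m)"
proof -
  let ?p = "[:\<gamma>, \<beta>, \<alpha>:] ^ k"
  have "degree ?p \<le> degree [:\<gamma>, \<beta>, \<alpha>:] * k" by (rule degree_power_le)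
  also have "\<dots> \<le> 2 * k" by (intro mult_right_mono) (auto intro: degree_pCons_le[THEN order_trans])
  finally have deg: "degree ?p \<le> 2 * k" .
  have "(\<alpha> * s\<^sup>2 + \<beta> * s + \<gamma>) ^ k = poly ?p s"
    by (simp add: power2_eq_square algebra_simps)
  also have "\<dots> = (\<Sum>m\<le>degree ?p. coeff ?p m * s ^ m)" by (rule poly_altdef)
  also have "\<dots> = (\<Sum>m\<le>2 * k. coeff ?p m * s ^ m)"
    using deg by (intro sum.mono_neutral_left) (auto simp: coeff_eq_0)
  finally show ?thesis .
qed

section \<open>Pochhammer symbols and binomial series\<close>

lemma Gamma_ratio_pochhammer: "0 < a \<Longrightarrow> Gamma (a + real q) / Gamma a = pochhammer a q"
  by (rule pochhammer_Gamma[symmetric]) (auto elim!: nonpos_Ints_cases)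

text \<open>This is where exponential series become binomial series: division by the radial moment
  of order 2 q turns the weight 1 / (k - q)! into a binomial coefficient with upper entry a + k - 1,
  up to a factor independent of q.\<close>

lemma binomial_gamma_ratio:
  assumes a: "0 < (a::real)" and q: "q \<le> k"
  shows "Gamma a / Gamma (a + real q) / fact (k - q) = ((a + real k - 1) gchoose (k - q)) / pochhammer a k"
proof -
  have "a + real k - 1 - real (k - q) + 1 = a + real q" using q by (simp add: of_nat_diff)
  then have 1: "(a + real k - 1) gchoose (k - q) = pochhammer (a + real q) (k - q) / fact (k - q)"
    unfolding gbinomial_pochhammer' by simp
  have 2: "pochhammer a k = pochhammer a q * pochhammer (a + real q) (k - q)"
    by (rule pochhammer_product[OF q])
  have p: "0 < pochhammer a q" "0 < pochhammer (a + real q) (k - q)"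
    using a by (auto intro!: pochhammer_pos add_pos_nonneg)
  have "Gamma a / Gamma (a + real q) = 1 / pochhammer a q"
    unfolding Gamma_ratio_pochhammer[OF a, symmetric] by simp
  then show ?thesis unfolding 1 2 using p by simp
qed

lemma gbinomial_nonneg_real:
  assumes "real l \<le> x + 1" shows "0 \<le> (x::real) gchoose l"
  unfolding gbinomial_prod_rev using assms by (auto intro!: divide_nonneg_nonneg prod_nonneg)

text \<open>Needed to strip \<open>ennreal\<close> from equations between moments. Only orders l
  \<le> k occur; for l \<ge> 1 and j \<ge> 1 the upper entry j c is at least c > l - 1, so no factor
  of the falling product is negative.\<close>

lemma binomial_exp_coeff_nonneg:
  assumes a: "0 < a" and S: "0 \<le> S" and c: "c = a + real k - 1"
  shows "0 \<le> (fps_binomial (real j * c) * fps_exp S) $ k"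
proof -
  have "0 \<le> (real j * c) gchoose l" if "l \<le> k" for l
  proof (cases "j = 0 \<or> l = 0")
    case True
    then show ?thesis by (cases l) auto
  next
    case False
    then have "1 \<le> real j" "0 \<le> c" using that a by (auto simp: c)
    then have "1 * c \<le> real j * c" by (intro mult_right_mono) auto
    then show ?thesis using that a by (intro gbinomial_nonneg_real) (simp add: c)
  qed
  then show ?thesis
    unfolding fps_mult_nth using S by (intro sum_nonneg mult_nonneg_nonneg) auto
qed

section \<open>Replacing Gaussian vertices one at a time\<close>

lemma measurable_simplex_gramdet:
  assumes "\<And>i. i \<in> {1..r+1} \<Longrightarrow> (\<lambda>\<omega>. X \<omega> i) \<in> borel_measurable M"
  shows "(\<lambda>\<omega>. simplex_gramdet r (X \<omega>)) \<in> borel_measurable M"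
  unfolding simplex_gramdet_def
  by (intro measurable_gramdet borel_measurable_diff assms) auto

text \<open>Under P the norm is at most 1; the Gaussian moments reduce to this through the radial
  decomposition and the finite moments of the Gamma law.\<close>

lemma norm_moment_finite:
  fixes P :: "(real ^ 'n) measure"
  assumes gr: "gaussian_radial a P" and t: "0 \<le> t"
  shows "(\<integral>\<^sup>+x. ennreal ((1 + t * norm x) ^ M) \<partial>P) < \<infinity>"
    and "(\<integral>\<^sup>+x. ennreal ((1 + t * norm x) ^ M) \<partial>(half_gaussian :: (real ^ 'n) measure)) < \<infinity>"
proof -
  have a: "0 < a" and P: "prob_space P" and setsP: "sets P = sets borel" and ae: "AE x in P. norm x \<le> 1"
    using gr by (auto simp: gaussian_radial_def)
  interpret P: prob_space P by fact
  interpret R: prob_space "gamma_law a" by (rule prob_space_gamma_law[OF a])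
  have le: "(\<integral>\<^sup>+x. ennreal ((1 + u * norm x) ^ M) \<partial>P) \<le> ennreal ((1 + u) ^ M)" if "0 \<le> u" for u
  proof -
    have "(\<integral>\<^sup>+x. ennreal ((1 + u * norm x) ^ M) \<partial>P) \<le> (\<integral>\<^sup>+x. ennreal ((1 + u) ^ M) \<partial>P)"
    proof (rule nn_integral_mono_AE, use ae in eventually_elim)
      fix x :: "real ^ 'n" assume "norm x \<le> 1"
      then have "u * norm x \<le> u * 1" using that by (intro mult_left_mono) auto
      then show "ennreal ((1 + u * norm x) ^ M) \<le> ennreal ((1 + u) ^ M)"
        using that by (intro ennreal_leI power_mono) auto
    qed
    then show ?thesis using P.emeasure_space_1 by simp
  qed
  from le[OF t] show "(\<integral>\<^sup>+x. ennreal ((1 + t * norm x) ^ M) \<partial>P) < \<infinity>"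
    by (rule order.strict_trans1) simp
  have "(\<integral>\<^sup>+x. ennreal ((1 + t * norm x) ^ M) \<partial>(half_gaussian :: (real ^ 'n) measure)) =
      (\<integral>\<^sup>+\<rho>. \<integral>\<^sup>+x. ennreal ((1 + t * norm (sqrt \<rho> *\<^sub>R x)) ^ M) \<partial>P \<partial>gamma_law a)"
    by (rule nn_integral_half_gaussian[OF gr]) measurable
  also have "\<dots> \<le> (\<integral>\<^sup>+\<rho>. ennreal ((1 + t * sqrt \<rho>) ^ M) \<partial>gamma_law a)"
  proof (rule nn_integral_mono_AE, use AE_gamma_law_pos[of a] in eventually_elim)
    fix \<rho> :: real assume "0 < \<rho>"
    then show "(\<integral>\<^sup>+x. ennreal ((1 + t * norm (sqrt \<rho> *\<^sub>R x)) ^ M) \<partial>P) \<le> ennreal ((1 + t * sqrt \<rho>) ^ M)"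
      using le[of "t * sqrt \<rho>"] t by (simp add: mult.assoc)
  qed
  also have "\<dots> = ennreal (\<integral>\<rho>. (1 + t * sqrt \<rho>) ^ M \<partial>gamma_law a)"
  proof (rule nn_integral_eq_integral)
    have "(\<lambda>\<rho>. (1 + t * sqrt \<rho>) ^ M) = (\<lambda>\<rho>. \<Sum>m\<le>M. (real (M choose m) * t ^ m) * sqrt \<rho> ^ m)"
      by (simp add: binomial_ring[of "t * sqrt _" 1 M, unfolded add.commute[of _ 1]] fun_eq_iff power_mult_distrib mult.assoc)
    then show "integrable (gamma_law a) (\<lambda>\<rho>. (1 + t * sqrt \<rho>) ^ M)"
      by (simp only:) (intro Bochner_Integration.integrable_sum integrable_mult_right gamma_law_sqrt_moment a)
    show "AE \<rho> in gamma_law a. 0 \<le> (1 + t * sqrt \<rho>) ^ M"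
      using AE_gamma_law_pos[of a] by eventually_elim (use t in simp)
  qed
  finally show "(\<integral>\<^sup>+x. ennreal ((1 + t * norm x) ^ M) \<partial>(half_gaussian :: (real ^ 'n) measure)) < \<infinity>"
    by (rule order.strict_trans1) simp
qed

lemma nn_integral_chi_squared_power:
  assumes "1 \<le> d"
  shows "(\<integral>\<^sup>+q. ennreal (q ^ k) \<partial>chi_squared_law d) = ennreal (2 ^ k * pochhammer (real d / 2) k)"
proof -
  have d: "0 < real d / 2" using assms by simp
  have "(\<integral>\<^sup>+q. ennreal (q ^ k) \<partial>chi_squared_law d) = (\<integral>\<^sup>+t. ennreal ((2 * t) ^ k) \<partial>gamma_law (real d / 2))"
    by (rule nn_integral_chi_squared_law[OF assms]) measurable
  also have "\<dots> = (\<integral>\<^sup>+t. ennreal (2 ^ k) * ennreal (t powr real k) \<partial>gamma_law (real d / 2))"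
    by (rule nn_integral_gamma_law_cong) (simp add: power_mult_distrib powr_realpow ennreal_mult')
  also have "\<dots> = ennreal (2 ^ k) * ennreal (Gamma (real d / 2 + real k) / Gamma (real d / 2))"
    using d by (subst nn_integral_cmult, simp, subst nn_integral_gamma_law_powr) auto
  also have "\<dots> = ennreal (2 ^ k * pochhammer (real d / 2) k)"
    unfolding Gamma_ratio_pochhammer[OF d] by (simp add: ennreal_mult')
  finally show ?thesis .
qed

text \<open>The k-th moment of the Gram determinant of r independent Gaussian vectors in dimension n
  with variance 1/2 per coordinate, that is, of a Wishart determinant.\<close>

definition wishart_moment :: "nat \<Rightarrow> nat \<Rightarrow> nat \<Rightarrow> real" where
  "wishart_moment n r k = (\<Prod>i<r. pochhammer (real (n - i) / 2) k)"

lemma wishart_moment_pos: "r \<le> n \<Longrightarrow> 0 < wishart_moment n r k"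
  unfolding wishart_moment_def by (intro prod_pos pochhammer_pos) auto

lemma half_gaussian_simplex_moment:
  assumes t: "\<And>i. 0 < t i" and r: "r \<le> CARD('n)"
  shows "(\<integral>\<^sup>+x. ennreal (simplex_gramdet r (\<lambda>i. t i *\<^sub>R x i) ^ k) \<partial>(\<Pi>\<^sub>M i\<in>{1..r+1}. (half_gaussian :: (real ^ 'n) measure))) =
    ennreal (wishart_moment CARD('n) r k * ((\<Prod>i\<in>{1..r+1}. (t i)\<^sup>2) * prec t (r + 1)) ^ k)"
proof -
  let ?G = "gaussian_model :: (real ^ 'n) measure" and ?H = "half_gaussian :: (real ^ 'n) measure"
  let ?I = "{1..r+1}" and ?n = "CARD('n)"
  interpret G: prob_space ?G by (rule prob_space_gaussian_model)
  interpret GI: prob_space "Pi\<^sub>M ?I (\<lambda>_. ?G)" by (intro prob_space_PiM prob_space_gaussian_model)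
  define f where "f x = ennreal (simplex_gramdet r (\<lambda>i. t i *\<^sub>R x i) ^ k)" for x :: "nat \<Rightarrow> real ^ 'n"
  have f[measurable]: "f \<in> borel_measurable (\<Pi>\<^sub>M i\<in>?I. ?H)"
    unfolding f_def[abs_def]
    by (intro measurable_compose[OF _ measurable_ennreal] borel_measurable_power measurable_simplex_gramdet) auto
  let ?t = "\<lambda>i. t i / sqrt 2"
  \<comment> \<open>The mixture lemma is used with a dummy second variable, to carry out the scaling
    by 1 / sqrt 2 in every coordinate at once.\<close>
  have "(\<integral>\<^sup>+x. f x \<partial>(\<Pi>\<^sub>M i\<in>?I. ?H)) = (\<integral>\<^sup>+z. \<integral>\<^sup>+z'. f (\<lambda>i\<in>?I. (1 / sqrt 2) *\<^sub>R z i) \<partial>(\<Pi>\<^sub>M i\<in>?I. ?G) \<partial>(\<Pi>\<^sub>M i\<in>?I. ?G))"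
  proof (rule nn_integral_PiM_mixture[where \<phi>="\<lambda>i z z'. (1 / sqrt 2) *\<^sub>R z"])
    show "(\<integral>\<^sup>+x. h x \<partial>?H) = (\<integral>\<^sup>+z. \<integral>\<^sup>+z'. h ((1 / sqrt 2) *\<^sub>R z) \<partial>?G \<partial>?G)" if "h \<in> borel_measurable ?H" for h
    proof -
      have "(\<integral>\<^sup>+x. h x \<partial>?H) = (\<integral>\<^sup>+z. h ((1 / sqrt 2) *\<^sub>R z) \<partial>?G)"
        unfolding half_gaussian_def using that by (intro nn_integral_distr) simp_all
      then show ?thesis using G.emeasure_space_1 by simp
    qed
  qed (use prob_space_gaussian_model prob_space_half_gaussian f in auto)
  also have "\<dots> = (\<integral>\<^sup>+z. f (\<lambda>i\<in>?I. (1 / sqrt 2) *\<^sub>R z i) \<partial>(\<Pi>\<^sub>M i\<in>?I. ?G))"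
    using GI.emeasure_space_1 by simp
  also have "\<dots> = (\<integral>\<^sup>+z. ennreal (simplex_gramdet r (\<lambda>i. ?t i *\<^sub>R z i) ^ k) \<partial>(\<Pi>\<^sub>M i\<in>?I. ?G))"
    unfolding f_def simplex_gramdet_def
    by (intro nn_integral_cong arg_cong[of _ _ ennreal] arg_cong[of _ _ "\<lambda>x. x ^ k"] gramdet_cong) auto
  also have "\<dots> = (\<integral>\<^sup>+q. ennreal (((\<Prod>i\<in>?I. (?t i)\<^sup>2) * prec ?t (r + 1) * (\<Prod>k<r. q k)) ^ k) \<partial>(\<Pi>\<^sub>M k\<in>{..<r}. chi_squared_law (?n - k)))"
    using t r by (intro nn_integral_gaussian_simplex[where f="\<lambda>v. ennreal (v ^ k)"]) auto
  \<comment> \<open>The r + 1 variances contribute 1 / 2^(r + 1) and the precision a factor 2. The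
    remaining 1 / 2^r cancels against the chi-squared moments.\<close>
  also have "(\<Prod>i\<in>?I. (?t i)\<^sup>2) * prec ?t (r + 1) = (\<Prod>i\<in>?I. (t i)\<^sup>2) * prec t (r + 1) / 2 ^ r"
  proof -
    have "(\<Prod>i\<in>?I. (?t i)\<^sup>2) = (\<Prod>i\<in>?I. (t i)\<^sup>2) / 2 ^ (r + 1)"
      unfolding power_divide prod_dividef by simp
    moreover have "prec ?t (r + 1) = 2 * prec t (r + 1)"
      unfolding prec_def sum_distrib_left by (intro sum.cong refl) (simp add: power_divide)
    ultimately show ?thesis by (simp only:) simp
  qed
  also have "(\<integral>\<^sup>+q. ennreal (((\<Prod>i\<in>?I. (t i)\<^sup>2) * prec t (r + 1) / 2 ^ r * (\<Prod>k<r. q k)) ^ k) \<partial>(\<Pi>\<^sub>M k\<in>{..<r}. chi_squared_law (?n - k))) =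
      ennreal (wishart_moment ?n r k * ((\<Prod>i\<in>?I. (t i)\<^sup>2) * prec t (r + 1)) ^ k)"
  proof -
    define C where "C = ((\<Prod>i\<in>?I. (t i)\<^sup>2) * prec t (r + 1)) ^ k"
    have "0 \<le> (\<Prod>i\<in>?I. (t i)\<^sup>2)" by (rule prod_nonneg) simp
    moreover have "0 \<le> prec t (r + 1)" unfolding prec_def by (rule sum_nonneg) simp
    ultimately have C: "0 \<le> C" unfolding C_def by (intro zero_le_power mult_nonneg_nonneg)
    interpret Q: product_sigma_finite "\<lambda>k. chi_squared_law (?n - k)"
      by (intro product_sigma_finite_prob prob_space_chi_squared_law)
    have chi_pos: "AE q in chi_squared_law d. 0 \<le> q" for d
      unfolding chi_squared_law_def by (subst AE_distr_iff) (auto intro!: AE_I2 sum_nonneg)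
    have "(\<integral>\<^sup>+q. ennreal (((\<Prod>i\<in>?I. (t i)\<^sup>2) * prec t (r + 1) / 2 ^ r * (\<Prod>k<r. q k)) ^ k) \<partial>(\<Pi>\<^sub>M k\<in>{..<r}. chi_squared_law (?n - k))) =
        (\<integral>\<^sup>+q. ennreal (C / (2 ^ k) ^ r) * (\<Prod>i<r. ennreal (q i ^ k)) \<partial>(\<Pi>\<^sub>M k\<in>{..<r}. chi_squared_law (?n - k)))"
    proof (rule nn_integral_cong_AE)
      have "AE q in (\<Pi>\<^sub>M k\<in>{..<r}. chi_squared_law (?n - k)). \<forall>i\<in>{..<r}. 0 \<le> q i"
        by (subst AE_finite_all) (auto intro!: AE_PiM_component[where P="\<lambda>x. 0 \<le> x"] prob_space_chi_squared_law chi_pos)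
      then show "AE q in (\<Pi>\<^sub>M k\<in>{..<r}. chi_squared_law (?n - k)).
          ennreal (((\<Prod>i\<in>?I. (t i)\<^sup>2) * prec t (r + 1) / 2 ^ r * (\<Prod>k<r. q k)) ^ k) = ennreal (C / (2 ^ k) ^ r) * (\<Prod>i<r. ennreal (q i ^ k))"
      proof eventually_elim
        case (elim q)
        have "((\<Prod>i\<in>?I. (t i)\<^sup>2) * prec t (r + 1) / 2 ^ r * (\<Prod>k<r. q k)) ^ k = C / (2 ^ k) ^ r * (\<Prod>i<r. q i ^ k)"
          by (simp add: C_def power_mult_distrib power_divide prod_power_distrib power_mult[symmetric] mult.commute)
        moreover have "ennreal (\<Prod>i<r. q i ^ k) = (\<Prod>i<r. ennreal (q i ^ k))"
          using elim by (intro prod_ennreal[symmetric]) auto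
        moreover have "ennreal (C / (2 ^ k) ^ r * (\<Prod>i<r. q i ^ k)) = ennreal (C / (2 ^ k) ^ r) * ennreal (\<Prod>i<r. q i ^ k)"
          using C by (intro ennreal_mult') auto
        ultimately show ?case by (simp only:)
      qed
    qed
    also have "\<dots> = ennreal (C / (2 ^ k) ^ r) * (\<Prod>i<r. \<integral>\<^sup>+q. ennreal (q ^ k) \<partial>chi_squared_law (?n - i))"
    proof -
      have m: "(\<lambda>q. \<Prod>i<r. ennreal (q i ^ k)) \<in> borel_measurable (\<Pi>\<^sub>M k\<in>{..<r}. chi_squared_law (?n - k))"
        by (intro borel_measurable_prod_ennreal measurable_PiM_component) auto
      show ?thesis
        unfolding nn_integral_cmult[OF m] by (subst Q.product_nn_integral_prod) auto
    qed
    also have "(\<Prod>i<r. \<integral>\<^sup>+q. ennreal (q ^ k) \<partial>chi_squared_law (?n - i)) = (\<Prod>i<r. ennreal (2 ^ k * pochhammer (real (?n - i) / 2) k))"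
      using r by (intro prod.cong refl nn_integral_chi_squared_power) auto
    also have "\<dots> = ennreal (\<Prod>i<r. 2 ^ k * pochhammer (real (?n - i) / 2) k)"
      using r by (intro prod_ennreal mult_nonneg_nonneg pochhammer_nonneg) auto
    also have "(\<Prod>i<r. 2 ^ k * pochhammer (real (?n - i) / 2) k) = (2 ^ k) ^ r * wishart_moment ?n r k"
      by (simp add: prod.distrib wishart_moment_def)
    also have "ennreal (C / (2 ^ k) ^ r) * ennreal ((2 ^ k) ^ r * wishart_moment ?n r k) = ennreal (C / (2 ^ k) ^ r * ((2 ^ k) ^ r * wishart_moment ?n r k))"
      using C by (intro ennreal_mult'[symmetric]) auto
    also have "C / (2 ^ k) ^ r * ((2 ^ k) ^ r * wishart_moment ?n r k) = wishart_moment ?n r k * C"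
      by simp
    finally show ?thesis by (simp only: C_def)
  qed
  finally show ?thesis by (simp only: f_def)
qed

text \<open>The intermediate stage at which vertices 1 to j follow the model under study and the
  others are still Gaussian.\<close>

definition mix_law :: "(real ^ 'n) measure \<Rightarrow> nat \<Rightarrow> nat \<Rightarrow> (real ^ 'n) measure" where
  "mix_law P j i = (if i \<le> j then P else half_gaussian)"

text \<open>For j = 0 the exponential coefficient is the k-th power of the total precision over k!,
  which gives back the Gaussian moment. Each replaced vertex, at scale 1, trades its exponential
  factor for (1 + X)^(a + k - 1) and a factor 1 / (a)_k. As the exponent depends on k, the formula
  treats one k at a time and is not a generating function in k.\<close>

definition mix_moment :: "nat \<Rightarrow> nat \<Rightarrow> real \<Rightarrow> nat \<Rightarrow> nat \<Rightarrow> (nat \<Rightarrow> real) \<Rightarrow> real" where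
  "mix_moment n r a k j t = wishart_moment n r k * fact k / pochhammer a k ^ j *
     (\<Prod>i\<in>{Suc j..r+1}. (t i)\<^sup>2) ^ k *
     (fps_binomial (real j * (a + real k - 1)) * fps_exp (\<Sum>i\<in>{Suc j..r+1}. 1 / (t i)\<^sup>2)) $ k"

lemma mix_moment_nonneg:
  assumes "0 < a" "r \<le> n" shows "0 \<le> mix_moment n r a k j t"
proof -
  have "0 \<le> (fps_binomial (real j * (a + real k - 1)) * fps_exp (\<Sum>i\<in>{Suc j..r+1}. 1 / (t i)\<^sup>2)) $ k"
    by (rule binomial_exp_coeff_nonneg[OF assms(1)]) (rule sum_nonneg, simp_all)
  moreover have "0 \<le> (\<Prod>i\<in>{Suc j..r+1}. (t i)\<^sup>2) ^ k" by (rule zero_le_power, rule prod_nonneg) simp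
  moreover have "0 \<le> wishart_moment n r k * fact k / pochhammer a k ^ j"
    using wishart_moment_pos[OF assms(2), of k] pochhammer_pos[OF assms(1), of k] by simp
  ultimately show ?thesis unfolding mix_moment_def by (intro mult_nonneg_nonneg)
qed

text \<open>With s the scale of vertex \<open>Suc j\<close>, multiplying s^(2 k) with the expansion
  of exp(X / s^2) leaves the terms s^(2 q) / (k - q)!. Division by the radial moments makes the sum
  a Cauchy product with the binomial series of exponent a + k - 1.\<close>

lemma mix_moment_step:
  assumes a: "0 < a" and j: "j \<le> r" and t1: "t (Suc j) = 1"
  obtains h where "\<And>s. 0 < s \<Longrightarrow> mix_moment n r a k j (t(Suc j := s)) = (\<Sum>m\<le>2 * k. h m * s ^ m)"
    and "(\<Sum>m\<le>2 * k. h m * (Gamma a / Gamma (a + real m / 2))) = mix_moment n r a k (Suc j) t"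
proof -
  let ?c = "a + real k - 1"
  let ?J = "{Suc (Suc j)..r+1}"
  define K where "K = wishart_moment n r k * fact k / pochhammer a k ^ j * (\<Prod>i\<in>?J. (t i)\<^sup>2) ^ k"
  define A where "A = fps_binomial (real j * ?c) * fps_exp (\<Sum>i\<in>?J. 1 / (t i)\<^sup>2)"
  \<comment> \<open>Only even powers of the scale occur, with q = m div 2.\<close>
  define h where "h m = (if even m then K * A $ (m div 2) / fact (k - m div 2) else 0)" for m
  have ins: "{Suc j..r+1} = insert (Suc j) ?J" using j by auto
  have even_sum: "(\<Sum>m\<le>2 * k. if even m then f (m div 2) else 0) = (\<Sum>q\<le>k. f q)" for f :: "nat \<Rightarrow> real"
  proof -
    have "(\<Sum>m\<le>2 * k. if even m then f (m div 2) else 0) = (\<Sum>m\<in>(\<lambda>q. 2 * q) ` {..k}. f (m div 2))"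
      by (rule sum.mono_neutral_cong_right) (auto simp: image_iff elim!: evenE)
    also have "\<dots> = (\<Sum>q\<le>k. f q)"
      by (subst sum.reindex) (auto simp: inj_on_def)
    finally show ?thesis .
  qed
  have "mix_moment n r a k j (t(Suc j := s)) = (\<Sum>m\<le>2 * k. h m * s ^ m)" if s: "0 < s" for s
  proof -
    have p: "(\<Prod>i\<in>{Suc j..r+1}. ((t(Suc j := s)) i)\<^sup>2) = s\<^sup>2 * (\<Prod>i\<in>?J. (t i)\<^sup>2)"
      unfolding ins by (subst prod.insert) (auto intro!: prod.cong arg_cong2[where f="(*)"])
    have w: "(\<Sum>i\<in>{Suc j..r+1}. 1 / ((t(Suc j := s)) i)\<^sup>2) = (\<Sum>i\<in>?J. 1 / (t i)\<^sup>2) + 1 / s\<^sup>2"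
      unfolding ins by (subst sum.insert) (auto intro!: sum.cong arg_cong2[where f="(+)"] simp: add.commute)
    have "mix_moment n r a k j (t(Suc j := s)) = K * (s\<^sup>2) ^ k * (A * fps_exp (1 / s\<^sup>2)) $ k"
      unfolding mix_moment_def p w fps_exp_add_mult K_def A_def by (simp add: power_mult_distrib mult_ac)
    also have "(A * fps_exp (1 / s\<^sup>2)) $ k = (\<Sum>q\<le>k. A $ q * ((1 / s\<^sup>2) ^ (k - q) / fact (k - q)))"
      unfolding fps_mult_nth by (simp add: atLeast0AtMost)
    also have "K * (s\<^sup>2) ^ k * \<dots> = (\<Sum>q\<le>k. K * A $ q / fact (k - q) * s ^ (2 * q))"
      unfolding sum_distrib_left
    proof (intro sum.cong refl)
      fix q assume "q \<in> {..k}"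
      then have "(s\<^sup>2) ^ k = (s\<^sup>2) ^ q * (s\<^sup>2) ^ (k - q)" by (simp flip: power_add)
      then have "(s\<^sup>2) ^ k * (1 / s\<^sup>2) ^ (k - q) = s ^ (2 * q)" using s by (simp add: power_divide power_mult)
      moreover have gen: "K * p * (A $ q * (R / fact (k - q))) = K * A $ q / fact (k - q) * (p * R)" for p R by simp
      ultimately show "K * (s\<^sup>2) ^ k * (A $ q * ((1 / s\<^sup>2) ^ (k - q) / fact (k - q))) = K * A $ q / fact (k - q) * s ^ (2 * q)"
        by (simp only: gen)
    qed
    also have "\<dots> = (\<Sum>m\<le>2 * k. if even m then K * A $ (m div 2) / fact (k - m div 2) * s ^ (2 * (m div 2)) else 0)"
      by (rule even_sum[symmetric])
    also have "\<dots> = (\<Sum>m\<le>2 * k. h m * s ^ m)"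
      by (intro sum.cong refl) (auto simp: h_def)
    finally show ?thesis .
  qed
  moreover have "(\<Sum>m\<le>2 * k. h m * (Gamma a / Gamma (a + real m / 2))) = mix_moment n r a k (Suc j) t"
  proof -
    have "(\<Sum>m\<le>2 * k. h m * (Gamma a / Gamma (a + real m / 2))) =
        (\<Sum>m\<le>2 * k. if even m then K * A $ (m div 2) / fact (k - m div 2) * (Gamma a / Gamma (a + real (m div 2))) else 0)"
      by (intro sum.cong refl) (auto simp: h_def elim!: evenE)
    also have "\<dots> = (\<Sum>q\<le>k. K * A $ q / fact (k - q) * (Gamma a / Gamma (a + real q)))" by (rule even_sum)
    also have "\<dots> = (\<Sum>q\<le>k. K / pochhammer a k * (A $ q * (?c gchoose (k - q))))"
    proof (intro sum.cong refl)
      fix q assume "q \<in> {..k}"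
      then have e: "Gamma a / Gamma (a + real q) / fact (k - q) = (?c gchoose (k - q)) / pochhammer a k"
        using binomial_gamma_ratio[OF a, of q k] by simp
      have "K * A $ q / fact (k - q) * (Gamma a / Gamma (a + real q)) = K * A $ q * (Gamma a / Gamma (a + real q) / fact (k - q))"
        by simp
      then show "K * A $ q / fact (k - q) * (Gamma a / Gamma (a + real q)) = K / pochhammer a k * (A $ q * (?c gchoose (k - q)))"
        unfolding e by simp
    qed
    also have "\<dots> = K / pochhammer a k * (A * fps_binomial ?c) $ k"
      unfolding fps_mult_nth sum_distrib_left[symmetric] by (simp add: atLeast0AtMost)
    also have "A * fps_binomial ?c = fps_binomial (real (Suc j) * ?c) * fps_exp (\<Sum>i\<in>?J. 1 / (t i)\<^sup>2)"
    proof -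
      have "real (Suc j) * ?c = real j * ?c + ?c" by (simp add: algebra_simps)
      then show ?thesis unfolding A_def by (simp add: fps_binomial_add_mult mult_ac)
    qed
    finally show ?thesis unfolding mix_moment_def K_def by simp
  qed
  ultimately show ?thesis using that by blast
qed

text \<open>Induction on the number of replaced vertices. The scales of the others remain free,
  because each step compares coefficients in the scale of vertex \<open>Suc j\<close> and afterwards
  sets it to 1.\<close>

lemma mixed_simplex_moment:
  fixes P :: "(real ^ 'n) measure"
  assumes gr: "gaussian_radial a P" and r: "1 \<le> r" "r \<le> CARD('n)" and "j \<le> r + 1"
    and "\<And>i. 0 < t i" and "\<And>i. i \<le> j \<Longrightarrow> t i = 1"
  shows "(\<integral>\<^sup>+x. ennreal (simplex_gramdet r (\<lambda>i. t i *\<^sub>R x i) ^ k) \<partial>(Pi\<^sub>M {1..r+1} (mix_law P j))) =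
    ennreal (mix_moment CARD('n) r a k j t)"
  using assms(4-6)
proof (induction j arbitrary: t)
  case 0
  have "Pi\<^sub>M {1..r+1} (mix_law P 0) = (\<Pi>\<^sub>M i\<in>{1..r+1}. (half_gaussian :: (real ^ 'n) measure))"
    by (intro PiM_cong) (auto simp: mix_law_def)
  then have "(\<integral>\<^sup>+x. ennreal (simplex_gramdet r (\<lambda>i. t i *\<^sub>R x i) ^ k) \<partial>(Pi\<^sub>M {1..r+1} (mix_law P 0))) =
      ennreal (wishart_moment CARD('n) r k * ((\<Prod>i\<in>{1..r+1}. (t i)\<^sup>2) * prec t (r + 1)) ^ k)"
    using half_gaussian_simplex_moment[OF 0(2) r(2), where k=k] by simp
  also have "wishart_moment CARD('n) r k * ((\<Prod>i\<in>{1..r+1}. (t i)\<^sup>2) * prec t (r + 1)) ^ k = mix_moment CARD('n) r a k 0 t"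
    by (simp add: mix_moment_def prec_def power_mult_distrib)
  finally show ?case .
next
  case (Suc j)
  let ?i = "Suc j" and ?I = "{1..r+1}"
  let ?J = "?I - {?i}"
  define \<Omega> where "\<Omega> = Pi\<^sub>M ?J (mix_law P j)"
  have a: "0 < a" and P: "prob_space P" and setsP: "sets P = sets borel"
    using gr by (auto simp: gaussian_radial_def)
  have mixp: "prob_space (mix_law P l i)" for l i
    by (simp add: mix_law_def P prob_space_half_gaussian)
  have mixs: "sets (mix_law P l i) = sets borel" for l i
    using setsP by (simp add: mix_law_def)
  note [measurable_cong] = setsP mixs
  interpret P: prob_space P by fact
  interpret \<Omega>: prob_space \<Omega> unfolding \<Omega>_def by (intro prob_space_PiM mixp)
  have M: "product_sigma_finite (mix_law P l)" for l by (intro product_sigma_finite_prob mixp)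
  have i: "?i \<in> ?I" "?i \<notin> ?J" "finite ?J" "insert ?i ?J = ?I" using Suc.prems(1) by auto
  have \<Omega>': "Pi\<^sub>M ?J (mix_law P (Suc j)) = \<Omega>"
    unfolding \<Omega>_def by (intro PiM_cong) (auto simp: mix_law_def le_Suc_eq)
  define D where "D x = simplex_gramdet r (\<lambda>i. t i *\<^sub>R x i)" for x :: "nat \<Rightarrow> real ^ 'n"
  define g where "g y x = D (y(?i := x)) ^ k" for y x
  have D_scale: "D (y(?i := s *\<^sub>R x)) = simplex_gramdet r (\<lambda>i. (t(?i := s)) i *\<^sub>R (y(?i := x)) i)" for y x s
    unfolding D_def using Suc.prems(3)[of ?i] by (intro arg_cong[of _ _ "simplex_gramdet r"]) (auto simp: fun_eq_iff)
  have coord: "(\<lambda>z. ((fst z)(?i := s *\<^sub>R snd z)) l) \<in> borel_measurable (\<Omega> \<Otimes>\<^sub>M borel)" if "l \<in> ?I" for l and s :: real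
  proof (cases "l = ?i")
    case False
    then have "(\<lambda>y. y l) \<in> \<Omega> \<rightarrow>\<^sub>M mix_law P j l" unfolding \<Omega>_def using that by (intro measurable_component_singleton) auto
    then have "(\<lambda>y. y l) \<in> borel_measurable \<Omega>" by (simp cong: measurable_cong_sets add: mixs)
    then show ?thesis using False by simp
  qed simp
  have D_m: "(\<lambda>z. D ((fst z)(?i := s *\<^sub>R snd z))) \<in> borel_measurable (\<Omega> \<Otimes>\<^sub>M borel)" for s
    unfolding D_def by (intro measurable_simplex_gramdet borel_measurable_scaleR borel_measurable_const coord)
  have D_m1: "(\<lambda>z. D ((fst z)(?i := snd z))) \<in> borel_measurable (\<Omega> \<Otimes>\<^sub>M borel)" using D_m[of 1] by simp
  have expand: "(\<integral>\<^sup>+x. ennreal (simplex_gramdet r (\<lambda>i. u i *\<^sub>R x i) ^ k) \<partial>(Pi\<^sub>M ?I (mix_law P l))) =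
      (\<integral>\<^sup>+y. \<integral>\<^sup>+x. ennreal (simplex_gramdet r (\<lambda>i. u i *\<^sub>R (y(?i := x)) i) ^ k) \<partial>mix_law P l ?i \<partial>(Pi\<^sub>M ?J (mix_law P l)))" for u l
  proof -
    have "(\<lambda>x. x i) \<in> borel_measurable (Pi\<^sub>M ?I (mix_law P l))" if "i \<in> ?I" for i
      using measurable_component_singleton[OF that, of "mix_law P l"] by (simp cong: measurable_cong_sets add: mixs)
    then have "(\<lambda>x. ennreal (simplex_gramdet r (\<lambda>i. u i *\<^sub>R x i) ^ k)) \<in> borel_measurable (Pi\<^sub>M ?I (mix_law P l))"
      by (intro measurable_compose[OF _ measurable_ennreal] borel_measurable_power measurable_simplex_gramdet borel_measurable_scaleR borel_measurable_const)
    then show ?thesis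
      by (rule product_sigma_finite.product_nn_integral_insert[OF M i(3) i(2), unfolded i(4)])
  qed
  obtain h where h: "\<And>s. 0 < s \<Longrightarrow> mix_moment CARD('n) r a k j (t(?i := s)) = (\<Sum>m\<le>2 * k. h m * s ^ m)"
    "(\<Sum>m\<le>2 * k. h m * (Gamma a / Gamma (a + real m / 2))) = mix_moment CARD('n) r a k (Suc j) t"
    using mix_moment_step[OF a, of j r t "CARD('n)" k] Suc.prems(1,3) by auto
  \<comment> \<open>The quadratic polynomial in the scale is recovered by interpolation at 0, 1 and
    -1, so measurability and bounds pass from its values to the coefficients
    \<open>c m\<close>.\<close>
  define q where "q s y x = D (y(?i := s *\<^sub>R x))" for s y x
  define c where "c m y x = coeff ([:q 0 y x, (q 1 y x - q (- 1) y x) / 2, (q 1 y x + q (- 1) y x) / 2 - q 0 y x:] ^ k) m" for m y x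
  have q_quad: "q s y x = ((q 1 y x + q (- 1) y x) / 2 - q 0 y x) * s\<^sup>2 + (q 1 y x - q (- 1) y x) / 2 * s + q 0 y x" for s y x
  proof -
    define z where "z = (\<lambda>i. t i *\<^sub>R (y(?i := x)) i)"
    have "q s y x = simplex_gramdet r (z(?i := s *\<^sub>R z ?i))" for s
      unfolding q_def D_def z_def by (intro arg_cong[of _ _ "simplex_gramdet r"]) (auto simp: fun_eq_iff)
    moreover obtain \<alpha> \<beta> \<gamma> where "\<And>s. simplex_gramdet r (z(?i := s *\<^sub>R z ?i)) = \<alpha> * s\<^sup>2 + \<beta> * s + \<gamma>"
      using simplex_gramdet_quadratic[of r ?i z] r i(1) by auto
    ultimately have "q s y x = \<alpha> * s\<^sup>2 + \<beta> * s + \<gamma>" for s by simp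
    then show ?thesis by (simp add: field_simps)
  qed
  have q_m: "(\<lambda>z. q s (fst z) (snd z)) \<in> borel_measurable (\<Omega> \<Otimes>\<^sub>M P)" for s
    unfolding q_def using D_m[of s] by (simp cong: measurable_cong_sets sets_pair_measure_cong add: setsP)
  \<comment> \<open>A dominating function in product form, with one factor per vertex, so that its
    powers integrate by independence.\<close>
  define W where "W y x = (\<Prod>l\<in>?J. 1 + t l * norm (y l :: real ^ 'n)) * (1 + t ?i * norm (x :: real ^ 'n))" for y x
  have t0: "0 \<le> t l" for l using Suc.prems(2)[of l] by simp
  have W1: "1 \<le> W y x" for y x
  proof -
    have "(1::real) * 1 \<le> (\<Prod>l\<in>?J. 1 + t l * norm (y l)) * (1 + t ?i * norm x)"
      using t0 by (intro mult_mono prod_ge_1) (auto intro: prod_nonneg)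
    then show ?thesis by (simp add: W_def)
  qed
  have q_le: "\<bar>q s y x\<bar> \<le> W y x ^ (2 * r)" if "\<bar>s\<bar> \<le> 1" for s y x
  proof -
    let ?z = "\<lambda>i. t i *\<^sub>R (y(?i := s *\<^sub>R x)) i"
    have "\<bar>q s y x\<bar> \<le> (\<Prod>l\<in>?I. 1 + norm (?z l)) ^ (2 * r)"
      unfolding q_def D_def using simplex_gramdet_le[of r ?z] simplex_gramdet_nonneg[of r ?z] by simp
    also have "(\<Prod>l\<in>?I. 1 + norm (?z l)) = (1 + norm (?z ?i)) * (\<Prod>l\<in>?J. 1 + norm (?z l))"
      using i by (intro prod.remove) auto
    also have "(\<Prod>l\<in>?J. 1 + norm (?z l)) = (\<Prod>l\<in>?J. 1 + t l * norm (y l))"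
      using t0 by (intro prod.cong) auto
    also have "((1 + norm (?z ?i)) * (\<Prod>l\<in>?J. 1 + t l * norm (y l))) ^ (2 * r) \<le> W y x ^ (2 * r)"
    proof (rule power_mono)
      have "\<bar>s\<bar> * norm x \<le> 1 * norm x" using that by (intro mult_right_mono) auto
      then have "t ?i * (\<bar>s\<bar> * norm x) \<le> t ?i * norm x" using t0 by (intro mult_left_mono) auto
      then have "norm (?z ?i) \<le> t ?i * norm x" using t0[of ?i] by (simp add: abs_mult)
      then have "(1 + norm (?z ?i)) * (\<Prod>l\<in>?J. 1 + t l * norm (y l)) \<le> (1 + t ?i * norm x) * (\<Prod>l\<in>?J. 1 + t l * norm (y l))"
        using t0 by (intro mult_right_mono prod_nonneg) auto
      then show "(1 + norm (?z ?i)) * (\<Prod>l\<in>?J. 1 + t l * norm (y l)) \<le> W y x"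
        by (simp only: W_def mult.commute)
      show "0 \<le> (1 + norm (?z ?i)) * (\<Prod>l\<in>?J. 1 + t l * norm (y l))"
        using t0 by (intro mult_nonneg_nonneg prod_nonneg) auto
    qed
    finally show ?thesis .
  qed
  have c_le: "\<bar>c m y x\<bar> \<le> 4 ^ k * W y x ^ (2 * r * k)" for m y x
  proof -
    let ?V = "W y x ^ (2 * r)"
    have "\<bar>c m y x\<bar> \<le> (\<bar>q 0 y x\<bar> + \<bar>(q 1 y x - q (- 1) y x) / 2\<bar> + \<bar>(q 1 y x + q (- 1) y x) / 2 - q 0 y x\<bar>) ^ k"
      unfolding c_def by (rule coeff_quadratic_power_le)
    also have "\<dots> \<le> (4 * ?V) ^ k"
    proof (rule power_mono)
      \<comment> \<open>The three terms are at most w, w and 2 w, whence the constant 4.\<close>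
      have arith: "\<bar>a\<bar> + \<bar>(b - c) / 2\<bar> + \<bar>(b + c) / 2 - a\<bar> \<le> 4 * w"
        if "\<bar>a\<bar> \<le> w" "\<bar>b\<bar> \<le> w" "\<bar>c\<bar> \<le> w" for a b c w :: real
      proof -
        have "\<bar>(b - c) / 2\<bar> \<le> w" using that unfolding abs_le_iff by (simp add: field_simps)
        moreover have "\<bar>(b + c) / 2 - a\<bar> \<le> 2 * w" using that unfolding abs_le_iff by (simp add: field_simps)
        ultimately show ?thesis using that(1) by linarith
      qed
      show "\<bar>q 0 y x\<bar> + \<bar>(q 1 y x - q (- 1) y x) / 2\<bar> + \<bar>(q 1 y x + q (- 1) y x) / 2 - q 0 y x\<bar> \<le> 4 * ?V"
        by (intro arith q_le) auto
    qed simp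
    finally show ?thesis by (simp add: power_mult_distrib power_mult)
  qed
  have c_m: "(\<lambda>z. c m (fst z) (snd z)) \<in> borel_measurable (\<Omega> \<Otimes>\<^sub>M P)" for m
    unfolding c_def
    by (intro measurable_coeff_quadratic_power borel_measurable_diff borel_measurable_add borel_measurable_divide borel_measurable_const q_m)
  have W_prod: "W y x ^ N = (\<Prod>l\<in>?J. (1 + t l * norm (y l)) ^ N) * (1 + t ?i * norm x) ^ N" for y x N
    by (simp add: W_def power_mult_distrib prod_power_distrib)
  have y_m: "(\<lambda>y. y l) \<in> borel_measurable \<Omega>" if "l \<in> ?J" for l
    using measurable_component_singleton[OF that, of "mix_law P j"] unfolding \<Omega>_def by (simp cong: measurable_cong_sets add: mixs)
  have W_int: "integrable (\<Omega> \<Otimes>\<^sub>M P) (\<lambda>z. W (fst z) (snd z) ^ N)" for N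
  proof (rule integrableI_nonneg)
    have A: "(\<lambda>y. ennreal (\<Prod>l\<in>?J. (1 + t l * norm (y l)) ^ N)) \<in> borel_measurable \<Omega>"
      by (intro measurable_compose[OF _ measurable_ennreal] borel_measurable_prod borel_measurable_power borel_measurable_add borel_measurable_const
          borel_measurable_times measurable_compose[OF _ borel_measurable_norm] y_m)
    have A': "(\<lambda>y. (\<Prod>l\<in>?J. (1 + t l * norm (y l)) ^ N)) \<in> borel_measurable \<Omega>"
      by (intro borel_measurable_prod borel_measurable_power borel_measurable_add borel_measurable_const
          borel_measurable_times measurable_compose[OF _ borel_measurable_norm] y_m)
    note [measurable] = A A'
    show m: "(\<lambda>z. W (fst z) (snd z) ^ N) \<in> borel_measurable (\<Omega> \<Otimes>\<^sub>M P)"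
      unfolding W_prod by measurable
    show "AE z in \<Omega> \<Otimes>\<^sub>M P. 0 \<le> W (fst z) (snd z) ^ N"
      by (intro AE_I2 zero_le_power order_trans[OF zero_le_one W1])
    have "(\<integral>\<^sup>+z. ennreal (W (fst z) (snd z) ^ N) \<partial>(\<Omega> \<Otimes>\<^sub>M P)) = (\<integral>\<^sup>+y. \<integral>\<^sup>+x. ennreal (W y x ^ N) \<partial>P \<partial>\<Omega>)"
      using m by (subst P.nn_integral_fst[symmetric]) auto
    also have "\<dots> = (\<integral>\<^sup>+y. \<integral>\<^sup>+x. ennreal (\<Prod>l\<in>?J. (1 + t l * norm (y l)) ^ N) * ennreal ((1 + t ?i * norm x) ^ N) \<partial>P \<partial>\<Omega>)"
      unfolding W_prod using t0 by (intro nn_integral_cong ennreal_mult' prod_nonneg zero_le_power) auto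
    also have "\<dots> = (\<integral>\<^sup>+y. ennreal (\<Prod>l\<in>?J. (1 + t l * norm (y l)) ^ N) \<partial>\<Omega>) * (\<integral>\<^sup>+x. ennreal ((1 + t ?i * norm x) ^ N) \<partial>P)"
      by (subst nn_integral_cmult, measurable, subst nn_integral_multc[OF A], rule refl)
    also have "(\<integral>\<^sup>+y. ennreal (\<Prod>l\<in>?J. (1 + t l * norm (y l)) ^ N) \<partial>\<Omega>) = (\<Prod>l\<in>?J. \<integral>\<^sup>+x. ennreal ((1 + t l * norm x) ^ N) \<partial>mix_law P j l)"
    proof -
      have "(\<integral>\<^sup>+y. ennreal (\<Prod>l\<in>?J. (1 + t l * norm (y l)) ^ N) \<partial>\<Omega>) = (\<integral>\<^sup>+y. (\<Prod>l\<in>?J. ennreal ((1 + t l * norm (y l)) ^ N)) \<partial>\<Omega>)"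
        using t0 by (intro nn_integral_cong prod_ennreal[symmetric]) auto
      also have "\<dots> = (\<Prod>l\<in>?J. \<integral>\<^sup>+x. ennreal ((1 + t l * norm x) ^ N) \<partial>mix_law P j l)"
        unfolding \<Omega>_def by (intro product_sigma_finite.product_nn_integral_prod[OF M] i(3)) measurable
      finally show ?thesis .
    qed
    also have "\<dots> * (\<integral>\<^sup>+x. ennreal ((1 + t ?i * norm x) ^ N) \<partial>P) < \<infinity>"
    proof -
      have "(\<Prod>l\<in>?J. \<integral>\<^sup>+x. ennreal ((1 + t l * norm x) ^ N) \<partial>mix_law P j l) \<noteq> \<infinity>"
        using norm_moment_finite[OF gr t0] by (auto simp: mix_law_def ennreal_prod_eq_top less_top)
      then show ?thesis using norm_moment_finite(1)[OF gr t0[of ?i], of N]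
        by (simp add: ennreal_mult_less_top less_top)
    qed
    finally show "(\<integral>\<^sup>+z. ennreal (W (fst z) (snd z) ^ N) \<partial>(\<Omega> \<Otimes>\<^sub>M P)) < \<infinity>" .
  qed
  have "(\<integral>\<^sup>+y. \<integral>\<^sup>+x. ennreal (g y x) \<partial>P \<partial>\<Omega>) = ennreal (\<Sum>m\<le>2 * k. h m * (Gamma a / Gamma (a + real m / 2)))"
  proof (rule radial_coefficient_step[OF gr \<Omega>.prob_space_axioms, where c=c])
    show "(\<lambda>(y, x). g y x) \<in> borel_measurable (\<Omega> \<Otimes>\<^sub>M borel)"
      unfolding g_def case_prod_unfold by (intro borel_measurable_power D_m1)
    show "0 \<le> g y x" for y x by (simp add: g_def D_def simplex_gramdet_nonneg)
    show "g y (s *\<^sub>R x) = (\<Sum>m\<le>2 * k. c m y x * s ^ m)" for y x s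
      unfolding g_def q_def[symmetric] c_def by (subst q_quad) (rule poly_quadratic_power)
    show "integrable (\<Omega> \<Otimes>\<^sub>M P) (\<lambda>(y, x). c m y x)" for m
    proof (rule Bochner_Integration.integrable_bound)
      show "integrable (\<Omega> \<Otimes>\<^sub>M P) (\<lambda>z. 4 ^ k * W (fst z) (snd z) ^ (2 * r * k))"
        by (intro integrable_mult_right W_int)
      show "AE z in \<Omega> \<Otimes>\<^sub>M P. norm (case z of (y, x) \<Rightarrow> c m y x) \<le> norm (4 ^ k * W (fst z) (snd z) ^ (2 * r * k))"
        using c_le by (intro AE_I2) (auto simp: case_prod_unfold intro: order_trans[OF _ abs_ge_self])
    qed (use c_m[of m] in \<open>simp add: case_prod_unfold\<close>)
    show "(\<integral>\<^sup>+y. \<integral>\<^sup>+z. ennreal (g y (s *\<^sub>R z)) \<partial>half_gaussian \<partial>\<Omega>) = ennreal (\<Sum>m\<le>2 * k. h m * s ^ m)" if s: "0 < s" for s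
    proof -
      have "(\<integral>\<^sup>+y. \<integral>\<^sup>+z. ennreal (g y (s *\<^sub>R z)) \<partial>half_gaussian \<partial>\<Omega>) =
          (\<integral>\<^sup>+x. ennreal (simplex_gramdet r (\<lambda>i. (t(?i := s)) i *\<^sub>R x i) ^ k) \<partial>(Pi\<^sub>M ?I (mix_law P j)))"
        unfolding expand g_def D_scale \<Omega>_def by (simp add: mix_law_def)
      \<comment> \<open>The induction hypothesis fixes only the scales of vertices up to j, so the
        scale of vertex \<open>Suc j\<close> may be any s > 0.\<close>
      also have "\<dots> = ennreal (mix_moment CARD('n) r a k j (t(?i := s)))"
        using Suc.prems s by (intro Suc.IH) auto
      finally show ?thesis unfolding h(1)[OF s] .
    qed
    show "0 \<le> (\<Sum>m\<le>2 * k. h m * s ^ m)" if s: "0 < s" for s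
      unfolding h(1)[OF s, symmetric] by (rule mix_moment_nonneg[OF a r(2)])
  qed
  moreover have "(\<integral>\<^sup>+x. ennreal (simplex_gramdet r (\<lambda>i. t i *\<^sub>R x i) ^ k) \<partial>(Pi\<^sub>M ?I (mix_law P (Suc j)))) =
      (\<integral>\<^sup>+y. \<integral>\<^sup>+x. ennreal (g y x) \<partial>P \<partial>\<Omega>)"
    unfolding expand \<Omega>' g_def D_def by (simp add: mix_law_def)
  ultimately show ?case by (simp only: h(2))
qed

text \<open>When all r + 1 vertices are replaced the exponential factor is 1, and the coefficient is
  a single generalised binomial coefficient with upper entry (r + 1) (a + k - 1), rewritten as a
  Pochhammer symbol.\<close>

lemma simplex_moment:
  fixes P :: "(real ^ 'n) measure"
  assumes gr: "gaussian_radial a P" and r: "1 \<le> r" "r \<le> CARD('n)"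
  shows "(\<integral>\<^sup>+x. ennreal (simplex_gramdet r x ^ k) \<partial>(\<Pi>\<^sub>M i\<in>{1..r+1}. P)) =
    ennreal (wishart_moment CARD('n) r k / pochhammer a k ^ (r + 1) *
      pochhammer (real (r + 1) * (a - 1) + real r * real k + 1) k)"
proof -
  have "(\<Pi>\<^sub>M i\<in>{1..r+1}. P) = Pi\<^sub>M {1..r+1} (mix_law P (r + 1))"
    by (intro PiM_cong) (auto simp: mix_law_def)
  then have "(\<integral>\<^sup>+x. ennreal (simplex_gramdet r x ^ k) \<partial>(\<Pi>\<^sub>M i\<in>{1..r+1}. P)) = ennreal (mix_moment CARD('n) r a k (r + 1) (\<lambda>_. 1))"
    using mixed_simplex_moment[OF gr r, of "r + 1" "\<lambda>_. 1" k] by simp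
  also have "mix_moment CARD('n) r a k (r + 1) (\<lambda>_. 1) = wishart_moment CARD('n) r k * fact k / pochhammer a k ^ (r + 1) *
      ((real (r + 1) * (a + real k - 1)) gchoose k)"
    by (simp add: mix_moment_def)
  also have "\<dots> = wishart_moment CARD('n) r k / pochhammer a k ^ (r + 1) * pochhammer (real (r + 1) * (a + real k - 1) - real k + 1) k"
    unfolding gbinomial_pochhammer' by simp
  also have "real (r + 1) * (a + real k - 1) - real k + 1 = real (r + 1) * (a - 1) + real r * real k + 1"
    by (simp add: algebra_simps)
  finally show ?thesis .
qed

section \<open>Equality of laws\<close>

text \<open>The Taylor polynomials of the two characteristic functions coincide, and for variables
  bounded by C the remainder is at most 2 (|t| C)^n / n!, which tends to 0. Equal characteristic
  functions give equal laws.\<close>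

lemma bounded_moments_determine_law:
  fixes \<mu> \<nu> :: "real measure"
  assumes \<mu>: "real_distribution \<mu>" and \<nu>: "real_distribution \<nu>"
    and b\<mu>: "AE x in \<mu>. \<bar>x\<bar> \<le> C" and b\<nu>: "AE x in \<nu>. \<bar>x\<bar> \<le> C"
    and eq: "\<And>k. (\<integral>x. x ^ k \<partial>\<mu>) = (\<integral>x. x ^ k \<partial>\<nu>)"
  shows "\<mu> = \<nu>"
proof (rule Levy_uniqueness[OF \<mu> \<nu>], rule ext)
  fix t :: real
  define c where "c n = (\<Sum>k\<le>n. ((\<i> * t)^k / fact k) * (\<integral>x. x ^ k \<partial>\<mu>))" for n :: nat
  have bound: "cmod (char \<rho> t - (\<Sum>k\<le>n. ((\<i> * t)^k / fact k) * (\<integral>x. x ^ k \<partial>\<rho>))) \<le> 2 * ((\<bar>t\<bar> * C) ^ n / fact n)"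
    if \<rho>: "real_distribution \<rho>" and b: "AE x in \<rho>. \<bar>x\<bar> \<le> C" for \<rho> n
  proof -
    interpret \<rho>: real_distribution \<rho> by fact
    have int: "integrable \<rho> (\<lambda>x. x ^ k)" for k
    proof (rule \<rho>.integrable_const_bound)
      show "AE x in \<rho>. norm (x ^ k) \<le> C ^ k"
        using b by eventually_elim (auto simp: power_abs intro: power_mono)
    qed simp
    have "(\<integral>x. \<bar>x\<bar> ^ n \<partial>\<rho>) \<le> (\<integral>x. C ^ n \<partial>\<rho>)"
    proof (rule integral_mono_AE)
      show "integrable \<rho> (\<lambda>x. \<bar>x\<bar> ^ n)" using integrable_abs[OF int[of n]] by (simp add: power_abs)
      show "AE x in \<rho>. \<bar>x\<bar> ^ n \<le> C ^ n" using b by eventually_elim (auto intro: power_mono)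
    qed simp
    then have "(\<integral>x. \<bar>x\<bar> ^ n \<partial>\<rho>) \<le> C ^ n" using \<rho>.prob_space by simp
    then have "(2 * \<bar>t\<bar> ^ n / fact n) * (\<integral>x. \<bar>x\<bar> ^ n \<partial>\<rho>) \<le> (2 * \<bar>t\<bar> ^ n / fact n) * C ^ n"
      by (intro mult_left_mono) auto
    also have "\<dots> = 2 * ((\<bar>t\<bar> * C) ^ n / fact n)" by (simp add: power_mult_distrib)
    finally show ?thesis using \<rho>.char_approx1[of n t, OF int] by linarith
  qed
  have "cmod (char \<mu> t - char \<nu> t) \<le> 4 * ((\<bar>t\<bar> * C) ^ n / fact n)" for n
  proof -
    have "char \<mu> t - char \<nu> t = (char \<mu> t - c n) - (char \<nu> t - c n)" by simp
    also have "cmod \<dots> \<le> cmod (char \<mu> t - c n) + cmod (char \<nu> t - c n)" by (rule norm_triangle_ineq4)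
    also have "\<dots> \<le> 4 * ((\<bar>t\<bar> * C) ^ n / fact n)"
      using bound[OF \<mu> b\<mu>, of n] bound[OF \<nu> b\<nu>, of n] unfolding c_def by (simp add: eq)
    finally show ?thesis .
  qed
  moreover have "(\<lambda>n. 4 * ((\<bar>t\<bar> * C) ^ n / fact n)) \<longlonglongrightarrow> 4 * 0"
    using summable_LIMSEQ_zero[OF summable_exp[of "\<bar>t\<bar> * C"]]
    by (intro tendsto_mult tendsto_const) (simp add: field_simps)
  ultimately have "cmod (char \<mu> t - char \<nu> t) \<le> 4 * 0"
    by (intro LIMSEQ_le_const) auto
  then show "char \<mu> t = char \<nu> t" by simp
qed

lemma distr_eq_of_bounded_moments:
  fixes Y :: "'a \<Rightarrow> real" and Z :: "'b \<Rightarrow> real"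
  assumes M: "prob_space M" and N: "prob_space N"
    and Y [measurable]: "Y \<in> borel_measurable M" and Z [measurable]: "Z \<in> borel_measurable N"
    and bY: "AE x in M. 0 \<le> Y x \<and> Y x \<le> C" and bZ: "AE x in N. 0 \<le> Z x \<and> Z x \<le> C"
    and eq: "\<And>k. (\<integral>\<^sup>+x. ennreal (Y x ^ k) \<partial>M) = (\<integral>\<^sup>+x. ennreal (Z x ^ k) \<partial>N)"
  shows "distr M borel Y = distr N borel Z"
proof (rule bounded_moments_determine_law)
  show "real_distribution (distr M borel Y)" "real_distribution (distr N borel Z)"
    by (simp_all add: M N prob_space.real_distribution_distr)
  show "AE x in distr M borel Y. \<bar>x\<bar> \<le> C"
    by (simp add: AE_distr_iff) (rule eventually_mono[OF bY], simp)
  show "AE x in distr N borel Z. \<bar>x\<bar> \<le> C"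
    by (simp add: AE_distr_iff) (rule eventually_mono[OF bZ], simp)
  fix k
  have "(\<integral>x. x ^ k \<partial>distr M borel Y) = enn2real (\<integral>\<^sup>+x. ennreal (Y x ^ k) \<partial>M)"
    by (subst integral_distr) (auto intro!: integral_eq_nn_integral eventually_mono[OF bY])
  moreover have "(\<integral>x. x ^ k \<partial>distr N borel Z) = enn2real (\<integral>\<^sup>+x. ennreal (Z x ^ k) \<partial>N)"
    by (subst integral_distr) (auto intro!: integral_eq_nn_integral eventually_mono[OF bZ])
  ultimately show "(\<integral>x. x ^ k \<partial>distr M borel Y) = (\<integral>x. x ^ k \<partial>distr N borel Z)" by (simp add: eq)
qed

text \<open>The Beta function, rewritten in Pochhammer symbols, has the right limit at b = 0: for m
  > 0 the factor \<open>pochhammer 0 m\<close> vanishes, as does 1 - t under the point mass at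
  1.\<close>

lemma nn_integral_beta_law:
  assumes a: "0 < a" and b: "0 \<le> b"
  shows "(\<integral>\<^sup>+t. ennreal (t ^ k * (1 - t) ^ m) \<partial>beta_law a b) =
    ennreal (pochhammer a k * pochhammer b m / pochhammer (a + b) (k + m))"
proof (cases "b = 0")
  case True
  have "pochhammer a k \<noteq> 0" using pochhammer_pos[OF a, of k] by simp
  then show ?thesis using True by (cases "m = 0") (auto simp: beta_law_def nn_integral_return pochhammer_0_left)
next
  case False
  then have b: "0 < b" using b by simp
  define G where "G = Gamma (a + b) / (Gamma a * Gamma b)"
  have G: "0 < G" using a b by (simp add: G_def Gamma_real_pos)
  let ?f = "\<lambda>t. t powr (a + real k - 1) * (1 - t) powr (b + real m - 1)"
  have "(?f has_integral Beta (a + real k) (b + real m)) {0<..<1}"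
    using has_integral_Beta_real[of "a + real k" "b + real m"] a b by (simp add: has_integral_Icc_iff_Ioo)
  then have Bint: "(\<integral>\<^sup>+t. ennreal (indicator {0<..<1} t * ?f t) \<partial>lborel) = ennreal (Beta (a + real k) (b + real m))"
    by (intro nn_integral_has_integral_lebesgue) auto
  have "(\<integral>\<^sup>+t. ennreal (t ^ k * (1 - t) ^ m) \<partial>beta_law a b) = (\<integral>\<^sup>+t. ennreal G * ennreal (indicator {0<..<1} t * ?f t) \<partial>lborel)"
    unfolding beta_law_def using b
  proof (simp, subst nn_integral_density, simp, simp, intro nn_integral_cong)
    fix t :: real
    show "ennreal (indicator {0<..<1} t * (Gamma (a + b) * t powr (a - 1) * (1 - t) powr (b - 1)) / (Gamma a * Gamma b)) * ennreal (t ^ k * (1 - t) ^ m) =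
      ennreal G * ennreal (indicator {0<..<1} t * ?f t)"
    proof (cases "t \<in> {0<..<1}")
      case True
      then have "t powr (a + real k - 1) = t powr (a - 1) * t ^ k" "(1 - t) powr (b + real m - 1) = (1 - t) powr (b - 1) * (1 - t) ^ m"
        by (simp_all add: powr_realpow[symmetric] powr_add[symmetric] algebra_simps)
      then have e: "Gamma (a + b) * t powr (a - 1) * (1 - t) powr (b - 1) / (Gamma a * Gamma b) * (t ^ k * (1 - t) ^ m) = G * ?f t"
        by (simp add: G_def)
      have "0 \<le> t ^ k * (1 - t) ^ m" using True by simp
      from ennreal_mult''[OF this, of "Gamma (a + b) * t powr (a - 1) * (1 - t) powr (b - 1) / (Gamma a * Gamma b)"]
      have "ennreal (Gamma (a + b) * t powr (a - 1) * (1 - t) powr (b - 1) / (Gamma a * Gamma b)) * ennreal (t ^ k * (1 - t) ^ m) = ennreal G * ennreal (?f t)"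
        unfolding e using G by (simp add: ennreal_mult')
      then show ?thesis using True by simp
    qed simp
  qed
  also have "\<dots> = ennreal (G * Beta (a + real k) (b + real m))"
    using G Bint by (subst nn_integral_cmult) (auto simp: ennreal_mult')
  also have "G * Beta (a + real k) (b + real m) = pochhammer a k * pochhammer b m / pochhammer (a + b) (k + m)"
  proof -
    have "Gamma (a + real k) = pochhammer a k * Gamma a" "Gamma (b + real m) = pochhammer b m * Gamma b"
      "Gamma (a + b + real (k + m)) = pochhammer (a + b) (k + m) * Gamma (a + b)"
      using a b by (auto simp: pochhammer_Gamma plus_of_nat_eq_0_imp nonpos_Ints_def Gamma_eq_zero_iff)
    moreover have "a + real k + (b + real m) = a + b + real (k + m)" by simp
    moreover have "Gamma a \<noteq> 0" "Gamma b \<noteq> 0" "Gamma (a + b) \<noteq> 0"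
      using Gamma_real_pos[OF a] Gamma_real_pos[OF b] Gamma_real_pos[OF add_pos_pos[OF a b]] by linarith+
    ultimately show ?thesis unfolding Beta_def G_def by (simp only:) (simp add: field_simps)
  qed
  finally show ?thesis .
qed

lemma AE_beta_law: "AE t in beta_law a b. 0 \<le> t \<and> t \<le> 1"
  unfolding beta_law_def by (auto simp: AE_return AE_density intro!: AE_I2 split: split_indicator)

text \<open>For \<open>n = r = 1\<close> the second parameter in the theorem may lie in \<open>(-1, 0)\<close>.  There the Gamma
  function is negative, so \<^const>\<open>ennreal\<close> cuts the density off to 0 and no random variable has this law.\<close>

lemma beta_law_negative:
  assumes "0 < a" "- 1 < b" "b < 0" "0 \<le> a + b"
  shows "emeasure (beta_law a b) UNIV = 0"
proof -
  have "b * Gamma b = Gamma (b + 1)" using assms by (intro Gamma_plus1[symmetric]) (auto elim!: nonpos_Ints_cases)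
  moreover have "0 < Gamma (b + 1)" using assms by (intro Gamma_real_pos) simp
  ultimately have "Gamma b < 0" using assms by (metis mult_neg_neg not_less_iff_gr_or_eq mult_zero_right zero_less_mult_iff order_less_asym)
  \<comment> \<open>The value a + b = 0 does occur, for spherical points in dimension 1, and there
    \<open>Gamma 0 = 0\<close> by convention.\<close>
  moreover have "0 \<le> Gamma (a + b)" using assms Gamma_real_pos[of "a + b"] by (cases "a + b = 0") auto
  moreover have "0 < Gamma a" using assms by simp
  ultimately have "Gamma (a + b) / (Gamma a * Gamma b) \<le> 0"
    by (simp add: divide_nonneg_neg mult_pos_neg)
  then have "Gamma (a + b) / (Gamma a * Gamma b) * t powr (a - 1) * (1 - t) powr (b - 1) \<le> 0" for t
    by (intro mult_nonpos_nonneg) auto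
  then have "indicator {0<..<1} t * (Gamma (a + b) / (Gamma a * Gamma b) * t powr (a - 1) * (1 - t) powr (b - 1)) \<le> 0" for t
    by (simp add: indicator_def del: times_divide_eq_left)
  then have "beta_law a b = density lborel (\<lambda>_. 0)"
    using assms unfolding beta_law_def by (simp add: ennreal_neg del: times_divide_eq_left)
  then show ?thesis by (simp add: emeasure_density)
qed

section \<open>Integrals over independent variables\<close>

lemma (in prob_space) nn_integral_indep_family:
  assumes X: "indep_vars (\<lambda>_. borel) X I" and I: "I \<noteq> {}"
    and L: "\<And>i. i \<in> I \<Longrightarrow> distr M borel (X i) = L i"
    and f: "f \<in> borel_measurable (Pi\<^sub>M I (\<lambda>_. borel))"
  shows "(\<integral>\<^sup>+\<omega>. f (\<lambda>i\<in>I. X i \<omega>) \<partial>M) = (\<integral>\<^sup>+x. f x \<partial>(Pi\<^sub>M I L))"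
proof -
  have rv: "\<And>i. i \<in> I \<Longrightarrow> random_variable borel (X i)" using X by (simp add: indep_vars_def)
  have "distr M (Pi\<^sub>M I (\<lambda>_. borel)) (\<lambda>x. \<lambda>i\<in>I. X i x) = (\<Pi>\<^sub>M i\<in>I. distr M borel (X i))"
    using indep_vars_iff_distr_eq_PiM'[where I=I and X=X and M'="\<lambda>_. borel", OF I] rv X by auto
  also have "\<dots> = Pi\<^sub>M I L" using L by (intro PiM_cong) auto
  finally have e: "Pi\<^sub>M I L = distr M (Pi\<^sub>M I (\<lambda>_. borel)) (\<lambda>x. \<lambda>i\<in>I. X i x)" by (rule sym)
  show ?thesis unfolding e using rv f by (intro nn_integral_distr[symmetric] measurable_restrict) auto
qed

lemma (in prob_space) nn_integral_indep_pair:
  assumes "indep_var borel A borel B" and f: "f \<in> borel_measurable (borel \<Otimes>\<^sub>M borel)"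
  shows "(\<integral>\<^sup>+\<omega>. f (A \<omega>, B \<omega>) \<partial>M) = (\<integral>\<^sup>+a. \<integral>\<^sup>+\<omega>. f (a, B \<omega>) \<partial>M \<partial>distr M borel A)"
proof -
  have A [measurable]: "random_variable borel A" and B [measurable]: "random_variable borel B"
    and e: "distr M borel A \<Otimes>\<^sub>M distr M borel B = distr M (borel \<Otimes>\<^sub>M borel) (\<lambda>x. (A x, B x))"
    using assms(1) by (auto simp: indep_var_distribution_eq)
  interpret B: prob_space "distr M borel B" by (rule prob_space_distr) fact
  have f': "f \<in> borel_measurable (distr M borel A \<Otimes>\<^sub>M distr M borel B)"
    using f by (simp cong: measurable_cong_sets sets_pair_measure_cong)
  have "(\<integral>\<^sup>+\<omega>. f (A \<omega>, B \<omega>) \<partial>M) = (\<integral>\<^sup>+z. f z \<partial>(distr M borel A \<Otimes>\<^sub>M distr M borel B))"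
    unfolding e by (subst nn_integral_distr) (use f in auto)
  also have "\<dots> = (\<integral>\<^sup>+a. \<integral>\<^sup>+\<omega>. f (a, B \<omega>) \<partial>M \<partial>distr M borel A)"
    unfolding B.nn_integral_fst[OF f', symmetric] using f by (intro nn_integral_cong nn_integral_distr) auto
  finally show ?thesis .
qed

lemma nn_integral_swap:
  fixes f :: "real \<Rightarrow> real \<Rightarrow> ennreal"
  assumes A: "prob_space A" "sets A = sets borel" and B: "prob_space B" "sets B = sets borel"
    and f: "(\<lambda>(x, y). f x y) \<in> borel_measurable (borel \<Otimes>\<^sub>M borel)"
  shows "(\<integral>\<^sup>+x. \<integral>\<^sup>+y. f x y \<partial>B \<partial>A) = (\<integral>\<^sup>+y. \<integral>\<^sup>+x. f x y \<partial>A \<partial>B)"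
proof -
  interpret A: prob_space A by fact
  interpret B: prob_space B by fact
  interpret pair_sigma_finite A B ..
  have "(\<lambda>(x, y). f x y) \<in> borel_measurable (A \<Otimes>\<^sub>M B)"
    using f by (simp cong: measurable_cong_sets sets_pair_measure_cong add: A B)
  then show ?thesis by (rule Fubini'[symmetric])
qed

section \<open>The Gamma identity behind the beta prime model\<close>

text \<open>With s the sum of all r + 1 variables, v the ratio of the last one to the sum of the
  others, and q the Dirichlet product of the others, sum over product equals (1 + v)^(r + 1) / (v
  s^r q). The factor (1 + \<eta>)^r replaces s by s / (1 + \<eta>), a Gamma variable of shape r
  \<alpha>. This is the role of the sum T on the right, where v becomes \<xi> and the product is T^r
  q.\<close>

lemma beta_prime_gamma_identity:
  fixes F :: "real \<Rightarrow> ennreal"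
  assumes \<alpha>: "0 < \<alpha>" and r: "1 \<le> r" and F [measurable]: "F \<in> borel_measurable borel"
  shows "(\<integral>\<^sup>+\<eta>. \<integral>\<^sup>+h. F ((1 + \<eta>) ^ r * ((\<Sum>i\<in>{1..r+1}. h i) / (\<Prod>i\<in>{1..r+1}. h i)))
        \<partial>(\<Pi>\<^sub>M i\<in>{1..r+1}. gamma_law \<alpha>) \<partial>beta_prime_law \<alpha> (real r * \<alpha>)) =
    (\<integral>\<^sup>+\<xi>. \<integral>\<^sup>+h. F (inverse \<xi> * (1 + \<xi>) ^ (r + 1) * (1 / (\<Prod>i\<in>{1..r}. h i)))
        \<partial>(\<Pi>\<^sub>M i\<in>{1..r}. gamma_law \<alpha>) \<partial>beta_prime_law \<alpha> (real r * \<alpha>))"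
proof -
  let ?B = "beta_prime_law \<alpha> (real r * \<alpha>)"
  have b: "0 < real r * \<alpha>" using \<alpha> r by simp
  obtain \<kappa> :: "real measure" where \<kappa>: "prob_space \<kappa>" and s\<kappa> [measurable_cong]: "sets \<kappa> = sets borel"
    and dir: "\<And>H :: real \<Rightarrow> real \<Rightarrow> ennreal. (\<lambda>(x, y). H x y) \<in> borel_measurable (borel \<Otimes>\<^sub>M borel) \<Longrightarrow>
      (\<integral>\<^sup>+h. H (\<Sum>i\<in>{1..r}. h i) (\<Prod>i\<in>{1..r}. h i) \<partial>(\<Pi>\<^sub>M i\<in>{1..r}. gamma_law \<alpha>)) =
      (\<integral>\<^sup>+T. \<integral>\<^sup>+q. H T (T ^ r * q) \<partial>\<kappa> \<partial>gamma_law (real r * \<alpha>))"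
    using dirichlet_decomposition[OF \<alpha> r] by blast
  interpret \<kappa>: prob_space \<kappa> by fact
  have pB: "prob_space ?B" using \<alpha> b by (rule prob_space_beta_prime_law)
  have pG: "prob_space (gamma_law (\<alpha> + real r * \<alpha>))" "prob_space (gamma_law (real r * \<alpha>))" "prob_space (gamma_law \<alpha>)"
    using \<alpha> b by (auto intro: prob_space_gamma_law)
  interpret B: prob_space ?B by fact
  interpret G\<alpha>: prob_space "gamma_law \<alpha>" by fact
  have step: "(\<integral>\<^sup>+h. F (c * ((\<Sum>i\<in>{1..r+1}. h i) / (\<Prod>i\<in>{1..r+1}. h i))) \<partial>(\<Pi>\<^sub>M i\<in>{1..r+1}. gamma_law \<alpha>)) =
      (\<integral>\<^sup>+s. \<integral>\<^sup>+v. \<integral>\<^sup>+q. F (c * ((1 + v) ^ (r + 1) / (v * (s ^ r * q)))) \<partial>\<kappa> \<partial>?B \<partial>gamma_law (\<alpha> + real r * \<alpha>))" for c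
  proof -
    interpret G: product_sigma_finite "\<lambda>_::nat. gamma_law \<alpha>" by (intro product_sigma_finite_prob pG)
    have I: "{1..r+1} = insert (r + 1) {1..r}" by auto
    have "(\<integral>\<^sup>+h. F (c * ((\<Sum>i\<in>{1..r+1}. h i) / (\<Prod>i\<in>{1..r+1}. h i))) \<partial>(\<Pi>\<^sub>M i\<in>{1..r+1}. gamma_law \<alpha>)) =
        (\<integral>\<^sup>+x. \<integral>\<^sup>+h. F (c * ((\<Sum>i\<in>{1..r+1}. (h(r + 1 := x)) i) / (\<Prod>i\<in>{1..r+1}. (h(r + 1 := x)) i))) \<partial>(\<Pi>\<^sub>M i\<in>{1..r}. gamma_law \<alpha>) \<partial>gamma_law \<alpha>)"
      unfolding I by (rule G.product_nn_integral_insert_rev) (simp, simp, measurable)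
    also have "\<dots> = (\<integral>\<^sup>+x. \<integral>\<^sup>+h. F (c * ((x + (\<Sum>i\<in>{1..r}. h i)) / (x * (\<Prod>i\<in>{1..r}. h i)))) \<partial>(\<Pi>\<^sub>M i\<in>{1..r}. gamma_law \<alpha>) \<partial>gamma_law \<alpha>)"
    proof -
      have "(\<Sum>i\<in>{1..r+1}. (h(r + 1 := x)) i) = x + (\<Sum>i\<in>{1..r}. h i)" "(\<Prod>i\<in>{1..r+1}. (h(r + 1 := x)) i) = x * (\<Prod>i\<in>{1..r}. h i)"
        for h :: "nat \<Rightarrow> real" and x
        unfolding I by (subst sum.insert prod.insert; auto intro!: arg_cong2[where f="(+)"] arg_cong2[where f="(*)"] sum.cong prod.cong)+
      then show ?thesis by (simp only:)
    qed
    also have "\<dots> = (\<integral>\<^sup>+x. \<integral>\<^sup>+T. \<integral>\<^sup>+q. F (c * ((x + T) / (x * (T ^ r * q)))) \<partial>\<kappa> \<partial>gamma_law (real r * \<alpha>) \<partial>gamma_law \<alpha>)"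
      by (intro nn_integral_cong dir[of "\<lambda>T p. F (c * ((x + T) / (x * p)))" for x]) measurable
    also have "\<dots> = (\<integral>\<^sup>+x. \<integral>\<^sup>+T. (\<lambda>s v. \<integral>\<^sup>+q. F (c * ((1 + v) ^ (r + 1) / (v * (s ^ r * q)))) \<partial>\<kappa>) (x + T) (x / T) \<partial>gamma_law (real r * \<alpha>) \<partial>gamma_law \<alpha>)"
    proof (rule nn_integral_gamma_law_cong, rule nn_integral_gamma_law_cong)
      fix x T :: real assume x: "0 < x" and T: "0 < T"
      have "1 + x / T = (x + T) / T" using T by (simp add: field_simps)
      then have "(1 + x / T) ^ (r + 1) / (x / T * (x + T) ^ r) = (x + T) / (x * T ^ r)"
        using x T by (simp add: power_divide)
      then have "(1 + x / T) ^ (r + 1) / (x / T * ((x + T) ^ r * q)) = (x + T) / (x * (T ^ r * q))" for q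
        by (metis divide_divide_eq_left mult.assoc)
      then show "(\<integral>\<^sup>+q. F (c * ((x + T) / (x * (T ^ r * q)))) \<partial>\<kappa>) = (\<lambda>s v. \<integral>\<^sup>+q. F (c * ((1 + v) ^ (r + 1) / (v * (s ^ r * q)))) \<partial>\<kappa>) (x + T) (x / T)"
        by (simp only:)
    qed
    also have "\<dots> = (\<integral>\<^sup>+s. \<integral>\<^sup>+v. \<integral>\<^sup>+q. F (c * ((1 + v) ^ (r + 1) / (v * (s ^ r * q)))) \<partial>\<kappa> \<partial>?B \<partial>gamma_law (\<alpha> + real r * \<alpha>))"
      by (rule nn_integral_gamma_sum_ratio[OF \<alpha> b]) measurable
    finally show ?thesis .
  qed
  \<comment> \<open>The common form of both sides, as a function of a single Gamma variable
    T.\<close>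
  define \<psi> where "\<psi> T = (\<integral>\<^sup>+v. \<integral>\<^sup>+q. F ((1 + v) ^ (r + 1) / (v * (T ^ r * q))) \<partial>\<kappa> \<partial>?B)" for T
  have \<psi> [measurable]: "\<psi> \<in> borel_measurable borel" unfolding \<psi>_def by measurable
  have "(\<integral>\<^sup>+\<eta>. \<integral>\<^sup>+h. F ((1 + \<eta>) ^ r * ((\<Sum>i\<in>{1..r+1}. h i) / (\<Prod>i\<in>{1..r+1}. h i))) \<partial>(\<Pi>\<^sub>M i\<in>{1..r+1}. gamma_law \<alpha>) \<partial>?B) =
      (\<integral>\<^sup>+\<eta>. \<integral>\<^sup>+s. \<psi> (s / (1 + \<eta>)) \<partial>gamma_law (\<alpha> + real r * \<alpha>) \<partial>?B)"
  proof (rule nn_integral_beta_prime_law_cong)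
    fix \<eta> :: real assume \<eta>: "0 < \<eta>"
    then have e: "(1 + v) ^ (r + 1) / (v * ((s / (1 + \<eta>)) ^ r * q)) = (1 + \<eta>) ^ r * ((1 + v) ^ (r + 1) / (v * (s ^ r * q)))" for v s q
      by (simp add: power_divide)
    show "(\<integral>\<^sup>+h. F ((1 + \<eta>) ^ r * ((\<Sum>i\<in>{1..r+1}. h i) / (\<Prod>i\<in>{1..r+1}. h i))) \<partial>(\<Pi>\<^sub>M i\<in>{1..r+1}. gamma_law \<alpha>)) =
      (\<integral>\<^sup>+s. \<psi> (s / (1 + \<eta>)) \<partial>gamma_law (\<alpha> + real r * \<alpha>))"
      unfolding step \<psi>_def e ..
  qed
  also have "\<dots> = (\<integral>\<^sup>+s. \<integral>\<^sup>+\<eta>. \<psi> (s / (1 + \<eta>)) \<partial>?B \<partial>gamma_law (\<alpha> + real r * \<alpha>))"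
    by (rule nn_integral_swap[OF pB _ pG(1)]) (simp, simp, measurable)
  \<comment> \<open>The sum-ratio identity read backwards: s and \<eta> become x + T and x / T, so s
    / (1 + \<eta>) is just T.\<close>
  also have "\<dots> = (\<integral>\<^sup>+x. \<integral>\<^sup>+T. \<psi> ((x + T) / (1 + x / T)) \<partial>gamma_law (real r * \<alpha>) \<partial>gamma_law \<alpha>)"
    by (rule nn_integral_gamma_sum_ratio[OF \<alpha> b, symmetric]) measurable
  also have "\<dots> = (\<integral>\<^sup>+x. \<integral>\<^sup>+T. \<psi> T \<partial>gamma_law (real r * \<alpha>) \<partial>gamma_law \<alpha>)"
  proof (rule nn_integral_gamma_law_cong, rule nn_integral_gamma_law_cong)
    fix x T :: real assume "0 < x" "0 < T"
    then have "(x + T) / (1 + x / T) = T" by (simp add: field_simps)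
    then show "\<psi> ((x + T) / (1 + x / T)) = \<psi> T" by simp
  qed
  also have "\<dots> = (\<integral>\<^sup>+T. \<psi> T \<partial>gamma_law (real r * \<alpha>))"
    using G\<alpha>.emeasure_space_1 by simp
  also have "\<dots> = (\<integral>\<^sup>+v. \<integral>\<^sup>+T. \<integral>\<^sup>+q. F ((1 + v) ^ (r + 1) / (v * (T ^ r * q))) \<partial>\<kappa> \<partial>gamma_law (real r * \<alpha>) \<partial>?B)"
    unfolding \<psi>_def by (rule nn_integral_swap[OF pG(2) _ pB]) (simp, simp, measurable)
  also have "\<dots> = (\<integral>\<^sup>+\<xi>. \<integral>\<^sup>+h. F (inverse \<xi> * (1 + \<xi>) ^ (r + 1) * (1 / (\<Prod>i\<in>{1..r}. h i))) \<partial>(\<Pi>\<^sub>M i\<in>{1..r}. gamma_law \<alpha>) \<partial>?B)"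
  proof (rule nn_integral_cong)
    fix v :: real
    have "inverse v * (1 + v) ^ (r + 1) * (1 / p) = (1 + v) ^ (r + 1) / (v * p)" for p
      by (simp add: field_simps)
    then show "(\<integral>\<^sup>+T. \<integral>\<^sup>+q. F ((1 + v) ^ (r + 1) / (v * (T ^ r * q))) \<partial>\<kappa> \<partial>gamma_law (real r * \<alpha>)) =
      (\<integral>\<^sup>+h. F (inverse v * (1 + v) ^ (r + 1) * (1 / (\<Prod>i\<in>{1..r}. h i))) \<partial>(\<Pi>\<^sub>M i\<in>{1..r}. gamma_law \<alpha>))"
      by (simp only:) (rule dir[of "\<lambda>T p. F ((1 + v) ^ (r + 1) / (v * p))", symmetric], measurable)
  qed
  finally show ?thesis .
qed

text \<open>Given h, the vertices are Gaussian with standard deviations 1 / sqrt(2 h_i). The product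
  of variances is the inverse of 2^(r + 1) times the product of the h_i, and the total precision is
  twice their sum.\<close>

lemma nn_integral_beta_prime_simplex:
  fixes g :: "real \<Rightarrow> ennreal"
  assumes \<nu>: "0 < \<nu>" and r: "r \<le> CARD('n)" and g [measurable]: "g \<in> borel_measurable borel"
  shows "(\<integral>\<^sup>+x. g (simplex_gramdet r x) \<partial>(\<Pi>\<^sub>M i\<in>{1..r+1}. (beta_prime_model \<nu> :: (real ^ 'n) measure))) =
    (\<integral>\<^sup>+h. \<integral>\<^sup>+q. g ((\<Sum>i\<in>{1..r+1}. h i) / (\<Prod>i\<in>{1..r+1}. h i) * ((\<Prod>k<r. q k) / 2 ^ r))
      \<partial>(\<Pi>\<^sub>M k\<in>{..<r}. chi_squared_law (CARD('n) - k)) \<partial>(\<Pi>\<^sub>M i\<in>{1..r+1}. gamma_law (\<nu> / 2)))"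
proof -
  let ?I = "{1..r+1}" and ?G = "gaussian_model :: (real ^ 'n) measure" and ?P = "beta_prime_model \<nu> :: (real ^ 'n) measure"
  have sets: "sets ?G = sets borel" "sets ?P = sets borel" by simp_all
  note [measurable_cong] = sets
  have meas: "(\<lambda>x. g (simplex_gramdet r x)) \<in> borel_measurable (\<Pi>\<^sub>M i\<in>?I. ?P)"
    by (intro measurable_compose[OF _ g] measurable_simplex_gramdet measurable_PiM_component) (auto cong: measurable_cong_sets)
  have "(\<integral>\<^sup>+x. g (simplex_gramdet r x) \<partial>(\<Pi>\<^sub>M i\<in>?I. ?P)) =
      (\<integral>\<^sup>+h. \<integral>\<^sup>+z. g (simplex_gramdet r (\<lambda>i\<in>?I. (1 / sqrt (2 * h i)) *\<^sub>R z i)) \<partial>(\<Pi>\<^sub>M i\<in>?I. ?G) \<partial>(\<Pi>\<^sub>M i\<in>?I. gamma_law (\<nu> / 2)))"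
  proof (rule nn_integral_PiM_mixture[where A="\<lambda>_. gamma_law (\<nu> / 2)" and B="\<lambda>_. ?G" and P="\<lambda>_. ?P" and \<phi>="\<lambda>_ h z. (1 / sqrt (2 * h)) *\<^sub>R z"])
    show "(\<lambda>(a, b). (1 / sqrt (2 * a)) *\<^sub>R b) \<in> gamma_law (\<nu> / 2) \<Otimes>\<^sub>M ?G \<rightarrow>\<^sub>M ?P"
      by measurable
    fix f :: "real ^ 'n \<Rightarrow> ennreal" assume "f \<in> borel_measurable ?P"
    then have "f \<in> borel_measurable borel" by (simp cong: measurable_cong_sets)
    then show "(\<integral>\<^sup>+x. f x \<partial>?P) = (\<integral>\<^sup>+a. \<integral>\<^sup>+b. f ((1 / sqrt (2 * a)) *\<^sub>R b) \<partial>?G \<partial>gamma_law (\<nu> / 2))"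
      by (rule nn_integral_beta_prime_model[OF \<nu>])
  qed (use \<nu> meas in \<open>simp_all add: prob_space_gamma_law prob_space_gaussian_model prob_space_beta_prime_model\<close>)
  also have "\<dots> = (\<integral>\<^sup>+h. \<integral>\<^sup>+q. g ((\<Sum>i\<in>?I. h i) / (\<Prod>i\<in>?I. h i) * ((\<Prod>k<r. q k) / 2 ^ r))
      \<partial>(\<Pi>\<^sub>M k\<in>{..<r}. chi_squared_law (CARD('n) - k)) \<partial>(\<Pi>\<^sub>M i\<in>?I. gamma_law (\<nu> / 2)))"
  proof (rule nn_integral_cong_AE)
    have "AE h in (\<Pi>\<^sub>M i\<in>?I. gamma_law (\<nu> / 2)). \<forall>i\<in>?I. 0 < h i"
      using \<nu> by (subst AE_finite_all) (auto intro!: AE_PiM_component[where P="\<lambda>x. 0 < x"] prob_space_gamma_law AE_gamma_law_pos)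
    then show "AE h in (\<Pi>\<^sub>M i\<in>?I. gamma_law (\<nu> / 2)).
      (\<integral>\<^sup>+z. g (simplex_gramdet r (\<lambda>i\<in>?I. (1 / sqrt (2 * h i)) *\<^sub>R z i)) \<partial>(\<Pi>\<^sub>M i\<in>?I. ?G)) =
      (\<integral>\<^sup>+q. g ((\<Sum>i\<in>?I. h i) / (\<Prod>i\<in>?I. h i) * ((\<Prod>k<r. q k) / 2 ^ r)) \<partial>(\<Pi>\<^sub>M k\<in>{..<r}. chi_squared_law (CARD('n) - k)))"
    proof eventually_elim
      case (elim h)
      \<comment> \<open>The value 1 outside the vertex range meets the requirement of the Gaussian
        theorem that all deviations be positive.\<close>
      define t where "t i = (if i \<in> ?I then 1 / sqrt (2 * h i) else 1)" for i
      have t: "0 < t i" for i using elim by (simp add: t_def)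
      have cancel: "1 / (2 ^ (r + 1) * (\<Prod>i\<in>?I. h i)) * (2 * (\<Sum>i\<in>?I. h i)) * p = (\<Sum>i\<in>?I. h i) / (\<Prod>i\<in>?I. h i) * (p / 2 ^ r)" for p
      proof -
        have "1 / (2 * A * B) * (2 * S) * p = S / B * (p / A)" for A B S :: real by simp
        from this[of "2 ^ r" "\<Prod>i\<in>?I. h i" "\<Sum>i\<in>?I. h i"] show ?thesis by (simp only: Suc_eq_plus1[symmetric] power_Suc)
      qed
      have "simplex_gramdet r (\<lambda>i\<in>?I. (1 / sqrt (2 * h i)) *\<^sub>R z i) = simplex_gramdet r (\<lambda>i. t i *\<^sub>R z i)" for z :: "nat \<Rightarrow> real ^ 'n"
        using r by (intro simplex_gramdet_set_cong) (auto simp: t_def)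
      then have "(\<integral>\<^sup>+z. g (simplex_gramdet r (\<lambda>i\<in>?I. (1 / sqrt (2 * h i)) *\<^sub>R z i)) \<partial>(\<Pi>\<^sub>M i\<in>?I. ?G)) =
          (\<integral>\<^sup>+q. g ((\<Prod>i\<in>?I. (t i)\<^sup>2) * prec t (r + 1) * (\<Prod>k<r. q k)) \<partial>(\<Pi>\<^sub>M k\<in>{..<r}. chi_squared_law (CARD('n) - k)))"
        using nn_integral_gaussian_simplex[OF t r g] by (simp only:)
      also have "(\<Prod>i\<in>?I. (t i)\<^sup>2) = (\<Prod>i\<in>?I. 1 / (2 * h i))"
        using elim by (intro prod.cong refl) (auto simp: t_def power_divide less_imp_le)
      also have "\<dots> = 1 / (2 ^ (r + 1) * (\<Prod>i\<in>?I. h i))" unfolding prod_dividef prod.distrib by simp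
      also have "prec t (r + 1) = 2 * (\<Sum>i\<in>?I. h i)"
        unfolding prec_def sum_distrib_left using elim by (intro sum.cong refl) (auto simp: t_def power_divide less_imp_le)
      finally show ?case by (simp only: cancel)
    qed
  qed
  finally show ?thesis .
qed

lemma nn_integral_chi_squared_reindex:
  fixes g :: "real \<Rightarrow> ennreal"
  assumes r: "r \<le> n" and [measurable]: "g \<in> borel_measurable borel"
  shows "(\<integral>\<^sup>+q. g (\<Prod>k<r. q k) \<partial>(\<Pi>\<^sub>M k\<in>{..<r}. chi_squared_law (n - k))) =
    (\<integral>\<^sup>+q. g (\<Prod>j\<in>{1..r}. q j) \<partial>(\<Pi>\<^sub>M j\<in>{1..r}. chi_squared_law (n - r + j)))"
proof -
  let ?M = "\<lambda>j. chi_squared_law (n - r + j)"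
  have "(\<Pi>\<^sub>M k\<in>{..<r}. chi_squared_law (n - k)) = (\<Pi>\<^sub>M k\<in>{..<r}. ?M (r - k))"
    using r by (intro PiM_cong) auto
  also have "\<dots> = distr (Pi\<^sub>M {1..r} ?M) (\<Pi>\<^sub>M k\<in>{..<r}. ?M (r - k)) (\<lambda>q. \<lambda>k\<in>{..<r}. q (r - k))"
    by (intro distr_PiM_reindex[symmetric] prob_space_chi_squared_law) (auto simp: inj_on_def)
  finally have e: "(\<Pi>\<^sub>M k\<in>{..<r}. chi_squared_law (n - k)) = distr (Pi\<^sub>M {1..r} ?M) (\<Pi>\<^sub>M k\<in>{..<r}. ?M (r - k)) (\<lambda>q. \<lambda>k\<in>{..<r}. q (r - k))" .
  have "(\<integral>\<^sup>+q. g (\<Prod>k<r. q k) \<partial>(\<Pi>\<^sub>M k\<in>{..<r}. chi_squared_law (n - k))) =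
      (\<integral>\<^sup>+q. g (\<Prod>k<r. (\<lambda>k\<in>{..<r}. q (r - k)) k) \<partial>Pi\<^sub>M {1..r} ?M)"
    unfolding e by (rule nn_integral_distr) (auto intro!: measurable_restrict measurable_component_singleton)
  moreover have "(\<Prod>k<r. (\<lambda>k\<in>{..<r}. q (r - k)) k) = (\<Prod>j\<in>{1..r}. q j)" for q :: "nat \<Rightarrow> real"
    by (rule prod.reindex_bij_witness[of _ "\<lambda>j. r - j" "\<lambda>k. r - k"]) auto
  ultimately show ?thesis by (simp only:)
qed

lemma nn_integral_chi_squared_prod:
  fixes g :: "real \<Rightarrow> ennreal"
  assumes g [measurable]: "g \<in> borel_measurable borel"
  shows "(\<integral>\<^sup>+q. g (\<Prod>j\<in>{1..r}. q j) \<partial>(\<Pi>\<^sub>M j\<in>{1..r}. chi_squared_law (m + j))) =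
    (\<integral>\<^sup>+x. g (2 ^ r * (\<Prod>j\<in>{1..r}. x j)) \<partial>(\<Pi>\<^sub>M j\<in>{1..r}. gamma_law (real (m + j) / 2)))"
proof -
  \<comment> \<open>The point masses \<open>?B\<close> are a dummy second variable. The mixture
    lemma asks for probability measures at every index; \<open>max 1 j\<close> keeps the Gamma shape
    positive at index 0 and changes nothing on {1..r}.\<close>
  let ?A = "\<lambda>j. gamma_law (real (m + max 1 j) / 2)" and ?B = "\<lambda>_::nat. return borel (0::real)" and ?P = "\<lambda>j. chi_squared_law (m + max 1 j)"
  have pB: "prob_space (?B i)" for i by (rule prob_space_return) simp
  interpret B: prob_space "Pi\<^sub>M {1..r} ?B" by (intro prob_space_PiM pB)
  have sB: "sets (?B i) = sets borel" for i by simp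
  have "(\<integral>\<^sup>+q. g (\<Prod>j\<in>{1..r}. q j) \<partial>(\<Pi>\<^sub>M j\<in>{1..r}. chi_squared_law (m + j))) = (\<integral>\<^sup>+q. g (\<Prod>j\<in>{1..r}. q j) \<partial>Pi\<^sub>M {1..r} ?P)"
    by (intro nn_integral_cong_simp arg_cong2[where f="nn_integral"] PiM_cong refl) (auto simp: max_def)
  also have "\<dots> = (\<integral>\<^sup>+x. \<integral>\<^sup>+y. g (\<Prod>j\<in>{1..r}. (\<lambda>j\<in>{1..r}. 2 * x j) j) \<partial>Pi\<^sub>M {1..r} ?B \<partial>Pi\<^sub>M {1..r} ?A)"
  proof (rule nn_integral_PiM_mixture[where A="?A" and B="?B" and P="?P" and \<phi>="\<lambda>_ x y. 2 * x"])
    fix i and f :: "real \<Rightarrow> ennreal" assume "f \<in> borel_measurable (?P i)"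
    then have f: "f \<in> borel_measurable borel" by (simp cong: measurable_cong_sets)
    show "(\<integral>\<^sup>+x. f x \<partial>?P i) = (\<integral>\<^sup>+a. \<integral>\<^sup>+b. f (2 * a) \<partial>?B i \<partial>?A i)"
      using nn_integral_chi_squared_law[of "m + max 1 i", OF _ f] prob_space.emeasure_space_1[OF pB] by simp
  next
    fix i show "(\<lambda>(a, b). 2 * a) \<in> ?A i \<Otimes>\<^sub>M ?B i \<rightarrow>\<^sub>M ?P i" by measurable
  next
    fix i show "prob_space (?A i)" by (rule prob_space_gamma_law) simp
  qed (simp_all add: pB prob_space_chi_squared_law)
  also have "\<dots> = (\<integral>\<^sup>+x. g (\<Prod>j\<in>{1..r}. 2 * x j) \<partial>Pi\<^sub>M {1..r} ?A)"
    using B.emeasure_space_1 by simp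
  also have "\<dots> = (\<integral>\<^sup>+x. g (2 ^ r * (\<Prod>j\<in>{1..r}. x j)) \<partial>(\<Pi>\<^sub>M j\<in>{1..r}. gamma_law (real (m + j) / 2)))"
    unfolding prod.distrib by (intro arg_cong2[where f="nn_integral"] PiM_cong refl) (auto simp: max_def)
  finally show ?thesis .
qed

text \<open>Each factor is a ratio of independent Gamma variables. Since all denominators have the
  same shape c, they form the kind of family to which the Dirichlet decomposition applies.\<close>

lemma nn_integral_beta_prime_prod:
  fixes g :: "real \<Rightarrow> ennreal"
  assumes c: "0 < c" and g [measurable]: "g \<in> borel_measurable borel"
  shows "(\<integral>\<^sup>+b. g (\<Prod>j\<in>{1..r}. b j) \<partial>(\<Pi>\<^sub>M j\<in>{1..r}. beta_prime_law (real (m + j) / 2) c)) =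
    (\<integral>\<^sup>+h. \<integral>\<^sup>+x. g (1 / (\<Prod>j\<in>{1..r}. h j) * (\<Prod>j\<in>{1..r}. x j))
      \<partial>(\<Pi>\<^sub>M j\<in>{1..r}. gamma_law (real (m + j) / 2)) \<partial>(\<Pi>\<^sub>M j\<in>{1..r}. gamma_law c))"
proof -
  let ?B = "\<lambda>j. gamma_law (real (m + max 1 j) / 2)" and ?P = "\<lambda>j. beta_prime_law (real (m + max 1 j) / 2) c"
  have "(\<integral>\<^sup>+b. g (\<Prod>j\<in>{1..r}. b j) \<partial>(\<Pi>\<^sub>M j\<in>{1..r}. beta_prime_law (real (m + j) / 2) c)) = (\<integral>\<^sup>+b. g (\<Prod>j\<in>{1..r}. b j) \<partial>Pi\<^sub>M {1..r} ?P)"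
    by (intro arg_cong2[where f="nn_integral"] PiM_cong refl) (auto simp: max_def)
  also have "\<dots> = (\<integral>\<^sup>+h. \<integral>\<^sup>+x. g (\<Prod>j\<in>{1..r}. (\<lambda>j\<in>{1..r}. x j / h j) j) \<partial>Pi\<^sub>M {1..r} ?B \<partial>(\<Pi>\<^sub>M j\<in>{1..r}. gamma_law c))"
  proof (rule nn_integral_PiM_mixture[where A="\<lambda>_. gamma_law c" and B="?B" and P="?P" and \<phi>="\<lambda>_ h x. x / h"])
    fix i and f :: "real \<Rightarrow> ennreal" assume "f \<in> borel_measurable (?P i)"
    then have [measurable]: "f \<in> borel_measurable borel" by (simp cong: measurable_cong_sets)
    have "(\<integral>\<^sup>+v. f v \<partial>?P i) = (\<integral>\<^sup>+x. \<integral>\<^sup>+h. f (x / h) \<partial>gamma_law c \<partial>?B i)"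
      using c by (intro nn_integral_gamma_ratio[symmetric]) auto
    also have "\<dots> = (\<integral>\<^sup>+h. \<integral>\<^sup>+x. f (x / h) \<partial>?B i \<partial>gamma_law c)"
      using c by (intro nn_integral_swap prob_space_gamma_law) auto
    finally show "(\<integral>\<^sup>+v. f v \<partial>?P i) = (\<integral>\<^sup>+h. \<integral>\<^sup>+x. f (x / h) \<partial>?B i \<partial>gamma_law c)" .
  next
    fix i show "(\<lambda>(h, x). x / h) \<in> gamma_law c \<Otimes>\<^sub>M ?B i \<rightarrow>\<^sub>M ?P i" by measurable
  next
    fix i show "prob_space (?B i)" by (rule prob_space_gamma_law) simp
  next
    fix i show "prob_space (?P i)" using c by (intro prob_space_beta_prime_law) auto
  qed (simp_all add: c prob_space_gamma_law)
  also have "\<dots> = (\<integral>\<^sup>+h. \<integral>\<^sup>+x. g (1 / (\<Prod>j\<in>{1..r}. h j) * (\<Prod>j\<in>{1..r}. x j)) \<partial>Pi\<^sub>M {1..r} ?B \<partial>(\<Pi>\<^sub>M j\<in>{1..r}. gamma_law c))"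
    by (simp add: prod_dividef)
  also have "Pi\<^sub>M {1..r} ?B = (\<Pi>\<^sub>M j\<in>{1..r}. gamma_law (real (m + j) / 2))"
    by (intro PiM_cong refl) (auto simp: max_def)
  finally show ?thesis .
qed

section \<open>Random simplices in the four models\<close>

context
  fixes M :: "'m measure" and X :: "nat \<Rightarrow> 'm \<Rightarrow> real ^ 'n" and V :: "'m \<Rightarrow> real" and P :: "(real ^ 'n) measure" and r :: nat
  assumes M: "prob_space M" and r: "r \<le> CARD('n)"
    and X: "prob_space.indep_vars M (\<lambda>_. borel) X {1..r+1}"
    and V: "\<And>\<omega>. V \<omega> = simplex_volume r (\<lambda>i. X i \<omega>)"
begin

lemma simplex_volume_square: "(fact r * V \<omega>)\<^sup>2 = simplex_gramdet r (\<lambda>i. X i \<omega>)"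
  using simplex_volume_eq[of r "\<lambda>i. X i \<omega>"] simplex_gramdet_nonneg[of r "\<lambda>i. X i \<omega>"] r
  by (simp add: V power_mult_distrib power_divide)

lemma vertex_measurable: "i \<in> {1..r+1} \<Longrightarrow> X i \<in> borel_measurable M"
  using X by (simp add: prob_space.indep_vars_def[OF M])

lemma simplex_volume_measurable: "V \<in> borel_measurable M"
proof -
  have "V = (\<lambda>\<omega>. sqrt (simplex_gramdet r (\<lambda>i. X i \<omega>)) / fact r)"
    by (rule ext) (use r in \<open>simp add: V simplex_volume_eq\<close>)
  moreover have "(\<lambda>\<omega>. simplex_gramdet r (\<lambda>i. X i \<omega>)) \<in> borel_measurable M"
    by (intro measurable_simplex_gramdet vertex_measurable)
  ultimately show ?thesis by simp
qed

lemma nn_integral_simplex_volume: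
  assumes dX: "\<And>i. i \<in> {1..r+1} \<Longrightarrow> distr M borel (X i) = P" and f: "f \<in> borel_measurable borel"
  shows "(\<integral>\<^sup>+\<omega>. f ((fact r * V \<omega>)\<^sup>2) \<partial>M) = (\<integral>\<^sup>+x. f (simplex_gramdet r x) \<partial>(\<Pi>\<^sub>M i\<in>{1..r+1}. P))"
proof -
  have "simplex_gramdet r (\<lambda>i. X i \<omega>) = simplex_gramdet r (\<lambda>i\<in>{1..r+1}. X i \<omega>)" for \<omega>
    using r by (intro simplex_gramdet_set_cong) auto
  then have "(\<integral>\<^sup>+\<omega>. f ((fact r * V \<omega>)\<^sup>2) \<partial>M) = (\<integral>\<^sup>+\<omega>. f (simplex_gramdet r (\<lambda>i\<in>{1..r+1}. X i \<omega>)) \<partial>M)"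
    unfolding simplex_volume_square by simp
  also have "\<dots> = (\<integral>\<^sup>+x. f (simplex_gramdet r x) \<partial>(\<Pi>\<^sub>M i\<in>{1..r+1}. P))"
    by (rule prob_space.nn_integral_indep_family[OF M X _ dX])
      (auto intro!: measurable_compose[OF _ f] measurable_simplex_gramdet measurable_component_singleton)
  finally show ?thesis .
qed

end

lemma wishart_moment_reindex:
  assumes "r \<le> n"
  shows "(\<Prod>j\<in>{1..r}. pochhammer ((real n - real r + real j) / 2) k) = wishart_moment n r k"
  unfolding wishart_moment_def
  by (rule prod.reindex_bij_witness[of _ "\<lambda>i. r - i" "\<lambda>j. r - j"]) (use assms in \<open>auto simp: of_nat_diff algebra_simps\<close>)

lemma AE_beta_distributed:
  assumes "Y \<in> borel_measurable L" "distr L borel Y = beta_law c d"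
  shows "AE \<omega> in L. 0 \<le> Y \<omega> \<and> Y \<omega> \<le> 1"
proof -
  have "AE t in distr L borel Y. 0 \<le> t \<and> t \<le> 1" unfolding assms(2) by (rule AE_beta_law)
  then show ?thesis using assms(1) by (subst (asm) AE_distr_iff) auto
qed

lemma nn_integral_beta_distributed:
  assumes "Y \<in> borel_measurable L" "distr L borel Y = beta_law c d" "0 < c" "0 \<le> d"
  shows "(\<integral>\<^sup>+\<omega>. ennreal (Y \<omega> ^ k * (1 - Y \<omega>) ^ m) \<partial>L) =
    ennreal (pochhammer c k * pochhammer d m / pochhammer (c + d) (k + m))"
  unfolding nn_integral_beta_law[OF assms(3,4), symmetric] assms(2)[symmetric]
  using assms(1) by (subst nn_integral_distr) auto

text \<open>Treats the beta model, with a = (n + \<nu>) / 2, and the spherical model, with a = n /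
  2, together. In both, the two parameters of each \<beta> j add up to a, so its k-th moment has
  denominator (a)_k; the r of them match the powers of 1 / (a)_k left over on the left.\<close>

lemma bounded_model_law:
  fixes M :: "'m measure" and N :: "'k measure" and X :: "nat \<Rightarrow> 'm \<Rightarrow> real ^ 'n" and a :: real and r :: nat
  defines "b \<equiv> real r * (a - 1)"
  assumes M: "prob_space M" and N: "prob_space N"
    and r: "1 \<le> r" "r \<le> CARD('n)"
    and X: "prob_space.indep_vars M (\<lambda>_. borel) X {1..r+1}"
    and V: "\<And>\<omega>. V \<omega> = simplex_volume r (\<lambda>i. X i \<omega>)"
    and gr: "gaussian_radial a P" and dX: "\<And>i. i \<in> {1..r+1} \<Longrightarrow> distr M borel (X i) = P"
    and a: "real CARD('n) / 2 \<le> a" and b: "- 1 < b" "0 \<le> a + b"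
    and d\<xi>: "distr M borel \<xi> = beta_law a b" and d\<eta>: "distr N borel \<eta> = beta_law a b"
    and d\<beta>: "\<And>j. j \<in> {1..r} \<Longrightarrow> distr N borel (\<beta> j) =
      beta_law ((real CARD('n) - real r + real j) / 2) (a - (real CARD('n) - real r + real j) / 2)"
    and ind\<xi>: "prob_space.indep_var M borel \<xi> borel V"
    and ind\<eta>: "indep_of_indep_family N r \<eta> \<beta>"
  shows "eq_in_law M (\<lambda>\<omega>. \<xi> \<omega> * (1 - \<xi> \<omega>) ^ r * (fact r * V \<omega>)\<^sup>2)
    N (\<lambda>\<omega>. (1 - \<eta> \<omega>) ^ r * (\<Prod>j=1..r. \<beta> j \<omega>))"
proof -
  interpret M: prob_space M by fact
  interpret N: prob_space N by fact
  let ?n = "CARD('n)"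
  let ?D = "\<lambda>\<omega>. (fact r * V \<omega>)\<^sup>2"
  have a0: "0 < a" and P: "prob_space P" and setsP: "sets P = sets borel" and P1: "AE x in P. norm x \<le> 1"
    using gr by (auto simp: gaussian_radial_def)
  have V_m [measurable]: "V \<in> borel_measurable M" using simplex_volume_measurable[OF M r(2) X V] .
  have \<xi>_m [measurable]: "\<xi> \<in> borel_measurable M" using M.indep_var_rv1[OF ind\<xi>] .
  have fam: "N.indep_vars (\<lambda>_. borel) (\<beta>(0 := \<eta>)) {0..r}" using ind\<eta> by (simp add: indep_of_indep_family_def)
  have fam_m: "i \<in> {0..r} \<Longrightarrow> (\<beta>(0 := \<eta>)) i \<in> borel_measurable N" for i using fam by (simp add: N.indep_vars_def)
  have \<eta>_m [measurable]: "\<eta> \<in> borel_measurable N" using fam_m[of 0] by simp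
  have \<beta>_m [measurable]: "\<beta> j \<in> borel_measurable N" if "j \<in> {1..r}" for j using fam_m[of j] that by simp
  \<comment> \<open>A negative second parameter would make the law of \<xi> the zero measure,
    although it is the distribution of a variable on a probability space.\<close>
  have b0: "0 \<le> b"
  proof (rule ccontr)
    assume "\<not> 0 \<le> b"
    then have "emeasure (distr M borel \<xi>) UNIV = 0" unfolding d\<xi> using a0 b by (intro beta_law_negative) auto
    moreover have "emeasure (distr M borel \<xi>) UNIV = 1" using M.emeasure_space_1 by (simp add: emeasure_distr)
    ultimately show False by simp
  qed
  have pb: "0 \<le> pochhammer b m" for m
    using b0 by (cases "b = 0") (auto simp: pochhammer_0_left intro: pochhammer_nonneg)
  have \<alpha>: "0 < (real ?n - real r + real j) / 2" "0 \<le> a - (real ?n - real r + real j) / 2" if "j \<in> {1..r}" for j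
    using that r(2) a by auto
  show ?thesis
    unfolding eq_in_law_def
  proof (intro conjI)
    show Y_m: "(\<lambda>\<omega>. \<xi> \<omega> * (1 - \<xi> \<omega>) ^ r * (fact r * V \<omega>)\<^sup>2) \<in> borel_measurable M" by measurable
    show Z_m: "(\<lambda>\<omega>. (1 - \<eta> \<omega>) ^ r * (\<Prod>j=1..r. \<beta> j \<omega>)) \<in> borel_measurable N"
      by (intro borel_measurable_times borel_measurable_prod \<beta>_m) auto
    \<comment> \<open>The determinant bound when each of the r + 1 factors 1 + norm is at most
      2.\<close>
    define C :: real where "C = (2 ^ (r + 1)) ^ (2 * r)"
    have C: "1 \<le> C" unfolding C_def by (intro one_le_power) simp
    have AE\<beta>: "AE \<omega> in N. \<forall>j\<in>{1..r}. 0 \<le> \<beta> j \<omega> \<and> \<beta> j \<omega> \<le> 1"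
      by (subst AE_finite_all, simp, intro ballI AE_beta_distributed[OF \<beta>_m d\<beta>]) assumption+
    have AE\<eta>: "AE \<omega> in N. 0 \<le> \<eta> \<omega> \<and> \<eta> \<omega> \<le> 1" using AE_beta_distributed[OF \<eta>_m d\<eta>] .
    have AE\<xi>: "AE \<omega> in M. 0 \<le> \<xi> \<omega> \<and> \<xi> \<omega> \<le> 1" using AE_beta_distributed[OF \<xi>_m d\<xi>] .
    have AEX: "AE \<omega> in M. \<forall>i\<in>{1..r+1}. norm (X i \<omega>) \<le> 1"
    proof (subst AE_finite_all, simp, intro ballI)
      fix i assume i: "i \<in> {1..r+1}"
      have "AE x in distr M borel (X i). norm x \<le> 1" using P1 by (simp only: dX[OF i])
      then show "AE \<omega> in M. norm (X i \<omega>) \<le> 1"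
        using vertex_measurable[OF M r(2) X V i] by (subst (asm) AE_distr_iff) auto
    qed
    show "distr M borel (\<lambda>\<omega>. \<xi> \<omega> * (1 - \<xi> \<omega>) ^ r * (fact r * V \<omega>)\<^sup>2) = distr N borel (\<lambda>\<omega>. (1 - \<eta> \<omega>) ^ r * (\<Prod>j=1..r. \<beta> j \<omega>))"
    proof (rule distr_eq_of_bounded_moments[OF M N Y_m Z_m])
      show "AE \<omega> in M. 0 \<le> \<xi> \<omega> * (1 - \<xi> \<omega>) ^ r * (fact r * V \<omega>)\<^sup>2 \<and> \<xi> \<omega> * (1 - \<xi> \<omega>) ^ r * (fact r * V \<omega>)\<^sup>2 \<le> C"
        using AE\<xi> AEX
      proof eventually_elim
        case (elim \<omega>)
        have "?D \<omega> \<le> (\<Prod>i\<in>{1..r+1}. 1 + norm (X i \<omega>)) ^ (2 * r)"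
          unfolding simplex_volume_square[OF M r(2) X V] by (rule simplex_gramdet_le)
        also have "\<dots> \<le> (\<Prod>i\<in>{1..r+1}. 2) ^ (2 * r)"
          using elim(2) by (intro power_mono prod_mono prod_nonneg) (auto simp del: One_nat_def)
        also have "\<dots> = C" by (simp add: C_def)
        finally have D: "?D \<omega> \<le> C" .
        have p: "0 \<le> (1 - \<xi> \<omega>) ^ r" "(1 - \<xi> \<omega>) ^ r \<le> 1" using elim(1) by (auto intro: power_le_one)
        then have "\<xi> \<omega> * (1 - \<xi> \<omega>) ^ r \<le> 1 * 1" using elim(1) by (intro mult_mono) auto
        then have "\<xi> \<omega> * (1 - \<xi> \<omega>) ^ r * ?D \<omega> \<le> 1 * C" using D elim(1) p by (intro mult_mono) auto
        then show ?case using elim(1) p by simp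
      qed
      show "AE \<omega> in N. 0 \<le> (1 - \<eta> \<omega>) ^ r * (\<Prod>j=1..r. \<beta> j \<omega>) \<and> (1 - \<eta> \<omega>) ^ r * (\<Prod>j=1..r. \<beta> j \<omega>) \<le> C"
        using AE\<eta> AE\<beta>
      proof eventually_elim
        case (elim \<omega>)
        have p: "0 \<le> (1 - \<eta> \<omega>) ^ r" "(1 - \<eta> \<omega>) ^ r \<le> 1" using elim(1) by (auto intro: power_le_one)
        have q: "0 \<le> (\<Prod>j=1..r. \<beta> j \<omega>)" "(\<Prod>j=1..r. \<beta> j \<omega>) \<le> 1"
          using elim(2) by (auto intro!: prod_nonneg prod_le_1 simp del: One_nat_def)
        have "(1 - \<eta> \<omega>) ^ r * (\<Prod>j=1..r. \<beta> j \<omega>) \<le> 1 * 1" using p q by (intro mult_mono) auto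
        then show ?case using p q C by simp
      qed
      fix k
      define W where "W = wishart_moment ?n r k"
      let ?S = "pochhammer (a + b + real (r * k)) k"
      have W: "0 \<le> W" unfolding W_def using wishart_moment_pos[OF r(2), of k] by simp
      have "(\<integral>\<^sup>+\<omega>. ennreal ((\<xi> \<omega> * (1 - \<xi> \<omega>) ^ r * ?D \<omega>) ^ k) \<partial>M) =
          (\<integral>\<^sup>+\<omega>. (\<lambda>(t, v). ennreal (t ^ k * (1 - t) ^ (r * k)) * ennreal (((fact r * v)\<^sup>2) ^ k)) (\<xi> \<omega>, V \<omega>) \<partial>M)"
      proof (intro nn_integral_cong)
        fix \<omega>
        have "(\<xi> \<omega> * (1 - \<xi> \<omega>) ^ r * ?D \<omega>) ^ k = (\<xi> \<omega> ^ k * (1 - \<xi> \<omega>) ^ (r * k)) * (?D \<omega>) ^ k"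
          by (simp only: power_mult_distrib[of _ _ k] power_mult)
        then show "ennreal ((\<xi> \<omega> * (1 - \<xi> \<omega>) ^ r * ?D \<omega>) ^ k) = (\<lambda>(t, v). ennreal (t ^ k * (1 - t) ^ (r * k)) * ennreal (((fact r * v)\<^sup>2) ^ k)) (\<xi> \<omega>, V \<omega>)"
          by (simp only: prod.case) (intro ennreal_mult'', simp)
      qed
      also have "\<dots> = (\<integral>\<^sup>+t. \<integral>\<^sup>+\<omega>. (\<lambda>(t, v). ennreal (t ^ k * (1 - t) ^ (r * k)) * ennreal (((fact r * v)\<^sup>2) ^ k)) (t, V \<omega>) \<partial>M \<partial>distr M borel \<xi>)"
        by (rule M.nn_integral_indep_pair[OF ind\<xi>]) measurable
      also have "\<dots> = (\<integral>\<^sup>+t. ennreal (t ^ k * (1 - t) ^ (r * k)) \<partial>distr M borel \<xi>) * (\<integral>\<^sup>+\<omega>. ennreal (?D \<omega> ^ k) \<partial>M)"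
        by (simp only: prod.case) (subst nn_integral_cmult, measurable, subst nn_integral_multc, measurable)
      also have "(\<integral>\<^sup>+t. ennreal (t ^ k * (1 - t) ^ (r * k)) \<partial>distr M borel \<xi>) = ennreal (pochhammer a k * pochhammer b (r * k) / pochhammer (a + b) (k + r * k))"
        unfolding d\<xi> by (rule nn_integral_beta_law[OF a0 b0])
      also have "(\<integral>\<^sup>+\<omega>. ennreal (?D \<omega> ^ k) \<partial>M) = ennreal (W / pochhammer a k ^ (r + 1) * ?S)"
      proof -
        have e: "real (r + 1) * (a - 1) + real r * real k + 1 = a + b + real (r * k)" by (simp add: b_def algebra_simps)
        have "(\<integral>\<^sup>+\<omega>. ennreal (?D \<omega> ^ k) \<partial>M) = (\<integral>\<^sup>+x. ennreal (simplex_gramdet r x ^ k) \<partial>(\<Pi>\<^sub>M i\<in>{1..r+1}. P))"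
          by (rule nn_integral_simplex_volume[OF M r(2) X V dX]) measurable
        then show ?thesis unfolding simplex_moment[OF gr r] e W_def .
      qed
      also have "ennreal (pochhammer a k * pochhammer b (r * k) / pochhammer (a + b) (k + r * k)) * ennreal (W / pochhammer a k ^ (r + 1) * ?S) =
          ennreal (pochhammer a k * pochhammer b (r * k) / pochhammer (a + b) (k + r * k) * (W / pochhammer a k ^ (r + 1) * ?S))"
        using a0 b0 W pb by (intro ennreal_mult'[symmetric] divide_nonneg_nonneg mult_nonneg_nonneg) (auto intro: pochhammer_nonneg)
      \<comment> \<open>The purpose of \<xi> (1 - \<xi>)^r: (a + b)_(k + r k) splits into (a + b)_(r
        k) and (a + b + r k)_k, and the latter cancels the Pochhammer symbol of the volume moment.
        The factor (a)_k reduces the power r + 1 to r.\<close>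
      also have "pochhammer a k * pochhammer b (r * k) / pochhammer (a + b) (k + r * k) * (W / pochhammer a k ^ (r + 1) * ?S) =
          pochhammer b (r * k) / pochhammer (a + b) (r * k) * (W / pochhammer a k ^ r)"
      proof -
        have "pochhammer (a + b) (k + r * k) = pochhammer (a + b) (r * k) * ?S"
          using pochhammer_product'[of "a + b" "r * k" k] by (simp add: add.commute)
        moreover have "0 < pochhammer a k" "0 < ?S" using a0 b0 by (auto intro!: pochhammer_pos add_pos_nonneg)
        ultimately show ?thesis by simp
      qed
      finally have L: "(\<integral>\<^sup>+\<omega>. ennreal ((\<xi> \<omega> * (1 - \<xi> \<omega>) ^ r * ?D \<omega>) ^ k) \<partial>M) =
        ennreal (pochhammer b (r * k) / pochhammer (a + b) (r * k) * (W / pochhammer a k ^ r))" .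
      \<comment> \<open>Index 0 is the slot of \<eta>, which contributes (1 - \<eta>)^(r k); the
        other indices contribute k-th powers.\<close>
      define g where "g i t = (if i = 0 then (1 - t) ^ (r * k) else t ^ k)" for i :: nat and t :: real
      have ins: "{0..r} = insert 0 {1..r}" by auto
      have "(\<integral>\<^sup>+\<omega>. ennreal (((1 - \<eta> \<omega>) ^ r * (\<Prod>j=1..r. \<beta> j \<omega>)) ^ k) \<partial>N) =
          (\<integral>\<^sup>+\<omega>. (\<Prod>i\<in>{0..r}. ennreal (g i ((\<beta>(0 := \<eta>)) i \<omega>))) \<partial>N)"
        using AE\<eta> AE\<beta>
      proof (intro nn_integral_cong_AE, eventually_elim)
        case (elim \<omega>)
        have "((1 - \<eta> \<omega>) ^ r * (\<Prod>j=1..r. \<beta> j \<omega>)) ^ k = (1 - \<eta> \<omega>) ^ (r * k) * (\<Prod>j=1..r. \<beta> j \<omega> ^ k)"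
          by (simp only: power_mult_distrib power_mult prod_power_distrib)
        also have "\<dots> = g 0 ((\<beta>(0 := \<eta>)) 0 \<omega>) * (\<Prod>j\<in>{1..r}. g j ((\<beta>(0 := \<eta>)) j \<omega>))"
          by (intro arg_cong2[where f="(*)"] prod.cong) (auto simp: g_def)
        also have "\<dots> = (\<Prod>i\<in>{0..r}. g i ((\<beta>(0 := \<eta>)) i \<omega>))"
          unfolding ins by (rule prod.insert[symmetric]) auto
        finally show ?case
          using elim by (simp only:) (intro prod_ennreal[symmetric], auto simp: g_def)
      qed
      also have "\<dots> = (\<Prod>i\<in>{0..r}. \<integral>\<^sup>+\<omega>. ennreal (g i ((\<beta>(0 := \<eta>)) i \<omega>)) \<partial>N)"
      proof (rule N.indep_vars_nn_integral)
        show "N.indep_vars (\<lambda>_. borel) (\<lambda>i \<omega>. ennreal (g i ((\<beta>(0 := \<eta>)) i \<omega>))) {0..r}"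
          by (rule N.indep_vars_compose2[OF fam]) (auto simp: g_def)
      qed auto
      also have "\<dots> = (\<integral>\<^sup>+\<omega>. ennreal ((1 - \<eta> \<omega>) ^ (r * k)) \<partial>N) * (\<Prod>j\<in>{1..r}. \<integral>\<^sup>+\<omega>. ennreal (\<beta> j \<omega> ^ k) \<partial>N)"
        unfolding ins by (subst prod.insert) (auto simp: g_def intro!: arg_cong2[where f="(*)"] prod.cong)
      also have "(\<integral>\<^sup>+\<omega>. ennreal ((1 - \<eta> \<omega>) ^ (r * k)) \<partial>N) = ennreal (pochhammer b (r * k) / pochhammer (a + b) (r * k))"
        using nn_integral_beta_distributed[OF \<eta>_m d\<eta> a0 b0, of 0 "r * k"] by simp
      also have "(\<Prod>j\<in>{1..r}. \<integral>\<^sup>+\<omega>. ennreal (\<beta> j \<omega> ^ k) \<partial>N) = (\<Prod>j\<in>{1..r}. ennreal (pochhammer ((real ?n - real r + real j) / 2) k / pochhammer a k))"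
      proof (rule prod.cong[OF refl])
        fix j assume j: "j \<in> {1..r}"
        show "(\<integral>\<^sup>+\<omega>. ennreal (\<beta> j \<omega> ^ k) \<partial>N) = ennreal (pochhammer ((real ?n - real r + real j) / 2) k / pochhammer a k)"
          using nn_integral_beta_distributed[OF \<beta>_m[OF j] d\<beta>[OF j] \<alpha>[OF j], of k 0] by simp
      qed
      also have "\<dots> = ennreal (W / pochhammer a k ^ r)"
      proof -
        have "(\<Prod>j\<in>{1..r}. ennreal (pochhammer ((real ?n - real r + real j) / 2) k / pochhammer a k)) = ennreal (\<Prod>j\<in>{1..r}. pochhammer ((real ?n - real r + real j) / 2) k / pochhammer a k)"
          using \<alpha> a0 by (intro prod_ennreal divide_nonneg_nonneg pochhammer_nonneg) auto
        also have "(\<Prod>j\<in>{1..r}. pochhammer ((real ?n - real r + real j) / 2) k / pochhammer a k) = W / pochhammer a k ^ r"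
          unfolding prod_dividef wishart_moment_reindex[OF r(2)] W_def by simp
        finally show ?thesis .
      qed
      also have "ennreal (pochhammer b (r * k) / pochhammer (a + b) (r * k)) * ennreal (W / pochhammer a k ^ r) =
          ennreal (pochhammer b (r * k) / pochhammer (a + b) (r * k) * (W / pochhammer a k ^ r))"
        using a0 b0 pb by (intro ennreal_mult'[symmetric] divide_nonneg_nonneg) (auto intro: pochhammer_nonneg)
      finally show "(\<integral>\<^sup>+\<omega>. ennreal ((\<xi> \<omega> * (1 - \<xi> \<omega>) ^ r * ?D \<omega>) ^ k) \<partial>M) =
          (\<integral>\<^sup>+\<omega>. ennreal (((1 - \<eta> \<omega>) ^ r * (\<Prod>j=1..r. \<beta> j \<omega>)) ^ k) \<partial>N)"
        unfolding L by (rule sym)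
    qed
  qed
qed

lemma distr_eqI_nn_integral:
  fixes Y :: "'m \<Rightarrow> real" and Z :: "'k \<Rightarrow> real"
  assumes Y: "Y \<in> borel_measurable M" and Z: "Z \<in> borel_measurable N"
    and eq: "\<And>f :: real \<Rightarrow> ennreal. f \<in> borel_measurable borel \<Longrightarrow> (\<integral>\<^sup>+\<omega>. f (Y \<omega>) \<partial>M) = (\<integral>\<^sup>+\<omega>. f (Z \<omega>) \<partial>N)"
  shows "distr M borel Y = distr N borel Z"
proof (rule measure_eqI)
  fix A assume "A \<in> sets (distr M borel Y)"
  then have A [measurable]: "A \<in> sets borel" by simp
  have "emeasure (distr M borel Y) A = (\<integral>\<^sup>+\<omega>. indicator A (Y \<omega>) \<partial>M)"
    using Y A by (subst nn_integral_distr[symmetric, where M'=borel]) auto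
  also have "\<dots> = (\<integral>\<^sup>+\<omega>. indicator A (Z \<omega>) \<partial>N)" by (rule eq) measurable
  also have "\<dots> = emeasure (distr N borel Z) A"
    using Z A by (subst nn_integral_distr[symmetric, where M'=borel]) auto
  finally show "emeasure (distr M borel Y) A = emeasure (distr N borel Z) A" .
qed simp

lemma nn_integral_product_swap:
  fixes B L W :: "real measure" and f :: "real \<Rightarrow> ennreal" and c :: "real \<Rightarrow> real"
  assumes B: "prob_space B" "sets B = sets borel" and L: "prob_space L" "sets L = sets borel"
    and W: "prob_space W" "sets W = sets borel"
    and [measurable]: "f \<in> borel_measurable borel" "c \<in> borel_measurable borel"
  shows "(\<integral>\<^sup>+t. \<integral>\<^sup>+w. \<integral>\<^sup>+u. f (c t * (w * u)) \<partial>W \<partial>L \<partial>B) = (\<integral>\<^sup>+u. \<integral>\<^sup>+t. \<integral>\<^sup>+w. f (c t * w * u) \<partial>L \<partial>B \<partial>W)"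
proof -
  interpret L: prob_space L by fact
  note [measurable_cong] = B(2) L(2) W(2)
  have "(\<integral>\<^sup>+t. \<integral>\<^sup>+w. \<integral>\<^sup>+u. f (c t * (w * u)) \<partial>W \<partial>L \<partial>B) = (\<integral>\<^sup>+t. \<integral>\<^sup>+u. \<integral>\<^sup>+w. f (c t * w * u) \<partial>L \<partial>W \<partial>B)"
    unfolding mult.assoc by (intro nn_integral_cong nn_integral_swap L W) measurable
  also have "\<dots> = (\<integral>\<^sup>+u. \<integral>\<^sup>+t. \<integral>\<^sup>+w. f (c t * w * u) \<partial>L \<partial>B \<partial>W)"
    by (intro nn_integral_swap B W) measurable
  finally show ?thesis .
qed

text \<open>For fixed u this is the Gamma identity applied to the function v \<mapsto> f (v u). The
  rest brings the integral over u outside; for this the functions of h are replaced by their laws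
  \<open>L1\<close> and \<open>L2\<close> on the line.\<close>

lemma beta_prime_mixture_identity:
  fixes f :: "real \<Rightarrow> ennreal"
  assumes \<alpha>: "0 < \<alpha>" and r: "1 \<le> r" and W: "prob_space W" "sets W = sets borel" and f [measurable]: "f \<in> borel_measurable borel"
  shows "(\<integral>\<^sup>+t. \<integral>\<^sup>+h. \<integral>\<^sup>+u. f ((1 + t) ^ r * ((\<Sum>i\<in>{1..r+1}. h i) / (\<Prod>i\<in>{1..r+1}. h i) * u))
        \<partial>W \<partial>(\<Pi>\<^sub>M i\<in>{1..r+1}. gamma_law \<alpha>) \<partial>beta_prime_law \<alpha> (real r * \<alpha>)) =
    (\<integral>\<^sup>+t. \<integral>\<^sup>+h. \<integral>\<^sup>+u. f (inverse t * (1 + t) ^ (r + 1) * (1 / (\<Prod>i\<in>{1..r}. h i) * u))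
        \<partial>W \<partial>(\<Pi>\<^sub>M i\<in>{1..r}. gamma_law \<alpha>) \<partial>beta_prime_law \<alpha> (real r * \<alpha>))"
proof -
  let ?B = "beta_prime_law \<alpha> (real r * \<alpha>)"
  let ?G = "\<lambda>s. \<Pi>\<^sub>M i\<in>{1..s}. gamma_law \<alpha>" and ?\<phi> = "\<lambda>h :: nat \<Rightarrow> real. (\<Sum>i\<in>{1..r+1}. h i) / (\<Prod>i\<in>{1..r+1}. h i)" and ?\<psi> = "\<lambda>h :: nat \<Rightarrow> real. 1 / (\<Prod>i\<in>{1..r}. h i)"
  interpret W: prob_space W by fact
  note [measurable_cong] = W(2)
  have pB: "prob_space ?B" using \<alpha> r by (intro prob_space_beta_prime_law) auto
  have pG: "prob_space (?G s)" for s :: nat using \<alpha> by (intro prob_space_PiM prob_space_gamma_law)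
  have \<phi> [measurable]: "?\<phi> \<in> borel_measurable (?G (r + 1))" by measurable
  have \<psi> [measurable]: "?\<psi> \<in> borel_measurable (?G r)" by measurable
  define L1 L2 where "L1 = distr (?G (r + 1)) borel ?\<phi>" and "L2 = distr (?G r) borel ?\<psi>"
  have L1: "prob_space L1" "sets L1 = sets borel" and L2: "prob_space L2" "sets L2 = sets borel"
    unfolding L1_def L2_def using pG by (auto intro!: prob_space.prob_space_distr)
  have I1: "(\<integral>\<^sup>+h. F (?\<phi> h) \<partial>?G (r + 1)) = (\<integral>\<^sup>+w. F w \<partial>L1)" if "F \<in> borel_measurable borel" for F
    unfolding L1_def using that by (intro nn_integral_distr[symmetric]) auto
  have I2: "(\<integral>\<^sup>+h. F (?\<psi> h) \<partial>?G r) = (\<integral>\<^sup>+w. F w \<partial>L2)" if "F \<in> borel_measurable borel" for F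
    unfolding L2_def using that by (intro nn_integral_distr[symmetric]) auto
  have "(\<integral>\<^sup>+t. \<integral>\<^sup>+h. \<integral>\<^sup>+u. f ((1 + t) ^ r * (?\<phi> h * u)) \<partial>W \<partial>?G (r + 1) \<partial>?B) =
      (\<integral>\<^sup>+t. \<integral>\<^sup>+w. \<integral>\<^sup>+u. f ((1 + t) ^ r * (w * u)) \<partial>W \<partial>L1 \<partial>?B)"
    by (rule nn_integral_cong, rule I1) measurable
  also have "\<dots> = (\<integral>\<^sup>+u. \<integral>\<^sup>+t. \<integral>\<^sup>+w. f ((1 + t) ^ r * w * u) \<partial>L1 \<partial>?B \<partial>W)"
    by (rule nn_integral_product_swap[OF pB _ L1 W]) auto
  also have "\<dots> = (\<integral>\<^sup>+u. \<integral>\<^sup>+t. \<integral>\<^sup>+h. f ((1 + t) ^ r * ?\<phi> h * u) \<partial>?G (r + 1) \<partial>?B \<partial>W)"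
    by (rule nn_integral_cong, rule nn_integral_cong, rule I1[symmetric]) measurable
  also have "\<dots> = (\<integral>\<^sup>+u. \<integral>\<^sup>+t. \<integral>\<^sup>+h. f (inverse t * (1 + t) ^ (r + 1) * ?\<psi> h * u) \<partial>?G r \<partial>?B \<partial>W)"
    by (rule nn_integral_cong, rule beta_prime_gamma_identity[OF \<alpha> r, of "\<lambda>v. f (v * u)" for u]) measurable
  also have "\<dots> = (\<integral>\<^sup>+u. \<integral>\<^sup>+t. \<integral>\<^sup>+w. f (inverse t * (1 + t) ^ (r + 1) * w * u) \<partial>L2 \<partial>?B \<partial>W)"
    by (rule nn_integral_cong, rule nn_integral_cong, rule I2) measurable
  also have "\<dots> = (\<integral>\<^sup>+t. \<integral>\<^sup>+w. \<integral>\<^sup>+u. f (inverse t * (1 + t) ^ (r + 1) * (w * u)) \<partial>W \<partial>L2 \<partial>?B)"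
    by (rule nn_integral_product_swap[OF pB _ L2 W, symmetric]) auto
  also have "\<dots> = (\<integral>\<^sup>+t. \<integral>\<^sup>+h. \<integral>\<^sup>+u. f (inverse t * (1 + t) ^ (r + 1) * (?\<psi> h * u)) \<partial>W \<partial>?G r \<partial>?B)"
    by (rule nn_integral_cong, rule I2[symmetric]) measurable
  finally show ?thesis .
qed

lemma gaussian_model_law:
  fixes M :: "'m measure" and N :: "'k measure" and X :: "nat \<Rightarrow> 'm \<Rightarrow> real ^ 'n"
  assumes M: "prob_space M" and N: "prob_space N"
    and r: "1 \<le> r" "r \<le> CARD('n)"
    and X: "prob_space.indep_vars M (\<lambda>_. borel) X {1..r+1}"
    and V: "\<And>\<omega>. V \<omega> = simplex_volume r (\<lambda>i. X i \<omega>)"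
    and dX: "\<And>i. i \<in> {1..r+1} \<Longrightarrow> distr M borel (X i) = gaussian_model"
    and Q: "prob_space.indep_vars N (\<lambda>_. borel) Q {1..r}"
    and dQ: "\<And>j. j \<in> {1..r} \<Longrightarrow> distr N borel (Q j) = chi_squared_law (CARD('n) - r + j)"
  shows "eq_in_law M (\<lambda>\<omega>. (fact r * V \<omega>)\<^sup>2) N (\<lambda>\<omega>. (real r + 1) * (\<Prod>j=1..r. Q j \<omega>))"
proof -
  have V_m [measurable]: "V \<in> borel_measurable M" using simplex_volume_measurable[OF M r(2) X V] .
  have Q_m: "Q j \<in> borel_measurable N" if "j \<in> {1..r}" for j
    using Q that by (simp add: prob_space.indep_vars_def[OF N])
  have Y: "(\<lambda>\<omega>. (fact r * V \<omega>)\<^sup>2) \<in> borel_measurable M" by measurable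
  have Z: "(\<lambda>\<omega>. (real r + 1) * (\<Prod>j=1..r. Q j \<omega>)) \<in> borel_measurable N"
    by (intro borel_measurable_times borel_measurable_prod Q_m) auto
  have "distr M borel (\<lambda>\<omega>. (fact r * V \<omega>)\<^sup>2) = distr N borel (\<lambda>\<omega>. (real r + 1) * (\<Prod>j=1..r. Q j \<omega>))"
  proof (rule distr_eqI_nn_integral[OF Y Z])
    fix f :: "real \<Rightarrow> ennreal" assume f [measurable]: "f \<in> borel_measurable borel"
    have "(\<integral>\<^sup>+\<omega>. f ((fact r * V \<omega>)\<^sup>2) \<partial>M) = (\<integral>\<^sup>+x. f (simplex_gramdet r x) \<partial>(\<Pi>\<^sub>M i\<in>{1..r+1}. (gaussian_model :: (real ^ 'n) measure)))"
      by (rule nn_integral_simplex_volume[OF M r(2) X V dX f])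
    \<comment> \<open>With unit deviations the product of variances is 1 and the total precision is
      r + 1.\<close>
    also have "\<dots> = (\<integral>\<^sup>+q. f ((real r + 1) * (\<Prod>k<r. q k)) \<partial>(\<Pi>\<^sub>M k\<in>{..<r}. chi_squared_law (CARD('n) - k)))"
      using nn_integral_gaussian_simplex[of "\<lambda>_. 1" r f, where 'n='n] r by (simp add: prec_def add.commute)
    also have "\<dots> = (\<integral>\<^sup>+q. f ((real r + 1) * (\<Prod>j\<in>{1..r}. q j)) \<partial>(\<Pi>\<^sub>M j\<in>{1..r}. chi_squared_law (CARD('n) - r + j)))"
      by (rule nn_integral_chi_squared_reindex[OF r(2)]) measurable
    also have "\<dots> = (\<integral>\<^sup>+\<omega>. f ((real r + 1) * (\<Prod>j\<in>{1..r}. (\<lambda>j\<in>{1..r}. Q j \<omega>) j)) \<partial>N)"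
      using r(1) by (intro prob_space.nn_integral_indep_family[OF N Q _ dQ, symmetric]) auto
    moreover have "(\<Prod>j\<in>{1..r}. (\<lambda>j\<in>{1..r}. Q j \<omega>) j) = (\<Prod>j=1..r. Q j \<omega>)" for \<omega>
      by (intro prod.cong) auto
    ultimately show "(\<integral>\<^sup>+\<omega>. f ((fact r * V \<omega>)\<^sup>2) \<partial>M) = (\<integral>\<^sup>+\<omega>. f ((real r + 1) * (\<Prod>j=1..r. Q j \<omega>)) \<partial>N)"
      by (simp only:)
  qed
  then show ?thesis using Y Z by (simp add: eq_in_law_def)
qed

text \<open>The chi-squared product is 2^r times a product of Gamma variables, which cancels the 1 /
  2^r from the scales. The mixture identity removes one of the r + 1 mixing variables; the r inverse
  variables left over pair with these Gamma variables to form the beta prime factors.\<close>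

lemma beta_prime_model_law:
  fixes M :: "'m measure" and N :: "'k measure" and X :: "nat \<Rightarrow> 'm \<Rightarrow> real ^ 'n"
  assumes M: "prob_space M" and N: "prob_space N"
    and r: "1 \<le> r" "r \<le> CARD('n)"
    and X: "prob_space.indep_vars M (\<lambda>_. borel) X {1..r+1}"
    and V: "\<And>\<omega>. V \<omega> = simplex_volume r (\<lambda>i. X i \<omega>)"
    and \<nu>: "0 < \<nu>" and dX: "\<And>i. i \<in> {1..r+1} \<Longrightarrow> distr M borel (X i) = beta_prime_model \<nu>"
    and d\<eta>: "distr M borel \<eta> = beta_prime_law (\<nu> / 2) (real r * (\<nu> / 2))"
    and d\<xi>: "distr N borel \<xi> = beta_prime_law (\<nu> / 2) (real r * (\<nu> / 2))"
    and d\<beta>: "\<And>j. j \<in> {1..r} \<Longrightarrow> distr N borel (\<beta> j) = beta_prime_law (real (CARD('n) - r + j) / 2) (\<nu> / 2)"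
    and ind\<eta>: "prob_space.indep_var M borel \<eta> borel V"
    and ind\<xi>: "indep_of_indep_family N r \<xi> \<beta>"
  shows "eq_in_law M (\<lambda>\<omega>. (1 + \<eta> \<omega>) ^ r * (fact r * V \<omega>)\<^sup>2)
    N (\<lambda>\<omega>. inverse (\<xi> \<omega>) * (1 + \<xi> \<omega>) ^ (r + 1) * (\<Prod>j=1..r. \<beta> j \<omega>))"
proof -
  interpret M: prob_space M by fact
  interpret N: prob_space N by fact
  let ?m = "CARD('n) - r" and ?\<alpha> = "\<nu> / 2"
  let ?B = "beta_prime_law ?\<alpha> (real r * ?\<alpha>)" and ?L = "\<Pi>\<^sub>M j\<in>{1..r}. beta_prime_law (real (?m + j) / 2) ?\<alpha>"
  let ?\<chi> = "\<Pi>\<^sub>M k\<in>{..<r}. chi_squared_law (CARD('n) - k)" and ?\<chi>' = "\<Pi>\<^sub>M j\<in>{1..r}. chi_squared_law (?m + j)"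
  let ?W = "\<Pi>\<^sub>M j\<in>{1..r}. gamma_law (real (?m + j) / 2)" and ?G = "\<lambda>s. \<Pi>\<^sub>M i\<in>{1..s}. gamma_law ?\<alpha>"
  have V_m [measurable]: "V \<in> borel_measurable M" using simplex_volume_measurable[OF M r(2) X V] .
  have \<eta>_m [measurable]: "\<eta> \<in> borel_measurable M" using M.indep_var_rv1[OF ind\<eta>] .
  have fam: "N.indep_vars (\<lambda>_. borel) (\<beta>(0 := \<xi>)) {0..r}" using ind\<xi> by (simp add: indep_of_indep_family_def)
  have fam_m: "i \<in> {0..r} \<Longrightarrow> (\<beta>(0 := \<xi>)) i \<in> borel_measurable N" for i using fam by (simp add: N.indep_vars_def)
  have \<xi>_m [measurable]: "\<xi> \<in> borel_measurable N" using fam_m[of 0] by simp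
  have \<beta>_m: "\<beta> j \<in> borel_measurable N" if "j \<in> {1..r}" for j using fam_m[of j] that by simp
  have Y: "(\<lambda>\<omega>. (1 + \<eta> \<omega>) ^ r * (fact r * V \<omega>)\<^sup>2) \<in> borel_measurable M" by measurable
  have Z: "(\<lambda>\<omega>. inverse (\<xi> \<omega>) * (1 + \<xi> \<omega>) ^ (r + 1) * (\<Prod>j=1..r. \<beta> j \<omega>)) \<in> borel_measurable N"
  proof -
    have "(\<lambda>\<omega>. \<Prod>j=1..r. \<beta> j \<omega>) \<in> borel_measurable N" by (intro borel_measurable_prod \<beta>_m)
    then show ?thesis by measurable
  qed
  \<comment> \<open>The law of the whole Gamma product: in the mixture identity this product matters
    only as one independent factor u.\<close>
  define W where "W = distr ?W borel (\<lambda>x. \<Prod>j\<in>{1..r}. x j)"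
  have W_m: "(\<lambda>x. \<Prod>j\<in>{1..r}. x j) \<in> borel_measurable ?W" by measurable
  have W: "prob_space W" "sets W = sets borel"
  proof -
    have "distr ?W borel (\<lambda>x. \<Prod>j\<in>{1..r}. x j) = distr (\<Pi>\<^sub>M j\<in>{1..r}. gamma_law (real (?m + max 1 j) / 2)) borel (\<lambda>x. \<Prod>j\<in>{1..r}. x j)"
      by (intro arg_cong[of _ _ "\<lambda>L. distr L _ _"] PiM_cong) (auto simp: max_def)
    moreover have "prob_space \<dots>"
      by (intro prob_space.prob_space_distr prob_space_PiM prob_space_gamma_law) auto
    ultimately show "prob_space W" by (simp only: W_def)
  qed (simp add: W_def)
  have IW: "(\<integral>\<^sup>+x. F (\<Prod>j\<in>{1..r}. x j) \<partial>?W) = (\<integral>\<^sup>+u. F u \<partial>W)" if "F \<in> borel_measurable borel" for F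
    unfolding W_def using that W_m by (intro nn_integral_distr[symmetric]) auto
  have "distr M borel (\<lambda>\<omega>. (1 + \<eta> \<omega>) ^ r * (fact r * V \<omega>)\<^sup>2) = distr N borel (\<lambda>\<omega>. inverse (\<xi> \<omega>) * (1 + \<xi> \<omega>) ^ (r + 1) * (\<Prod>j=1..r. \<beta> j \<omega>))"
  proof (rule distr_eqI_nn_integral[OF Y Z])
    fix f :: "real \<Rightarrow> ennreal" assume f [measurable]: "f \<in> borel_measurable borel"
    have "(\<integral>\<^sup>+\<omega>. f ((1 + \<eta> \<omega>) ^ r * (fact r * V \<omega>)\<^sup>2) \<partial>M) = (\<integral>\<^sup>+t. \<integral>\<^sup>+\<omega>. f ((1 + t) ^ r * (fact r * V \<omega>)\<^sup>2) \<partial>M \<partial>?B)"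
      using M.nn_integral_indep_pair[OF ind\<eta>, of "\<lambda>(t, v). f ((1 + t) ^ r * (fact r * v)\<^sup>2)"] unfolding d\<eta> by simp
    also have "\<dots> = (\<integral>\<^sup>+t. \<integral>\<^sup>+h. \<integral>\<^sup>+u. f ((1 + t) ^ r * ((\<Sum>i\<in>{1..r+1}. h i) / (\<Prod>i\<in>{1..r+1}. h i) * u)) \<partial>W \<partial>?G (r + 1) \<partial>?B)"
    proof (rule nn_integral_cong)
      fix t :: real
      have "(\<integral>\<^sup>+\<omega>. f ((1 + t) ^ r * (fact r * V \<omega>)\<^sup>2) \<partial>M) =
          (\<integral>\<^sup>+x. f ((1 + t) ^ r * simplex_gramdet r x) \<partial>(\<Pi>\<^sub>M i\<in>{1..r+1}. (beta_prime_model \<nu> :: (real ^ 'n) measure)))"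
        by (rule nn_integral_simplex_volume[OF M r(2) X V dX, of "\<lambda>v. f ((1 + t) ^ r * v)"]) measurable
      also have "\<dots> = (\<integral>\<^sup>+h. \<integral>\<^sup>+q. f ((1 + t) ^ r * ((\<Sum>i\<in>{1..r+1}. h i) / (\<Prod>i\<in>{1..r+1}. h i) * ((\<Prod>k<r. q k) / 2 ^ r))) \<partial>?\<chi> \<partial>?G (r + 1))"
        by (rule nn_integral_beta_prime_simplex[OF \<nu> r(2), of "\<lambda>v. f ((1 + t) ^ r * v)"]) measurable
      also have "\<dots> = (\<integral>\<^sup>+h. \<integral>\<^sup>+u. f ((1 + t) ^ r * ((\<Sum>i\<in>{1..r+1}. h i) / (\<Prod>i\<in>{1..r+1}. h i) * u)) \<partial>W \<partial>?G (r + 1))"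
      proof (rule nn_integral_cong)
        fix h :: "nat \<Rightarrow> real"
        define F where "F u = f ((1 + t) ^ r * ((\<Sum>i\<in>{1..r+1}. h i) / (\<Prod>i\<in>{1..r+1}. h i) * u))" for u
        have [measurable]: "F \<in> borel_measurable borel" unfolding F_def by measurable
        have "(\<integral>\<^sup>+q. F ((\<Prod>k<r. q k) / 2 ^ r) \<partial>?\<chi>) = (\<integral>\<^sup>+q. F ((\<Prod>j\<in>{1..r}. q j) / 2 ^ r) \<partial>?\<chi>')"
          by (rule nn_integral_chi_squared_reindex[OF r(2), of "\<lambda>p. F (p / 2 ^ r)"]) measurable
        also have "\<dots> = (\<integral>\<^sup>+x. F (2 ^ r * (\<Prod>j\<in>{1..r}. x j) / 2 ^ r) \<partial>?W)"
          by (rule nn_integral_chi_squared_prod[of "\<lambda>p. F (p / 2 ^ r)"]) measurable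
        also have "\<dots> = (\<integral>\<^sup>+u. F u \<partial>W)" using IW[of F] by simp
        finally show "(\<integral>\<^sup>+q. f ((1 + t) ^ r * ((\<Sum>i\<in>{1..r+1}. h i) / (\<Prod>i\<in>{1..r+1}. h i) * ((\<Prod>k<r. q k) / 2 ^ r))) \<partial>?\<chi>) =
            (\<integral>\<^sup>+u. f ((1 + t) ^ r * ((\<Sum>i\<in>{1..r+1}. h i) / (\<Prod>i\<in>{1..r+1}. h i) * u)) \<partial>W)" by (simp only: F_def)
      qed
      finally show "(\<integral>\<^sup>+\<omega>. f ((1 + t) ^ r * (fact r * V \<omega>)\<^sup>2) \<partial>M) =
        (\<integral>\<^sup>+h. \<integral>\<^sup>+u. f ((1 + t) ^ r * ((\<Sum>i\<in>{1..r+1}. h i) / (\<Prod>i\<in>{1..r+1}. h i) * u)) \<partial>W \<partial>?G (r + 1))" .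
    qed
    also have "\<dots> = (\<integral>\<^sup>+t. \<integral>\<^sup>+h. \<integral>\<^sup>+u. f (inverse t * (1 + t) ^ (r + 1) * (1 / (\<Prod>i\<in>{1..r}. h i) * u)) \<partial>W \<partial>?G r \<partial>?B)"
      using \<nu> by (intro beta_prime_mixture_identity r W f) auto
    also have "\<dots> = (\<integral>\<^sup>+t. \<integral>\<^sup>+b. f (inverse t * (1 + t) ^ (r + 1) * (\<Prod>j\<in>{1..r}. b j)) \<partial>?L \<partial>?B)"
    proof (rule nn_integral_cong)
      fix t :: real
      have "(\<integral>\<^sup>+b. f (inverse t * (1 + t) ^ (r + 1) * (\<Prod>j\<in>{1..r}. b j)) \<partial>?L) =
          (\<integral>\<^sup>+h. \<integral>\<^sup>+x. f (inverse t * (1 + t) ^ (r + 1) * (1 / (\<Prod>j\<in>{1..r}. h j) * (\<Prod>j\<in>{1..r}. x j))) \<partial>?W \<partial>?G r)"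
        using \<nu> by (intro nn_integral_beta_prime_prod[of _ "\<lambda>p. f (inverse t * (1 + t) ^ (r + 1) * p)"]) auto
      also have "\<dots> = (\<integral>\<^sup>+h. \<integral>\<^sup>+u. f (inverse t * (1 + t) ^ (r + 1) * (1 / (\<Prod>i\<in>{1..r}. h i) * u)) \<partial>W \<partial>?G r)"
        by (rule nn_integral_cong, rule IW) measurable
      finally show "(\<integral>\<^sup>+h. \<integral>\<^sup>+u. f (inverse t * (1 + t) ^ (r + 1) * (1 / (\<Prod>i\<in>{1..r}. h i) * u)) \<partial>W \<partial>?G r) =
        (\<integral>\<^sup>+b. f (inverse t * (1 + t) ^ (r + 1) * (\<Prod>j\<in>{1..r}. b j)) \<partial>?L)" by (rule sym)
    qed
    also have "\<dots> = (\<integral>\<^sup>+\<omega>. f (inverse (\<xi> \<omega>) * (1 + \<xi> \<omega>) ^ (r + 1) * (\<Prod>j=1..r. \<beta> j \<omega>)) \<partial>N)"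
    proof -
      \<comment> \<open>The joint law of \<xi> and the \<beta> j, with \<xi> at index 0 as in
        \<open>indep_of_indep_family\<close>.\<close>
      define K where "K i = (if i = 0 then ?B else beta_prime_law (real (?m + i) / 2) ?\<alpha>)" for i :: nat
      define H where "H x = f (inverse (x 0) * (1 + x 0) ^ (r + 1) * (\<Prod>j\<in>{1..r}. x j))" for x :: "nat \<Rightarrow> real"
      have ins: "{0..r} = insert 0 {1..r}" by auto
      interpret K: product_sigma_finite K
        by (intro product_sigma_finite_prob) (use \<nu> r in \<open>auto simp: K_def intro!: prob_space_beta_prime_law\<close>)
      have K_s [measurable_cong]: "sets (K i) = sets borel" for i by (simp add: K_def)
      have H_m: "H \<in> borel_measurable (Pi\<^sub>M {0..r} K)"
      proof -
        have c: "(\<lambda>x. x i) \<in> borel_measurable (Pi\<^sub>M {0..r} K)" if "i \<in> {0..r}" for i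
          using measurable_component_singleton[OF that, of K] by (simp cong: measurable_cong_sets add: K_s)
        have [measurable]: "(\<lambda>x. x 0) \<in> borel_measurable (Pi\<^sub>M {0..r} K)" "(\<lambda>x. \<Prod>j\<in>{1..r}. x j) \<in> borel_measurable (Pi\<^sub>M {0..r} K)"
          by (auto intro!: c borel_measurable_prod)
        show ?thesis unfolding H_def by measurable
      qed
      have "(\<integral>\<^sup>+\<omega>. H (\<lambda>i\<in>{0..r}. (\<beta>(0 := \<xi>)) i \<omega>) \<partial>N) = (\<integral>\<^sup>+x. H x \<partial>Pi\<^sub>M {0..r} K)"
      proof (rule N.nn_integral_indep_family[OF fam])
        show "H \<in> borel_measurable (Pi\<^sub>M {0..r} (\<lambda>_. borel))"
          using H_m by (simp cong: measurable_cong_sets sets_PiM_cong add: K_s)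
      qed (auto simp: K_def d\<xi> d\<beta>)
      also have "\<dots> = (\<integral>\<^sup>+t. \<integral>\<^sup>+b. H (b(0 := t)) \<partial>Pi\<^sub>M {1..r} K \<partial>K 0)"
        using H_m unfolding ins by (intro K.product_nn_integral_insert_rev) auto
      also have "\<dots> = (\<integral>\<^sup>+t. \<integral>\<^sup>+b. f (inverse t * (1 + t) ^ (r + 1) * (\<Prod>j\<in>{1..r}. b j)) \<partial>?L \<partial>?B)"
      proof -
        have "Pi\<^sub>M {1..r} K = ?L" by (intro PiM_cong) (auto simp: K_def)
        moreover have "H (b(0 := t)) = f (inverse t * (1 + t) ^ (r + 1) * (\<Prod>j\<in>{1..r}. b j))" for b t
        proof -
          have "(\<Prod>j\<in>{1..r}. (b(0 := t)) j) = (\<Prod>j\<in>{1..r}. b j)" by (intro prod.cong) auto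
          then show ?thesis by (simp only: H_def fun_upd_same)
        qed
        ultimately show ?thesis by (simp add: K_def)
      qed
      moreover have "H (\<lambda>i\<in>{0..r}. (\<beta>(0 := \<xi>)) i \<omega>) = f (inverse (\<xi> \<omega>) * (1 + \<xi> \<omega>) ^ (r + 1) * (\<Prod>j=1..r. \<beta> j \<omega>))" for \<omega>
      proof -
        have "(\<Prod>j\<in>{1..r}. (\<lambda>i\<in>{0..r}. (\<beta>(0 := \<xi>)) i \<omega>) j) = (\<Prod>j=1..r. \<beta> j \<omega>)" by (intro prod.cong) auto
        then show ?thesis by (simp only: H_def) simp
      qed
      ultimately show ?thesis by simp
    qed
    finally show "(\<integral>\<^sup>+\<omega>. f ((1 + \<eta> \<omega>) ^ r * (fact r * V \<omega>)\<^sup>2) \<partial>M) = (\<integral>\<^sup>+\<omega>. f (inverse (\<xi> \<omega>) * (1 + \<xi> \<omega>) ^ (r + 1) * (\<Prod>j=1..r. \<beta> j \<omega>)) \<partial>N)" .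
  qed
  then show ?thesis using Y Z by (simp add: eq_in_law_def)
qed

theorem theorem2p5:
  fixes M :: "'m measure" and N :: "'k measure"
    and X :: "nat \<Rightarrow> 'm \<Rightarrow> real ^ 'n" and V :: "'m \<Rightarrow> real" and n r :: nat
  assumes "prob_space M" and "prob_space N"
    and n: "n = CARD('n)" and r: "1 \<le> r" "r \<le> n"
    and indep: "prob_space.indep_vars M (\<lambda>_. borel) X {1..r+1}"
    and V: "\<And>\<omega>. V \<omega> = simplex_volume r (\<lambda>i. X i \<omega>)"
  shows
    "((\<forall>i\<in>{1..r+1}. distr M borel (X i) = gaussian_model) \<longrightarrow>
       (\<forall>Q :: nat \<Rightarrow> 'k \<Rightarrow> real.
          prob_space.indep_vars N (\<lambda>_. borel) Q {1..r} \<longrightarrow>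
          (\<forall>j\<in>{1..r}. distr N borel (Q j) = chi_squared_law (n - r + j)) \<longrightarrow>
          eq_in_law M (\<lambda>\<omega>. (fact r * V \<omega>)\<^sup>2)
                    N (\<lambda>\<omega>. (real r + 1) * (\<Prod>j=1..r. Q j \<omega>))))
     \<and>
     (\<forall>\<nu>>0. (\<forall>i\<in>{1..r+1}. distr M borel (X i) = beta_model \<nu>) \<longrightarrow>
       (\<forall>(\<xi> :: 'm \<Rightarrow> real) (\<eta> :: 'k \<Rightarrow> real) (\<beta> :: nat \<Rightarrow> 'k \<Rightarrow> real).
          distr M borel \<xi> = beta_law ((real n + \<nu>) / 2) (real r * (real n + \<nu> - 2) / 2) \<longrightarrow>
          distr N borel \<eta> = beta_law ((real n + \<nu>) / 2) (real r * (real n + \<nu> - 2) / 2) \<longrightarrow>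
          (\<forall>j\<in>{1..r}. distr N borel (\<beta> j) =
             beta_law ((real n - real r + real j) / 2) ((\<nu> + real r - real j) / 2)) \<longrightarrow>
          prob_space.indep_var M borel \<xi> borel V \<longrightarrow>
          indep_of_indep_family N r \<eta> \<beta> \<longrightarrow>
          eq_in_law M (\<lambda>\<omega>. \<xi> \<omega> * (1 - \<xi> \<omega>) ^ r * (fact r * V \<omega>)\<^sup>2)
                    N (\<lambda>\<omega>. (1 - \<eta> \<omega>) ^ r * (\<Prod>j=1..r. \<beta> j \<omega>))))
     \<and>
     (\<forall>\<nu>>0. (\<forall>i\<in>{1..r+1}. distr M borel (X i) = beta_prime_model \<nu>) \<longrightarrow>
       (\<forall>(\<eta> :: 'm \<Rightarrow> real) (\<xi> :: 'k \<Rightarrow> real) (\<beta>' :: nat \<Rightarrow> 'k \<Rightarrow> real).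
          distr M borel \<eta> = beta_prime_law (\<nu> / 2) (real r * \<nu> / 2) \<longrightarrow>
          distr N borel \<xi> = beta_prime_law (\<nu> / 2) (real r * \<nu> / 2) \<longrightarrow>
          (\<forall>j\<in>{1..r}. distr N borel (\<beta>' j) =
             beta_prime_law ((real n - real r + real j) / 2) (\<nu> / 2)) \<longrightarrow>
          prob_space.indep_var M borel \<eta> borel V \<longrightarrow>
          indep_of_indep_family N r \<xi> \<beta>' \<longrightarrow>
          eq_in_law M (\<lambda>\<omega>. (1 + \<eta> \<omega>) ^ r * (fact r * V \<omega>)\<^sup>2)
                    N (\<lambda>\<omega>. inverse (\<xi> \<omega>) * (1 + \<xi> \<omega>) ^ (r + 1) * (\<Prod>j=1..r. \<beta>' j \<omega>))))
     \<and>
     ((\<forall>i\<in>{1..r+1}. distr M borel (X i) = spherical_model) \<longrightarrow>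
       (\<forall>(\<xi> :: 'm \<Rightarrow> real) (\<eta> :: 'k \<Rightarrow> real) (\<beta> :: nat \<Rightarrow> 'k \<Rightarrow> real).
          distr M borel \<xi> = beta_law (real n / 2) (real r * (real n - 2) / 2) \<longrightarrow>
          distr N borel \<eta> = beta_law (real n / 2) (real r * (real n - 2) / 2) \<longrightarrow>
          (\<forall>j\<in>{1..r}. distr N borel (\<beta> j) =
             beta_law ((real n - real r + real j) / 2) ((real r - real j) / 2)) \<longrightarrow>
          prob_space.indep_var M borel \<xi> borel V \<longrightarrow>
          indep_of_indep_family N r \<eta> \<beta> \<longrightarrow>
          eq_in_law M (\<lambda>\<omega>. \<xi> \<omega> * (1 - \<xi> \<omega>) ^ r * (fact r * V \<omega>)\<^sup>2)
                    N (\<lambda>\<omega>. (1 - \<eta> \<omega>) ^ r * (\<Prod>j=1..r. \<beta> j \<omega>))))"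
proof -
  let ?n = "CARD('n)"
  have rn: "r \<le> ?n" using r n by simp
  have \<alpha>: "(real n - real r + real j) / 2 = real (?n - r + j) / 2" for j
    using rn n by (simp add: of_nat_diff)
  have small: "n = 1 \<Longrightarrow> r = 1" using r by simp
  show ?thesis
  proof (intro conjI allI impI, goal_cases)
    case (1 Q)
    then show ?case
      using gaussian_model_law[OF assms(1,2) r(1) rn indep V, of Q] by (auto simp: n)
  next
    case (2 \<nu> \<xi> \<eta> \<beta>)
    have a: "real r * ((real ?n + \<nu>) / 2 - 1) = real r * (real n + \<nu> - 2) / 2"
      "(real ?n + \<nu>) / 2 - (real ?n - real r + real j) / 2 = (\<nu> + real r - real j) / 2" for j
      by (simp_all add: n field_simps)
    \<comment> \<open>The second parameter can be negative only for n = r = 1, where it is (\<nu> -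
      1) / 2 > -1/2 and the two parameters add up to \<nu>.\<close>
    have b: "- 1 < real r * (real n + \<nu> - 2) / 2 \<and> 0 \<le> (real n + \<nu>) / 2 + real r * (real n + \<nu> - 2) / 2"
    proof (cases "n = 1")
      case True
      then show ?thesis using small 2(1) by (simp add: field_simps)
    next
      case False
      then have "0 \<le> real n + \<nu> - 2" using r 2(1) by linarith
      then have "0 \<le> real r * (real n + \<nu> - 2)" by simp
      then show ?thesis using 2(1) by simp
    qed
    show ?case
    proof (rule bounded_model_law[OF assms(1,2) r(1) rn indep V gaussian_radial_beta_model[OF 2(1)]], unfold a)
      show "\<And>i. i \<in> {1..r+1} \<Longrightarrow> distr M borel (X i) = beta_model \<nu>" using 2(2) by blast
    qed (use 2 b in \<open>simp_all add: n\<close>)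
  next
    case (3 \<nu> \<eta> \<xi> \<beta>)
    have e: "real r * \<nu> / 2 = real r * (\<nu> / 2)" by simp
    show ?case
    proof (rule beta_prime_model_law[OF assms(1,2) r(1) rn indep V 3(1) _ _ _ _ 3(6,7)])
      show "\<And>i. i \<in> {1..r+1} \<Longrightarrow> distr M borel (X i) = beta_prime_model \<nu>" using 3(2) by blast
      show "distr M borel \<eta> = beta_prime_law (\<nu> / 2) (real r * (\<nu> / 2))" using 3(3) unfolding e .
      show "distr N borel \<xi> = beta_prime_law (\<nu> / 2) (real r * (\<nu> / 2))" using 3(4) unfolding e .
      show "\<And>j. j \<in> {1..r} \<Longrightarrow> distr N borel (\<beta> j) = beta_prime_law (real (?n - r + j) / 2) (\<nu> / 2)"
        using 3(5) unfolding \<alpha> by blast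
    qed
  next
    case (4 \<xi> \<eta> \<beta>)
    have a: "real r * (real ?n / 2 - 1) = real r * (real n - 2) / 2"
      "real ?n / 2 - (real ?n - real r + real j) / 2 = (real r - real j) / 2" for j
      by (simp_all add: n field_simps)
    have b: "- 1 < real r * (real n - 2) / 2 \<and> 0 \<le> real n / 2 + real r * (real n - 2) / 2"
    proof (cases "n = 1")
      case True
      then show ?thesis using small by simp
    next
      case False
      then have "0 \<le> real n - 2" using r by linarith
      then have "0 \<le> real r * (real n - 2)" by simp
      then show ?thesis by simp
    qed
    show ?case
    proof (rule bounded_model_law[OF assms(1,2) r(1) rn indep V gaussian_radial_spherical_model], unfold a)
      show "\<And>i. i \<in> {1..r+1} \<Longrightarrow> distr M borel (X i) = spherical_model" using 4(1) by blast
    qed (use 4 b in \<open>simp_all add: n\<close>)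
  qed
qed

end
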